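(* Let $(\varepsilon_n)_{n\in\mathbb{N}}$ be a sequence of positive numbers converging to zero and, for every $n$, let $u_n\in W^{1,p}_0(\Omega)$ be such that for any $w\in W^{1,p}_0(\Omega)$, $$\int_\Omega \Lambda\nabla u_n\cdot\nabla w\,dx+\varepsilon_n\int_\Omega|\nabla\psi(u_n)|^{p-2}\nabla u_n\cdot\nabla w\,dx=\int_\Omega w\,df .$$ Then there exist a subsequence, again denoted $(\varepsilon_n,u_n)_{n\in\mathbb{N}}$, and $u\in\mathcal{S}_N(\Omega)$ such that $(u_n)_{n\in\mathbb{N}}$ converges to $u$ weakly in $W^{1,q}_0(\Omega)$ for any $q\in(1,N/(N-1))$, strongly in $L^{\hat q}(\Omega)$ for all $\hat q\in[1,+\infty)$ if $N=2$ and for all $\hat q\in[1,N/(N-2))$ if $N\ge 3$, and almost everywhere in $\Omega$. Moreover, $u$ is a weak solution of the linear problem $-\mathrm{div}(\Lambda\nabla u)=f$ in $\Omega$, $u=0$ on $\partial\Omega$, that is, $u\in\mathcal{S}_N(\Omega)$ and $\int_\Omega\Lambda\nabla u\cdot\nabla w\,dx=\int_\Omega w\,df$ for any $w\in\mathcal{T}_N(\Omega)$; and, for any $1<q<\frac{N}{N-1}$, there exists $C$ only depending on $q$, $N$, $|\Omega|$, $\underline{\lambda}$ and $\|f\|_{M(\Omega)}$ such that $\|\nabla u\|_{L^q(\Omega)}\le C$.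
   Context: $N\ge2$ is an integer, $\Omega\subset\mathbb{R}^N$ is open and bounded, and $p\in(N,+\infty)$ is fixed (so $W^{1,p}_0(\Omega)\subset C(\overline\Omega)$). $\Lambda\in L^\infty(\Omega)^{N\times N}$ is symmetric and there exist $\underline\lambda,\overline\lambda>0$ such that for a.e. $x\in\Omega$ and all $\xi\in\mathbb{R}^N$, $\underline\lambda|\xi|^2\le\Lambda(x)\xi\cdot\xi\le\overline\lambda|\xi|^2$. $f\in M(\Omega)$, where $M(\Omega)$ is the set of Radon measures defined as the dual space of $C(\overline\Omega)$ with its usual norm; $\int_\Omega w\,df$ denotes the duality pairing. The function $\psi:\mathbb{R}\to(-1,1)$ is $\psi(s)=\frac{\ln(1+|s|)}{1+\ln(1+|s|)}\,\mathrm{sign}(s)$, with $\mathrm{sign}(s)=1$ if $s\ge0$ and $-1$ if $s<0$. $\mathcal{S}_N(\Omega)=\bigcap_{q\in(1,\frac{N}{N-1})}W^{1,q}_0(\Omega)$ and $\mathcal{T}_N(\Omega)=\bigcup_{r\in(N,+\infty)}W^{1,r}_0(\Omega)\subset C(\overline\Omega)$. *)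

theory Defs
  imports "HOL-Analysis.Analysis"
begin

section \<open>Lebesgue spaces\<close>

text \<open>Function spaces on \<open>\<Omega>\<close> are sets of representatives defined on the whole space; only the values on
  \<open>\<Omega>\<close>, up to Lebesgue null sets, matter.\<close>

definition Lp :: "(real^'n) set \<Rightarrow> real \<Rightarrow> (real^'n \<Rightarrow> 'b::euclidean_space) set" where
  "Lp \<Omega> q = {u \<in> borel_measurable (lebesgue_on \<Omega>).
               integrable (lebesgue_on \<Omega>) (\<lambda>x. norm (u x) powr q)}"

definition Lp_norm :: "(real^'n) set \<Rightarrow> real \<Rightarrow> (real^'n \<Rightarrow> 'b::euclidean_space) \<Rightarrow> real" where
  "Lp_norm \<Omega> q u = (LINT x|lebesgue_on \<Omega>. norm (u x) powr q) powr (1 / q)"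

definition Linfty :: "(real^'n) set \<Rightarrow> (real^'n \<Rightarrow> 'b::euclidean_space) set" where
  "Linfty \<Omega> = {u \<in> borel_measurable (lebesgue_on \<Omega>).
                \<exists>K. AE x in lebesgue_on \<Omega>. norm (u x) \<le> K}"

definition strongly_converges_Lp ::
    "(real^'n) set \<Rightarrow> real \<Rightarrow> (nat \<Rightarrow> real^'n \<Rightarrow> real) \<Rightarrow> (real^'n \<Rightarrow> real) \<Rightarrow> bool" where
  "strongly_converges_Lp \<Omega> q v u \<longleftrightarrow>
     (\<forall>n. v n \<in> Lp \<Omega> q) \<and> u \<in> Lp \<Omega> q \<and>
     (\<lambda>n. Lp_norm \<Omega> q (\<lambda>x. v n x - u x)) \<longlonglongrightarrow> 0"


section \<open>Test functions and weak gradients\<close>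

definition partial :: "'n \<Rightarrow> (real^'n \<Rightarrow> real) \<Rightarrow> real^'n \<Rightarrow> real" where
  "partial i \<phi> x = frechet_derivative \<phi> (at x) (axis i 1)"

primrec C_k :: "nat \<Rightarrow> (real^'n \<Rightarrow> real) \<Rightarrow> bool" where
  "C_k 0 \<phi> \<longleftrightarrow> continuous_on UNIV \<phi>"
| "C_k (Suc k) \<phi> \<longleftrightarrow> (\<forall>x. \<phi> differentiable (at x)) \<and> (\<forall>i. C_k k (partial i \<phi>))"

definition test_functions :: "(real^'n) set \<Rightarrow> (real^'n \<Rightarrow> real) set" where
  "test_functions \<Omega> = {\<phi>. (\<forall>k. C_k k \<phi>) \<and>
      compact (closure {x. \<phi> x \<noteq> 0}) \<and> closure {x. \<phi> x \<noteq> 0} \<subseteq> \<Omega>}"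

definition has_weak_gradient ::
    "(real^'n) set \<Rightarrow> (real^'n \<Rightarrow> real) \<Rightarrow> (real^'n \<Rightarrow> real^'n) \<Rightarrow> bool" where
  "has_weak_gradient \<Omega> u G \<longleftrightarrow>
     (\<forall>K. compact K \<and> K \<subseteq> \<Omega> \<longrightarrow> integrable (lebesgue_on K) u \<and> integrable (lebesgue_on K) G) \<and>
     (\<forall>\<phi>\<in>test_functions \<Omega>. \<forall>i.
        (LINT x|lebesgue_on \<Omega>. u x * partial i \<phi> x) = - (LINT x|lebesgue_on \<Omega>. G x $ i * \<phi> x))"

text \<open>On an open set a weak gradient is unique up to null sets, so the choice is harmless; the value is
  meaningless if there is no weak gradient.\<close>

definition weak_gradient :: "(real^'n) set \<Rightarrow> (real^'n \<Rightarrow> real) \<Rightarrow> real^'n \<Rightarrow> real^'n" where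
  "weak_gradient \<Omega> u = (SOME G. has_weak_gradient \<Omega> u G)"


section \<open>Sobolev spaces\<close>

definition W1 :: "(real^'n) set \<Rightarrow> real \<Rightarrow> (real^'n \<Rightarrow> real) set" where
  "W1 \<Omega> q = {u \<in> Lp \<Omega> q. \<exists>G \<in> Lp \<Omega> q. has_weak_gradient \<Omega> u G}"

definition W1_norm :: "(real^'n) set \<Rightarrow> real \<Rightarrow> (real^'n \<Rightarrow> real) \<Rightarrow> real" where
  "W1_norm \<Omega> q u = Lp_norm \<Omega> q u + Lp_norm \<Omega> q (weak_gradient \<Omega> u)"

text \<open>The closure of the test functions in \<open>W1 \<Omega> q\<close>.\<close>

definition W1_0 :: "(real^'n) set \<Rightarrow> real \<Rightarrow> (real^'n \<Rightarrow> real) set" where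
  "W1_0 \<Omega> q = {u \<in> W1 \<Omega> q.
      \<forall>e>0. \<exists>\<phi>\<in>test_functions \<Omega>. W1_norm \<Omega> q (\<lambda>x. u x - \<phi> x) < e}"

definition W1_0_dual ::
    "(real^'n) set \<Rightarrow> real \<Rightarrow> ((real^'n \<Rightarrow> real) \<Rightarrow> real) set" where
  "W1_0_dual \<Omega> q = {L.
     (\<forall>v\<in>W1_0 \<Omega> q. \<forall>w\<in>W1_0 \<Omega> q. L (\<lambda>x. v x + w x) = L v + L w) \<and>
     (\<forall>c. \<forall>v\<in>W1_0 \<Omega> q. L (\<lambda>x. c * v x) = c * L v) \<and>
     (\<exists>K. \<forall>v\<in>W1_0 \<Omega> q. \<bar>L v\<bar> \<le> K * W1_norm \<Omega> q v)}"

definition weakly_converges_W1_0 ::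
    "(real^'n) set \<Rightarrow> real \<Rightarrow> (nat \<Rightarrow> real^'n \<Rightarrow> real) \<Rightarrow> (real^'n \<Rightarrow> real) \<Rightarrow> bool" where
  "weakly_converges_W1_0 \<Omega> q v u \<longleftrightarrow>
     (\<forall>n. v n \<in> W1_0 \<Omega> q) \<and> u \<in> W1_0 \<Omega> q \<and>
     (\<forall>L\<in>W1_0_dual \<Omega> q. (\<lambda>n. L (v n)) \<longlonglongrightarrow> L u)"

definition S_N :: "(real^'n) set \<Rightarrow> (real^'n \<Rightarrow> real) set" where
  "S_N \<Omega> = (\<Inter>q\<in>{1 <..< real CARD('n) / (real CARD('n) - 1)}. W1_0 \<Omega> q)"

definition T_N :: "(real^'n) set \<Rightarrow> (real^'n \<Rightarrow> real) set" where
  "T_N \<Omega> = (\<Union>r\<in>{real CARD('n) <..}. W1_0 \<Omega> r)"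


section \<open>Radon measures as the dual of the continuous functions on the closure\<close>

text \<open>Elements are functionals on representatives; boundedness on the unit ball together with linearity
  forces \<open>f w\<close> to depend only on the values of \<open>w\<close> on \<open>closure \<Omega>\<close>.\<close>

definition radon_measures :: "(real^'n) set \<Rightarrow> ((real^'n \<Rightarrow> real) \<Rightarrow> real) set" where
  "radon_measures \<Omega> = {f.
     (\<forall>v w. continuous_on (closure \<Omega>) v \<longrightarrow> continuous_on (closure \<Omega>) w \<longrightarrow>
        f (\<lambda>x. v x + w x) = f v + f w) \<and>
     (\<forall>c v. continuous_on (closure \<Omega>) v \<longrightarrow> f (\<lambda>x. c * v x) = c * f v) \<and>
     (\<exists>K. \<forall>v. continuous_on (closure \<Omega>) v \<longrightarrow> (\<forall>x\<in>closure \<Omega>. \<bar>v x\<bar> \<le> 1) \<longrightarrow> \<bar>f v\<bar> \<le> K)}"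

definition radon_norm :: "(real^'n) set \<Rightarrow> ((real^'n \<Rightarrow> real) \<Rightarrow> real) \<Rightarrow> real" where
  "radon_norm \<Omega> f =
     Sup {\<bar>f v\<bar> | v. continuous_on (closure \<Omega>) v \<and> (\<forall>x\<in>closure \<Omega>. \<bar>v x\<bar> \<le> 1)}"

text \<open>For \<open>r > N\<close> every element of \<open>W1_0 \<Omega> r\<close> has a representative that is continuous on
  \<open>closure \<Omega>\<close>, and its values there are unique. The duality pairing is taken with it.\<close>

definition continuous_rep :: "(real^'n) set \<Rightarrow> (real^'n \<Rightarrow> real) \<Rightarrow> real^'n \<Rightarrow> real" where
  "continuous_rep \<Omega> w =
     (SOME v. continuous_on (closure \<Omega>) v \<and> (AE x in lebesgue_on \<Omega>. v x = w x))"

definition pairing ::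
    "(real^'n) set \<Rightarrow> ((real^'n \<Rightarrow> real) \<Rightarrow> real) \<Rightarrow> (real^'n \<Rightarrow> real) \<Rightarrow> real" where
  "pairing \<Omega> f w = f (continuous_rep \<Omega> w)"


section \<open>The regularised and the linear problem\<close>

definition psi :: "real \<Rightarrow> real" where
  "psi s = ln (1 + \<bar>s\<bar>) / (1 + ln (1 + \<bar>s\<bar>)) * (if s \<ge> 0 then 1 else - 1)"

definition elliptic_coefficient ::
    "(real^'n) set \<Rightarrow> real \<Rightarrow> real \<Rightarrow> (real^'n \<Rightarrow> real^'n^'n) \<Rightarrow> bool" where
  "elliptic_coefficient \<Omega> lam_lo lam_hi \<Lambda> \<longleftrightarrow>
     \<Lambda> \<in> Linfty \<Omega> \<and>
     (AE x in lebesgue_on \<Omega>. transpose (\<Lambda> x) = \<Lambda> x) \<and>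
     0 < lam_lo \<and> 0 < lam_hi \<and>
     (AE x in lebesgue_on \<Omega>. \<forall>\<xi>. lam_lo * (norm \<xi>)\<^sup>2 \<le> (\<Lambda> x *v \<xi>) \<bullet> \<xi> \<and>
                                   (\<Lambda> x *v \<xi>) \<bullet> \<xi> \<le> lam_hi * (norm \<xi>)\<^sup>2)"

definition regularised_solution ::
    "(real^'n) set \<Rightarrow> real \<Rightarrow> (real^'n \<Rightarrow> real^'n^'n) \<Rightarrow> ((real^'n \<Rightarrow> real) \<Rightarrow> real) \<Rightarrow>
      real \<Rightarrow> (real^'n \<Rightarrow> real) \<Rightarrow> bool" where
  "regularised_solution \<Omega> p \<Lambda> f \<epsilon> u \<longleftrightarrow>
     u \<in> W1_0 \<Omega> p \<and>
     (\<forall>w\<in>W1_0 \<Omega> p.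
        (LINT x|lebesgue_on \<Omega>. (\<Lambda> x *v weak_gradient \<Omega> u x) \<bullet> weak_gradient \<Omega> w x) +
        \<epsilon> * (LINT x|lebesgue_on \<Omega>. norm (weak_gradient \<Omega> (\<lambda>y. psi (u y)) x) powr (p - 2) *
                (weak_gradient \<Omega> u x \<bullet> weak_gradient \<Omega> w x))
        = pairing \<Omega> f w)"

definition weak_solution ::
    "(real^'n) set \<Rightarrow> (real^'n \<Rightarrow> real^'n^'n) \<Rightarrow> ((real^'n \<Rightarrow> real) \<Rightarrow> real) \<Rightarrow>
      (real^'n \<Rightarrow> real) \<Rightarrow> bool" where
  "weak_solution \<Omega> \<Lambda> f u \<longleftrightarrow>
     u \<in> S_N \<Omega> \<and>
     (\<forall>w\<in>T_N \<Omega>.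
        (LINT x|lebesgue_on \<Omega>. (\<Lambda> x *v weak_gradient \<Omega> u x) \<bullet> weak_gradient \<Omega> w x)
        = pairing \<Omega> f w)"

end

theory Submission
  imports Defs "HOL-Complex_Analysis.Great_Picard" "HOL-Library.Diagonal_Subsequence"
begin

text \<open>All bounds come from one choice of test function. A solution is tested with a bounded, increasing function of itself
  whose derivative decays like \<open>\<bar>s\<bar> powr (- \<theta>)\<close> for a \<open>\<theta> > 1\<close> as close to \<open>1\<close> as desired. The right-hand side is then at most
  a multiple of the norm of the measure \<open>f\<close>, uniformly in \<open>n\<close>, and the left-hand side controls the integral of
  \<open>(1 + u\<^sup>2) powr (- \<theta> / 2) * \<bar>\<nabla>u\<bar>\<^sup>2\<close> together with the corresponding integral for the regularising term (\<open>energy_estimate\<close>).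

  A Sobolev inequality in \<open>L\<^sup>1\<close>, proved from the Riesz potential of the gradient, applied to a power of \<open>1 + u\<^sup>2\<close> turns
  this weighted bound into bounds of \<open>u\<close> in \<open>L\<^sup>m\<close> for \<open>m (N - 2) < N\<close> (\<open>power_estimate\<close>) and, by Hoelder's inequality, of
  \<open>\<nabla>u\<close> in \<open>L\<^sup>q\<close> for \<open>q < N / (N - 1)\<close> (\<open>gradient_estimate\<close>). The kernel of the potential enters through integrals over sets
  of given measure, which is why the constants depend on the domain through its measure only.

  Convergence in \<open>L\<^sup>1\<close> and almost everywhere along a subsequence follows from the compactness theorem \<open>Rellich_L1\<close>, and
  strong convergence in the other spaces by interpolation with the bounds in \<open>L\<^sup>m\<close> (\<open>strong_convergence\<close>). For weak
  convergence in \<open>W1_0 \<Omega> q\<close> the weighted bounds are used a second time: after passing to a subsequence all \<open>\<bar>u\<^sub>n\<bar>\<close> are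
  dominated by one function \<open>S\<close>, so that the gradients are bounded in one weighted \<open>L\<^sup>2\<close> space. In this Hilbert space convex
  combinations of them with almost minimal norm form a Cauchy sequence (\<open>convex_combinations_converge\<close>), hence converge
  in \<open>L\<^sup>q\<close>; a functional that separated the sequence from its limit would separate these combinations as well.

  The derivative of \<open>psi\<close> decays at least like \<open>1 / \<bar>s\<bar>\<close>. Therefore the regularising energy and the bounds in \<open>L\<^sup>m\<close> show
  that the regularising term is of order \<open>\<epsilon> powr (1/p)\<close> (\<open>regularising_term_bound\<close>). The limit equation then holds for
  test functions. It extends to \<open>T_N \<Omega>\<close> because for \<open>r > N\<close> convergence in \<open>W1_0 \<Omega> r\<close> is uniform, so that the duality
  pairing is continuous there (\<open>pairing_limit\<close>).\<close>

section \<open>Power integrals\<close>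

text \<open>The \<open>q\<close>-th power of the \<open>L\<^sup>q\<close> norm, as an extended nonnegative number. Boundedness and convergence to
  zero are insensitive to the root, and the inequality with the factor \<open>2 powr q\<close> serves as triangle inequality.\<close>

definition Lmod :: "'a measure \<Rightarrow> real \<Rightarrow> ('a \<Rightarrow> 'b::real_normed_vector) \<Rightarrow> ennreal" where
  "Lmod M q f = (\<integral>\<^sup>+x. ennreal (norm (f x) powr q) \<partial>M)"

text \<open>Hoelder's inequality for weighted geometric means. With real bounds for the two integrals all roots are taken of
  real numbers, and each application only has to exhibit its integrand as a geometric mean.\<close>

lemma nn_integral_Holder:
  assumes [measurable]: "f \<in> borel_measurable M" "g \<in> borel_measurable M"
    and nn: "\<And>x. f x \<ge> 0" "\<And>x. g x \<ge> 0"
    and ab: "\<alpha> > 0" "\<beta> > 0" "\<alpha> + \<beta> = 1"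
    and A: "(\<integral>\<^sup>+x. ennreal (f x) \<partial>M) \<le> ennreal A" "A \<ge> 0"
    and B: "(\<integral>\<^sup>+x. ennreal (g x) \<partial>M) \<le> ennreal B" "B \<ge> 0"
  shows "(\<integral>\<^sup>+x. ennreal (f x powr \<alpha> * g x powr \<beta>) \<partial>M) \<le> ennreal (A powr \<alpha> * B powr \<beta>)"
proof (cases "A = 0 \<or> B = 0")
  case True
  then have "(AE x in M. f x = 0) \<or> (AE x in M. g x = 0)"
  proof
    assume "A = 0"
    then have "(\<integral>\<^sup>+x. ennreal (f x) \<partial>M) = 0" using A by simp
    then have "AE x in M. ennreal (f x) = 0" by (subst (asm) nn_integral_0_iff_AE) auto
    then have "AE x in M. f x = 0" by eventually_elim (use nn in \<open>auto simp: ennreal_eq_0_iff intro: antisym\<close>)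
    then show ?thesis by simp
  next
    assume "B = 0"
    then have "(\<integral>\<^sup>+x. ennreal (g x) \<partial>M) = 0" using B by simp
    then have "AE x in M. ennreal (g x) = 0" by (subst (asm) nn_integral_0_iff_AE) auto
    then have "AE x in M. g x = 0" by eventually_elim (use nn in \<open>auto simp: ennreal_eq_0_iff intro: antisym\<close>)
    then show ?thesis by simp
  qed
  then have "AE x in M. ennreal (f x powr \<alpha> * g x powr \<beta>) = 0" by (auto elim: eventually_mono)
  then have "(\<integral>\<^sup>+x. ennreal (f x powr \<alpha> * g x powr \<beta>) \<partial>M) = 0"
    by (subst nn_integral_0_iff_AE) auto
  then show ?thesis by simp
next
  case False
  then have pos: "A > 0" "B > 0" using A B by auto
  define C where "C = A powr \<alpha> * B powr \<beta>"
  have C: "C > 0" using pos by (simp add: C_def)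
  have young: "f x powr \<alpha> * g x powr \<beta> \<le> C * (\<alpha> / A * f x + \<beta> / B * g x)" for x
  proof (cases "f x = 0 \<or> g x = 0")
    case True then show ?thesis using nn[of x] ab pos C by auto
  next
    case False
    then have p: "f x > 0" "g x > 0" using nn[of x] by (auto simp: less_le)
    have "(f x / A) powr \<alpha> * (g x / B) powr \<beta> \<le> \<alpha> * (f x / A) + \<beta> * (g x / B)"
      by (rule Youngs_inequality_0) (use p pos ab in auto)
    moreover have "(f x / A) powr \<alpha> * (g x / B) powr \<beta> = (f x powr \<alpha> * g x powr \<beta>) / C"
      using p pos by (simp add: powr_divide C_def)
    ultimately show ?thesis using C by (simp add: field_simps)
  qed
  have "(\<integral>\<^sup>+x. ennreal (f x powr \<alpha> * g x powr \<beta>) \<partial>M) \<le> (\<integral>\<^sup>+x. ennreal (C * \<alpha> / A) * ennreal (f x) + ennreal (C * \<beta> / B) * ennreal (g x) \<partial>M)"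
    using young nn ab pos C by (intro nn_integral_mono) (simp add: ennreal_mult'[symmetric] ennreal_plus[symmetric] algebra_simps del: ennreal_plus)
  also have "\<dots> = ennreal (C * \<alpha> / A) * (\<integral>\<^sup>+x. ennreal (f x) \<partial>M) + ennreal (C * \<beta> / B) * (\<integral>\<^sup>+x. ennreal (g x) \<partial>M)"
    by (simp add: nn_integral_add nn_integral_cmult)
  also have "\<dots> \<le> ennreal (C * \<alpha> / A) * ennreal A + ennreal (C * \<beta> / B) * ennreal B"
    by (intro add_mono mult_left_mono A B) auto
  also have "\<dots> = ennreal (C * \<alpha> + C * \<beta>)"
    using pos ab C by (simp add: ennreal_mult'[symmetric] ennreal_plus[symmetric] del: ennreal_plus)
  also have "\<dots> = ennreal C" using ab by (simp add: distrib_left[symmetric])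
  finally show ?thesis by (simp add: C_def)
qed

lemma powr_add_le:
  fixes a b :: real assumes "a \<ge> 0" "b \<ge> 0" "q > 0"
  shows "(a + b) powr q \<le> 2 powr q * (a powr q + b powr q)"
proof -
  have "(a + b) powr q \<le> (2 * max a b) powr q" using assms by (intro powr_mono2) auto
  also have "\<dots> = 2 powr q * max a b powr q" using assms by (simp add: powr_mult)
  also have "max a b powr q \<le> a powr q + b powr q" by (auto simp: max_def)
  finally show ?thesis by simp
qed

lemma Lmod_add:
  fixes f g :: "'a \<Rightarrow> 'b::euclidean_space"
  assumes [measurable]: "f \<in> borel_measurable M" "g \<in> borel_measurable M" and q: "q > 0"
  shows "Lmod M q (\<lambda>x. f x + g x) \<le> ennreal (2 powr q) * (Lmod M q f + Lmod M q g)"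
proof -
  have "norm (f x + g x) powr q \<le> 2 powr q * (norm (f x) powr q + norm (g x) powr q)" for x
    using powr_add_le[of "norm (f x)" "norm (g x)" q] powr_mono2[of q "norm (f x + g x)" "norm (f x) + norm (g x)"] q
    by (smt (verit) norm_ge_zero norm_triangle_ineq)
  then have "Lmod M q (\<lambda>x. f x + g x) \<le> (\<integral>\<^sup>+x. ennreal (2 powr q) * (ennreal (norm (f x) powr q) + ennreal (norm (g x) powr q)) \<partial>M)"
    unfolding Lmod_def by (intro nn_integral_mono) (simp add: ennreal_mult'[symmetric] ennreal_plus[symmetric] del: ennreal_plus)
  also have "\<dots> = ennreal (2 powr q) * (Lmod M q f + Lmod M q g)"
    by (simp add: Lmod_def nn_integral_cmult nn_integral_add)
  finally show ?thesis .
qed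

lemma Lmod_minus: "Lmod M q (\<lambda>x. f x - g x) = Lmod M q (\<lambda>x. g x - f x)"
  unfolding Lmod_def by (simp add: norm_minus_commute)

lemma Lmod_diff:
  fixes f g :: "'a \<Rightarrow> 'b::euclidean_space"
  assumes [measurable]: "f \<in> borel_measurable M" "g \<in> borel_measurable M" and q: "q > 0"
  shows "Lmod M q (\<lambda>x. f x - g x) \<le> ennreal (2 powr q) * (Lmod M q f + Lmod M q g)"
  using Lmod_add[of f M "\<lambda>x. - g x" q] q by (simp add: Lmod_def)

lemma Lmod_triangle:
  fixes f g h :: "'a \<Rightarrow> 'b::euclidean_space"
  assumes [measurable]: "f \<in> borel_measurable M" "g \<in> borel_measurable M" "h \<in> borel_measurable M" and q: "q > 0"
  shows "Lmod M q (\<lambda>x. f x - h x) \<le> ennreal (2 powr q) * (Lmod M q (\<lambda>x. f x - g x) + Lmod M q (\<lambda>x. g x - h x))"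
  using Lmod_add[of "\<lambda>x. f x - g x" M "\<lambda>x. g x - h x" q] q by simp

lemma Lmod_scaleR:
  fixes f :: "'a \<Rightarrow> 'b::euclidean_space"
  assumes [measurable]: "f \<in> borel_measurable M"
  shows "Lmod M q (\<lambda>x. c *\<^sub>R f x) = ennreal (\<bar>c\<bar> powr q) * Lmod M q f"
  unfolding Lmod_def by (simp add: powr_mult ennreal_mult' nn_integral_cmult)

lemma Lmod_mono_AE:
  assumes "AE x in M. norm (f x) \<le> norm (g x)" "q > 0"
  shows "Lmod M q f \<le> Lmod M q g"
  unfolding Lmod_def
  by (rule nn_integral_mono_AE) (use assms(1) in eventually_elim, auto intro!: ennreal_leI powr_mono2 simp: assms(2) less_imp_le)

lemma Lmod_cong_AE:
  assumes "AE x in M. f x = g x"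
  shows "Lmod M q f = Lmod M q g"
  unfolding Lmod_def
  by (rule nn_integral_cong_AE) (use assms(1) in eventually_elim, auto)

lemma tendsto_ennreal_0_squeeze:
  assumes "\<And>k. (f k :: ennreal) \<le> g k" "g \<longlonglongrightarrow> 0"
  shows "f \<longlonglongrightarrow> 0"
  by (rule tendsto_sandwich[OF _ _ tendsto_const assms(2)]) (use assms in auto)

lemma tendsto_ennreal_0_add_cmult:
  assumes "(f::nat \<Rightarrow> ennreal) \<longlonglongrightarrow> 0" "g \<longlonglongrightarrow> 0"
  shows "(\<lambda>k. ennreal c * (f k + g k)) \<longlonglongrightarrow> 0"
  using ennreal_tendsto_cmult[OF _ tendsto_add[OF assms], of "ennreal c"] by simp

lemma Lmod_tendsto_add:
  fixes f g :: "'a \<Rightarrow> 'b::euclidean_space"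
  assumes [measurable]: "f \<in> borel_measurable M" "g \<in> borel_measurable M"
    "\<And>k. F k \<in> borel_measurable M" "\<And>k. H k \<in> borel_measurable M" and q: "q > 0"
    and F: "(\<lambda>k. Lmod M q (\<lambda>x. F k x - f x)) \<longlonglongrightarrow> 0"
    and H: "(\<lambda>k. Lmod M q (\<lambda>x. H k x - g x)) \<longlonglongrightarrow> 0"
  shows "(\<lambda>k. Lmod M q (\<lambda>x. (F k x + H k x) - (f x + g x))) \<longlonglongrightarrow> 0"
proof (rule tendsto_ennreal_0_squeeze[OF _ tendsto_ennreal_0_add_cmult[OF F H, of "2 powr q"]])
  fix k
  have "Lmod M q (\<lambda>x. (F k x + H k x) - (f x + g x)) = Lmod M q (\<lambda>x. (F k x - f x) + (H k x - g x))"
    by (simp add: algebra_simps)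
  also have "\<dots> \<le> ennreal (2 powr q) * (Lmod M q (\<lambda>x. F k x - f x) + Lmod M q (\<lambda>x. H k x - g x))"
    by (rule Lmod_add) (use q in auto)
  finally show "Lmod M q (\<lambda>x. (F k x + H k x) - (f x + g x)) \<le> \<dots>" .
qed

lemma Lmod_tendsto_scaleR:
  fixes f :: "'a \<Rightarrow> 'b::euclidean_space"
  assumes [measurable]: "f \<in> borel_measurable M" "\<And>k. F k \<in> borel_measurable M"
    and F: "(\<lambda>k. Lmod M q (\<lambda>x. F k x - f x)) \<longlonglongrightarrow> 0"
  shows "(\<lambda>k. Lmod M q (\<lambda>x. c *\<^sub>R F k x - c *\<^sub>R f x)) \<longlonglongrightarrow> 0"
  using ennreal_tendsto_cmult[OF _ F, of "ennreal (\<bar>c\<bar> powr q)"]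
  by (simp add: Lmod_scaleR[symmetric] scaleR_diff_right)

lemma Lmod_finite_if_tendsto:
  fixes f :: "'a \<Rightarrow> 'b::euclidean_space"
  assumes [measurable]: "f \<in> borel_measurable M" "\<And>k. F k \<in> borel_measurable M"
    and fin: "\<And>k. Lmod M q (F k) < \<infinity>" and q: "q > 0"
    and F: "(\<lambda>k. Lmod M q (\<lambda>x. F k x - f x)) \<longlonglongrightarrow> 0"
  shows "Lmod M q f < \<infinity>"
proof -
  have "eventually (\<lambda>k. Lmod M q (\<lambda>x. F k x - f x) < 1) sequentially"
    by (rule order_tendstoD[OF F]) simp
  then obtain k where k: "Lmod M q (\<lambda>x. F k x - f x) < 1" by (auto simp: eventually_sequentially)
  have "Lmod M q f \<le> ennreal (2 powr q) * (Lmod M q (F k) + Lmod M q (\<lambda>x. F k x - f x))"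
    using Lmod_diff[of "F k" M "\<lambda>x. F k x - f x" q] q by simp
  also have "\<dots> < \<infinity>" using k fin[of k] by (auto simp: ennreal_mult_less_top top_unique less_top dest: less_trans[OF _ ennreal_one_less_top])
  finally show ?thesis .
qed

lemma tendsto_inverse_plus_1: "(\<lambda>k. 1 / (real k + 1)) \<longlonglongrightarrow> 0"
  using LIMSEQ_inverse_real_of_nat by (simp add: inverse_eq_divide add.commute)

lemma tendsto_ennreal_inverse_plus_1: "(\<lambda>k. ennreal (1 / (real k + 1))) \<longlonglongrightarrow> 0"
  using tendsto_ennrealI[OF tendsto_inverse_plus_1] by simp

lemma tendsto_0_if_ennreal_abs:
  fixes f :: "nat \<Rightarrow> real"
  assumes "(\<lambda>k. ennreal \<bar>f k\<bar>) \<longlonglongrightarrow> 0" shows "f \<longlonglongrightarrow> 0"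
  using tendsto_enn2real[of "\<lambda>k. ennreal \<bar>f k\<bar>" 0] assms by (simp add: tendsto_rabs_zero_iff)

lemma ae_subseq_if_nn_integral_tendsto_0:
  fixes f :: "nat \<Rightarrow> 'a \<Rightarrow> real"
  assumes [measurable]: "\<And>k. f k \<in> borel_measurable M" and nn: "\<And>k x. f k x \<ge> 0"
    and lim: "(\<lambda>k. \<integral>\<^sup>+x. ennreal (f k x) \<partial>M) \<longlonglongrightarrow> 0"
  shows "\<exists>r::nat\<Rightarrow>nat. strict_mono r \<and> (AE x in M. (\<lambda>k. f (r k) x) \<longlonglongrightarrow> 0)"
proof -
  have "eventually (\<lambda>k. (\<integral>\<^sup>+x. ennreal (f k x) \<partial>M) < 1) sequentially"
    by (rule order_tendstoD[OF lim]) simp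
  then obtain K where K: "\<And>k. k \<ge> K \<Longrightarrow> (\<integral>\<^sup>+x. ennreal (f k x) \<partial>M) < 1" by (auto simp: eventually_sequentially)
  have int: "integrable M (f (k + K))" for k
    by (rule integrableI_bounded) (use K[of "k+K"] nn in \<open>auto intro: less_trans[OF _ ennreal_one_less_top]\<close>)
  have "(\<lambda>k. enn2real (\<integral>\<^sup>+x. ennreal (f (k + K) x) \<partial>M)) \<longlonglongrightarrow> enn2real 0"
    by (rule tendsto_enn2real) (use LIMSEQ_ignore_initial_segment[OF lim, of K] in auto)
  then have "(\<lambda>k. \<integral>x. norm (f (k + K) x) \<partial>M) \<longlonglongrightarrow> 0"
    using nn by (simp add: integral_eq_nn_integral)
  from tendsto_L1_AE_subseq[OF int this] obtain r :: "nat \<Rightarrow> nat" where r: "strict_mono r"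
      "AE x in M. (\<lambda>k. f (r k + K) x) \<longlonglongrightarrow> 0" by auto
  then show ?thesis by (intro exI[of _ "\<lambda>k. r k + K"]) (auto simp: strict_mono_def)
qed

lemma Lmod_tendsto_AE_subseq:
  fixes f :: "'a \<Rightarrow> 'b::euclidean_space"
  assumes [measurable]: "f \<in> borel_measurable M" "\<And>k. F k \<in> borel_measurable M" and q: "q > 0"
    and F: "(\<lambda>k. Lmod M q (\<lambda>x. F k x - f x)) \<longlonglongrightarrow> 0"
  shows "\<exists>r::nat\<Rightarrow>nat. strict_mono r \<and> (AE x in M. (\<lambda>k. F (r k) x) \<longlonglongrightarrow> f x)"
proof -
  obtain r :: "nat \<Rightarrow> nat" where r: "strict_mono r" "AE x in M. (\<lambda>k. norm (F (r k) x - f x) powr q) \<longlonglongrightarrow> 0"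
    using ae_subseq_if_nn_integral_tendsto_0[of "\<lambda>k x. norm (F k x - f x) powr q" M] F unfolding Lmod_def by auto
  from r(2) have "AE x in M. (\<lambda>k. F (r k) x) \<longlonglongrightarrow> f x"
  proof eventually_elim
    case (elim x)
    have "(\<lambda>k. (norm (F (r k) x - f x) powr q) powr (1/q)) \<longlonglongrightarrow> 0 powr (1/q)"
      by (rule tendsto_powr2[OF elim]) (use q in auto)
    then have "(\<lambda>k. norm (F (r k) x - f x)) \<longlonglongrightarrow> 0" using q by (simp add: powr_powr)
    then show ?case by (simp add: LIM_zero_iff tendsto_norm_zero_iff)
  qed
  with r show ?thesis by auto
qed

lemma Lmod_Fatou:
  fixes f :: "'a \<Rightarrow> 'b::euclidean_space"
  assumes [measurable]: "\<And>k. F k \<in> borel_measurable M"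
    and lim: "AE x in M. (\<lambda>k. F k x) \<longlonglongrightarrow> f x" and q: "q > 0"
    and le: "eventually (\<lambda>k. Lmod M q (F k) \<le> C) sequentially"
  shows "Lmod M q f \<le> C"
proof -
  have "Lmod M q f = (\<integral>\<^sup>+x. liminf (\<lambda>k. ennreal (norm (F k x) powr q)) \<partial>M)"
    unfolding Lmod_def
  proof (rule nn_integral_cong_AE, use lim in eventually_elim)
    fix x assume "(\<lambda>k. F k x) \<longlonglongrightarrow> f x"
    then have "(\<lambda>k. norm (F k x) powr q) \<longlonglongrightarrow> norm (f x) powr q"
      using q by (intro tendsto_powr2 tendsto_norm) auto
    then have "(\<lambda>k. ennreal (norm (F k x) powr q)) \<longlonglongrightarrow> ennreal (norm (f x) powr q)" by (rule tendsto_ennrealI)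
    then show "ennreal (norm (f x) powr q) = liminf (\<lambda>k. ennreal (norm (F k x) powr q))"
      using lim_imp_Liminf[of sequentially] by (metis sequentially_bot)
  qed
  also have "\<dots> \<le> liminf (\<lambda>k. Lmod M q (F k))"
    unfolding Lmod_def by (rule nn_integral_liminf) auto
  also have "\<dots> \<le> C"
    by (rule Liminf_le[OF _ le]) simp
  finally show ?thesis .
qed

lemma ennreal_tendsto_0_iff:
  fixes f :: "nat \<Rightarrow> ennreal"
  shows "f \<longlonglongrightarrow> 0 \<longleftrightarrow> (\<forall>e>0. eventually (\<lambda>k. f k \<le> ennreal e) sequentially)"
proof
  assume L: "f \<longlonglongrightarrow> 0"
  show "\<forall>e>0. eventually (\<lambda>k. f k \<le> ennreal e) sequentially"
  proof (intro allI impI)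
    fix e :: real assume "e > 0"
    then have "eventually (\<lambda>k. f k < ennreal e) sequentially" by (intro order_tendstoD[OF L]) simp
    then show "eventually (\<lambda>k. f k \<le> ennreal e) sequentially" by eventually_elim simp
  qed
next
  assume R: "\<forall>e>0. eventually (\<lambda>k. f k \<le> ennreal e) sequentially"
  show "f \<longlonglongrightarrow> 0"
  proof (rule order_tendstoI)
    fix a :: ennreal assume "0 < a"
    then obtain b where b: "0 < b" "b < a" using dense by blast
    then obtain e where e: "b = ennreal e" "e \<ge> 0" by (cases b) auto
    have "e > 0" using b e by (cases "e = 0") auto
    then have "eventually (\<lambda>k. f k \<le> ennreal e) sequentially" using R by blast
    then show "eventually (\<lambda>k. f k < a) sequentially" by eventually_elim (use b e in auto)
  qed auto
qed

text \<open>Transfers convergence through an estimate with a positive power, as all the Hoelder estimates are.\<close>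

lemma tendsto_0_via_powr:
  fixes f g :: "nat \<Rightarrow> ennreal"
  assumes le: "\<And>k A. A \<ge> 0 \<Longrightarrow> f k \<le> ennreal A \<Longrightarrow> g k \<le> ennreal (C * A powr s)"
    and s: "s > 0" and C: "C \<ge> 0" and lim: "f \<longlonglongrightarrow> 0"
  shows "g \<longlonglongrightarrow> 0"
  unfolding ennreal_tendsto_0_iff
proof (intro allI impI)
  fix e :: real assume e: "e > 0"
  define A where "A = (e / (C + 1)) powr (1/s)"
  have A: "A > 0" using e C by (auto simp: A_def)
  have "C * A powr s = C * (e / (C + 1))" using s e C by (simp add: A_def powr_powr)
  also have "\<dots> \<le> e" using e C by (simp add: field_simps)
  finally have Ae: "C * A powr s \<le> e" .
  have "eventually (\<lambda>k. f k \<le> ennreal A) sequentially" using lim A ennreal_tendsto_0_iff by blast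
  then show "eventually (\<lambda>k. g k \<le> ennreal e) sequentially"
    by eventually_elim (use le[of A] A Ae in \<open>force intro: order_trans ennreal_leI\<close>)
qed

text \<open>A subsequence whose \<open>k\<close>-th member satisfies the \<open>k\<close>-th of countably many conditions of increasing strength; it
  provides the rapidly convergent subsequences below.\<close>

lemma subseq_eventually:
  assumes "\<And>k::nat. eventually (P k) sequentially"
  shows "\<exists>r::nat\<Rightarrow>nat. strict_mono r \<and> (\<forall>k. P k (r k))"
proof -
  have "\<exists>n>m. P k n" for k m
  proof -
    have "eventually (\<lambda>n. n > m \<and> P k n) sequentially"
      by (intro eventually_conj assms eventually_gt_at_top)
    then show ?thesis by (auto simp: eventually_sequentially)
  qed
  then have "\<forall>k. \<exists>h. \<forall>m. h m > m \<and> P k (h m)" by (intro allI choice) blast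
  then obtain g where "\<forall>k m. g k m > m \<and> P k (g k m)" using choice by meson
  then have g: "\<And>k m. g k m > m \<and> P k (g k m)" by blast
  define r where "r = rec_nat (g 0 0) (\<lambda>k m. g (Suc k) m)"
  have "r (Suc k) = g (Suc k) (r k)" for k by (simp add: r_def)
  then have "strict_mono r" using g by (auto simp: strict_mono_Suc_iff)
  moreover have "P k (r k)" for k using g by (cases k) (auto simp: r_def)
  ultimately show ?thesis by blast
qed

text \<open>The weights \<open>2 ^ k\<close> make the increments decay geometrically, whatever the exponent.\<close>

lemma convergent_if_weighted_powr_sum_finite:
  fixes a :: "nat \<Rightarrow> 'b::euclidean_space"
  assumes fin: "(\<Sum>k. ennreal (2 ^ k * norm (a (Suc k) - a k) powr q)) \<noteq> \<infinity>" and q: "q > 0"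
  shows "convergent a"
proof -
  have real: "\<exists>C\<ge>0. S = ennreal C" if "S \<noteq> \<infinity>" for S using that by (cases S) auto
  obtain C where C: "(\<Sum>k. ennreal (2 ^ k * norm (a (Suc k) - a k) powr q)) = ennreal C" "C \<ge> 0"
    using real[OF fin] by blast
  have le: "norm (a (Suc k) - a k) \<le> C powr (1/q) * (2 powr (-1/q)) ^ k" for k
  proof -
    have "(\<Sum>j\<in>{k}. ennreal (2 ^ j * norm (a (Suc j) - a j) powr q)) \<le> ennreal C"
      unfolding C(1)[symmetric] by (rule sum_le_suminf) auto
    then have "2 ^ k * norm (a (Suc k) - a k) powr q \<le> C" using C by simp
    then have "norm (a (Suc k) - a k) powr q \<le> C * 2 powr (- real k)"
      by (simp add: powr_minus powr_realpow field_simps)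
    then have "(norm (a (Suc k) - a k) powr q) powr (1/q) \<le> (C * 2 powr (- real k)) powr (1/q)"
      using q by (intro powr_mono2) auto
    then show ?thesis using q C by (simp add: powr_powr powr_mult powr_realpow[symmetric] mult.commute)
  qed
  have "summable (\<lambda>k. a (Suc k) - a k)"
  proof (rule summable_comparison_test')
    show "summable (\<lambda>k. C powr (1/q) * (2 powr (-1/q)) ^ k)"
      using q by (intro summable_mult summable_geometric) (auto simp: powr_less_one)
    show "norm (a (Suc k) - a k) \<le> C powr (1/q) * (2 powr (-1/q)) ^ k" if "k \<ge> 0" for k by (rule le)
  qed
  then have "convergent (\<lambda>n. \<Sum>k<n. a (Suc k) - a k)" by (simp add: summable_iff_convergent)
  then have "convergent (\<lambda>n. (a n - a 0) + a 0)" by (intro convergent_add convergent_const) (simp add: sum_lessThan_telescope)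
  then show ?thesis by simp
qed

text \<open>Completeness of \<open>L\<^sup>q\<close>: along a subsequence with rapidly decreasing increments the values converge almost
  everywhere, and Fatou's lemma identifies the limit of the whole sequence.\<close>

lemma Lmod_complete:
  fixes F :: "nat \<Rightarrow> 'a \<Rightarrow> 'b::euclidean_space"
  assumes meas[measurable]: "\<And>k. F k \<in> borel_measurable M" and q: "q > 0"
    and Cauchy: "\<And>e. e > 0 \<Longrightarrow> \<exists>K. \<forall>m\<ge>K. \<forall>n\<ge>K. Lmod M q (\<lambda>x. F m x - F n x) \<le> ennreal e"
  shows "\<exists>f r. f \<in> borel_measurable M \<and> strict_mono (r::nat\<Rightarrow>nat) \<and> (AE x in M. (\<lambda>k. F (r k) x) \<longlonglongrightarrow> f x) \<and>
      (\<lambda>k. Lmod M q (\<lambda>x. F k x - f x)) \<longlonglongrightarrow> 0"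
proof -
  have ev: "eventually (\<lambda>n. \<forall>m\<ge>n. Lmod M q (\<lambda>x. F m x - F n x) \<le> ennreal ((1/4)^k)) sequentially" for k::nat
  proof -
    obtain K where "\<And>m n. m \<ge> K \<Longrightarrow> n \<ge> K \<Longrightarrow> Lmod M q (\<lambda>x. F m x - F n x) \<le> ennreal ((1/4)^k)"
      using Cauchy[of "(1/4)^k"] by auto
    then show ?thesis unfolding eventually_sequentially by (intro exI[of _ K]) auto
  qed
  from subseq_eventually[of "\<lambda>k n. \<forall>m\<ge>n. Lmod M q (\<lambda>x. F m x - F n x) \<le> ennreal ((1/4)^k)", OF ev] obtain r :: "nat \<Rightarrow> nat" where r: "strict_mono r"
    and rle: "\<And>k m. m \<ge> r k \<Longrightarrow> Lmod M q (\<lambda>x. F m x - F (r k) x) \<le> ennreal ((1/4)^k)" by blast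
  let ?t = "\<lambda>k x. ennreal (2 ^ k * norm (F (r (Suc k)) x - F (r k) x) powr q)"
  have "(\<integral>\<^sup>+x. ?t k x \<partial>M) \<le> ennreal ((1/2)^k)" for k
  proof -
    have "(\<integral>\<^sup>+x. ?t k x \<partial>M) = ennreal (2^k) * Lmod M q (\<lambda>x. F (r (Suc k)) x - F (r k) x)"
      by (simp add: Lmod_def ennreal_mult' nn_integral_cmult)
    also have "\<dots> \<le> ennreal (2^k) * ennreal ((1/4)^k)"
      by (intro mult_left_mono rle) (use r in \<open>auto simp: strict_mono_less_eq\<close>)
    also have "\<dots> = ennreal ((1/2)^k)" by (simp add: ennreal_mult'[symmetric] power_mult_distrib[symmetric])
    finally show ?thesis .
  qed
  then have "(\<integral>\<^sup>+x. (\<Sum>k. ?t k x) \<partial>M) \<le> (\<Sum>k. ennreal ((1/2)^k))"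
    by (subst nn_integral_suminf) (auto intro!: suminf_le)
  also have "\<dots> = ennreal (\<Sum>k. (1/2::real)^k)" by (rule suminf_ennreal2) (auto intro: summable_geometric)
  also have "\<dots> < \<infinity>" by simp
  finally have "AE x in M. (\<Sum>k. ?t k x) \<noteq> \<infinity>" by (intro nn_integral_noteq_infinite) auto
  then have conv: "AE x in M. convergent (\<lambda>k. F (r k) x)"
    by eventually_elim (rule convergent_if_weighted_powr_sum_finite[OF _ q], simp)
  define f where "f x = lim (\<lambda>k. F (r k) x)" for x
  have f[measurable]: "f \<in> borel_measurable M" unfolding f_def by measurable
  from conv have AE: "AE x in M. (\<lambda>k. F (r k) x) \<longlonglongrightarrow> f x"
    by eventually_elim (simp add: f_def convergent_LIMSEQ_iff)
  have "(\<lambda>k. Lmod M q (\<lambda>x. F k x - f x)) \<longlonglongrightarrow> 0"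
    unfolding ennreal_tendsto_0_iff
  proof (intro allI impI)
    fix e :: real assume "e > 0"
    then obtain K where K: "\<And>m n. m \<ge> K \<Longrightarrow> n \<ge> K \<Longrightarrow> Lmod M q (\<lambda>x. F m x - F n x) \<le> ennreal e" using Cauchy by blast
    have "Lmod M q (\<lambda>x. F m x - f x) \<le> ennreal e" if m: "m \<ge> K" for m
    proof (rule Lmod_Fatou[of "\<lambda>k x. F m x - F (r k) x"])
      show "AE x in M. (\<lambda>k. F m x - F (r k) x) \<longlonglongrightarrow> F m x - f x"
        using AE by eventually_elim (intro tendsto_diff tendsto_const)
      show "eventually (\<lambda>k. Lmod M q (\<lambda>x. F m x - F (r k) x) \<le> ennreal e) sequentially"
        using eventually_ge_at_top[of K] by eventually_elim (use K m r seq_suble order_trans in blast)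
    qed (use q in auto)
    then show "eventually (\<lambda>k. Lmod M q (\<lambda>x. F k x - f x) \<le> ennreal e) sequentially"
      by (auto simp: eventually_sequentially)
  qed
  with f r AE show ?thesis by blast
qed

text \<open>The chain rule is passed to the limit with this lemma: \<open>a k\<close> is a bounded derivative evaluated along
  converging functions and \<open>H k\<close> is a converging sequence of gradients.\<close>

lemma Lmod_tendsto_dominated_product:
  fixes G :: "'a \<Rightarrow> 'b::euclidean_space" and b :: "'a \<Rightarrow> real"
  assumes [measurable]: "G \<in> borel_measurable M" "\<And>k. H k \<in> borel_measurable M"
     "b \<in> borel_measurable M" "\<And>k. a k \<in> borel_measurable M" and q: "q > 0"
    and lim: "AE x in M. (\<lambda>k. a k x) \<longlonglongrightarrow> b x" and bd: "\<And>k. AE x in M. \<bar>a k x\<bar> \<le> B"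
    and fin: "Lmod M q G < \<infinity>" and H: "(\<lambda>k. Lmod M q (\<lambda>x. H k x - G x)) \<longlonglongrightarrow> 0"
  shows "(\<lambda>k. Lmod M q (\<lambda>x. a k x *\<^sub>R H k x - b x *\<^sub>R G x)) \<longlonglongrightarrow> 0"
proof -
  have bd': "AE x in M. \<forall>k. \<bar>a k x\<bar> \<le> B" using bd by (simp add: AE_all_countable)
  have bB: "AE x in M. \<bar>b x\<bar> \<le> B"
    using lim bd' by eventually_elim (rule LIMSEQ_le_const2[OF tendsto_rabs], auto)
  have 1: "(\<lambda>k. Lmod M q (\<lambda>x. a k x *\<^sub>R (H k x - G x))) \<longlonglongrightarrow> 0"
  proof (rule tendsto_ennreal_0_squeeze)
    show "Lmod M q (\<lambda>x. a k x *\<^sub>R (H k x - G x)) \<le> ennreal (\<bar>B\<bar> powr q) * Lmod M q (\<lambda>x. H k x - G x)" for k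
      by (subst Lmod_scaleR[symmetric], simp, rule Lmod_mono_AE[OF _ q])
         (use bd[of k] in eventually_elim, auto intro!: mult_right_mono)
    show "(\<lambda>k. ennreal (\<bar>B\<bar> powr q) * Lmod M q (\<lambda>x. H k x - G x)) \<longlonglongrightarrow> 0"
      using ennreal_tendsto_cmult[OF _ H, of "ennreal (\<bar>B\<bar> powr q)"] by simp
  qed
  have 2: "(\<lambda>k. Lmod M q (\<lambda>x. (a k x - b x) *\<^sub>R G x)) \<longlonglongrightarrow> 0"
  proof -
    have "(\<lambda>k. \<integral>\<^sup>+x. ennreal (norm ((a k x - b x) *\<^sub>R G x) powr q) \<partial>M) \<longlonglongrightarrow> (\<integral>\<^sup>+x. 0 \<partial>M)"
    proof (rule nn_integral_dominated_convergence[where w="\<lambda>x. ennreal ((2*\<bar>B\<bar>) powr q) * ennreal (norm (G x) powr q)"])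
      show "(\<integral>\<^sup>+x. ennreal ((2*\<bar>B\<bar>) powr q) * ennreal (norm (G x) powr q) \<partial>M) < \<infinity>"
        using fin by (simp add: nn_integral_cmult Lmod_def ennreal_mult_less_top)
      show "AE x in M. ennreal (norm ((a k x - b x) *\<^sub>R G x) powr q) \<le> ennreal ((2*\<bar>B\<bar>) powr q) * ennreal (norm (G x) powr q)" for k
        using bd[of k] bB
        by eventually_elim
          (use q in \<open>auto simp: ennreal_mult'[symmetric] powr_mult[symmetric] intro!: ennreal_leI powr_mono2 mult_right_mono\<close>)
      show "AE x in M. (\<lambda>k. ennreal (norm ((a k x - b x) *\<^sub>R G x) powr q)) \<longlonglongrightarrow> 0"
        using lim
      proof eventually_elim
        fix x assume "(\<lambda>k. a k x) \<longlonglongrightarrow> b x"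
        then have "(\<lambda>k. norm ((a k x - b x) *\<^sub>R G x)) \<longlonglongrightarrow> norm ((b x - b x) *\<^sub>R G x)" by (intro tendsto_intros)
        then have "(\<lambda>k. norm ((a k x - b x) *\<^sub>R G x) powr q) \<longlonglongrightarrow> norm ((b x - b x) *\<^sub>R G x) powr q"
          using q by (intro tendsto_powr2) auto
        then show "(\<lambda>k. ennreal (norm ((a k x - b x) *\<^sub>R G x) powr q)) \<longlonglongrightarrow> 0"
          by (intro tendsto_eq_rhs[OF tendsto_ennrealI]) auto
      qed
    qed auto
    then show ?thesis by (simp add: Lmod_def)
  qed
  show ?thesis
  proof (rule tendsto_ennreal_0_squeeze[OF _ tendsto_ennreal_0_add_cmult[OF 1 2, of "2 powr q"]])
    show "Lmod M q (\<lambda>x. a k x *\<^sub>R H k x - b x *\<^sub>R G x)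
       \<le> ennreal (2 powr q) * (Lmod M q (\<lambda>x. a k x *\<^sub>R (H k x - G x)) + Lmod M q (\<lambda>x. (a k x - b x) *\<^sub>R G x))" for k
      using Lmod_add[of "\<lambda>x. a k x *\<^sub>R (H k x - G x)" M "\<lambda>x. (a k x - b x) *\<^sub>R G x" q] q
      by (simp add: algebra_simps)
  qed
qed

lemma Lmod_Holder:
  fixes f :: "'a \<Rightarrow> 'b::euclidean_space" and g :: "'a \<Rightarrow> 'c::euclidean_space"
  assumes [measurable]: "f \<in> borel_measurable M" "g \<in> borel_measurable M"
    and p: "p > 1" and A: "Lmod M p f \<le> ennreal A" "A \<ge> 0" and B: "Lmod M (p / (p - 1)) g \<le> ennreal B" "B \<ge> 0"
  shows "(\<integral>\<^sup>+x. ennreal (norm (f x) * norm (g x)) \<partial>M) \<le> ennreal (A powr (1/p) * B powr (1 - 1/p))"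
proof -
  have "(\<integral>\<^sup>+x. ennreal ((norm (f x) powr p) powr (1/p) * (norm (g x) powr (p/(p-1))) powr (1 - 1/p)) \<partial>M)
      \<le> ennreal (A powr (1/p) * B powr (1 - 1/p))"
    by (rule nn_integral_Holder) (use A B p in \<open>auto simp: Lmod_def\<close>)
  moreover have "p / (p-1) * (1 - 1/p) = 1" using p by (simp add: field_simps)
  ultimately show ?thesis using p by (simp add: powr_powr)
qed

lemma Lmod_lower_exponent:
  fixes f :: "'a \<Rightarrow> 'b::euclidean_space"
  assumes "finite_measure M" and [measurable]: "f \<in> borel_measurable M"
    and q: "0 < q" "q < p" and A: "Lmod M p f \<le> ennreal A" "A \<ge> 0"
  shows "Lmod M q f \<le> ennreal (A powr (q/p) * measure M (space M) powr (1 - q/p))"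
proof -
  interpret finite_measure M by fact
  have "(\<integral>\<^sup>+x. ennreal ((norm (f x) powr p) powr (q/p) * 1 powr (1 - q/p)) \<partial>M)
      \<le> ennreal (A powr (q/p) * measure M (space M) powr (1 - q/p))"
    by (rule nn_integral_Holder) (use A q in \<open>auto simp: Lmod_def emeasure_eq_measure\<close>)
  then show ?thesis using q by (simp add: powr_powr Lmod_def)
qed

lemma Lmod_lower_exponent_finite:
  fixes f :: "'a \<Rightarrow> 'b::euclidean_space"
  assumes "finite_measure M" and [measurable]: "f \<in> borel_measurable M"
    and q: "0 < q" "q \<le> p" and A: "Lmod M p f < \<infinity>"
  shows "Lmod M q f < \<infinity>"
proof (cases "q = p")
  case False
  have "Lmod M p f \<le> ennreal (enn2real (Lmod M p f))" using A by simp
  from Lmod_lower_exponent[OF assms(1,2) q(1) _ this] False q show ?thesis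
    by (auto intro: le_less_trans)
qed (use A in simp)

lemma Lmod_lower_exponent_tendsto:
  fixes f :: "'a \<Rightarrow> 'b::euclidean_space"
  assumes fm: "finite_measure M" and [measurable]: "f \<in> borel_measurable M" "\<And>k. F k \<in> borel_measurable M"
    and q: "0 < q" "q \<le> p" and lim: "(\<lambda>k. Lmod M p (\<lambda>x. F k x - f x)) \<longlonglongrightarrow> 0"
  shows "(\<lambda>k. Lmod M q (\<lambda>x. F k x - f x)) \<longlonglongrightarrow> 0"
proof (cases "q = p")
  case False
  show ?thesis
  proof (rule tendsto_0_via_powr[OF _ _ _ lim])
    show "Lmod M q (\<lambda>x. F k x - f x) \<le> ennreal (measure M (space M) powr (1 - q/p) * A powr (q/p))"
      if "A \<ge> 0" "Lmod M p (\<lambda>x. F k x - f x) \<le> ennreal A" for k A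
      using Lmod_lower_exponent[OF fm _ q(1) _ that(2,1)] False q by (simp add: mult.commute)
  qed (use q in auto)
qed (use lim in simp)

lemma integrable_inner_Holder:
  fixes f g :: "'a \<Rightarrow> 'b::euclidean_space"
  assumes [measurable]: "f \<in> borel_measurable M" "g \<in> borel_measurable M"
    and p: "p > 1" and A: "Lmod M p f < \<infinity>" and B: "Lmod M (p / (p - 1)) g < \<infinity>"
  shows "integrable M (\<lambda>x. f x \<bullet> g x)"
proof (rule integrableI_bounded)
  have "(\<integral>\<^sup>+x. ennreal (norm (f x \<bullet> g x)) \<partial>M) \<le> (\<integral>\<^sup>+x. ennreal (norm (f x) * norm (g x)) \<partial>M)"
    by (intro nn_integral_mono ennreal_leI) (simp add: Cauchy_Schwarz_ineq2)
  also have "\<dots> \<le> ennreal (enn2real (Lmod M p f) powr (1/p) * enn2real (Lmod M (p/(p-1)) g) powr (1 - 1/p))"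
    by (rule Lmod_Holder) (use p A B in auto)
  finally show "(\<integral>\<^sup>+x. ennreal (norm (f x \<bullet> g x)) \<partial>M) < \<infinity>" by (rule le_less_trans) simp
qed simp

lemma abs_integral_inner_Holder:
  fixes f g :: "'a \<Rightarrow> 'b::euclidean_space"
  assumes [measurable]: "f \<in> borel_measurable M" "g \<in> borel_measurable M"
    and p: "p > 1" and A: "Lmod M p f \<le> ennreal A" "A \<ge> 0" and B: "Lmod M (p / (p - 1)) g \<le> ennreal B" "B \<ge> 0"
  shows "\<bar>\<integral>x. f x \<bullet> g x \<partial>M\<bar> \<le> A powr (1/p) * B powr (1 - 1/p)"
proof -
  have i: "integrable M (\<lambda>x. f x \<bullet> g x)"
    by (rule integrable_inner_Holder[OF _ _ p]) (use A B in \<open>auto intro: le_less_trans\<close>)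
  have "ennreal \<bar>\<integral>x. f x \<bullet> g x \<partial>M\<bar> \<le> (\<integral>\<^sup>+x. ennreal (norm (f x \<bullet> g x)) \<partial>M)"
    using integral_norm_bound_ennreal[OF i] by simp
  also have "\<dots> \<le> (\<integral>\<^sup>+x. ennreal (norm (f x) * norm (g x)) \<partial>M)"
    by (intro nn_integral_mono ennreal_leI) (simp add: Cauchy_Schwarz_ineq2)
  also have "\<dots> \<le> ennreal (A powr (1/p) * B powr (1 - 1/p))"
    by (rule Lmod_Holder) (use p A B in auto)
  finally show ?thesis by (subst (asm) ennreal_le_iff) auto
qed

lemma tendsto_integral_inner:
  fixes f g :: "'a \<Rightarrow> 'b::euclidean_space"
  assumes [measurable]: "f \<in> borel_measurable M" "g \<in> borel_measurable M" "\<And>k. F k \<in> borel_measurable M"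
    and p: "p > 1" and A: "\<And>k. Lmod M p (F k) < \<infinity>" and B: "Lmod M (p / (p - 1)) g < \<infinity>"
    and lim: "(\<lambda>k. Lmod M p (\<lambda>x. F k x - f x)) \<longlonglongrightarrow> 0"
  shows "(\<lambda>k. \<integral>x. F k x \<bullet> g x \<partial>M) \<longlonglongrightarrow> (\<integral>x. f x \<bullet> g x \<partial>M)"
proof -
  have finf: "Lmod M p f < \<infinity>" by (rule Lmod_finite_if_tendsto[OF _ _ A _ lim]) (use p in auto)
  have "(\<lambda>k. ennreal \<bar>(\<integral>x. F k x \<bullet> g x \<partial>M) - (\<integral>x. f x \<bullet> g x \<partial>M)\<bar>) \<longlonglongrightarrow> 0"
  proof (rule tendsto_0_via_powr[OF _ _ _ lim])
    fix k A0 assume A0: "(A0::real) \<ge> 0" "Lmod M p (\<lambda>x. F k x - f x) \<le> ennreal A0"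
    have "(\<integral>x. F k x \<bullet> g x \<partial>M) - (\<integral>x. f x \<bullet> g x \<partial>M) = (\<integral>x. (F k x - f x) \<bullet> g x \<partial>M)"
      unfolding inner_diff_left
      by (rule Bochner_Integration.integral_diff[symmetric]) (auto intro!: integrable_inner_Holder[OF _ _ p] A B finf)
    also have "\<bar>\<dots>\<bar> \<le> A0 powr (1/p) * enn2real (Lmod M (p/(p-1)) g) powr (1 - 1/p)"
      by (rule abs_integral_inner_Holder) (use A0 B p in auto)
    finally show "ennreal \<bar>(\<integral>x. F k x \<bullet> g x \<partial>M) - (\<integral>x. f x \<bullet> g x \<partial>M)\<bar>
        \<le> ennreal (enn2real (Lmod M (p/(p-1)) g) powr (1 - 1/p) * A0 powr (1/p))"
      by (intro ennreal_leI) (simp add: mult.commute)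
  qed (use p in auto)
  then show ?thesis by (rule tendsto_0_if_ennreal_abs[THEN LIM_zero_cancel])
qed

section \<open>Continuously differentiable functions with compact support\<close>

text \<open>The second argument is the gradient of the first.\<close>

definition C1c :: "('a::euclidean_space \<Rightarrow> real) \<Rightarrow> ('a \<Rightarrow> 'a) \<Rightarrow> bool" where
  "C1c g G \<longleftrightarrow> (\<forall>x. (g has_derivative (\<lambda>h. G x \<bullet> h)) (at x)) \<and> continuous_on UNIV G \<and>
     (\<exists>R>0. \<forall>x. norm x \<ge> R \<longrightarrow> g x = 0 \<and> G x = 0)"

lemma ball_borel [measurable]: "ball (c::'a::euclidean_space) r \<in> sets borel" by simp

lemma emeasure_cball_less_top: "emeasure lborel (cball (c::'a::euclidean_space) r) < top"
  using emeasure_bounded_finite[of "cball c r"] by simp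

lemma C1c_continuous:
  assumes "C1c g G" shows "continuous_on A g" "continuous_on A G"
proof -
  show "continuous_on A g"
    using assms by (auto simp: C1c_def intro!: continuous_at_imp_continuous_on has_derivative_continuous)
  show "continuous_on A G" using assms by (auto simp: C1c_def intro: continuous_on_subset)
qed

lemma C1c_measurable:
  assumes "C1c g G"
  shows "g \<in> borel_measurable borel" "G \<in> borel_measurable borel"
  using C1c_continuous[OF assms] by (auto intro: borel_measurable_continuous_onI)

lemma C1c_bounded:
  assumes "C1c g G"
  shows "\<exists>B>0. \<forall>x. \<bar>g x\<bar> \<le> B \<and> norm (G x) \<le> B"
proof -
  obtain R where R: "R > 0" "\<And>x. norm x \<ge> R \<Longrightarrow> g x = 0 \<and> G x = 0" using assms by (auto simp: C1c_def)
  have "bounded (g ` cball 0 R)" "bounded (G ` cball 0 R)"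
    by (intro compact_imp_bounded compact_continuous_image C1c_continuous[OF assms] compact_cball)+
  then obtain B1 B2 where "\<forall>x\<in>cball 0 R. \<bar>g x\<bar> \<le> B1" "\<forall>x\<in>cball 0 R. norm (G x) \<le> B2"
    unfolding bounded_iff by auto
  then have B1: "\<And>x. x \<in> cball 0 R \<Longrightarrow> \<bar>g x\<bar> \<le> B1" and B2: "\<And>x. x \<in> cball 0 R \<Longrightarrow> norm (G x) \<le> B2" by blast+
  show ?thesis
  proof (intro exI[of _ "\<bar>B1\<bar> + \<bar>B2\<bar> + 1"] conjI allI)
    fix x show "\<bar>g x\<bar> \<le> \<bar>B1\<bar> + \<bar>B2\<bar> + 1" "norm (G x) \<le> \<bar>B1\<bar> + \<bar>B2\<bar> + 1"
      using B1[of x] B2[of x] R(2)[of x] by (cases "norm x \<ge> R"; force)+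
  qed auto
qed

lemma C1c_line:
  assumes C: "C1c g G"
  shows "((\<lambda>t. g (x + t *\<^sub>R z)) has_real_derivative (G (x + t *\<^sub>R z) \<bullet> z)) (at t)"
proof -
  have "((\<lambda>t. g (x + t *\<^sub>R z)) has_derivative (\<lambda>h. G (x + t *\<^sub>R z) \<bullet> (h *\<^sub>R z))) (at t)"
    by (rule has_derivative_compose[of "\<lambda>t. x + t *\<^sub>R z" "\<lambda>h. h *\<^sub>R z"])
       (use C in \<open>auto simp: C1c_def intro!: derivative_eq_intros\<close>)
  moreover have "(\<lambda>h. G (x + t *\<^sub>R z) \<bullet> (h *\<^sub>R z)) = (*) (G (x + t *\<^sub>R z) \<bullet> z)" by (auto simp: mult.commute)
  ultimately show ?thesis by (simp only: has_field_derivative_def)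
qed

lemma C1c_difference_le_line_integral:
  assumes C: "C1c g G" and ab: "a \<le> b"
  shows "ennreal \<bar>g (x + b *\<^sub>R z) - g (x + a *\<^sub>R z)\<bar>
    \<le> (\<integral>\<^sup>+t. ennreal (norm (G (x + t *\<^sub>R z)) * norm z) * indicator {a..b} t \<partial>lborel)"
proof -
  have cont: "isCont (\<lambda>t. G (x + t *\<^sub>R z) \<bullet> z) t" for t
  proof -
    have "continuous_on UNIV (\<lambda>t. G (x + t *\<^sub>R z))"
      by (rule continuous_on_compose2[of UNIV G]) (use C in \<open>auto simp: C1c_def intro!: continuous_intros\<close>)
    then have "continuous_on UNIV (\<lambda>t. G (x + t *\<^sub>R z) \<bullet> z)" by (intro continuous_on_inner continuous_on_const)
    then show ?thesis by (simp add: continuous_on_eq_continuous_at)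
  qed
  from has_bochner_integral_FTC_Icc_real[OF ab C1c_line[OF C, of x z] cont]
  have h: "has_bochner_integral lborel (\<lambda>t. (G (x + t *\<^sub>R z) \<bullet> z) * indicator {a..b} t) (g (x + b *\<^sub>R z) - g (x + a *\<^sub>R z))" by simp
  have "ennreal (norm (g (x + b *\<^sub>R z) - g (x + a *\<^sub>R z))) \<le> (\<integral>\<^sup>+t. ennreal (norm ((G (x + t *\<^sub>R z) \<bullet> z) * indicator {a..b} t)) \<partial>lborel)"
    using integral_norm_bound_ennreal[OF integrable.intros[OF h]] unfolding has_bochner_integral_integral_eq[OF h] .
  also have "\<dots> \<le> (\<integral>\<^sup>+t. ennreal (norm (G (x + t *\<^sub>R z)) * norm z) * indicator {a..b} t \<partial>lborel)"
  proof (intro nn_integral_mono)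
    fix t :: real
    show "ennreal (norm ((G (x + t *\<^sub>R z) \<bullet> z) * indicator {a..b} t)) \<le> ennreal (norm (G (x + t *\<^sub>R z)) * norm z) * indicator {a..b} t"
      using Cauchy_Schwarz_ineq2[of "G (x + t *\<^sub>R z)" z] by (cases "t \<in> {a..b}") (auto intro!: ennreal_leI)
  qed
  finally show ?thesis by simp
qed

text \<open>Far out on the ray the function vanishes.\<close>

lemma C1c_le_ray_integral:
  assumes C: "C1c g G" and z: "z \<noteq> 0"
  shows "ennreal \<bar>g x\<bar> \<le> (\<integral>\<^sup>+t. ennreal (norm (G (x + t *\<^sub>R z)) * norm z) * indicator {0<..} t \<partial>lborel)"
proof -
  obtain R where R: "R > 0" "\<And>x. norm x \<ge> R \<Longrightarrow> g x = 0 \<and> G x = 0" using C by (auto simp: C1c_def)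
  define T where "T = (R + norm x) / norm z"
  have T: "T \<ge> 0" using R by (auto simp: T_def)
  have "norm (x + T *\<^sub>R z) \<ge> norm (T *\<^sub>R z) - norm x" by (metis add.commute norm_diff_ineq)
  also have "norm (T *\<^sub>R z) = R + norm x" using z T R by (simp add: T_def) 
  finally have "g (x + T *\<^sub>R z) = 0" using R by auto
  then have "ennreal \<bar>g x\<bar> \<le> (\<integral>\<^sup>+t. ennreal (norm (G (x + t *\<^sub>R z)) * norm z) * indicator {0..T} t \<partial>lborel)"
    using C1c_difference_le_line_integral[OF C T, of x z] by simp
  also have "\<dots> \<le> (\<integral>\<^sup>+t. ennreal (norm (G (x + t *\<^sub>R z)) * norm z) * indicator {0<..} t \<partial>lborel)"
    using AE_lborel_singleton[of "0::real"]
    by (intro nn_integral_mono_AE, eventually_elim) (auto simp: indicator_def)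
  finally show ?thesis .
qed

lemma nn_integral_lborel_shift:
  fixes f :: "'a::euclidean_space \<Rightarrow> ennreal"
  assumes [measurable]: "f \<in> borel_measurable borel"
  shows "(\<integral>\<^sup>+x. f (x + c) \<partial>lborel) = (\<integral>\<^sup>+x. f x \<partial>lborel)"
proof -
  have "(\<integral>\<^sup>+x. f x \<partial>lborel) = (\<integral>\<^sup>+x. f x \<partial>distr lborel borel ((+) c))" by (simp add: lborel_distr_plus)
  also have "\<dots> = (\<integral>\<^sup>+x. f (c + x) \<partial>lborel)" by (subst nn_integral_distr) auto
  finally show ?thesis by (simp add: add.commute)
qed

lemma nn_integral_lborel_affine:
  fixes f :: "'a::euclidean_space \<Rightarrow> ennreal"
  assumes [measurable]: "f \<in> borel_measurable borel" and t: "t > 0"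
  shows "(\<integral>\<^sup>+z. f (x + t *\<^sub>R z) \<partial>lborel) = ennreal (t powr (- real DIM('a))) * (\<integral>\<^sup>+x. f x \<partial>lborel)"
proof -
  have "(\<integral>\<^sup>+x. f x \<partial>lborel) = (\<integral>\<^sup>+x. f x \<partial>density (distr lborel borel (\<lambda>z. x + t *\<^sub>R z)) (\<lambda>_. \<bar>t\<bar>^DIM('a)))"
    by (subst lborel_affine[of t x]) (use t in auto)
  also have "\<dots> = ennreal (t ^ DIM('a)) * (\<integral>\<^sup>+z. f (x + t *\<^sub>R z) \<partial>lborel)"
    using t by (simp add: nn_integral_density nn_integral_distr nn_integral_cmult)
  finally have "(\<integral>\<^sup>+x. f x \<partial>lborel) = ennreal (t ^ DIM('a)) * (\<integral>\<^sup>+z. f (x + t *\<^sub>R z) \<partial>lborel)" .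
  then have "ennreal (t powr (- real DIM('a))) * (\<integral>\<^sup>+x. f x \<partial>lborel)
     = ennreal (t powr (- real DIM('a)) * t ^ DIM('a)) * (\<integral>\<^sup>+z. f (x + t *\<^sub>R z) \<partial>lborel)"
    by (simp add: ennreal_mult' mult.assoc)
  also have "t powr (- real DIM('a)) * t ^ DIM('a) = 1"
    using t by (simp add: powr_minus powr_realpow)
  finally show ?thesis by simp
qed

text \<open>Integrate the bound by the line integral over \<open>x\<close>; by translation invariance every point of the segment contributes
  the same amount.\<close>

lemma C1c_translation:
  assumes C: "C1c g G"
  shows "(\<integral>\<^sup>+x. ennreal \<bar>g (x + z) - g x\<bar> \<partial>lborel) \<le> ennreal (norm z) * (\<integral>\<^sup>+x. ennreal (norm (G x)) \<partial>lborel)"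
proof -
  note [measurable] = C1c_measurable[OF C]
  have "(\<integral>\<^sup>+x. ennreal \<bar>g (x + z) - g x\<bar> \<partial>lborel)
     \<le> (\<integral>\<^sup>+x. (\<integral>\<^sup>+t. ennreal (norm (G (x + t *\<^sub>R z)) * norm z) * indicator {0..1} t \<partial>lborel) \<partial>lborel)"
    using C1c_difference_le_line_integral[OF C, of 0 1 _ z] by (intro nn_integral_mono) simp
  also have "\<dots> = (\<integral>\<^sup>+t. (\<integral>\<^sup>+x. ennreal (norm (G (x + t *\<^sub>R z)) * norm z) * indicator {0..1} t \<partial>lborel) \<partial>lborel)"
    by (rule lborel_pair.Fubini'[symmetric]) measurable
  also have "\<dots> = (\<integral>\<^sup>+t. ennreal (norm z) * (\<integral>\<^sup>+x. ennreal (norm (G x)) \<partial>lborel) * indicator {0..1::real} t \<partial>lborel)"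
  proof (intro nn_integral_cong)
    fix t :: real
    have "(\<integral>\<^sup>+x. ennreal (norm (G (x + t *\<^sub>R z)) * norm z) * indicator {0..1} t \<partial>lborel)
       = (\<integral>\<^sup>+x. ennreal (norm (G (x + t *\<^sub>R z))) * (ennreal (norm z) * indicator {0..1} t) \<partial>lborel)"
      by (simp add: ennreal_mult'' mult.assoc)
    also have "\<dots> = (\<integral>\<^sup>+x. ennreal (norm (G (x + t *\<^sub>R z))) \<partial>lborel) * (ennreal (norm z) * indicator {0..1} t)"
      by (rule nn_integral_multc) measurable
    also have "(\<integral>\<^sup>+x. ennreal (norm (G (x + t *\<^sub>R z))) \<partial>lborel) = (\<integral>\<^sup>+x. ennreal (norm (G x)) \<partial>lborel)"
      by (rule nn_integral_lborel_shift) measurable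
    finally show "(\<integral>\<^sup>+x. ennreal (norm (G (x + t *\<^sub>R z)) * norm z) * indicator {0..1} t \<partial>lborel)
       = ennreal (norm z) * (\<integral>\<^sup>+x. ennreal (norm (G x)) \<partial>lborel) * indicator {0..1} t"
      by (simp add: mult_ac)
  qed
  also have "\<dots> = ennreal (norm z) * (\<integral>\<^sup>+x. ennreal (norm (G x)) \<partial>lborel)"
    by (simp add: nn_integral_cmult_indicator)
  finally show ?thesis .
qed

lemma C1c_integrable:
  assumes C: "C1c g G"
  shows "integrable lborel g" "integrable lborel G"
proof -
  note [measurable] = C1c_measurable[OF C]
  obtain R where R: "R > 0" "\<And>x. norm x \<ge> R \<Longrightarrow> g x = 0 \<and> G x = 0" using C by (auto simp: C1c_def)
  obtain B where B: "B > 0" "\<And>x. \<bar>g x\<bar> \<le> B \<and> norm (G x) \<le> B" using C1c_bounded[OF C] by blast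
  have i: "integrable lborel (\<lambda>x. B * indicator (cball 0 R) x)" for B :: real
    by (intro integrable_mult_right integrable_real_indicator) (auto simp: emeasure_cball_less_top)
  show "integrable lborel g"
    by (rule Bochner_Integration.integrable_bound[OF i[of B]]) (use R B in \<open>auto simp: indicator_def not_le intro: less_imp_le\<close>)
  show "integrable lborel G"
    by (rule Bochner_Integration.integrable_bound[OF i[of B]]) (use R B in \<open>auto simp: indicator_def not_le intro: less_imp_le\<close>)
qed

text \<open>The integral of a difference quotient vanishes because Lebesgue measure is invariant under translations; the
  quotients are bounded and live on a fixed ball, so the limit can be taken under the integral.\<close>

lemma C1c_integral_gradient:
  assumes C: "C1c g G"
  shows "(\<integral>x. G x \<bullet> e \<partial>lborel) = 0"
proof -
  note [measurable] = C1c_measurable[OF C]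
  obtain R where R: "R > 0" "\<And>x. norm x \<ge> R \<Longrightarrow> g x = 0 \<and> G x = 0" using C by (auto simp: C1c_def)
  obtain B where B: "B > 0" "\<And>x. \<bar>g x\<bar> \<le> B \<and> norm (G x) \<le> B" using C1c_bounded[OF C] by blast
  define t where "t n = 1 / (real n + 1)" for n
  have t: "t n > 0" "t n \<le> 1" for n by (auto simp: t_def)
  have t0: "t \<longlonglongrightarrow> 0" unfolding t_def by (rule tendsto_inverse_plus_1)
  define D where "D n x = (g (x + t n *\<^sub>R e) - g x) / t n" for n x
  have shift: "(\<integral>x. g (x + c) \<partial>lborel) = (\<integral>x. g x \<partial>lborel)" "integrable lborel (\<lambda>x. g (x + c))" for c
  proof -
    have "(\<integral>x. g x \<partial>lborel) = (\<integral>x. g x \<partial>distr lborel borel ((+) c))" by (simp add: lborel_distr_plus)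
    also have "\<dots> = (\<integral>x. g (c + x) \<partial>lborel)" by (subst integral_distr) auto
    finally show "(\<integral>x. g (x + c) \<partial>lborel) = (\<integral>x. g x \<partial>lborel)" by (simp add: add.commute)
    have "integrable (distr lborel borel ((+) c)) g" using C1c_integrable[OF C] by (simp add: lborel_distr_plus)
    then show "integrable lborel (\<lambda>x. g (x + c))" by (subst (asm) integrable_distr_eq) (auto simp: add.commute)
  qed
  have D0: "(\<integral>x. D n x \<partial>lborel) = 0" for n
    unfolding D_def using shift C1c_integrable[OF C] by simp
  have "(\<lambda>n. \<integral>x. D n x \<partial>lborel) \<longlonglongrightarrow> (\<integral>x. G x \<bullet> e \<partial>lborel)"
  proof (rule integral_dominated_convergence[where w="\<lambda>x. B * norm e * indicator (cball 0 (R + norm e)) x"])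
    show "integrable lborel (\<lambda>x. B * norm e * indicator (cball 0 (R + norm e)) x)"
      by (intro integrable_mult_right integrable_real_indicator) (auto simp: emeasure_cball_less_top)
    show "AE x in lborel. (\<lambda>n. D n x) \<longlonglongrightarrow> G x \<bullet> e"
    proof (intro AE_I2)
      fix x
      have "((\<lambda>h. (g (x + h *\<^sub>R e) - g (x + 0 *\<^sub>R e)) / h) \<longlongrightarrow> G (x + 0 *\<^sub>R e) \<bullet> e) (at 0)"
        using C1c_line[OF C, of x e 0] by (simp add: DERIV_def)
      then have lim: "((\<lambda>h. (g (x + h *\<^sub>R e) - g x) / h) \<longlongrightarrow> G x \<bullet> e) (at 0)" by simp
      have "filterlim t (at 0) sequentially"
        using t0 t by (auto simp: filterlim_at intro!: always_eventually less_imp_neq[symmetric])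
      from filterlim_compose[OF lim this] show "(\<lambda>n. D n x) \<longlonglongrightarrow> G x \<bullet> e" by (simp add: D_def)
    qed
    show "AE x in lborel. norm (D n x) \<le> B * norm e * indicator (cball 0 (R + norm e)) x" for n
    proof (intro AE_I2)
      fix x
      show "norm (D n x) \<le> B * norm e * indicator (cball 0 (R + norm e)) x"
      proof (cases "norm x \<le> R + norm e")
        case True
        have "ennreal \<bar>g (x + t n *\<^sub>R e) - g (x + 0 *\<^sub>R e)\<bar> \<le> (\<integral>\<^sup>+s. ennreal (norm (G (x + s *\<^sub>R e)) * norm e) * indicator {0..t n} s \<partial>lborel)"
          by (rule C1c_difference_le_line_integral[OF C]) (use t[of n] in auto)
        also have "\<dots> \<le> (\<integral>\<^sup>+s. ennreal (B * norm e) * indicator {0..t n} s \<partial>lborel)"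
          using B by (intro nn_integral_mono) (auto simp: indicator_def intro!: ennreal_leI mult_right_mono)
        also have "\<dots> = ennreal (B * norm e * t n)"
          using t[of n] B by (simp add: nn_integral_cmult_indicator ennreal_mult')
        finally have "\<bar>g (x + t n *\<^sub>R e) - g x\<bar> \<le> B * norm e * t n"
          using B t[of n] by (subst (asm) ennreal_le_iff) auto
        then show ?thesis using True t[of n] by (simp add: D_def field_simps)
      next
        case False
        have "norm (t n *\<^sub>R e) \<le> norm e" using t[of n] by (simp add: mult_left_le_one_le)
        then have "norm (x + t n *\<^sub>R e) \<ge> R" using False norm_diff_ineq[of x "t n *\<^sub>R e"] by linarith
        moreover have "norm x \<ge> R" using False norm_ge_zero[of e] by linarith
        ultimately have "D n x = 0" using R by (auto simp: D_def)
        then show ?thesis using False by simp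
      qed
    qed
  qed (auto simp: D_def)
  with D0 show ?thesis by (simp add: LIMSEQ_const_iff)
qed

section \<open>The Riesz potential of the gradient\<close>

text \<open>Integrate the bound by the ray integral in direction \<open>z\<close> over all \<open>z\<close> in the unit ball. After Tonelli's theorem
  and the substitution \<open>y = x + t z\<close>, the weight of \<open>\<bar>G y\<bar>\<close> is \<open>\<bar>y - x\<bar>\<close> times the integral of \<open>t powr (- N - 1)\<close> over
  \<open>t > \<bar>y - x\<bar>\<close>. Averaging over the ball rather than over the sphere lets Lebesgue measure play the role of polar
  coordinates.\<close>

lemma C1c_le_Riesz_potential:
  fixes g :: "'a::euclidean_space \<Rightarrow> real"
  assumes C: "C1c g G"
  shows "ennreal \<bar>g x\<bar> * emeasure lborel (ball (0::'a) 1)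
     \<le> ennreal (1 / DIM('a)) * (\<integral>\<^sup>+y. ennreal (norm (G y)) * ennreal (norm (y - x) powr (1 - real DIM('a))) \<partial>lborel)"
proof -
  note [measurable] = C1c_measurable[OF C]
  let ?N = "real DIM('a)"
  have N: "?N > 0" by simp
  let ?h = "\<lambda>y t. ennreal (norm (G y)) * ennreal (norm (y - x)) * (if norm (y - x) < t then 1 else 0) * ennreal (t powr (- ?N - 1))"
  have "ennreal \<bar>g x\<bar> * emeasure lborel (ball (0::'a) 1) = (\<integral>\<^sup>+z. ennreal \<bar>g x\<bar> * indicator (ball (0::'a) 1) z \<partial>lborel)"
    by (simp add: nn_integral_cmult_indicator)
  also have "\<dots> \<le> (\<integral>\<^sup>+z. (\<integral>\<^sup>+t. ennreal (norm (G (x + t *\<^sub>R z)) * norm z) * indicator {0<..} t \<partial>lborel) * indicator (ball 0 1) z \<partial>lborel)"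
    using AE_lborel_singleton[of "0::'a"]
    by (intro nn_integral_mono_AE, eventually_elim) (use C1c_le_ray_integral[OF C, of _ x] in \<open>auto simp: indicator_def\<close>)
  also have "\<dots> = (\<integral>\<^sup>+z. (\<integral>\<^sup>+t. ennreal (norm (G (x + t *\<^sub>R z)) * norm z) * indicator {0<..} t * indicator (ball 0 1) z \<partial>lborel) \<partial>lborel)"
    by (intro nn_integral_cong nn_integral_multc[symmetric]) measurable
  also have "\<dots> = (\<integral>\<^sup>+t. (\<integral>\<^sup>+z. ennreal (norm (G (x + t *\<^sub>R z)) * norm z) * indicator {0<..} t * indicator (ball 0 1) z \<partial>lborel) \<partial>lborel)"
    by (rule lborel_pair.Fubini'[symmetric]) measurable
  also have "\<dots> = (\<integral>\<^sup>+t. (\<integral>\<^sup>+y. ?h y t * indicator {0<..} t \<partial>lborel) \<partial>lborel)"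
  proof (rule nn_integral_cong)
    fix t :: real
    show "(\<integral>\<^sup>+z. ennreal (norm (G (x + t *\<^sub>R z)) * norm z) * indicator {0<..} t * indicator (ball 0 1) z \<partial>lborel)
       = (\<integral>\<^sup>+y. ?h y t * indicator {0<..} t \<partial>lborel)"
    proof (cases "t > 0")
      case True
      let ?F = "\<lambda>y. ennreal (norm (G y)) * ennreal (norm (y - x) / t) * indicator (ball x t) y"
      have F: "?F \<in> borel_measurable borel"
        by (intro borel_measurable_times_ennreal borel_measurable_indicator ball_borel; measurable)
      have "(\<integral>\<^sup>+z. ennreal (norm (G (x + t *\<^sub>R z)) * norm z) * indicator {0<..} t * indicator (ball 0 1) z \<partial>lborel)
         = (\<integral>\<^sup>+z. ?F (x + t *\<^sub>R z) \<partial>lborel)"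
        using True by (intro nn_integral_cong) (auto simp: indicator_def ennreal_mult' dist_norm)
      also have "\<dots> = ennreal (t powr (- ?N)) * (\<integral>\<^sup>+y. ?F y \<partial>lborel)"
        by (rule nn_integral_lborel_affine[OF F True])
      also have "\<dots> = (\<integral>\<^sup>+y. ennreal (t powr (- ?N)) * ?F y \<partial>lborel)"
        by (rule nn_integral_cmult[symmetric]) (simp only: measurable_lborel1 measurable_lborel2 F)
      also have "\<dots> = (\<integral>\<^sup>+y. ?h y t * indicator {0<..} t \<partial>lborel)"
      proof (intro nn_integral_cong)
        fix y
        have "ennreal (t powr (- ?N)) * ennreal (norm (y - x) / t) = ennreal (norm (y - x)) * ennreal (t powr (- ?N - 1))"
          using True by (simp add: ennreal_mult'[symmetric] powr_diff)
        then show "ennreal (t powr (- ?N)) * ?F y = ?h y t * indicator {0<..} t"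
          using True by (auto simp: indicator_def mult_ac dist_norm norm_minus_commute)
      qed
      finally show ?thesis .
    qed simp
  qed
  also have "\<dots> = (\<integral>\<^sup>+y. (\<integral>\<^sup>+t. ?h y t * indicator {0<..} t \<partial>lborel) \<partial>lborel)"
    by (rule lborel_pair.Fubini') measurable
  also have "\<dots> \<le> (\<integral>\<^sup>+y. ennreal (1 / ?N) * (ennreal (norm (G y)) * ennreal (norm (y - x) powr (1 - ?N))) \<partial>lborel)"
  proof (rule nn_integral_mono)
    fix y
    show "(\<integral>\<^sup>+t. ?h y t * indicator {0<..} t \<partial>lborel) \<le> ennreal (1 / ?N) * (ennreal (norm (G y)) * ennreal (norm (y - x) powr (1 - ?N)))"
    proof (cases "y = x")
      case False
      define a where "a = norm (y - x)"
      have a: "a > 0" using False by (simp add: a_def)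
      have "(\<integral>\<^sup>+t. ?h y t * indicator {0<..} t \<partial>lborel) \<le>
         (\<integral>\<^sup>+t. (ennreal (norm (G y)) * ennreal a) * (ennreal (t powr (- ?N - 1)) * indicator {a..} t) \<partial>lborel)"
        by (intro nn_integral_mono) (auto simp: indicator_def a_def dist_norm norm_minus_commute mult_ac)
      also have "\<dots> = (ennreal (norm (G y)) * ennreal a) * (\<integral>\<^sup>+t. ennreal (t powr (- ?N - 1)) * indicator {a..} t \<partial>lborel)"
        by (rule nn_integral_cmult) measurable
      also have "(\<integral>\<^sup>+t. ennreal (t powr (- ?N - 1)) * indicator {a..} t \<partial>lborel) = ennreal (0 - (- (a powr (- ?N) / ?N)))"
      proof (rule nn_integral_FTC_atLeast)
        show "((\<lambda>t. - (t powr (- ?N) / ?N)) has_real_derivative x powr (- ?N - 1)) (at x)" if "a \<le> x" for x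
          using that a N by (auto intro!: derivative_eq_intros simp: powr_diff)
        have "((\<lambda>t. t powr (- ?N)) \<longlongrightarrow> 0) at_top"
          using N by (intro tendsto_neg_powr filterlim_ident) auto
        from tendsto_minus[OF tendsto_divide[OF this tendsto_const[of ?N]]]
        show "((\<lambda>t. - (t powr (- ?N) / ?N)) \<longlongrightarrow> 0) at_top" using N by simp
      qed auto
      also have "ennreal (norm (G y)) * ennreal a * ennreal (0 - (- (a powr (- ?N) / ?N))) = ennreal (1 / ?N) * (ennreal (norm (G y)) * ennreal (a powr (1 - ?N)))"
        using a N by (simp add: ennreal_mult'[symmetric] ennreal_mult''[symmetric] powr_diff powr_minus field_simps)
      finally show ?thesis by (simp add: a_def)
    qed simp
  qed
  also have "\<dots> = ennreal (1 / ?N) * (\<integral>\<^sup>+y. ennreal (norm (G y)) * ennreal (norm (y - x) powr (1 - ?N)) \<partial>lborel)"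
    by (rule nn_integral_cmult) measurable
  finally show ?thesis by simp
qed

text \<open>On the shell between radii \<open>(1/2) ^ (k + 1)\<close> and \<open>(1/2) ^ k\<close> the kernel is at most \<open>2 powr (a * (k + 1))\<close>, and the
  volume of the ball of radius \<open>(1/2) ^ k\<close> is proportional to \<open>(1/2) ^ (k * N)\<close>; the sum is geometric with ratio
  \<open>2 powr (a - N)\<close>.\<close>

lemma kernel_unit_ball:
  assumes a: "0 \<le> a" "a < real DIM('a::euclidean_space)"
  shows "\<exists>K\<ge>0. (\<integral>\<^sup>+z. ennreal (norm z powr (- a)) * indicator (ball (0::'a) 1) z \<partial>lborel) \<le> ennreal K"
proof -
  let ?N = "real DIM('a)"
  define \<beta> where "\<beta> = unit_ball_vol ?N"
  have \<beta>: "\<beta> \<ge> 0" by (simp add: \<beta>_def)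
  define c where "c k = 2 powr (a * (real k + 1)) * (\<beta> * (1/2) ^ (k * DIM('a)))" for k
  have ceq: "c k = (2 powr a * \<beta>) * (2 powr (a - ?N)) ^ k" for k
  proof -
    have "(1/2::real) ^ (k * DIM('a)) = 2 powr (- (?N * real k))"
      by (simp add: powr_minus powr_realpow[symmetric] power_one_over inverse_eq_divide mult.commute)
    moreover have "(2 powr (a - ?N)) ^ k = 2 powr (a * real k) * 2 powr (- (?N * real k))"
      by (simp add: powr_realpow[symmetric] powr_powr powr_add[symmetric] algebra_simps)
    ultimately show ?thesis by (simp add: c_def powr_add algebra_simps)
  qed
  have "summable c" unfolding ceq by (intro summable_mult summable_geometric) (use a in \<open>auto simp: powr_less_one\<close>)
  have c0: "c k \<ge> 0" for k using \<beta> by (simp add: c_def)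
  have pt: "ennreal (norm z powr (- a)) * indicator (ball (0::'a) 1) z
     \<le> (\<Sum>k. ennreal (2 powr (a * (real k + 1))) * indicator (cball 0 ((1/2)^k)) z)" for z
  proof (cases "z = 0 \<or> norm z \<ge> 1")
    case False
    then have z: "0 < norm z" "norm z < 1" by auto
    have ex: "\<exists>k. (1/2)^(Suc k) \<le> norm z"
    proof -
      obtain k where "(1/2::real)^k < norm z" using real_arch_pow_inv[OF z(1), of "1/2"] by auto
      moreover have "(1/2::real)^(Suc k) \<le> (1/2)^k" by simp
      ultimately show ?thesis by (intro exI[of _ k]) linarith
    qed
    define k where "k = (LEAST k. (1/2)^(Suc k) \<le> norm z)"
    have k1: "(1/2)^(Suc k) \<le> norm z" unfolding k_def by (rule LeastI_ex[OF ex])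
    have k2: "norm z \<le> (1/2)^k"
    proof (cases k)
      case (Suc j)
      then have "\<not> (1/2)^(Suc j) \<le> norm z" unfolding k_def using not_less_Least lessI by metis
      then show ?thesis using Suc by simp
    qed (use z in simp)
    have "norm z powr (- a) \<le> ((1/2)^(Suc k)) powr (- a)"
      by (rule powr_mono2') (use a k1 in auto)
    also have "\<dots> = 2 powr (a * (real k + 1))"
    proof -
      have "(1/2::real)^(Suc k) = 2 powr (- (real k + 1))"
      proof -
        have "2 powr (real k + 1) = 2 ^ Suc k" using powr_realpow[of 2 "Suc k"] by (simp add: add.commute)
        then show ?thesis unfolding powr_minus_divide by (simp add: power_one_over)
      qed
      then show ?thesis by (simp add: powr_powr algebra_simps del: power_Suc)
    qed
    finally have "ennreal (norm z powr (- a)) * indicator (ball (0::'a) 1) z \<le> (\<Sum>j\<in>{k}. ennreal (2 powr (a * (real j + 1))) * indicator (cball 0 ((1/2)^j)) z)"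
      using z k2 by (auto simp: ennreal_leI)
    also have "\<dots> \<le> (\<Sum>k. ennreal (2 powr (a * (real k + 1))) * indicator (cball 0 ((1/2)^k)) z)"
      by (rule sum_le_suminf) auto
    finally show ?thesis .
  next
    case True
    then have "ennreal (norm z powr (- a)) * indicator (ball (0::'a) 1) z = 0" by (auto simp: indicator_def)
    then show ?thesis by (simp only: zero_le)
  qed
  have "(\<integral>\<^sup>+z. ennreal (norm z powr (- a)) * indicator (ball (0::'a) 1) z \<partial>lborel)
     \<le> (\<integral>\<^sup>+z. (\<Sum>k. ennreal (2 powr (a * (real k + 1))) * indicator (cball (0::'a) ((1/2)^k)) z) \<partial>lborel)"
    by (rule nn_integral_mono) (rule pt)
  also have "\<dots> = (\<Sum>k. \<integral>\<^sup>+z. ennreal (2 powr (a * (real k + 1))) * indicator (cball (0::'a) ((1/2)^k)) z \<partial>lborel)"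
    by (rule nn_integral_suminf) (simp only: measurable_lborel1 measurable_lborel2, intro borel_measurable_times_ennreal borel_measurable_const borel_measurable_indicator, simp)
  also have "\<dots> = (\<Sum>k. ennreal (c k))"
  proof (rule suminf_cong)
    fix k
    have "emeasure lborel (cball (0::'a) ((1/2)^k)) = ennreal (\<beta> * ((1/2)^k) ^ DIM('a))"
      by (subst emeasure_cball) (auto simp: \<beta>_def)
    then show "(\<integral>\<^sup>+z. ennreal (2 powr (a * (real k + 1))) * indicator (cball (0::'a) ((1/2)^k)) z \<partial>lborel) = ennreal (c k)"
      by (subst nn_integral_cmult_indicator) (auto simp: c_def ennreal_mult' power_mult)
  qed
  also have "\<dots> = ennreal (suminf c)" by (rule suminf_ennreal2) (use c0 \<open>summable c\<close> in auto)
  finally show ?thesis using suminf_nonneg[OF \<open>summable c\<close> c0] by blast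
qed

text \<open>Outside the unit ball around \<open>x\<close> the kernel is at most 1, so that the bound depends on \<open>A\<close> through its measure
  only. This is why all later constants depend on the measure of the domain only.\<close>

lemma kernel_integral_bound:
  assumes a: "0 \<le> a" "a < real DIM('a::euclidean_space)"
  shows "\<exists>K\<ge>0. \<forall>(x::'a) A. A \<in> sets borel \<longrightarrow>
    (\<integral>\<^sup>+y. ennreal (norm (y - x) powr (- a)) * indicator A y \<partial>lborel) \<le> ennreal K + emeasure lborel A"
proof -
  obtain K where K: "K \<ge> 0" "(\<integral>\<^sup>+z. ennreal (norm z powr (- a)) * indicator (ball (0::'a) 1) z \<partial>lborel) \<le> ennreal K"
    using kernel_unit_ball[OF a] by blast
  show ?thesis
  proof (intro exI[of _ K] conjI allI impI K)
    fix x :: 'a and A :: "'a set" assume [measurable]: "A \<in> sets borel"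
    have "(\<integral>\<^sup>+y. ennreal (norm (y - x) powr (- a)) * indicator A y \<partial>lborel)
      \<le> (\<integral>\<^sup>+y. ennreal (norm (y - x) powr (- a)) * indicator (ball 0 1) (y - x) + indicator A y \<partial>lborel)"
    proof (intro nn_integral_mono)
      fix y
      have "norm (y - x) powr (- a) \<le> 1" if "norm (y - x) \<ge> 1"
        using powr_mono[of "- a" 0 "norm (y - x)"] a that by (smt (verit) powr_zero_eq_one norm_zero norm_eq_zero)
      then show "ennreal (norm (y - x) powr (- a)) * indicator A y \<le> ennreal (norm (y - x) powr (- a)) * indicator (ball 0 1) (y - x) + indicator A y"
        by (auto simp: indicator_def not_less)
    qed
    also have "\<dots> = (\<integral>\<^sup>+y. ennreal (norm (y - x) powr (- a)) * indicator (ball 0 1) (y - x) \<partial>lborel) + emeasure lborel A"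
      by (simp add: nn_integral_add)
    also have "(\<integral>\<^sup>+y. ennreal (norm (y - x) powr (- a)) * indicator (ball 0 1) (y - x) \<partial>lborel) = (\<integral>\<^sup>+z. ennreal (norm z powr (- a)) * indicator (ball (0::'a) 1) z \<partial>lborel)"
      using nn_integral_lborel_shift[of "\<lambda>z. ennreal (norm z powr (- a)) * indicator (ball (0::'a) 1) z" "- x"] by simp
    finally show "(\<integral>\<^sup>+y. ennreal (norm (y - x) powr (- a)) * indicator A y \<partial>lborel) \<le> ennreal K + emeasure lborel A"
      using K(2) by (meson add_right_mono order_trans)
  qed
qed

lemma C1c_le_Riesz_potential':
  assumes N: "DIM('a::euclidean_space) \<ge> 2"
  shows "\<exists>c>0. \<forall>(g::'a \<Rightarrow> real) G x. C1c g G \<longrightarrow>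
     ennreal \<bar>g x\<bar> \<le> ennreal c * (\<integral>\<^sup>+y. ennreal (norm (G y)) * ennreal (norm (y - x) powr (1 - real DIM('a))) \<partial>lborel)"
proof -
  define \<beta> where "\<beta> = unit_ball_vol (real DIM('a))"
  have \<beta>: "\<beta> > 0" by (simp add: \<beta>_def)
  have eb: "emeasure lborel (ball (0::'a) 1) = ennreal \<beta>" by (simp add: emeasure_ball \<beta>_def)
  show ?thesis
  proof (intro exI[of _ "1 / (real DIM('a) * \<beta>)"] conjI allI impI)
    fix g :: "'a \<Rightarrow> real" and G x assume C: "C1c g G"
    let ?I = "\<integral>\<^sup>+y. ennreal (norm (G y)) * ennreal (norm (y - x) powr (1 - real DIM('a))) \<partial>lborel"
    have "ennreal \<bar>g x\<bar> = ennreal (1/\<beta>) * (ennreal \<bar>g x\<bar> * ennreal \<beta>)"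
      using \<beta> by (simp add: ennreal_mult'[symmetric])
    also have "\<dots> \<le> ennreal (1/\<beta>) * (ennreal (1 / DIM('a)) * ?I)"
      using C1c_le_Riesz_potential[OF C, of x] unfolding eb by (intro mult_left_mono) auto
    also have "\<dots> = ennreal (1 / (real DIM('a) * \<beta>)) * ?I"
      using \<beta> by (simp add: ennreal_mult'[symmetric] mult.assoc[symmetric] mult.commute)
    finally show "ennreal \<bar>g x\<bar> \<le> ennreal (1 / (real DIM('a) * \<beta>)) * ?I" .
  qed (use \<beta> in auto)
qed

text \<open>By Hoelder's inequality \<open>(\<integral> k h) powr s \<le> (\<integral> h) powr (s - 1) * \<integral> k powr s h\<close> with \<open>h = \<bar>G\<bar>\<close> and the Riesz kernel \<open>k\<close>;
  integrating over \<open>A\<close> and exchanging the integrals leaves the integral of \<open>k powr s\<close>, which is finite exactly for the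
  subcritical exponents \<open>s (N - 1) < N\<close>.\<close>

lemma L1_Sobolev:
  assumes N: "DIM('a::euclidean_space) \<ge> 2" and s: "1 < s" "s * (real DIM('a) - 1) < real DIM('a)" and V: "V \<ge> 0"
  shows "\<exists>c\<ge>0. \<forall>(g::'a \<Rightarrow> real) G A D. C1c g G \<longrightarrow> A \<in> sets borel \<longrightarrow> emeasure lborel A \<le> ennreal V \<longrightarrow> D > 0 \<longrightarrow>
     (\<integral>\<^sup>+y. ennreal (norm (G y)) \<partial>lborel) \<le> ennreal D \<longrightarrow>
     (\<integral>\<^sup>+x. ennreal (\<bar>g x\<bar> powr s) * indicator A x \<partial>lborel) \<le> ennreal (c * D powr s)"
proof -
  let ?N = "real DIM('a)"
  define a where "a = s * (?N - 1)"
  have a: "0 \<le> a" "a < ?N" using s N by (auto simp: a_def)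
  obtain c0 where c0: "c0 > 0" and R: "\<And>(g::'a \<Rightarrow> real) G x. C1c g G \<Longrightarrow>
     ennreal \<bar>g x\<bar> \<le> ennreal c0 * (\<integral>\<^sup>+y. ennreal (norm (G y)) * ennreal (norm (y - x) powr (1 - ?N)) \<partial>lborel)"
    using C1c_le_Riesz_potential'[OF N] by blast
  obtain K where K: "K \<ge> 0" "\<And>(x::'a) A. A \<in> sets borel \<Longrightarrow>
    (\<integral>\<^sup>+y. ennreal (norm (y - x) powr (- a)) * indicator A y \<partial>lborel) \<le> ennreal K + emeasure lborel A"
    using kernel_integral_bound[OF a] by blast
  show ?thesis
  proof (intro exI[of _ "c0 powr s * (K + V)"] conjI allI impI)
    fix g :: "'a \<Rightarrow> real" and G and A :: "'a set" and D :: real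
    assume C: "C1c g G" and A[measurable]: "A \<in> sets borel" and AV: "emeasure lborel A \<le> ennreal V" and D: "D > 0"
      and GD: "(\<integral>\<^sup>+y. ennreal (norm (G y)) \<partial>lborel) \<le> ennreal D"
    note [measurable] = C1c_measurable[OF C]
    let ?J = "\<lambda>x. \<integral>\<^sup>+y. ennreal (norm (G y) * norm (y - x) powr (- a)) \<partial>lborel"
    have pt: "ennreal (\<bar>g x\<bar> powr s) \<le> ennreal (c0 powr s * D powr (s - 1)) * ?J x" for x
    proof (cases "?J x = \<infinity>")
      case True
      then show ?thesis using c0 D by (simp add: ennreal_mult_top)
    next
      case False
      have real: "\<exists>C\<ge>0. S = ennreal C" if "S \<noteq> \<infinity>" for S using that by (cases S) auto
      obtain B where B: "?J x = ennreal B" "B \<ge> 0" using real[OF False] by blast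
      have "(\<integral>\<^sup>+y. ennreal ((norm (G y) * norm (y - x) powr (- a)) powr (1/s) * norm (G y) powr (1 - 1/s)) \<partial>lborel)
         \<le> ennreal (B powr (1/s) * D powr (1 - 1/s))"
        by (rule nn_integral_Holder) (use B D GD s in auto)
      also have "(\<lambda>y. (norm (G y) * norm (y - x) powr (- a)) powr (1/s) * norm (G y) powr (1 - 1/s))
         = (\<lambda>y. norm (G y) * norm (y - x) powr (1 - ?N))"
      proof
        fix y
        have "- a * (1/s) = 1 - ?N" using s by (simp add: a_def)
        then have "(norm (y - x) powr (- a)) powr (1/s) = norm (y - x) powr (1 - ?N)" by (simp add: powr_powr)
        moreover have "norm (G y) powr (1/s) * norm (G y) powr (1 - 1/s) = norm (G y)"
          by (simp flip: powr_add)
        ultimately show "(norm (G y) * norm (y - x) powr (- a)) powr (1/s) * norm (G y) powr (1 - 1/s) = norm (G y) * norm (y - x) powr (1 - ?N)"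
          by (simp add: powr_mult mult_ac)
      qed
      finally have "(\<integral>\<^sup>+y. ennreal (norm (G y)) * ennreal (norm (y - x) powr (1 - ?N)) \<partial>lborel)
          \<le> ennreal (B powr (1/s) * D powr (1 - 1/s))" by (simp only: ennreal_mult' norm_ge_zero)
      with R[OF C, of x] have "ennreal \<bar>g x\<bar> \<le> ennreal c0 * ennreal (B powr (1/s) * D powr (1 - 1/s))"
        by (meson order_trans mult_left_mono zero_le)
      then have "\<bar>g x\<bar> \<le> c0 * (B powr (1/s) * D powr (1 - 1/s))"
        using c0 by (simp add: ennreal_mult'[symmetric])
      then have "\<bar>g x\<bar> powr s \<le> (c0 * (B powr (1/s) * D powr (1 - 1/s))) powr s"
        using s by (intro powr_mono2) auto
      also have "\<dots> = c0 powr s * D powr (s - 1) * B"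
        using s c0 B D by (simp add: powr_mult powr_powr algebra_simps)
      finally have "ennreal (\<bar>g x\<bar> powr s) \<le> ennreal (c0 powr s * D powr (s - 1) * B)" by (rule ennreal_leI)
      also have "\<dots> = ennreal (c0 powr s * D powr (s - 1)) * ?J x" using B by (simp add: ennreal_mult'')
      finally show ?thesis .
    qed
    have "(\<integral>\<^sup>+x. ennreal (\<bar>g x\<bar> powr s) * indicator A x \<partial>lborel)
       \<le> (\<integral>\<^sup>+x. ennreal (c0 powr s * D powr (s - 1)) * (?J x * indicator A x) \<partial>lborel)"
      using pt by (intro nn_integral_mono) (auto simp: indicator_def)
    also have "\<dots> = ennreal (c0 powr s * D powr (s - 1)) * (\<integral>\<^sup>+x. ?J x * indicator A x \<partial>lborel)"
      by (rule nn_integral_cmult) measurable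
    also have "(\<integral>\<^sup>+x. ?J x * indicator A x \<partial>lborel) = (\<integral>\<^sup>+x. (\<integral>\<^sup>+y. ennreal (norm (G y) * norm (y - x) powr (- a)) * indicator A x \<partial>lborel) \<partial>lborel)"
      by (intro nn_integral_cong nn_integral_multc[symmetric]) measurable
    also have "\<dots> = (\<integral>\<^sup>+y. (\<integral>\<^sup>+x. ennreal (norm (G y) * norm (y - x) powr (- a)) * indicator A x \<partial>lborel) \<partial>lborel)"
      by (rule lborel_pair.Fubini'[symmetric]) measurable
    also have "\<dots> = (\<integral>\<^sup>+y. ennreal (norm (G y)) * (\<integral>\<^sup>+x. ennreal (norm (x - y) powr (- a)) * indicator A x \<partial>lborel) \<partial>lborel)"
    proof (intro nn_integral_cong)
      fix y
      have "(\<integral>\<^sup>+x. ennreal (norm (G y) * norm (y - x) powr (- a)) * indicator A x \<partial>lborel)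
         = (\<integral>\<^sup>+x. ennreal (norm (G y)) * (ennreal (norm (x - y) powr (- a)) * indicator A x) \<partial>lborel)"
        by (simp add: ennreal_mult' norm_minus_commute mult.assoc)
      also have "\<dots> = ennreal (norm (G y)) * (\<integral>\<^sup>+x. ennreal (norm (x - y) powr (- a)) * indicator A x \<partial>lborel)"
        by (rule nn_integral_cmult) measurable
      finally show "(\<integral>\<^sup>+x. ennreal (norm (G y) * norm (y - x) powr (- a)) * indicator A x \<partial>lborel) = \<dots>" .
    qed
    also have "\<dots> \<le> (\<integral>\<^sup>+y. ennreal (norm (G y)) * ennreal (K + V) \<partial>lborel)"
    proof (intro nn_integral_mono mult_left_mono)
      fix y
      have "(\<integral>\<^sup>+x. ennreal (norm (x - y) powr (- a)) * indicator A x \<partial>lborel) \<le> ennreal K + ennreal V"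
        using K(2)[OF A, of y] AV by (meson add_left_mono order_trans)
      then show "(\<integral>\<^sup>+x. ennreal (norm (x - y) powr (- a)) * indicator A x \<partial>lborel) \<le> ennreal (K + V)"
        using K V by simp
    qed auto
    also have "\<dots> = (\<integral>\<^sup>+y. ennreal (norm (G y)) \<partial>lborel) * ennreal (K + V)" by (rule nn_integral_multc) measurable
    also have "\<dots> \<le> ennreal D * ennreal (K + V)" using GD by (intro mult_right_mono) auto
    finally have "(\<integral>\<^sup>+x. ennreal (\<bar>g x\<bar> powr s) * indicator A x \<partial>lborel) \<le> ennreal (c0 powr s * D powr (s - 1)) * (ennreal D * ennreal (K + V))"
      by (simp add: mult_left_mono)
    also have "\<dots> = ennreal (c0 powr s * (K + V) * D powr s)"
    proof -
      have "ennreal (c0 powr s * D powr (s - 1)) * (ennreal D * ennreal (K + V)) = ennreal (c0 powr s * D powr (s - 1) * (D * (K + V)))"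
        using D K(1) V by (simp only: ennreal_mult'' mult_nonneg_nonneg powr_ge_zero less_imp_le add_nonneg_nonneg)
      also have "c0 powr s * D powr (s - 1) * (D * (K + V)) = c0 powr s * (K + V) * D powr s"
        using D by (simp add: powr_diff)
      finally show ?thesis .
    qed
    finally show "(\<integral>\<^sup>+x. ennreal (\<bar>g x\<bar> powr s) * indicator A x \<partial>lborel) \<le> ennreal (c0 powr s * (K + V) * D powr s)" .
  qed (use K V in auto)
qed

text \<open>Hoelder's inequality again: for \<open>r > N\<close> the Riesz kernel is locally integrable to the conjugate power of \<open>r\<close>, which
  is the condition \<open>(N - 1) * r / (r - 1) < N\<close>.\<close>

lemma sup_bound_supercritical:
  assumes N: "DIM('a::euclidean_space) \<ge> 2" and r: "real DIM('a) < r" and V: "V \<ge> 0"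
  shows "\<exists>c\<ge>0. \<forall>(g::'a \<Rightarrow> real) G A D x. C1c g G \<longrightarrow> A \<in> sets borel \<longrightarrow> emeasure lborel A \<le> ennreal V \<longrightarrow> D \<ge> 0 \<longrightarrow>
     (\<forall>x. x \<notin> A \<longrightarrow> G x = 0) \<longrightarrow>
     (\<integral>\<^sup>+y. ennreal (norm (G y) powr r) * indicator A y \<partial>lborel) \<le> ennreal D \<longrightarrow> \<bar>g x\<bar> \<le> c * D powr (1 / r)"
proof -
  let ?N = "real DIM('a)"
  have r1: "r > 1" "r \<ge> 2" using r N by auto
  define a where "a = (?N - 1) * (r / (r - 1))"
  have "(?N - 1) * r < ?N * (r - 1)" using r by (simp add: algebra_simps)
  then have a: "0 \<le> a" "a < ?N" using r1 N by (auto simp: a_def field_simps)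
  obtain c0 where c0: "c0 > 0" and R: "\<And>(g::'a \<Rightarrow> real) G x. C1c g G \<Longrightarrow>
     ennreal \<bar>g x\<bar> \<le> ennreal c0 * (\<integral>\<^sup>+y. ennreal (norm (G y)) * ennreal (norm (y - x) powr (1 - ?N)) \<partial>lborel)"
    using C1c_le_Riesz_potential'[OF N] by blast
  obtain K where K: "K \<ge> 0" "\<And>(x::'a) A. A \<in> sets borel \<Longrightarrow>
    (\<integral>\<^sup>+y. ennreal (norm (y - x) powr (- a)) * indicator A y \<partial>lborel) \<le> ennreal K + emeasure lborel A"
    using kernel_integral_bound[OF a] by blast
  show ?thesis
  proof (intro exI[of _ "c0 * (K + V) powr (1 - 1/r)"] conjI allI impI)
    fix g :: "'a \<Rightarrow> real" and G and A :: "'a set" and D :: real and x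
    assume C: "C1c g G" and A[measurable]: "A \<in> sets borel" and AV: "emeasure lborel A \<le> ennreal V" and D: "D \<ge> 0"
      and supp: "\<forall>x. x \<notin> A \<longrightarrow> G x = 0" and GD: "(\<integral>\<^sup>+y. ennreal (norm (G y) powr r) * indicator A y \<partial>lborel) \<le> ennreal D"
    note [measurable] = C1c_measurable[OF C]
    have KV: "(\<integral>\<^sup>+y. ennreal (norm (y - x) powr (- a)) * indicator A y \<partial>lborel) \<le> ennreal (K + V)"
    proof -
      have "(\<integral>\<^sup>+y. ennreal (norm (y - x) powr (- a)) * indicator A y \<partial>lborel) \<le> ennreal K + ennreal V"
        using K(2)[OF A, of x] add_left_mono[OF AV] by (rule order_trans)
      then show ?thesis using K(1) V by (simp only: ennreal_plus)
    qed
    have "(\<integral>\<^sup>+y. ennreal ((norm (G y) powr r * indicator A y) powr (1/r) * (norm (y - x) powr (- a) * indicator A y) powr (1 - 1/r)) \<partial>lborel)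
      \<le> ennreal (D powr (1/r) * (K + V) powr (1 - 1/r))"
    proof (rule nn_integral_Holder)
      show "(\<integral>\<^sup>+y. ennreal (norm (G y) powr r * indicator A y) \<partial>lborel) \<le> ennreal D"
        using GD by (simp add: ennreal_mult' ennreal_indicator)
      show "(\<integral>\<^sup>+y. ennreal (norm (y - x) powr (- a) * indicator A y) \<partial>lborel) \<le> ennreal (K + V)"
        using KV by (simp add: ennreal_mult' ennreal_indicator)
    qed (use r1 D K V in auto)
    also have "(\<lambda>y. ennreal ((norm (G y) powr r * indicator A y) powr (1/r) * (norm (y - x) powr (- a) * indicator A y) powr (1 - 1/r)))
      = (\<lambda>y. ennreal (norm (G y)) * ennreal (norm (y - x) powr (1 - ?N)))"
    proof
      fix y
      have "- a * (1 - 1/r) = 1 - ?N" using r1 by (simp add: a_def field_simps)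
      then have "(norm (y - x) powr (- a)) powr (1 - 1/r) = norm (y - x) powr (1 - ?N)" by (simp only: powr_powr)
      then show "ennreal ((norm (G y) powr r * indicator A y) powr (1/r) * (norm (y - x) powr (- a) * indicator A y) powr (1 - 1/r))
          = ennreal (norm (G y)) * ennreal (norm (y - x) powr (1 - ?N))"
        using r1 supp by (cases "y \<in> A") (auto simp: powr_powr ennreal_mult')
    qed
    finally have "ennreal \<bar>g x\<bar> \<le> ennreal c0 * ennreal (D powr (1/r) * (K + V) powr (1 - 1/r))"
      using R[OF C, of x] by (meson order_trans mult_left_mono zero_le)
    then have "\<bar>g x\<bar> \<le> c0 * (D powr (1/r) * (K + V) powr (1 - 1/r))"
      using c0 by (simp add: ennreal_mult'[symmetric])
    then show "\<bar>g x\<bar> \<le> c0 * (K + V) powr (1 - 1/r) * D powr (1/r)" by (simp add: mult_ac)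
  qed (use c0 in auto)
qed

section \<open>Smooth functions\<close>

definition grad :: "(real^'n \<Rightarrow> real) \<Rightarrow> real^'n \<Rightarrow> real^'n" where
  "grad \<phi> x = (\<chi> i. partial i \<phi> x)"

lemma partial_eq:
  assumes "(\<phi> has_derivative D) (at x)"
  shows "partial i \<phi> x = D (axis i 1)"
  using frechet_derivative_at[OF assms] by (simp add: partial_def)

lemma has_derivative_grad:
  assumes "\<phi> differentiable (at x)"
  shows "(\<phi> has_derivative (\<lambda>h. grad \<phi> x \<bullet> h)) (at x)"
proof -
  let ?D = "frechet_derivative \<phi> (at x)"
  have D: "(\<phi> has_derivative ?D) (at x)" using assms by (simp add: frechet_derivative_works)
  then have lin: "linear ?D" by (rule has_derivative_linear)
  have "?D h = grad \<phi> x \<bullet> h" for h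
  proof -
    have "?D h = ?D (\<Sum>i\<in>UNIV. h $ i *\<^sub>R axis i 1)"
      by (simp add: basis_expansion flip: scalar_mult_eq_scaleR)
    also have "\<dots> = (\<Sum>i\<in>UNIV. h $ i *\<^sub>R ?D (axis i 1))"
      by (simp add: linear_sum[OF lin] linear_scale[OF lin])
    also have "\<dots> = grad \<phi> x \<bullet> h"
      by (simp add: inner_vec_def grad_def partial_def mult.commute)
    finally show ?thesis .
  qed
  then have "?D = (\<lambda>h. grad \<phi> x \<bullet> h)" by blast
  with D show ?thesis by simp
qed

lemma C_k_Suc_imp: "C_k (Suc k) \<phi> \<Longrightarrow> C_k k \<phi>"
proof (induction k arbitrary: \<phi>)
  case 0
  then show ?case by (auto simp: continuous_on_eq_continuous_at differentiable_imp_continuous_within)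
next
  case (Suc k)
  from Suc.prems have "\<phi> differentiable (at x)" "C_k (Suc k) (partial i \<phi>)" for x i by simp_all
  then show ?case using Suc.IH by simp
qed

lemma C_k_const: "C_k k (\<lambda>x. c)"
proof (induction k arbitrary: c)
  case (Suc k)
  have "partial i (\<lambda>x. c) = (\<lambda>x. 0)" for i :: 'a
    by (rule ext, subst partial_eq[of _ "\<lambda>h. 0"]) auto
  then show ?case using Suc by simp
qed simp

lemma C_k_coord: "C_k k (\<lambda>x. x $ j)"
proof (cases k)
  case (Suc l)
  have D: "((\<lambda>x. x $ j) has_derivative (\<lambda>h. h $ j)) (at x)" for x :: "real^'a"
    by (rule bounded_linear_imp_has_derivative[OF bounded_linear_vec_nth])
  have "partial i (\<lambda>x. x $ j) = (\<lambda>x. axis i 1 $ j)" for i :: 'a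
    by (rule ext, subst partial_eq[OF D]) auto
  moreover have "(\<lambda>x. x $ j) differentiable (at x)" for x :: "real^'a" using D differentiable_def by blast
  ultimately show ?thesis using Suc by (auto intro: C_k_const)
qed (simp add: continuous_on_component)

lemma C_k_add: "C_k k f \<Longrightarrow> C_k k g \<Longrightarrow> C_k k (\<lambda>x. f x + g x)"
proof (induction k arbitrary: f g)
  case (Suc k)
  then have d: "f differentiable (at x)" "g differentiable (at x)" for x by auto
  have "partial i (\<lambda>x. f x + g x) = (\<lambda>x. partial i f x + partial i g x)" for i
    by (rule ext, subst partial_eq[OF has_derivative_add[OF has_derivative_grad[OF d(1)] has_derivative_grad[OF d(2)]]])
       (simp add: grad_def inner_axis)
  then show ?case using Suc d by (auto intro: differentiable_add)
qed (auto intro: continuous_on_add)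

lemma C_k_mult: "C_k k f \<Longrightarrow> C_k k g \<Longrightarrow> C_k k (\<lambda>x. f x * g x)"
proof (induction k arbitrary: f g)
  case (Suc k)
  then have d: "f differentiable (at x)" "g differentiable (at x)" for x by auto
  have "partial i (\<lambda>x. f x * g x) = (\<lambda>x. f x * partial i g x + partial i f x * g x)" for i
    by (rule ext, subst partial_eq[OF has_derivative_mult[OF has_derivative_grad[OF d(1)] has_derivative_grad[OF d(2)]]])
       (simp add: grad_def inner_axis)
  then show ?case using Suc d C_k_Suc_imp[OF Suc.prems(1)] C_k_Suc_imp[OF Suc.prems(2)]
    by (auto intro!: C_k_add differentiable_mult)
qed (auto intro: continuous_on_mult)

lemma C_k_prod:
  assumes "finite A" "\<And>i. i \<in> A \<Longrightarrow> C_k k (f i)"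
  shows "C_k k (\<lambda>x. \<Prod>i\<in>A. f i x)"
  using assms by (induction A rule: finite_induct) (auto intro: C_k_const C_k_mult)

lemma partial_compose:
  assumes "(F has_real_derivative F') (at (\<phi> x))" "\<phi> differentiable (at x)"
  shows "((\<lambda>x. F (\<phi> x)) has_derivative (\<lambda>h. F' * (grad \<phi> x \<bullet> h))) (at x)"
    "partial i (\<lambda>x. F (\<phi> x)) x = F' * partial i \<phi> x"
proof -
  show D: "((\<lambda>x. F (\<phi> x)) has_derivative (\<lambda>h. F' * (grad \<phi> x \<bullet> h))) (at x)"
    using has_derivative_compose[OF has_derivative_grad[OF assms(2)], of F "(*) F'"] assms(1)
    by (simp add: has_field_derivative_def)
  show "partial i (\<lambda>x. F (\<phi> x)) x = F' * partial i \<phi> x"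
    by (subst partial_eq[OF D]) (simp add: grad_def inner_axis)
qed

text \<open>The family \<open>F\<close> lists a function and its derivatives. They are needed on the range of \<open>\<phi>\<close> only, so that real
  powers of positive functions are covered.\<close>

lemma C_k_compose:
  assumes "\<And>n x. (F n has_real_derivative F (Suc n) (\<phi> x)) (at (\<phi> x))" "C_k k \<phi>"
  shows "C_k k (\<lambda>x. F n (\<phi> x))"
  using assms(2)
proof (induction k arbitrary: n)
  case 0
  have "isCont (\<lambda>x. F n (\<phi> x)) x" for x
    by (rule isCont_o2[where g="F n" and f=\<phi>, OF _ DERIV_isCont[OF assms(1)]]) (use 0 in \<open>simp add: continuous_on_eq_continuous_at\<close>)
  then show ?case by (simp add: continuous_on_eq_continuous_at)
next
  case (Suc k)
  then have d: "\<phi> differentiable (at x)" for x by auto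
  have "partial i (\<lambda>x. F n (\<phi> x)) = (\<lambda>x. F (Suc n) (\<phi> x) * partial i \<phi> x)" for i
    by (rule ext, rule partial_compose(2)[OF assms(1) d])
  moreover have "(\<lambda>x. F n (\<phi> x)) differentiable (at x)" for x
    using partial_compose(1)[OF assms(1) d] differentiable_def by blast
  ultimately show ?case using Suc C_k_Suc_imp[OF Suc.prems] by (auto intro!: C_k_mult)
qed

lemma C_k_powr:
  assumes "C_k k \<phi>" "\<And>x. \<phi> x > 0"
  shows "C_k k (\<lambda>x. \<phi> x powr b)"
proof -
  define F where "F n t = (\<Prod>i<n. b - real i) * t powr (b - real n)" for n t
  have "(F n has_real_derivative F (Suc n) (\<phi> x)) (at (\<phi> x))" for n x
  proof -
    have D: "((\<lambda>t. c * t powr e) has_real_derivative c * (e * \<phi> x powr (e - 1))) (at (\<phi> x))" for c e :: real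
      using assms(2)[of x] by (auto intro!: derivative_eq_intros simp: powr_diff)
    show ?thesis
      using D[of "\<Prod>i<n. b - real i" "b - real n"] by (simp add: F_def[abs_def] diff_diff_eq add.commute mult.assoc)
  qed
  from C_k_compose[where F=F and \<phi>=\<phi> and n=0, OF this assms(1)] show ?thesis by (simp add: F_def)
qed

subsection \<open>Bump functions\<close>

text \<open>The family is closed under differentiation up to linear combinations, see \<open>exp_flat_deriv\<close>; this yields the
  smoothness of \<open>exp (- 1 / t)\<close> at \<open>0\<close> by induction.\<close>

definition exp_flat :: "nat \<Rightarrow> real \<Rightarrow> real" where
  "exp_flat n t = (if t > 0 then exp (- 1 / t) / t ^ n else 0)"

text \<open>The exponential series gives \<open>exp (1/t) \<ge> (1/t) ^ (n + 2) / fact (n + 2)\<close>. The factor \<open>t\<^sup>2\<close> makes the derivative at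
  \<open>0\<close> vanish.\<close>

lemma exp_flat_le: "\<bar>exp_flat n t\<bar> \<le> fact (n + 2) * t^2"
proof (cases "t > 0")
  case True
  have "exp (- 1/t) \<le> fact m * t^m" for m
  proof -
    have "(\<Sum>k\<in>{m}. (1/t)^k /\<^sub>R fact k) \<le> (\<Sum>k. (1/t)^k /\<^sub>R fact k)"
      by (rule sum_le_suminf[OF summable_exp_generic]) (use True in auto)
    then have "(1/t) ^ m / fact m \<le> exp (1/t)" by (simp add: exp_def divide_inverse mult.commute)
    then show ?thesis using True by (simp add: exp_minus field_simps)
  qed
  note e = this
  define c :: real where "c = fact (n + 2)"
  have "t^(n+2) = t^2 * t^n" by (simp only: power_add mult.commute)
  with e[of "n+2"] have "exp (- 1/t) \<le> c * (t^2 * t^n)" unfolding c_def by (simp only:)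
  then have "exp (- 1/t) / t^n \<le> c * t^2" using True by (subst pos_divide_le_eq) (simp_all only: mult.assoc zero_less_power)
  then show ?thesis unfolding c_def[symmetric] using True by (simp add: exp_flat_def)
qed (simp add: exp_flat_def)

lemma exp_flat_deriv:
  "(exp_flat n has_real_derivative (exp_flat (n + 2) t - real n * exp_flat (n + 1) t)) (at t)"
proof -
  consider "t > 0" | "t < 0" | "t = 0" by linarith
  then show ?thesis
  proof cases
    case 1
    have "((\<lambda>t. exp (- 1 / t) / t ^ n) has_real_derivative (exp_flat (n + 2) t - real n * exp_flat (n + 1) t)) (at t)"
      using 1 by (auto intro!: derivative_eq_intros simp: exp_flat_def)
        (cases n; simp add: field_simps power2_eq_square power_add)
    moreover have "eventually (\<lambda>s. s \<in> {0<..}) (nhds t)" by (rule eventually_nhds_in_open) (use 1 in auto)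
    then have "eventually (\<lambda>s. exp_flat n s = exp (- 1 / s) / s ^ n) (nhds t)"
      by eventually_elim (simp add: exp_flat_def)
    ultimately show ?thesis by (subst DERIV_cong_ev[OF refl _ refl])
  next
    case 2
    have "eventually (\<lambda>s. s \<in> {..<0}) (nhds t)" by (rule eventually_nhds_in_open) (use 2 in auto)
    then have "eventually (\<lambda>s. exp_flat n s = 0) (nhds t)"
      by eventually_elim (simp add: exp_flat_def)
    then show ?thesis using 2 by (subst DERIV_cong_ev[OF refl _ refl]) (auto simp: exp_flat_def)
  next
    case 3
    have "((\<lambda>h. exp_flat n h / h) \<longlongrightarrow> 0) (at 0)"
    proof (rule Lim_null_comparison)
      show "eventually (\<lambda>h. norm (exp_flat n h / h) \<le> fact (n+2) * \<bar>h\<bar>) (at 0)"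
        using eventually_neq_at_within[of 0]
      proof eventually_elim
        case (elim h)
        then show ?case using exp_flat_le[of n h] by (simp add: divide_simps power2_eq_square abs_mult)
      qed
      show "((\<lambda>h. fact (n+2) * \<bar>h\<bar>) \<longlongrightarrow> 0) (at (0::real))"
        by (auto intro!: tendsto_eq_intros)
    qed
    then show ?thesis using 3 by (simp add: DERIV_def exp_flat_def)
  qed
qed

lemma C_k_exp_flat: "C_k k \<phi> \<Longrightarrow> C_k k (\<lambda>x. exp_flat n (\<phi> x))"
proof (induction k arbitrary: n)
  case 0
  have "isCont (\<lambda>x. exp_flat n (\<phi> x)) x" for x
    by (rule isCont_o2[where g="exp_flat n" and f=\<phi>, OF _ DERIV_isCont[OF exp_flat_deriv]]) (use 0 in \<open>simp add: continuous_on_eq_continuous_at\<close>)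
  then show ?case by (simp add: continuous_on_eq_continuous_at)
next
  case (Suc k)
  then have d: "\<phi> differentiable (at x)" for x by auto
  have "partial i (\<lambda>x. exp_flat n (\<phi> x)) = (\<lambda>x. (exp_flat (n+2) (\<phi> x) + (- real n) * exp_flat (n+1) (\<phi> x)) * partial i \<phi> x)" for i
    by (rule ext, subst partial_compose(2)[OF exp_flat_deriv d]) simp
  moreover have "(\<lambda>x. exp_flat n (\<phi> x)) differentiable (at x)" for x
    using partial_compose(1)[OF exp_flat_deriv d] differentiable_def by blast
  moreover have "C_k k (\<lambda>x. (exp_flat (n+2) (\<phi> x) + (- real n) * exp_flat (n+1) (\<phi> x)) * partial i \<phi> x)" for i
    using Suc C_k_Suc_imp[OF Suc.prems] by (intro C_k_mult C_k_add C_k_const) auto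
  ultimately show ?case by simp
qed

text \<open>Smooth functions that converge boundedly to the indicator of an open box as \<open>k\<close> grows.\<close>

definition box_bump :: "real^'n \<Rightarrow> real^'n \<Rightarrow> nat \<Rightarrow> real^'n \<Rightarrow> real" where
  "box_bump a b k x = (\<Prod>i\<in>UNIV. exp_flat 0 (real k * (x $ i - a $ i)) * exp_flat 0 (real k * (b $ i - x $ i)))"

lemma box_bump_C_k: "C_k l (box_bump a b k)"
proof -
  have "C_k l (\<lambda>x. real k * (x $ i + (- (a $ i))))" "C_k l (\<lambda>x. real k * (b $ i + (-1) * (x $ i)))" for i
    by (intro C_k_mult C_k_const C_k_add C_k_coord)+
  then have "C_k l (\<lambda>x. real k * (x $ i - a $ i))" "C_k l (\<lambda>x. real k * (b $ i - x $ i))" for i by simp_all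
  from C_k_exp_flat[OF this(1), where n=0] C_k_exp_flat[OF this(2), where n=0] show ?thesis
    unfolding box_bump_def by (intro C_k_prod C_k_mult) auto
qed

lemma box_bump_bounds: "0 \<le> box_bump a b k x" "box_bump a b k x \<le> 1"
proof -
  have e: "0 \<le> exp_flat 0 t" "exp_flat 0 t \<le> 1" for t by (auto simp: exp_flat_def)
  show "0 \<le> box_bump a b k x" "box_bump a b k x \<le> 1"
    unfolding box_bump_def by (auto intro!: prod_nonneg prod_le_1 mult_nonneg_nonneg mult_le_one e)
qed

lemma box_bump_outside:
  assumes "x \<notin> box a b" shows "box_bump a b k x = 0"
proof -
  obtain i where "x $ i \<le> a $ i \<or> b $ i \<le> x $ i" using assms by (auto simp: mem_box_cart not_less)
  then have "exp_flat 0 (real k * (x $ i - a $ i)) * exp_flat 0 (real k * (b $ i - x $ i)) = 0"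
    by (auto simp: exp_flat_def mult_less_0_iff zero_less_mult_iff)
  then show ?thesis unfolding box_bump_def by (intro prod_zero) auto
qed

lemma box_bump_tendsto: "(\<lambda>k. box_bump a b k x) \<longlonglongrightarrow> indicator (box a b) x"
proof (cases "x \<in> box a b")
  case True
  have e: "(\<lambda>k. exp_flat 0 (real k * t)) \<longlonglongrightarrow> 1" if "t > 0" for t
  proof -
    have "(\<lambda>k. exp (- (1/t) * (1 / real k))) \<longlonglongrightarrow> exp (- (1/t) * 0)"
      by (intro tendsto_exp tendsto_mult tendsto_const lim_1_over_n)
    moreover have "eventually (\<lambda>k. exp_flat 0 (real k * t) = exp (- (1/t) * (1 / real k))) sequentially"
      using eventually_gt_at_top[of 0] by eventually_elim (use that in \<open>auto simp: exp_flat_def mult.commute\<close>)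
    ultimately show ?thesis by (subst tendsto_cong) auto
  qed
  have "(\<lambda>k. box_bump a b k x) \<longlonglongrightarrow> (\<Prod>i\<in>(UNIV::'a set). 1 * 1)"
    unfolding box_bump_def using True by (intro tendsto_prod tendsto_mult e) (auto simp: mem_box_cart)
  then show ?thesis using True by simp
qed (simp add: box_bump_outside)

lemma box_bump_test:
  assumes "cbox a b \<subseteq> \<Omega>" shows "box_bump a b k \<in> test_functions \<Omega>"
proof -
  have "{x. box_bump a b k x \<noteq> 0} \<subseteq> cbox a b" using box_bump_outside box_subset_cbox by blast
  then have "closure {x. box_bump a b k x \<noteq> 0} \<subseteq> cbox a b" by (intro closure_minimal) auto
  then show ?thesis using assms box_bump_C_k
    by (auto simp: test_functions_def compact_eq_bounded_closed intro: bounded_subset bounded_cbox)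
qed

subsection \<open>Test functions\<close>

lemma test_functions_C1c:
  assumes "\<phi> \<in> test_functions \<Omega>"
  shows "C1c \<phi> (grad \<phi>)" "\<exists>K. compact K \<and> K \<subseteq> \<Omega> \<and> (\<forall>x. x \<notin> K \<longrightarrow> \<phi> x = 0 \<and> grad \<phi> x = 0)"
proof -
  let ?K = "closure {x. \<phi> x \<noteq> 0}"
  have K: "compact ?K" "?K \<subseteq> \<Omega>" and C: "\<And>k. C_k k \<phi>" using assms by (auto simp: test_functions_def)
  have d: "\<phi> differentiable (at x)" for x using C[of "Suc 0"] by simp
  have out: "\<phi> x = 0 \<and> grad \<phi> x = 0" if "x \<notin> ?K" for x
  proof
    show "\<phi> x = 0" using that closure_subset[of "{x. \<phi> x \<noteq> 0}"] by auto
    have "eventually (\<lambda>y. y \<in> - ?K) (nhds x)" using that by (intro eventually_nhds_in_open) auto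
    then have "eventually (\<lambda>y. 0 = \<phi> y) (nhds x)"
      by eventually_elim (use closure_subset[of "{x. \<phi> x \<noteq> 0}"] in auto)
    then have "(\<phi> has_derivative (\<lambda>h. 0)) (at x)"
      by (intro has_derivative_transform_eventually[of "\<lambda>x. 0" "\<lambda>h. 0" x UNIV \<phi>])
         (auto simp: eventually_at_filter elim: eventually_mono dest: eventually_nhds_x_imp_x)
    then show "grad \<phi> x = 0" by (simp add: grad_def vec_eq_iff partial_eq)
  qed
  then show "\<exists>K. compact K \<and> K \<subseteq> \<Omega> \<and> (\<forall>x. x \<notin> K \<longrightarrow> \<phi> x = 0 \<and> grad \<phi> x = 0)" using K by blast
  obtain R where R: "R > 0" "\<And>x. x \<in> ?K \<Longrightarrow> norm x < R"
    using compact_imp_bounded[OF K(1)] by (auto simp: bounded_pos_less)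
  have "continuous_on UNIV (grad \<phi>)"
    unfolding grad_def using C[of "Suc 0"] by (intro continuous_on_vec_lambda) simp
  moreover have "\<forall>x. norm x \<ge> R \<longrightarrow> \<phi> x = 0 \<and> grad \<phi> x = 0" using R out by (meson not_le)
  ultimately show "C1c \<phi> (grad \<phi>)" using has_derivative_grad[OF d] R by (auto simp: C1c_def)
qed

lemma test_functions_outside:
  assumes "\<phi> \<in> test_functions \<Omega>" "x \<notin> \<Omega>"
  shows "\<phi> x = 0" "grad \<phi> x = 0"
  using test_functions_C1c(2)[OF assms(1)] assms(2) by auto

lemma closure_support_minimal_compact:
  fixes \<phi> :: "'a::euclidean_space \<Rightarrow> real"
  assumes "compact K" "{x. \<phi> x \<noteq> 0} \<subseteq> K" "K \<subseteq> \<Omega>"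
  shows "compact (closure {x. \<phi> x \<noteq> 0})" "closure {x. \<phi> x \<noteq> 0} \<subseteq> \<Omega>"
proof -
  have "closure {x. \<phi> x \<noteq> 0} \<subseteq> K" using assms by (intro closure_minimal) (auto simp: compact_imp_closed)
  then show "closure {x. \<phi> x \<noteq> 0} \<subseteq> \<Omega>" "compact (closure {x. \<phi> x \<noteq> 0})"
    using assms by (auto simp: compact_eq_bounded_closed intro: bounded_subset)
qed

lemma test_functions_add:
  assumes "\<phi> \<in> test_functions \<Omega>" "\<eta> \<in> test_functions \<Omega>"
  shows "(\<lambda>x. \<phi> x + \<eta> x) \<in> test_functions \<Omega>"
proof -
  let ?K = "closure {x. \<phi> x \<noteq> 0} \<union> closure {x. \<eta> x \<noteq> 0}"
  have "compact ?K" "?K \<subseteq> \<Omega>" using assms by (auto simp: test_functions_def)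
  moreover have "{x. \<phi> x + \<eta> x \<noteq> 0} \<subseteq> ?K"
    using closure_subset[of "{x. \<phi> x \<noteq> 0}"] closure_subset[of "{x. \<eta> x \<noteq> 0}"] by (auto simp: subset_iff) (metis add_0)
  ultimately show ?thesis using closure_support_minimal_compact[of ?K "\<lambda>x. \<phi> x + \<eta> x" \<Omega>] assms
    by (auto simp: test_functions_def intro: C_k_add)
qed

lemma test_functions_compose:
  assumes "\<phi> \<in> test_functions \<Omega>" "\<And>k. C_k k (\<lambda>x. F (\<phi> x))" "F 0 = 0"
  shows "(\<lambda>x. F (\<phi> x)) \<in> test_functions \<Omega>"
proof -
  let ?K = "closure {x. \<phi> x \<noteq> 0}"
  have "compact ?K" "?K \<subseteq> \<Omega>" using assms by (auto simp: test_functions_def)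
  moreover have "{x. F (\<phi> x) \<noteq> 0} \<subseteq> ?K" using closure_subset[of "{x. \<phi> x \<noteq> 0}"] assms(3) by auto
  ultimately show ?thesis using closure_support_minimal_compact[of ?K "\<lambda>x. F (\<phi> x)" \<Omega>] assms
    by (auto simp: test_functions_def)
qed

lemma test_functions_scale:
  assumes "\<phi> \<in> test_functions \<Omega>" shows "(\<lambda>x. c * \<phi> x) \<in> test_functions \<Omega>"
  using assms by (intro test_functions_compose[of \<phi> \<Omega> "\<lambda>t. c * t"]) (auto simp: test_functions_def intro: C_k_mult C_k_const)

lemma test_functions_differentiable: "\<phi> \<in> test_functions \<Omega> \<Longrightarrow> \<phi> differentiable (at x)"
  using test_functions_C1c(1)[of \<phi> \<Omega>] by (auto simp: C1c_def differentiable_def)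

lemma grad_add:
  assumes "\<phi> \<in> test_functions \<Omega>" "\<eta> \<in> test_functions \<Omega>"
  shows "grad (\<lambda>x. \<phi> x + \<eta> x) x = grad \<phi> x + grad \<eta> x"
proof -
  note d = assms[THEN test_functions_differentiable]
  show ?thesis unfolding vec_eq_iff grad_def[of "\<lambda>x. \<phi> x + \<eta> x"]
    by (auto simp: partial_eq[OF has_derivative_add[OF has_derivative_grad[OF d(1)] has_derivative_grad[OF d(2)]]] inner_axis)
qed

lemma grad_compose:
  assumes "\<phi> differentiable (at x)" "(F has_real_derivative F') (at (\<phi> x))"
  shows "grad (\<lambda>x. F (\<phi> x)) x = F' *\<^sub>R grad \<phi> x"
  unfolding vec_eq_iff by (simp add: grad_def partial_compose(2)[OF assms(2,1)])

lemma grad_scale: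
  assumes "\<phi> \<in> test_functions \<Omega>"
  shows "grad (\<lambda>x. c * \<phi> x) x = c *\<^sub>R grad \<phi> x"
  by (rule grad_compose[OF test_functions_differentiable[OF assms]]) (auto intro!: derivative_eq_intros)

lemma C1c_compose:
  assumes C: "C1c g G" and F: "\<And>t. (F has_real_derivative F' t) (at t)" "continuous_on UNIV F'" "F 0 = 0"
  shows "C1c (\<lambda>x. F (g x)) (\<lambda>x. F' (g x) *\<^sub>R G x)"
proof -
  have D: "((\<lambda>x. F (g x)) has_derivative (\<lambda>h. (F' (g x) *\<^sub>R G x) \<bullet> h)) (at x)" for x
    using has_derivative_compose[of g "\<lambda>h. G x \<bullet> h" x UNIV F "(*) (F' (g x))"] F(1) C
    by (simp add: has_field_derivative_def C1c_def)
  have "continuous_on UNIV (\<lambda>x. F' (g x) *\<^sub>R G x)"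
    using F(2) C1c_continuous[OF C, of UNIV] by (intro continuous_on_scaleR continuous_on_compose2[of UNIV F' UNIV g]) auto
  moreover obtain R where "R > 0" "\<forall>x. norm x \<ge> R \<longrightarrow> g x = 0 \<and> G x = 0" using C by (auto simp: C1c_def)
  then have "R > 0 \<and> (\<forall>x. norm x \<ge> R \<longrightarrow> F (g x) = 0 \<and> F' (g x) *\<^sub>R G x = 0)" using F(3) by simp
  ultimately show ?thesis using D unfolding C1c_def by blast
qed

lemma C1c_product:
  assumes C: "C1c g G" and H: "C1c h H"
  shows "C1c (\<lambda>x. g x * h x) (\<lambda>x. h x *\<^sub>R G x + g x *\<^sub>R H x)"
proof -
  have D: "((\<lambda>x. g x * h x) has_derivative (\<lambda>k. (h x *\<^sub>R G x + g x *\<^sub>R H x) \<bullet> k)) (at x)" for x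
  proof -
    have "((\<lambda>x. g x * h x) has_derivative (\<lambda>k. g x * (H x \<bullet> k) + (G x \<bullet> k) * h x)) (at x)"
      using C H by (intro has_derivative_mult) (auto simp: C1c_def)
    then show ?thesis by (simp add: inner_add_left algebra_simps)
  qed
  have "continuous_on UNIV (\<lambda>x. h x *\<^sub>R G x + g x *\<^sub>R H x)"
    by (intro continuous_on_add continuous_on_scaleR C1c_continuous[OF C] C1c_continuous[OF H])
  moreover obtain R where "R > 0" "\<forall>x. norm x \<ge> R \<longrightarrow> g x = 0 \<and> G x = 0" using C by (auto simp: C1c_def)
  ultimately show ?thesis using D by (auto simp: C1c_def)
qed

section \<open>Uniqueness of weak gradients\<close>

text \<open>The positive and the negative part of \<open>g\<close> are densities of two finite measures that agree on all boxes; boxes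
  generate the Borel sets and are stable under intersection.\<close>

lemma AE_eq_0_if_box_integrals_0:
  fixes g :: "'a::euclidean_space \<Rightarrow> real"
  assumes int: "integrable lebesgue g" and box0: "\<And>c d. (\<integral>x. g x * indicator (box c d) x \<partial>lebesgue) = 0"
  shows "AE x in lebesgue. g x = 0"
proof -
  obtain h where h[measurable]: "h \<in> borel_measurable lborel" and gh: "AE x in lborel. g x = h x"
    using completion_ex_borel_measurable_real[of g lborel] int by auto
  have gh': "AE x in lebesgue. g x = h x" using gh by (simp add: AE_completion_iff)
  have "integrable lebesgue h"
    using int gh' by (subst integrable_cong_AE[of h _ g]) (auto intro: measurable_completion elim: eventually_mono)
  then have inth: "integrable lborel h" using h integrable_completion[of h lborel] by simp
  have hbox: "(\<integral>x. h x * indicator (box c d) x \<partial>lborel) = 0" for c d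
  proof -
    have "(\<integral>x. h x * indicator (box c d) x \<partial>lborel) = (\<integral>x. h x * indicator (box c d) x \<partial>lebesgue)"
      by (rule integral_completion[symmetric]) measurable
    also have "\<dots> = (\<integral>x. g x * indicator (box c d) x \<partial>lebesgue)"
    proof (rule integral_cong_AE)
      have [measurable]: "box c d \<in> sets lebesgue" "g \<in> borel_measurable lebesgue" "h \<in> borel_measurable lebesgue"
        using int by (auto intro: measurable_completion)
      show "(\<lambda>x. h x * indicator (box c d) x) \<in> borel_measurable lebesgue" "(\<lambda>x. g x * indicator (box c d) x) \<in> borel_measurable lebesgue"
        by measurable
      show "AE x in lebesgue. h x * indicator (box c d) x = g x * indicator (box c d) x" using gh' by eventually_elim simp
    qed
    finally show ?thesis using box0 by simp
  qed
  let ?P = "density lborel (\<lambda>x. ennreal (h x))" and ?Q = "density lborel (\<lambda>x. ennreal (- h x))"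
  have fin: "(\<integral>\<^sup>+x. ennreal (h x) * indicator A x \<partial>lborel) < \<infinity>" "(\<integral>\<^sup>+x. ennreal (- h x) * indicator A x \<partial>lborel) < \<infinity>" for A
  proof -
    have "(\<integral>\<^sup>+x. ennreal (norm (h x)) \<partial>lborel) < \<infinity>" using inth by (simp add: integrable_iff_bounded)
    moreover have "(\<integral>\<^sup>+x. ennreal (h x) * indicator A x \<partial>lborel) \<le> (\<integral>\<^sup>+x. ennreal (norm (h x)) \<partial>lborel)"
      "(\<integral>\<^sup>+x. ennreal (- h x) * indicator A x \<partial>lborel) \<le> (\<integral>\<^sup>+x. ennreal (norm (h x)) \<partial>lborel)"
      by (auto intro!: nn_integral_mono ennreal_leI simp: indicator_def)
    ultimately show "(\<integral>\<^sup>+x. ennreal (h x) * indicator A x \<partial>lborel) < \<infinity>" "(\<integral>\<^sup>+x. ennreal (- h x) * indicator A x \<partial>lborel) < \<infinity>"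
      by (auto intro: le_less_trans)
  qed
  have boxeq: "emeasure ?P (box c d) = emeasure ?Q (box c d)" for c d :: 'a
  proof -
    let ?p = "\<integral>\<^sup>+x. ennreal (h x) * indicator (box c d) x \<partial>lborel" and ?q = "\<integral>\<^sup>+x. ennreal (- h x) * indicator (box c d) x \<partial>lborel"
    have i: "integrable lborel (\<lambda>x. h x * indicator (box c d) x)"
      using integrable_mult_indicator[OF _ inth, of "box c d"] by (simp add: mult.commute)
    have "(\<lambda>x. ennreal (h x * indicator (box c d) x)) = (\<lambda>x. ennreal (h x) * indicator (box c d) x)"
      "(\<lambda>x. ennreal (- (h x * indicator (box c d) x))) = (\<lambda>x. ennreal (- h x) * indicator (box c d) x)"
      by (auto simp: indicator_def)
    with real_lebesgue_integral_def[OF i] hbox[of c d] have "enn2real ?p = enn2real ?q" by simp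
    then have "?p = ?q" using fin by (metis ennreal_enn2real infinity_ennreal_def)
    then show ?thesis by (simp add: emeasure_density)
  qed
  have "?P = ?Q"
  proof (rule measure_eqI_generator_eq)
    let ?E = "range (\<lambda>(a, b). box a b::'a set)"
    show "Int_stable ?E" by (auto simp: Int_stable_def box_Int_box)
    show "?E \<subseteq> Pow UNIV" "sets ?P = sigma_sets UNIV ?E" "sets ?Q = sigma_sets UNIV ?E"
      by (simp_all add: borel_eq_box)
    let ?A = "\<lambda>n::nat. box (- (real n *\<^sub>R One)) (real n *\<^sub>R One) :: 'a set"
    show "range ?A \<subseteq> ?E" "(\<Union>i. ?A i) = UNIV" unfolding UN_box_eq_UNIV by auto
    show "emeasure ?P (?A i) \<noteq> \<infinity>" for i using fin(1)[of "?A i"] by (simp add: emeasure_density)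
    show "emeasure ?P X = emeasure ?Q X" if "X \<in> ?E" for X using that boxeq by auto
  qed
  then have "AE x in lborel. ennreal (h x) = ennreal (- h x)"
    by (intro sigma_finite_measure.density_unique[OF lborel.sigma_finite_measure_axioms]) auto
  then have "AE x in lborel. h x = 0"
    by eventually_elim (metis ennreal_eq_zero_iff ennreal_neg le_cases neg_0_le_iff_le neg_le_0_iff_le order_antisym)
  with gh have "AE x in lborel. g x = 0" by eventually_elim simp
  then show ?thesis by (simp add: AE_completion_iff)
qed

text \<open>A locally integrable function becomes integrable when it is multiplied by a bounded function that lives on a compact
  subset of the domain.\<close>

lemma integrable_test_function_product:
  fixes f :: "real^'n \<Rightarrow> real"
  assumes loc: "\<And>K. compact K \<Longrightarrow> K \<subseteq> \<Omega> \<Longrightarrow> integrable (lebesgue_on K) f"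
    and K: "compact K" "K \<subseteq> \<Omega>" and h: "h \<in> borel_measurable borel" "\<And>x. x \<notin> K \<Longrightarrow> h x = 0" "\<And>x. \<bar>h x\<bar> \<le> B"
    and \<Omega>: "open \<Omega>"
  shows "integrable (lebesgue_on \<Omega>) (\<lambda>x. f x * h x)"
proof -
  have i: "integrable lebesgue (\<lambda>x. indicator K x *\<^sub>R f x)"
    using loc[OF K] integrable_restrict_space[of K lebesgue f] K(1) by (auto simp: compact_imp_closed lmeasurable_compact fmeasurableD)
  have "integrable lebesgue (\<lambda>x. h x * (indicator K x *\<^sub>R f x))"
  proof (rule Bochner_Integration.integrable_bound)
    show "integrable lebesgue (\<lambda>x. B *\<^sub>R (indicator K x *\<^sub>R f x))" using i by (rule integrable_scaleR_right)
    show "(\<lambda>x. h x * (indicator K x *\<^sub>R f x)) \<in> borel_measurable lebesgue"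
      by (rule borel_measurable_times[OF measurable_completion borel_measurable_integrable[OF i]]) (use h(1) in simp)
    show "AE x in lebesgue. norm (h x * (indicator K x *\<^sub>R f x)) \<le> norm (B *\<^sub>R (indicator K x *\<^sub>R f x))"
      using h(3) by (intro AE_I2) (auto simp: abs_mult intro!: mult_right_mono order_trans[OF h(3)])
  qed
  also have "(\<lambda>x. h x * (indicator K x *\<^sub>R f x)) = (\<lambda>x. indicator \<Omega> x *\<^sub>R (f x * h x))"
    using h(2) K by (auto simp: indicator_def fun_eq_iff)
  finally show ?thesis using \<Omega> by (subst integrable_restrict_space) auto
qed

text \<open>The fundamental lemma of the calculus of variations: approximate the indicator of a box by bump functions.\<close>

lemma AE_eq_0_if_test_function_integrals_0:
  fixes f :: "real^'n \<Rightarrow> real"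
  assumes \<Omega>: "open \<Omega>" and loc: "\<And>K. compact K \<Longrightarrow> K \<subseteq> \<Omega> \<Longrightarrow> integrable (lebesgue_on K) f"
    and test0: "\<And>\<phi>. \<phi> \<in> test_functions \<Omega> \<Longrightarrow> (\<integral>x. f x * \<phi> x \<partial>lebesgue_on \<Omega>) = 0"
  shows "AE x in lebesgue_on \<Omega>. f x = 0"
proof -
  have cb: "AE x in lebesgue. x \<in> cbox a b \<longrightarrow> f x = 0" if ab: "cbox a b \<subseteq> \<Omega>" for a b
  proof -
    have iab: "integrable lebesgue (\<lambda>x. indicator (cbox a b) x *\<^sub>R f x)"
      using loc[OF _ ab] integrable_restrict_space[of "cbox a b" lebesgue f] by auto
    let ?g = "\<lambda>x. f x * indicator (box a b) x"
    have ind: "(\<lambda>x. indicator (box a b) x *\<^sub>R (indicator (cbox a b) x *\<^sub>R f x)) = ?g"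
      using box_subset_cbox[of a b] by (auto simp: indicator_def fun_eq_iff)
    have ig: "integrable lebesgue ?g"
      using integrable_mult_indicator[OF _ iab, of "box a b"] unfolding ind by auto
    have "(\<integral>x. ?g x * indicator (box c d) x \<partial>lebesgue) = 0" for c d
    proof -
      obtain c' d' where cd: "box c d \<inter> box a b = box c' d'" by (auto simp: box_Int_box)
      have sub: "cbox c' d' \<subseteq> cbox a b" if "box c' d' \<noteq> {}"
        using cd that by (metis Int_lower2 box_subset_cbox subset_box(2) closure_box closure_minimal closed_cbox order_trans)
      have eq: "?g x * indicator (box c d) x = indicator (cbox a b) x *\<^sub>R f x * indicator (box c' d') x" for x
        using cd box_subset_cbox[of a b] unfolding cd[symmetric] by (auto simp: indicator_def)
      show ?thesis
      proof (cases "box c' d' = {}")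
        case False
        have "(\<lambda>k. \<integral>x. indicator (cbox a b) x *\<^sub>R f x * box_bump c' d' k x \<partial>lebesgue) \<longlonglongrightarrow>
            (\<integral>x. indicator (cbox a b) x *\<^sub>R f x * indicator (box c' d') x \<partial>lebesgue)"
        proof (rule integral_dominated_convergence[where w="\<lambda>x. norm (indicator (cbox a b) x *\<^sub>R f x)"])
          have bm: "box_bump c' d' k \<in> borel_measurable lebesgue" for k
            using box_bump_C_k[of 0 c' d' k] by (intro measurable_completion) (auto intro: borel_measurable_continuous_onI)
          show "(\<lambda>x. indicator (cbox a b) x *\<^sub>R f x * box_bump c' d' k x) \<in> borel_measurable lebesgue" for k
            using bm iab by (intro borel_measurable_times) auto
          show "(\<lambda>x. indicator (cbox a b) x *\<^sub>R f x * indicator (box c' d') x) \<in> borel_measurable lebesgue"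
            by (rule borel_measurable_times[OF borel_measurable_integrable[OF iab] borel_measurable_indicator]) simp
          show "integrable lebesgue (\<lambda>x. norm (indicator (cbox a b) x *\<^sub>R f x))" using iab by (rule integrable_norm)
          show "AE x in lebesgue. (\<lambda>k. indicator (cbox a b) x *\<^sub>R f x * box_bump c' d' k x) \<longlonglongrightarrow> indicator (cbox a b) x *\<^sub>R f x * indicator (box c' d') x"
            by (intro AE_I2 tendsto_mult tendsto_const box_bump_tendsto)
          show "AE x in lebesgue. norm (indicator (cbox a b) x *\<^sub>R f x * box_bump c' d' k x) \<le> norm (indicator (cbox a b) x *\<^sub>R f x)" for k
            using box_bump_bounds[of c' d' k] by (intro AE_I2) (auto simp: abs_mult intro!: mult_left_le)
        qed
        moreover have "(\<integral>x. indicator (cbox a b) x *\<^sub>R f x * box_bump c' d' k x \<partial>lebesgue) = 0" for k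
        proof -
          have "indicator (cbox a b) x *\<^sub>R f x * box_bump c' d' k x = indicator \<Omega> x *\<^sub>R (f x * box_bump c' d' k x)" for x
            using ab sub[OF False] box_bump_outside[of x c' d' k] box_subset_cbox[of c' d'] by (cases "x \<in> box c' d'") (auto simp: indicator_def)
          then have "(\<integral>x. indicator (cbox a b) x *\<^sub>R f x * box_bump c' d' k x \<partial>lebesgue) = (\<integral>x. f x * box_bump c' d' k x \<partial>lebesgue_on \<Omega>)"
            using \<Omega> by (subst integral_restrict_space) (auto intro!: Bochner_Integration.integral_cong simp del: real_scaleR_def)
          then show ?thesis using test0[OF box_bump_test[of c' d' \<Omega> k]] sub[OF False] ab by auto
        qed
        ultimately show ?thesis unfolding eq by (simp add: LIMSEQ_const_iff)
      qed (simp add: eq)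
    qed
    from AE_eq_0_if_box_integrals_0[OF ig this] have "AE x in lebesgue. ?g x = 0" .
    moreover have "AE x in lebesgue. x \<notin> cbox a b - box a b"
    proof -
      have "negligible (cbox a b - box a b)"
        using negligible_frontier_interval[of a b] by (simp add: frontier_cbox)
      then show ?thesis by (intro AE_not_in) (simp add: negligible_iff_null_sets)
    qed
    ultimately show ?thesis by eventually_elim (auto simp: indicator_def split: if_splits)
  qed
  obtain \<D> where \<D>: "countable \<D>" "\<D> \<subseteq> Pow \<Omega>" "\<And>X. X \<in> \<D> \<Longrightarrow> \<exists>a b. X = cbox a b" "\<Union>\<D> = \<Omega>"
    using open_countable_Union_open_cbox[OF \<Omega>] by metis
  have "AE x in lebesgue. \<forall>X\<in>\<D>. x \<in> X \<longrightarrow> f x = 0"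
    using \<D>(1) by (subst AE_ball_countable) (use cb \<D> in blast)+
  then have "AE x in lebesgue. x \<in> \<Omega> \<longrightarrow> f x = 0" by eventually_elim (use \<D>(4) in blast)
  then show ?thesis using \<Omega> by (simp add: AE_restrict_space_iff)
qed

lemma weak_gradient_unique:
  assumes \<Omega>: "open \<Omega>" and G: "has_weak_gradient \<Omega> u G" and H: "has_weak_gradient \<Omega> u H"
  shows "AE x in lebesgue_on \<Omega>. G x = H x"
proof -
  have "AE x in lebesgue_on \<Omega>. (G x - H x) $ i = 0" for i
  proof (rule AE_eq_0_if_test_function_integrals_0[OF \<Omega>])
    have loc: "integrable (lebesgue_on K) (\<lambda>x. G x $ i)" "integrable (lebesgue_on K) (\<lambda>x. H x $ i)" if "compact K" "K \<subseteq> \<Omega>" for K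
      using G H that by (auto simp: has_weak_gradient_def intro!: integrable_bounded_linear[OF bounded_linear_vec_nth])
    then show "integrable (lebesgue_on K) (\<lambda>x. (G x - H x) $ i)" if "compact K" "K \<subseteq> \<Omega>" for K
      using that by simp
    fix \<phi> assume \<phi>: "\<phi> \<in> test_functions \<Omega>"
    obtain K where K: "compact K" "K \<subseteq> \<Omega>" "\<And>x. x \<notin> K \<Longrightarrow> \<phi> x = 0" using test_functions_C1c(2)[OF \<phi>] by blast
    obtain B where B: "\<And>x. \<bar>\<phi> x\<bar> \<le> B" using C1c_bounded[OF test_functions_C1c(1)[OF \<phi>]] by blast
    have "integrable (lebesgue_on \<Omega>) (\<lambda>x. G x $ i * \<phi> x)" "integrable (lebesgue_on \<Omega>) (\<lambda>x. H x $ i * \<phi> x)"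
      by (rule integrable_test_function_product[OF loc(1) K(1,2) _ K(3) B \<Omega>] integrable_test_function_product[OF loc(2) K(1,2) _ K(3) B \<Omega>];
          use C1c_measurable[OF test_functions_C1c(1)[OF \<phi>]] in simp)+
    moreover have "(\<integral>x. G x $ i * \<phi> x \<partial>lebesgue_on \<Omega>) = (\<integral>x. H x $ i * \<phi> x \<partial>lebesgue_on \<Omega>)"
      using G H \<phi> by (force simp: has_weak_gradient_def)
    ultimately show "(\<integral>x. (G x - H x) $ i * \<phi> x \<partial>lebesgue_on \<Omega>) = 0"
      by (simp add: left_diff_distrib)
  qed
  then have "AE x in lebesgue_on \<Omega>. \<forall>i. (G x - H x) $ i = 0" by (simp add: AE_all_countable)
  then show ?thesis by eventually_elim (simp add: vec_eq_iff)
qed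

lemma weak_gradient_AE:
  assumes "open \<Omega>" "has_weak_gradient \<Omega> u G"
  shows "AE x in lebesgue_on \<Omega>. weak_gradient \<Omega> u x = G x"
  unfolding weak_gradient_def by (rule weak_gradient_unique[OF assms(1) someI[of "has_weak_gradient \<Omega> u", OF assms(2)] assms(2)])

section \<open>Sobolev functions as limits of test functions\<close>

lemma borel_measurable_lebesgue_on_AE:
  fixes f g :: "'a::euclidean_space \<Rightarrow> 'b::topological_space"
  assumes S: "S \<in> sets lebesgue" and ae: "AE x in lebesgue_on S. f x = g x" and g: "g \<in> borel_measurable (lebesgue_on S)"
  shows "f \<in> borel_measurable (lebesgue_on S)"
proof (rule measurableI)
  fix A :: "'b set" assume A: "A \<in> sets borel"
  obtain N where N: "N \<in> null_sets (lebesgue_on S)" "{x \<in> space (lebesgue_on S). f x \<noteq> g x} \<subseteq> N"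
    using ae unfolding eventually_ae_filter by auto
  have N0: "N \<in> null_sets lebesgue" using N(1) S by (simp add: null_sets_restrict_space)
  have "f -` A \<inter> S \<inter> N \<in> null_sets lebesgue" using N0 by (rule null_sets_completion_subset[rotated]) auto
  moreover have "g -` A \<inter> space (lebesgue_on S) \<in> sets (lebesgue_on S)" using g A by (rule measurable_sets)
  then have "g -` A \<inter> S \<in> sets lebesgue" using S by (simp add: sets_restrict_space_iff)
  moreover have "f -` A \<inter> S = ((g -` A \<inter> S) - N) \<union> (f -` A \<inter> S \<inter> N)" using N(2) by auto
  ultimately have "f -` A \<inter> S \<in> sets lebesgue" using N0 by (metis null_setsD2 sets.Diff sets.Un)
  then show "f -` A \<inter> space (lebesgue_on S) \<in> sets (lebesgue_on S)" using S by (simp add: sets_restrict_space_iff)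
qed simp

lemma borel_measurable_component [measurable (raw)]:
  fixes f :: "'a \<Rightarrow> real^'n"
  assumes "f \<in> borel_measurable M" shows "(\<lambda>x. f x $ i) \<in> borel_measurable M"
  by (rule borel_measurable_continuous_on[OF _ assms, of "\<lambda>y. y $ i"]) (intro continuous_on_component continuous_on_id)

lemma integrable_if_Lmod_1:
  fixes f :: "'a \<Rightarrow> 'b::euclidean_space"
  assumes "f \<in> borel_measurable M" "Lmod M 1 f < \<infinity>"
  shows "integrable M f"
  using assms by (intro integrableI_bounded) (auto simp: Lmod_def)

lemma tendsto_integral_mult_bounded:
  fixes f b :: "'a \<Rightarrow> real"
  assumes [measurable]: "f \<in> borel_measurable M" "\<And>k. F k \<in> borel_measurable M" "b \<in> borel_measurable M"
    and fin: "\<And>k. Lmod M 1 (F k) < \<infinity>" and bd: "\<And>x. x \<in> space M \<Longrightarrow> \<bar>b x\<bar> \<le> B"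
    and lim: "(\<lambda>k. Lmod M 1 (\<lambda>x. F k x - f x)) \<longlonglongrightarrow> 0"
  shows "(\<lambda>k. \<integral>x. F k x * b x \<partial>M) \<longlonglongrightarrow> (\<integral>x. f x * b x \<partial>M)"
proof -
  have finf: "Lmod M 1 f < \<infinity>" by (rule Lmod_finite_if_tendsto[OF _ _ fin _ lim]) auto
  have I: "integrable M (\<lambda>x. g x * b x)" if [measurable]: "g \<in> borel_measurable M" and "Lmod M 1 g < \<infinity>" for g :: "'a \<Rightarrow> real"
  proof (rule Bochner_Integration.integrable_bound)
    show "integrable M (\<lambda>x. B * g x)" using integrable_if_Lmod_1[OF that] by simp
    show "AE x in M. norm (g x * b x) \<le> norm (B * g x)"
      using bd by (intro AE_I2) (force simp: abs_mult mult.commute intro: mult_right_mono)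
  qed measurable
  have "(\<lambda>k. ennreal \<bar>(\<integral>x. F k x * b x \<partial>M) - (\<integral>x. f x * b x \<partial>M)\<bar>) \<longlonglongrightarrow> 0"
  proof (rule tendsto_ennreal_0_squeeze)
    fix k
    have "(\<integral>x. F k x * b x \<partial>M) - (\<integral>x. f x * b x \<partial>M) = (\<integral>x. F k x * b x - f x * b x \<partial>M)"
      using I[of "F k"] I[of f] fin finf by simp
    also have "ennreal \<bar>\<dots>\<bar> \<le> (\<integral>\<^sup>+x. ennreal (norm (F k x * b x - f x * b x)) \<partial>M)"
      using I[of "F k"] I[of f] fin finf integral_norm_bound_ennreal[of M "\<lambda>x. F k x * b x - f x * b x"] by simp
    also have "\<dots> \<le> (\<integral>\<^sup>+x. ennreal \<bar>B\<bar> * ennreal (norm (F k x - f x) powr 1) \<partial>M)"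
    proof (rule nn_integral_mono)
      fix x assume "x \<in> space M"
      then have "\<bar>b x\<bar> \<le> \<bar>B\<bar>" using bd[of x] by linarith
      then have "\<bar>F k x - f x\<bar> * \<bar>b x\<bar> \<le> \<bar>F k x - f x\<bar> * \<bar>B\<bar>" by (rule mult_left_mono) simp
      then show "ennreal (norm (F k x * b x - f x * b x)) \<le> ennreal \<bar>B\<bar> * ennreal (norm (F k x - f x) powr 1)"
        unfolding left_diff_distrib[symmetric] real_norm_def abs_mult
        by (simp add: ennreal_mult'[symmetric] mult.commute[of "\<bar>B\<bar>"] ennreal_leI)
    qed
    also have "\<dots> = ennreal \<bar>B\<bar> * Lmod M 1 (\<lambda>x. F k x - f x)"
      unfolding Lmod_def by (rule nn_integral_cmult) measurable
    finally show "ennreal \<bar>(\<integral>x. F k x * b x \<partial>M) - (\<integral>x. f x * b x \<partial>M)\<bar> \<le> \<dots>" .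
  next
    show "(\<lambda>k. ennreal \<bar>B\<bar> * Lmod M 1 (\<lambda>x. F k x - f x)) \<longlonglongrightarrow> 0"
      using ennreal_tendsto_cmult[OF _ lim, of "ennreal \<bar>B\<bar>"] by simp
  qed
  then show ?thesis by (rule tendsto_0_if_ennreal_abs[THEN LIM_zero_cancel])
qed

locale bounded_domain =
  fixes \<Omega> :: "(real^'n) set"
  assumes open_domain: "open \<Omega>" and bounded_domain: "bounded \<Omega>"
begin

abbreviation M :: "(real^'n) measure" where "M \<equiv> lebesgue_on \<Omega>"

lemma sets_domain [simp, measurable]: "\<Omega> \<in> sets lebesgue" "\<Omega> \<in> sets borel" "\<Omega> \<in> sets lborel"
  using open_domain by auto

lemma finite_measure_domain: "finite_measure M"
proof (rule finite_measure_lebesgue_on)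
  show "\<Omega> \<in> lmeasurable" using bounded_domain by (intro bounded_set_imp_lmeasurable) auto
qed

lemma measure_domain: "measure M (space M) = measure lebesgue \<Omega>"
  by (simp add: measure_restrict_space)

lemma emeasure_domain: "emeasure lborel \<Omega> = ennreal (measure lebesgue \<Omega>)"
proof -
  have "emeasure lebesgue \<Omega> = ennreal (measure lebesgue \<Omega>)"
    using bounded_domain by (intro emeasure_eq_measure2 bounded_set_imp_lmeasurable) auto
  then show ?thesis by simp
qed

lemma borel_measurable_domain: "f \<in> borel_measurable borel \<Longrightarrow> f \<in> borel_measurable M"
  by (intro measurable_restrict_space1 measurable_completion) simp

lemma nn_integral_domain:
  assumes [measurable]: "f \<in> borel_measurable borel"
  shows "(\<integral>\<^sup>+x. f x \<partial>M) = (\<integral>\<^sup>+x. f x * indicator \<Omega> x \<partial>lborel)"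
  by (subst nn_integral_restrict_space) (auto simp: nn_integral_completion)

lemma integral_domain:
  fixes f :: "real^'n \<Rightarrow> real"
  assumes [measurable]: "f \<in> borel_measurable borel" and "\<And>x. x \<notin> \<Omega> \<Longrightarrow> f x = 0"
  shows "(\<integral>x. f x \<partial>M) = (\<integral>x. f x \<partial>lborel)"
proof -
  have "(\<integral>x. f x \<partial>M) = (\<integral>x. indicator \<Omega> x *\<^sub>R f x \<partial>lebesgue)" by (rule integral_restrict_space) simp
  also have "(\<lambda>x. indicator \<Omega> x *\<^sub>R f x) = f" using assms(2) by (auto simp: indicator_def fun_eq_iff)
  also have "(\<integral>x. f x \<partial>lebesgue) = (\<integral>x. f x \<partial>lborel)" by (rule integral_completion) simp
  finally show ?thesis .
qed

lemma test_measurable [measurable]: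
  assumes "\<phi> \<in> test_functions \<Omega>"
  shows "\<phi> \<in> borel_measurable M" "grad \<phi> \<in> borel_measurable M"
  using C1c_measurable[OF test_functions_C1c(1)[OF assms]] by (auto intro: borel_measurable_domain)

lemma C1c_Lmod_finite:
  assumes "C1c g G" "q > 0"
  shows "Lmod M q g < \<infinity>" "Lmod M q G < \<infinity>"
proof -
  interpret finite_measure M by (rule finite_measure_domain)
  obtain B where B: "B > 0" "\<And>x. \<bar>g x\<bar> \<le> B \<and> norm (G x) \<le> B" using C1c_bounded[OF assms(1)] by blast
  have "Lmod M q (\<lambda>x. B) < \<infinity>" unfolding Lmod_def by (simp add: emeasure_eq_measure ennreal_mult_less_top)
  moreover have "Lmod M q g \<le> Lmod M q (\<lambda>x. B)" "Lmod M q G \<le> Lmod M q (\<lambda>x. B)"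
    using B assms(2) by (auto intro!: Lmod_mono_AE)
  ultimately show "Lmod M q g < \<infinity>" "Lmod M q G < \<infinity>" by (auto intro: le_less_trans)
qed

lemma Lp_iff: "u \<in> Lp \<Omega> q \<longleftrightarrow> u \<in> borel_measurable M \<and> Lmod M q u < \<infinity>"
  by (auto simp: Lp_def Lmod_def integrable_iff_bounded)

lemma Lp_norm_eq: "u \<in> borel_measurable M \<Longrightarrow> Lp_norm \<Omega> q u = enn2real (Lmod M q u) powr (1/q)"
  by (simp add: Lp_norm_def Lmod_def integral_eq_nn_integral)

lemma Lp_norm_tendsto_0:
  assumes "\<And>k. u k \<in> borel_measurable M" "(\<lambda>k. Lmod M q (u k)) \<longlonglongrightarrow> 0" "q > 0"
  shows "(\<lambda>k. Lp_norm \<Omega> q (u k)) \<longlonglongrightarrow> 0"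
proof -
  have "(\<lambda>k. enn2real (Lmod M q (u k))) \<longlonglongrightarrow> 0" using tendsto_enn2real[of _ 0] assms(2) by fastforce
  then have "(\<lambda>k. enn2real (Lmod M q (u k)) powr (1/q)) \<longlonglongrightarrow> 0 powr (1/q)"
    using assms(3) by (intro tendsto_powr2) auto
  then show ?thesis using assms by (simp add: Lp_norm_eq)
qed

lemma integrable_compact_if_integrable:
  fixes f :: "real^'n \<Rightarrow> 'b::euclidean_space"
  assumes f: "integrable M f" and K: "compact K" "K \<subseteq> \<Omega>"
  shows "integrable (lebesgue_on K) f"
proof -
  have Ks: "K \<in> sets lebesgue" using K by (simp add: lmeasurable_compact fmeasurableD)
  have "integrable lebesgue (\<lambda>x. indicator \<Omega> x *\<^sub>R f x)" using f by (subst (asm) integrable_restrict_space) auto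
  then have "integrable lebesgue (\<lambda>x. indicator K x *\<^sub>R (indicator \<Omega> x *\<^sub>R f x))"
    by (rule integrable_mult_indicator[OF Ks])
  also have "(\<lambda>x. indicator K x *\<^sub>R (indicator \<Omega> x *\<^sub>R f x)) = (\<lambda>x. indicator K x *\<^sub>R f x)"
    using K by (auto simp: indicator_def fun_eq_iff)
  finally show ?thesis using Ks by (subst integrable_restrict_space) auto
qed

text \<open>The product \<open>g * h\<close> has compact support, so its partial derivatives have integral zero.\<close>

lemma integration_by_parts_test_function:
  assumes g: "C1c g G" and h: "h \<in> test_functions \<Omega>"
  shows "(\<integral>x. g x * partial i h x \<partial>M) = - (\<integral>x. G x $ i * h x \<partial>M)"
proof -
  note hC = test_functions_C1c(1)[OF h]
  note meas[measurable] = C1c_measurable[OF g] C1c_measurable[OF hC]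
  have p: "partial i h x = grad h x $ i" for x by (simp add: grad_def)
  have 1: "(\<integral>x. g x * partial i h x \<partial>M) = (\<integral>x. g x * (grad h x $ i) \<partial>lborel)"
    unfolding p by (rule integral_domain) (use test_functions_outside[OF h] in auto)
  have 2: "(\<integral>x. G x $ i * h x \<partial>M) = (\<integral>x. G x $ i * h x \<partial>lborel)"
    by (rule integral_domain) (use test_functions_outside[OF h] in auto)
  obtain B where B: "\<And>x. \<bar>g x\<bar> \<le> B \<and> norm (G x) \<le> B" using C1c_bounded[OF g] by blast
  have B0: "\<bar>g x\<bar> \<le> \<bar>B\<bar>" "\<bar>G x $ i\<bar> \<le> \<bar>B\<bar>" for x
    using B[of x] component_le_norm_cart[of "G x" i] by linarith+
  have i1: "integrable lborel (\<lambda>x. g x * (grad h x $ i))"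
  proof (rule Bochner_Integration.integrable_bound)
    show "integrable lborel (\<lambda>x. \<bar>B\<bar> * norm (grad h x))" using C1c_integrable(2)[OF hC] by (intro integrable_mult_right integrable_norm)
    show "AE x in lborel. norm (g x * (grad h x $ i)) \<le> norm (\<bar>B\<bar> * norm (grad h x))"
      using B0 component_le_norm_cart[of "grad h _" i] by (intro AE_I2) (auto simp: abs_mult intro!: mult_mono)
  qed measurable
  have i2: "integrable lborel (\<lambda>x. G x $ i * h x)"
  proof (rule Bochner_Integration.integrable_bound)
    show "integrable lborel (\<lambda>x. \<bar>B\<bar> * h x)" using C1c_integrable(1)[OF hC] by (intro integrable_mult_right)
    show "AE x in lborel. norm (G x $ i * h x) \<le> norm (\<bar>B\<bar> * h x)"
      using B0 by (intro AE_I2) (auto simp: abs_mult intro!: mult_mono)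
  qed measurable
  have "0 = (\<integral>x. (h x *\<^sub>R G x + g x *\<^sub>R grad h x) \<bullet> axis i 1 \<partial>lborel)"
    using C1c_integral_gradient[OF C1c_product[OF g hC]] by simp
  also have "\<dots> = (\<integral>x. G x $ i * h x + g x * (grad h x $ i) \<partial>lborel)"
    by (simp add: inner_axis inner_add_left mult.commute)
  also have "\<dots> = (\<integral>x. G x $ i * h x \<partial>lborel) + (\<integral>x. g x * (grad h x $ i) \<partial>lborel)"
    using i1 i2 by simp
  finally show ?thesis using 1 2 by simp
qed

text \<open>Integration by parts against a test function survives limits in \<open>L\<^sup>1\<close>. The functions \<open>g k\<close> may be nonzero outside
  \<open>\<Omega>\<close>, since the test function cuts off there.\<close>

lemma has_weak_gradient_limit:
  assumes C: "\<And>k. C1c (g k) (G k)" and [measurable]: "u \<in> borel_measurable M" "H \<in> borel_measurable M"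
    and u: "(\<lambda>k. Lmod M 1 (\<lambda>x. g k x - u x)) \<longlonglongrightarrow> 0" and H: "(\<lambda>k. Lmod M 1 (\<lambda>x. G k x - H x)) \<longlonglongrightarrow> 0"
  shows "has_weak_gradient \<Omega> u H"
proof -
  note [measurable] = C1c_measurable[OF C, THEN borel_measurable_domain]
  have fin: "Lmod M 1 (g k) < \<infinity>" "Lmod M 1 (G k) < \<infinity>" for k using C1c_Lmod_finite[OF C] by auto
  have iu: "integrable M u" "integrable M H"
    by (intro integrable_if_Lmod_1 Lmod_finite_if_tendsto[OF _ _ fin(1) _ u] Lmod_finite_if_tendsto[OF _ _ fin(2) _ H]; simp)+
  show ?thesis unfolding has_weak_gradient_def
  proof (intro conjI allI impI ballI; (elim conjE)?)
    fix K assume "compact K" "K \<subseteq> \<Omega>"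
    then show "integrable (lebesgue_on K) u" "integrable (lebesgue_on K) H"
      using iu integrable_compact_if_integrable by blast+
  next
    fix h i assume h: "h \<in> test_functions \<Omega>"
    note hC = test_functions_C1c(1)[OF h]
    note [measurable] = test_measurable[OF h]
    obtain B where B: "\<And>x. \<bar>h x\<bar> \<le> B \<and> norm (grad h x) \<le> B" using C1c_bounded[OF hC] by blast
    have p: "partial i h x = grad h x $ i" for x by (simp add: grad_def)
    have "(\<lambda>k. \<integral>x. g k x * (grad h x $ i) \<partial>M) \<longlonglongrightarrow> (\<integral>x. u x * (grad h x $ i) \<partial>M)"
      by (rule tendsto_integral_mult_bounded[OF _ _ _ fin(1) _ u, of _ B])
         (measurable, use B in \<open>auto intro: order_trans[OF component_le_norm_cart]\<close>)
    moreover have "(\<lambda>k. \<integral>x. (G k x $ i) * h x \<partial>M) \<longlonglongrightarrow> (\<integral>x. (H x $ i) * h x \<partial>M)"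
    proof (rule tendsto_integral_mult_bounded[of _ _ _ _ B])
      show "Lmod M 1 (\<lambda>x. G k x $ i) < \<infinity>" for k
        by (rule le_less_trans[OF Lmod_mono_AE fin(2)[of k]]) (auto intro: component_le_norm_cart)
      show "(\<lambda>k. Lmod M 1 (\<lambda>x. G k x $ i - H x $ i)) \<longlonglongrightarrow> 0"
        by (rule tendsto_ennreal_0_squeeze[OF Lmod_mono_AE H])
           (auto intro!: AE_I2 component_le_norm_cart simp flip: vector_minus_component)
    qed (use B in auto)
    moreover have "(\<integral>x. g k x * (grad h x $ i) \<partial>M) = - (\<integral>x. (G k x $ i) * h x \<partial>M)" for k
      using integration_by_parts_test_function[OF C h, of k i] by (simp add: p)
    ultimately have "(\<lambda>k. - (\<integral>x. (G k x $ i) * h x \<partial>M)) \<longlonglongrightarrow> (\<integral>x. u x * (grad h x $ i) \<partial>M)"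
      and "(\<lambda>k. - (\<integral>x. (G k x $ i) * h x \<partial>M)) \<longlonglongrightarrow> - (\<integral>x. H x $ i * h x \<partial>M)"
      by (simp_all only: tendsto_minus)
    then show "(\<integral>x. u x * partial i h x \<partial>M) = - (\<integral>x. H x $ i * h x \<partial>M)"
      unfolding p by (rule LIMSEQ_unique)
  qed
qed

text \<open>Membership in \<open>W1_0 \<Omega> q\<close> with all its data made explicit: the approximating test functions \<open>\<phi>\<close> and the limit \<open>G\<close>
  of their gradients, which is the weak gradient of \<open>u\<close>. The lemmas \<open>approx_imp_W1_0\<close> and \<open>W1_0_imp_approx\<close> show that
  nothing is gained or lost. With explicit gradients the nonuniqueness of \<open>weak_gradient\<close> on null sets disappears from
  the arguments.\<close>

definition approx :: "real \<Rightarrow> (nat \<Rightarrow> real^'n \<Rightarrow> real) \<Rightarrow> (real^'n \<Rightarrow> real) \<Rightarrow> (real^'n \<Rightarrow> real^'n) \<Rightarrow> bool" where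
  "approx q \<phi> u G \<longleftrightarrow> u \<in> borel_measurable M \<and> G \<in> borel_measurable M \<and> (\<forall>k. \<phi> k \<in> test_functions \<Omega>) \<and>
     (\<lambda>k. Lmod M q (\<lambda>x. \<phi> k x - u x)) \<longlonglongrightarrow> 0 \<and> (\<lambda>k. Lmod M q (\<lambda>x. grad (\<phi> k) x - G x)) \<longlonglongrightarrow> 0"

lemma approxD:
  assumes "approx q \<phi> u G"
  shows "u \<in> borel_measurable M" "G \<in> borel_measurable M" "\<phi> k \<in> test_functions \<Omega>"
    "(\<lambda>k. Lmod M q (\<lambda>x. \<phi> k x - u x)) \<longlonglongrightarrow> 0" "(\<lambda>k. Lmod M q (\<lambda>x. grad (\<phi> k) x - G x)) \<longlonglongrightarrow> 0"
    "\<phi> k \<in> borel_measurable M" "grad (\<phi> k) \<in> borel_measurable M" "C1c (\<phi> k) (grad (\<phi> k))"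
  using assms test_functions_C1c(1) unfolding approx_def by (auto intro: test_measurable)

lemma approx_Lmod_finite:
  assumes a: "approx q \<phi> u G" and q: "q > 0"
  shows "Lmod M q u < \<infinity>" "Lmod M q G < \<infinity>"
proof -
  have fin: "Lmod M q (\<phi> k) < \<infinity>" "Lmod M q (grad (\<phi> k)) < \<infinity>" for k
    using C1c_Lmod_finite[OF approxD(8)[OF a] q] by auto
  show "Lmod M q u < \<infinity>"
    by (rule Lmod_finite_if_tendsto[OF approxD(1)[OF a] approxD(6)[OF a] fin(1) q approxD(4)[OF a]])
  show "Lmod M q G < \<infinity>"
    by (rule Lmod_finite_if_tendsto[OF approxD(2)[OF a] approxD(7)[OF a] fin(2) q approxD(5)[OF a]])
qed

lemma approx_lower_exponent:
  assumes a: "approx q \<phi> u G" and q: "0 < r" "r \<le> q"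
  shows "approx r \<phi> u G"
  unfolding approx_def
proof (intro conjI allI)
  show "(\<lambda>k. Lmod M r (\<lambda>x. \<phi> k x - u x)) \<longlonglongrightarrow> 0"
    by (rule Lmod_lower_exponent_tendsto[OF finite_measure_domain approxD(1)[OF a] approxD(6)[OF a] q approxD(4)[OF a]])
  show "(\<lambda>k. Lmod M r (\<lambda>x. grad (\<phi> k) x - G x)) \<longlonglongrightarrow> 0"
    by (rule Lmod_lower_exponent_tendsto[OF finite_measure_domain approxD(2)[OF a] approxD(7)[OF a] q approxD(5)[OF a]])
qed (use approxD[OF a] in auto)

lemma approx_has_weak_gradient:
  assumes a: "approx q \<phi> u G" and q: "q \<ge> 1"
  shows "has_weak_gradient \<Omega> u G"
proof -
  have a1: "approx 1 \<phi> u G" by (rule approx_lower_exponent[OF a]) (use q in auto)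
  show ?thesis by (rule has_weak_gradient_limit[OF approxD(8)[OF a1] approxD(1,2,4,5)[OF a1]])
qed

lemma weak_gradient_approx_AE:
  assumes "approx q \<phi> u G" "q \<ge> 1"
  shows "AE x in M. weak_gradient \<Omega> u x = G x"
  by (rule weak_gradient_AE[OF open_domain approx_has_weak_gradient[OF assms]])

lemma weak_gradient_measurable:
  assumes "has_weak_gradient \<Omega> u G" "G \<in> borel_measurable M"
  shows "weak_gradient \<Omega> u \<in> borel_measurable M"
  by (rule borel_measurable_lebesgue_on_AE[OF _ weak_gradient_AE[OF open_domain assms(1)] assms(2)]) simp

lemma approx_const:
  assumes "\<phi> \<in> test_functions \<Omega>"
  shows "approx q (\<lambda>_. \<phi>) \<phi> (grad \<phi>)"
  using assms unfolding approx_def by (auto simp: Lmod_def)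

lemma approx_add:
  assumes a: "approx q \<phi> u G" and b: "approx q \<psi> v H" and q: "q > 0"
  shows "approx q (\<lambda>k x. \<phi> k x + \<psi> k x) (\<lambda>x. u x + v x) (\<lambda>x. G x + H x)"
  unfolding approx_def
proof (intro conjI allI)
  note [measurable] = approxD[OF a] approxD[OF b]
  show "(\<lambda>x. u x + v x) \<in> borel_measurable M" "(\<lambda>x. G x + H x) \<in> borel_measurable M" by measurable
  show "(\<lambda>k. Lmod M q (\<lambda>x. \<phi> k x + \<psi> k x - (u x + v x))) \<longlonglongrightarrow> 0"
    by (rule Lmod_tendsto_add) (use approxD[OF a] approxD[OF b] q in auto)
  show "(\<lambda>k. Lmod M q (\<lambda>x. grad (\<lambda>x. \<phi> k x + \<psi> k x) x - (G x + H x))) \<longlonglongrightarrow> 0"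
    unfolding grad_add[OF approxD(3)[OF a] approxD(3)[OF b]]
    by (rule Lmod_tendsto_add) (use approxD[OF a] approxD[OF b] q in auto)
qed (use approxD(3)[OF a] approxD(3)[OF b] in \<open>auto intro: test_functions_add\<close>)

lemma approx_scale:
  assumes a: "approx q \<phi> u G"
  shows "approx q (\<lambda>k x. c * \<phi> k x) (\<lambda>x. c * u x) (\<lambda>x. c *\<^sub>R G x)"
  unfolding approx_def
proof (intro conjI allI)
  note [measurable] = approxD[OF a]
  show "(\<lambda>x. c * u x) \<in> borel_measurable M" "(\<lambda>x. c *\<^sub>R G x) \<in> borel_measurable M" by measurable
  show "(\<lambda>k. Lmod M q (\<lambda>x. c * \<phi> k x - c * u x)) \<longlonglongrightarrow> 0"
    using Lmod_tendsto_scaleR[OF approxD(1,6,4)[OF a], of c] by simp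
  show "(\<lambda>k. Lmod M q (\<lambda>x. grad (\<lambda>x. c * \<phi> k x) x - c *\<^sub>R G x)) \<longlonglongrightarrow> 0"
    unfolding grad_scale[OF approxD(3)[OF a]] by (rule Lmod_tendsto_scaleR[OF approxD(2,7,5)[OF a]])
qed (use approxD(3)[OF a] in \<open>auto intro: test_functions_scale\<close>)

lemma approx_diff:
  assumes a: "approx q \<phi> u G" and b: "approx q \<psi> v H" and q: "q > 0"
  shows "approx q (\<lambda>k x. \<phi> k x - \<psi> k x) (\<lambda>x. u x - v x) (\<lambda>x. G x - H x)"
  using approx_add[OF a approx_scale[OF b, of "-1"] q] by simp

lemma approx_subseq:
  assumes a: "approx q \<phi> u G" and r: "strict_mono (r::nat\<Rightarrow>nat)"
  shows "approx q (\<lambda>k. \<phi> (r k)) u G"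
  using a LIMSEQ_subseq_LIMSEQ[OF approxD(4)[OF a] r] LIMSEQ_subseq_LIMSEQ[OF approxD(5)[OF a] r]
  unfolding approx_def o_def by auto

lemma approx_AE_subseq:
  assumes a: "approx q \<phi> u G" and q: "q > 0"
  shows "\<exists>\<psi>. approx q \<psi> u G \<and> (AE x in M. (\<lambda>k. \<psi> k x) \<longlonglongrightarrow> u x) \<and> (AE x in M. (\<lambda>k. grad (\<psi> k) x) \<longlonglongrightarrow> G x)"
proof -
  obtain r :: "nat \<Rightarrow> nat" where r: "strict_mono r" "AE x in M. (\<lambda>k. \<phi> (r k) x) \<longlonglongrightarrow> u x"
    using Lmod_tendsto_AE_subseq[OF approxD(1)[OF a] approxD(6)[OF a] q approxD(4)[OF a]] by blast
  note a1 = approx_subseq[OF a r(1)]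
  obtain s :: "nat \<Rightarrow> nat" where s: "strict_mono s" "AE x in M. (\<lambda>k. grad (\<phi> (r (s k))) x) \<longlonglongrightarrow> G x"
    using Lmod_tendsto_AE_subseq[OF approxD(2)[OF a1] approxD(7)[OF a1] q approxD(5)[OF a1]] by blast
  have "AE x in M. (\<lambda>k. \<phi> (r (s k)) x) \<longlonglongrightarrow> u x"
    using r(2) by eventually_elim (use LIMSEQ_subseq_LIMSEQ[OF _ s(1)] in \<open>force simp: o_def\<close>)
  with approx_subseq[OF a1 s(1)] s(2) show ?thesis by blast
qed

text \<open>In \<open>W1_norm\<close> of a difference the weak gradient is chosen anew; linearity relates it to the gradients of both terms.\<close>

lemma has_weak_gradient_diff_test:
  assumes u: "has_weak_gradient \<Omega> u G" and h: "h \<in> test_functions \<Omega>"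
  shows "has_weak_gradient \<Omega> (\<lambda>x. u x - h x) (\<lambda>x. G x - grad h x)"
proof -
  have hw: "has_weak_gradient \<Omega> h (grad h)" by (rule approx_has_weak_gradient[OF approx_const[OF h], of 1]) simp
  show ?thesis unfolding has_weak_gradient_def
  proof (intro conjI allI impI ballI; (elim conjE)?)
    fix K assume "compact K" "K \<subseteq> \<Omega>"
    then show "integrable (lebesgue_on K) (\<lambda>x. u x - h x)" "integrable (lebesgue_on K) (\<lambda>x. G x - grad h x)"
      using u hw unfolding has_weak_gradient_def by auto
  next
    fix \<phi> i assume \<phi>: "\<phi> \<in> test_functions \<Omega>"
    obtain K where K: "compact K" "K \<subseteq> \<Omega>" "\<And>x. x \<notin> K \<Longrightarrow> \<phi> x = 0" "\<And>x. x \<notin> K \<Longrightarrow> grad \<phi> x = 0"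
      using test_functions_C1c(2)[OF \<phi>] by blast
    obtain B where B: "\<And>x. \<bar>\<phi> x\<bar> \<le> B" "\<And>x. norm (grad \<phi> x) \<le> B" using C1c_bounded[OF test_functions_C1c(1)[OF \<phi>]] by blast
    note meas[measurable] = C1c_measurable[OF test_functions_C1c(1)[OF \<phi>]]
    have p: "partial i \<phi> x = grad \<phi> x $ i" for x by (simp add: grad_def)
    have i1: "integrable M (\<lambda>x. v x * (grad \<phi> x $ i))" if "has_weak_gradient \<Omega> v H" for v H
      by (rule integrable_test_function_product[OF _ K(1,2) _ _ _ open_domain])
         (use that K(4) B(2) meas in \<open>auto simp: has_weak_gradient_def intro: order_trans[OF component_le_norm_cart] borel_measurable_component\<close>)
    have i2: "integrable M (\<lambda>x. (H x $ i) * \<phi> x)" if "has_weak_gradient \<Omega> v H" for v H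
      by (rule integrable_test_function_product[OF _ K(1,2) _ _ B(1) open_domain])
         (use that K(3) in \<open>auto simp: has_weak_gradient_def intro!: integrable_bounded_linear[OF bounded_linear_vec_nth]\<close>)
    have e: "(\<integral>x. v x * (grad \<phi> x $ i) \<partial>M) = - (\<integral>x. (H x $ i) * \<phi> x \<partial>M)" if "has_weak_gradient \<Omega> v H" for v H
      using that \<phi> unfolding has_weak_gradient_def p[symmetric] by blast
    show "(\<integral>x. (u x - h x) * partial i \<phi> x \<partial>M) = - (\<integral>x. (G x - grad h x) $ i * \<phi> x \<partial>M)"
      unfolding p using i1[OF u] i1[OF hw] i2[OF u] i2[OF hw] e[OF u] e[OF hw] by (simp add: left_diff_distrib)
  qed
qed

lemma Lp_norm_weak_gradient:
  assumes a: "approx q \<phi> u G" and q: "q \<ge> 1"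
  shows "Lp_norm \<Omega> q (weak_gradient \<Omega> u) = Lp_norm \<Omega> q G"
  using Lmod_cong_AE[OF weak_gradient_approx_AE[OF a q], of q]
  by (simp add: Lp_norm_eq weak_gradient_measurable[OF approx_has_weak_gradient[OF a q] approxD(2)[OF a]] approxD(2)[OF a])

lemma approx_imp_W1_0:
  assumes a: "approx q \<phi> u G" and q: "q \<ge> 1"
  shows "u \<in> W1_0 \<Omega> q"
proof -
  have q0: "q > 0" using q by simp
  note fin = approx_Lmod_finite[OF a q0]
  have "u \<in> W1 \<Omega> q" unfolding W1_def
    using fin approxD(1,2)[OF a] approx_has_weak_gradient[OF a q] by (auto simp: Lp_iff)
  moreover have "\<exists>\<eta>\<in>test_functions \<Omega>. W1_norm \<Omega> q (\<lambda>x. u x - \<eta> x) < e" if e: "e > 0" for e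
  proof -
    have d: "approx q (\<lambda>j x. \<phi> j x - \<phi> k x) (\<lambda>x. u x - \<phi> k x) (\<lambda>x. G x - grad (\<phi> k) x)" for k
      by (rule approx_diff[OF a approx_const[OF approxD(3)[OF a]] q0])
    note n = Lp_norm_weak_gradient[OF d q]
    have 1: "(\<lambda>k. Lp_norm \<Omega> q (\<lambda>x. u x - \<phi> k x)) \<longlonglongrightarrow> 0"
      by (rule Lp_norm_tendsto_0[OF approxD(1)[OF d] _ q0]) (use approxD(4)[OF a] in \<open>simp add: Lmod_minus[of M q u]\<close>)
    have 2: "(\<lambda>k. Lp_norm \<Omega> q (\<lambda>x. G x - grad (\<phi> k) x)) \<longlonglongrightarrow> 0"
      by (rule Lp_norm_tendsto_0[OF approxD(2)[OF d] _ q0]) (use approxD(5)[OF a] in \<open>simp add: Lmod_minus[of M q G]\<close>)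
    have "(\<lambda>k. W1_norm \<Omega> q (\<lambda>x. u x - \<phi> k x)) \<longlonglongrightarrow> 0"
      unfolding W1_norm_def n using tendsto_add[OF 1 2] by simp
    then have "eventually (\<lambda>k. W1_norm \<Omega> q (\<lambda>x. u x - \<phi> k x) < e) sequentially" by (rule order_tendstoD) (use e in simp)
    then show ?thesis using approxD(3)[OF a] by (auto simp: eventually_sequentially)
  qed
  ultimately show ?thesis by (simp add: W1_0_def)
qed

lemma W1_0_imp_approx:
  assumes u: "u \<in> W1_0 \<Omega> q" and q: "q \<ge> 1"
  shows "\<exists>\<phi>. approx q \<phi> u (weak_gradient \<Omega> u)"
proof -
  have q0: "q > 0" using q by simp
  obtain G where G: "G \<in> Lp \<Omega> q" "has_weak_gradient \<Omega> u G" and uL: "u \<in> Lp \<Omega> q" using u by (auto simp: W1_0_def W1_def)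
  have "\<forall>k. \<exists>\<phi>\<in>test_functions \<Omega>. W1_norm \<Omega> q (\<lambda>x. u x - \<phi> x) < 1 / (real k + 1)"
    using u by (auto simp: W1_0_def)
  then obtain \<phi> where \<phi>: "\<And>k. \<phi> k \<in> test_functions \<Omega>" "\<And>k. W1_norm \<Omega> q (\<lambda>x. u x - \<phi> k x) < 1 / (real k + 1)" by metis
  note [measurable] = test_measurable[OF \<phi>(1)]
  have um[measurable]: "u \<in> borel_measurable M" "G \<in> borel_measurable M" and fin: "Lmod M q u < \<infinity>" "Lmod M q G < \<infinity>"
    using uL G by (auto simp: Lp_iff)
  have wm[measurable]: "weak_gradient \<Omega> u \<in> borel_measurable M" by (rule weak_gradient_measurable[OF G(2) um(2)])
  note wae = weak_gradient_AE[OF open_domain G(2)]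
  note wd = has_weak_gradient_diff_test[OF G(2) \<phi>(1)]
  have wdm: "weak_gradient \<Omega> (\<lambda>x. u x - \<phi> k x) \<in> borel_measurable M" for k
    by (rule weak_gradient_measurable[OF wd]) measurable
  have l: "Lmod M q (weak_gradient \<Omega> (\<lambda>x. u x - \<phi> k x)) = Lmod M q (\<lambda>x. G x - grad (\<phi> k) x)" for k
    by (rule Lmod_cong_AE[OF weak_gradient_AE[OF open_domain wd]])
  have l': "Lmod M q (\<lambda>x. grad (\<phi> k) x - weak_gradient \<Omega> u x) = Lmod M q (\<lambda>x. G x - grad (\<phi> k) x)" for k
    unfolding Lmod_minus[of M q "grad (\<phi> k)"] by (rule Lmod_cong_AE) (use wae in eventually_elim, simp)
  have lim0: "(\<lambda>k. Lmod M q (F k)) \<longlonglongrightarrow> 0"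
    if F: "\<And>k. F k \<in> borel_measurable M" "\<And>k. Lmod M q (F k) < \<infinity>" "\<And>k. Lp_norm \<Omega> q (F k) \<le> 1 / (real k + 1)" for F :: "nat \<Rightarrow> real^'n \<Rightarrow> 'b::euclidean_space"
  proof (rule tendsto_ennreal_0_squeeze)
    fix k
    have "(enn2real (Lmod M q (F k)) powr (1/q)) powr q \<le> (1 / (real k + 1)) powr q"
      using F(3)[of k] q0 by (intro powr_mono2) (auto simp: Lp_norm_eq[OF F(1)])
    then have "enn2real (Lmod M q (F k)) \<le> (1 / (real k + 1)) powr q" using q0 by (simp add: powr_powr)
    then show "Lmod M q (F k) \<le> ennreal ((1 / (real k + 1)) powr q)"
      using F(2)[of k] by (metis ennreal_enn2real ennreal_leI infinity_ennreal_def)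
  next
    have "(\<lambda>k. (1 / (real k + 1)) powr q) \<longlonglongrightarrow> 0 powr q" using q0 by (intro tendsto_powr2 tendsto_inverse_plus_1) auto
    then show "(\<lambda>k. ennreal ((1 / (real k + 1)) powr q)) \<longlonglongrightarrow> 0" by (intro tendsto_eq_rhs[OF tendsto_ennrealI]) auto
  qed
  have nn: "Lp_norm \<Omega> q (f :: real^'n \<Rightarrow> 'b::euclidean_space) \<ge> 0" for f by (simp add: Lp_norm_def)
  have b: "Lp_norm \<Omega> q (\<lambda>x. u x - \<phi> k x) \<le> 1 / (real k + 1)" "Lp_norm \<Omega> q (weak_gradient \<Omega> (\<lambda>x. u x - \<phi> k x)) \<le> 1 / (real k + 1)" for k
    using \<phi>(2)[of k] nn[of "\<lambda>x. u x - \<phi> k x"] nn[of "weak_gradient \<Omega> (\<lambda>x. u x - \<phi> k x)"] unfolding W1_norm_def by linarith+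
  have cf: "Lmod M q (\<phi> k) < \<infinity>" "Lmod M q (grad (\<phi> k)) < \<infinity>" for k
    using C1c_Lmod_finite[OF test_functions_C1c(1)[OF \<phi>(1)] q0] by auto
  have df: "Lmod M q (\<lambda>x. f x - g x) < \<infinity>" if "f \<in> borel_measurable M" "g \<in> borel_measurable M" "Lmod M q f < \<infinity>" "Lmod M q g < \<infinity>"
    for f g :: "real^'n \<Rightarrow> 'b::euclidean_space"
    by (rule le_less_trans[OF Lmod_diff[OF that(1,2) q0]]) (use that(3,4) in \<open>auto simp: ennreal_mult_less_top\<close>)
  have "(\<lambda>k. Lmod M q (\<lambda>x. u x - \<phi> k x)) \<longlonglongrightarrow> 0"
    by (rule lim0) (use b df[OF _ _ fin(1) cf(1)] in auto)
  moreover have "(\<lambda>k. Lmod M q (weak_gradient \<Omega> (\<lambda>x. u x - \<phi> k x))) \<longlonglongrightarrow> 0"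
    by (rule lim0) (use b wdm df[OF _ _ fin(2) cf(2)] in \<open>auto simp: l\<close>)
  ultimately have "approx q \<phi> u (weak_gradient \<Omega> u)"
    unfolding approx_def using \<phi>(1) um wm by (simp add: Lmod_minus[of M q u] l l')
  then show ?thesis by blast
qed

text \<open>A diagonal choice of test functions: \<open>W1_0\<close> is closed.\<close>

lemma approx_closed:
  assumes a: "\<And>j. approx q (\<phi> j) (v j) (H j)" and [measurable]: "U \<in> borel_measurable M" "G \<in> borel_measurable M" and q: "q > 0"
    and v: "(\<lambda>j. Lmod M q (\<lambda>x. v j x - U x)) \<longlonglongrightarrow> 0" and H: "(\<lambda>j. Lmod M q (\<lambda>x. H j x - G x)) \<longlonglongrightarrow> 0"
  shows "\<exists>\<psi>. approx q \<psi> U G"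
proof -
  have "\<exists>k. Lmod M q (\<lambda>x. \<phi> j k x - v j x) \<le> ennreal (1 / (real j + 1)) \<and> Lmod M q (\<lambda>x. grad (\<phi> j k) x - H j x) \<le> ennreal (1 / (real j + 1))" for j
  proof -
    have "eventually (\<lambda>k. Lmod M q (\<lambda>x. \<phi> j k x - v j x) \<le> ennreal (1 / (real j + 1))) sequentially"
      "eventually (\<lambda>k. Lmod M q (\<lambda>x. grad (\<phi> j k) x - H j x) \<le> ennreal (1 / (real j + 1))) sequentially"
      using approxD(4,5)[OF a[of j]] unfolding ennreal_tendsto_0_iff by auto
    from eventually_conj[OF this] show ?thesis by (auto simp: eventually_sequentially)
  qed
  then have "\<exists>k. \<forall>j. Lmod M q (\<lambda>x. \<phi> j (k j) x - v j x) \<le> ennreal (1 / (real j + 1)) \<and>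
      Lmod M q (\<lambda>x. grad (\<phi> j (k j)) x - H j x) \<le> ennreal (1 / (real j + 1))"
    by (intro choice allI)
  then obtain k where k: "\<And>j. Lmod M q (\<lambda>x. \<phi> j (k j) x - v j x) \<le> ennreal (1 / (real j + 1))"
     "\<And>j. Lmod M q (\<lambda>x. grad (\<phi> j (k j)) x - H j x) \<le> ennreal (1 / (real j + 1))" by blast
  note lim = tendsto_ennreal_inverse_plus_1
  have "(\<lambda>j. Lmod M q (\<lambda>x. \<phi> j (k j) x - U x)) \<longlonglongrightarrow> 0"
  proof (rule tendsto_ennreal_0_squeeze[OF _ tendsto_ennreal_0_add_cmult[OF lim v, of "2 powr q"]])
    show "Lmod M q (\<lambda>x. \<phi> j (k j) x - U x) \<le> ennreal (2 powr q) * (ennreal (1 / (real j + 1)) + Lmod M q (\<lambda>x. v j x - U x))" for j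
      by (rule order_trans[OF Lmod_triangle[of _ _ "v j"]]) (use approxD[OF a[of j]] q k in \<open>auto intro!: mult_left_mono add_right_mono\<close>)
  qed
  moreover have "(\<lambda>j. Lmod M q (\<lambda>x. grad (\<phi> j (k j)) x - G x)) \<longlonglongrightarrow> 0"
  proof (rule tendsto_ennreal_0_squeeze[OF _ tendsto_ennreal_0_add_cmult[OF lim H, of "2 powr q"]])
    show "Lmod M q (\<lambda>x. grad (\<phi> j (k j)) x - G x) \<le> ennreal (2 powr q) * (ennreal (1 / (real j + 1)) + Lmod M q (\<lambda>x. H j x - G x))" for j
      by (rule order_trans[OF Lmod_triangle[of _ _ "H j"]]) (use approxD[OF a[of j]] q k in \<open>auto intro!: mult_left_mono add_right_mono\<close>)
  qed
  ultimately have "approx q (\<lambda>j. \<phi> j (k j)) U G" unfolding approx_def using approxD(3)[OF a] by auto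
  then show ?thesis by blast
qed

end

context bounded_domain begin

section \<open>The duality pairing\<close>

lemma radon_diff:
  assumes f: "f \<in> radon_measures \<Omega>" and v: "continuous_on (closure \<Omega>) v" "continuous_on (closure \<Omega>) w"
  shows "f (\<lambda>x. v x - w x) = f v - f w"
proof -
  have "f (\<lambda>x. v x + (-1) * w x) = f v + f (\<lambda>x. (-1) * w x)"
    using f v unfolding radon_measures_def by (auto intro: continuous_on_minus)
  also have "f (\<lambda>x. (-1) * w x) = (-1) * f w" using f v unfolding radon_measures_def by blast
  finally show ?thesis by simp
qed

lemma radon_norm_bound:
  assumes f: "f \<in> radon_measures \<Omega>" and v: "continuous_on (closure \<Omega>) v" and B: "B > 0" "\<And>x. x \<in> closure \<Omega> \<Longrightarrow> \<bar>v x\<bar> \<le> B"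
  shows "\<bar>f v\<bar> \<le> radon_norm \<Omega> f * B"
proof -
  let ?S = "{\<bar>f v\<bar> | v. continuous_on (closure \<Omega>) v \<and> (\<forall>x\<in>closure \<Omega>. \<bar>v x\<bar> \<le> 1)}"
  obtain K where K: "\<And>v. continuous_on (closure \<Omega>) v \<Longrightarrow> \<forall>x\<in>closure \<Omega>. \<bar>v x\<bar> \<le> 1 \<Longrightarrow> \<bar>f v\<bar> \<le> K"
    using f unfolding radon_measures_def by blast
  have bdd: "bdd_above ?S" using K by (auto intro!: bdd_aboveI[of _ K])
  let ?w = "\<lambda>x. (1/B) * v x"
  have w: "continuous_on (closure \<Omega>) ?w" using v by (intro continuous_on_mult continuous_on_const)
  have "\<forall>x\<in>closure \<Omega>. \<bar>?w x\<bar> \<le> 1" using B by (auto simp: abs_mult)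
  then have "\<bar>f ?w\<bar> \<in> ?S" using w by blast
  then have "\<bar>f ?w\<bar> \<le> radon_norm \<Omega> f" unfolding radon_norm_def by (rule cSup_upper[OF _ bdd])
  moreover have "f ?w = (1/B) * f v" using f v unfolding radon_measures_def by blast
  ultimately have "\<bar>(1/B) * f v\<bar> \<le> radon_norm \<Omega> f" by simp
  then show ?thesis using B(1) by (simp add: abs_mult pos_divide_le_eq)
qed

lemma radon_norm_nonneg:
  assumes f: "f \<in> radon_measures \<Omega>" shows "radon_norm \<Omega> f \<ge> 0"
  using radon_norm_bound[OF f, of "\<lambda>x. 0" 1] by (auto intro: order_trans[OF abs_ge_zero])

text \<open>The set in \<open>\<Omega>\<close> where the functions differ is open and negligible, hence empty. So the continuous representative is
  determined on \<open>closure \<Omega>\<close>.\<close>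

lemma continuous_AE_unique:
  fixes v c :: "real^'n \<Rightarrow> real"
  assumes v: "continuous_on (closure \<Omega>) v" and c: "continuous_on (closure \<Omega>) c" and ae: "AE x in M. v x = c x"
    and x: "x \<in> closure \<Omega>"
  shows "v x = c x"
proof -
  let ?S = "{x \<in> \<Omega>. v x - c x \<noteq> 0}"
  have d: "continuous_on (closure \<Omega>) (\<lambda>x. v x - c x)" using v c by (intro continuous_on_diff)
  have "open ?S"
  proof -
    have "continuous_on \<Omega> (\<lambda>x. v x - c x)" by (rule continuous_on_subset[OF d closure_subset])
    then have "open (\<Omega> \<inter> (\<lambda>x. v x - c x) -` (- {0}))" using open_domain by (intro continuous_open_preimage) auto
    also have "\<Omega> \<inter> (\<lambda>x. v x - c x) -` (- {0}) = ?S" by auto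
    finally show ?thesis .
  qed
  moreover have "negligible ?S"
  proof -
    have "AE x in lebesgue. x \<notin> ?S" using ae by (simp add: AE_restrict_space_iff) 
    moreover have "?S \<in> sets lebesgue" using \<open>open ?S\<close> by auto
    ultimately show ?thesis unfolding negligible_iff_null_sets by (subst (asm) AE_iff_null_sets[symmetric]) auto
  qed
  ultimately have "?S = {}" using open_not_negligible by blast
  then have "v x - c x = 0"
    using continuous_constant_on_closure[OF d _ x, of 0] by auto
  then show ?thesis by simp
qed

lemma sup_bound_test:
  assumes N: "CARD('n) \<ge> 2" and r: "real CARD('n) < r"
  shows "\<exists>c\<ge>0. \<forall>\<phi>\<in>test_functions \<Omega>. \<forall>D\<ge>0. Lmod M r (grad \<phi>) \<le> ennreal D \<longrightarrow> (\<forall>x. \<bar>\<phi> x\<bar> \<le> c * D powr (1/r))"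
proof -
  obtain c where c: "c \<ge> 0" "\<And>(g::real^'n \<Rightarrow> real) G A D x. C1c g G \<Longrightarrow> A \<in> sets borel \<Longrightarrow> emeasure lborel A \<le> ennreal (measure lebesgue \<Omega>) \<Longrightarrow> D \<ge> 0 \<Longrightarrow>
     (\<forall>x. x \<notin> A \<longrightarrow> G x = 0) \<Longrightarrow>
     (\<integral>\<^sup>+y. ennreal (norm (G y) powr r) * indicator A y \<partial>lborel) \<le> ennreal D \<Longrightarrow> \<bar>g x\<bar> \<le> c * D powr (1 / r)"
    using sup_bound_supercritical[where 'a="real^'n", of r "measure lebesgue \<Omega>"] N r by auto
  show ?thesis
  proof (intro exI[of _ c] conjI ballI allI impI c(1))
    fix \<phi> D x assume \<phi>: "\<phi> \<in> test_functions \<Omega>" and D: "(D::real) \<ge> 0" and le: "Lmod M r (grad \<phi>) \<le> ennreal D"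
    note C = test_functions_C1c(1)[OF \<phi>]
    note [measurable] = C1c_measurable[OF C]
    have "(\<integral>\<^sup>+y. ennreal (norm (grad \<phi> y) powr r) * indicator \<Omega> y \<partial>lborel) \<le> ennreal D"
      using le unfolding Lmod_def by (subst (asm) nn_integral_domain) auto
    then show "\<bar>\<phi> x\<bar> \<le> c * D powr (1/r)"
      using c(2)[OF C, of \<Omega> D x] D emeasure_domain test_functions_outside[OF \<phi>] by auto
  qed
qed

text \<open>The bound of the supremum by the gradient turns convergence in \<open>W1_0 \<Omega> r\<close> into uniform convergence. So the duality
  pairing is the limit of the values of \<open>f\<close> at approximating test functions.\<close>

lemma continuous_representative:
  assumes N: "CARD('n) \<ge> 2" and r: "real CARD('n) < r" and a: "approx r \<phi> w G"
  shows "\<exists>c. continuous_on (closure \<Omega>) c \<and> (AE x in M. c x = w x) \<and> uniform_limit UNIV \<phi> c sequentially"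
proof -
  have r0: "r > 0" using r by (meson less_trans of_nat_0_less_iff zero_less_card_finite)
  obtain c where c: "c \<ge> 0" and sup: "\<And>\<phi> D x. \<phi> \<in> test_functions \<Omega> \<Longrightarrow> D \<ge> 0 \<Longrightarrow> Lmod M r (grad \<phi>) \<le> ennreal D \<Longrightarrow> \<bar>\<phi> x\<bar> \<le> c * D powr (1/r)"
    using sup_bound_test[OF N r] by blast
  have "uniformly_Cauchy_on UNIV \<phi>"
    unfolding uniformly_Cauchy_on_def
  proof (intro allI impI)
    fix e :: real assume e: "e > 0"
    \<comment> \<open>The value \<open>D\<close> makes the bound \<open>c * D powr (1/r)\<close> smaller than \<open>e\<close>, and \<open>2 powr r * (\<delta> + \<delta>) = D\<close>.\<close>
    define D where "D = (e / (2 * (c + 1))) powr r"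
    have D: "D > 0" using e c by (auto simp: D_def)
    have cD: "c * D powr (1/r) < e"
    proof -
      have "D powr (1/r) = e / (2 * (c + 1))" using e c r0 by (simp add: D_def powr_powr)
      then have "c * D powr (1/r) = e * (c / (2 * (c + 1)))" by simp
      also have "\<dots> < e * 1" using e c by (intro mult_strict_left_mono) (auto simp: field_simps)
      finally show ?thesis by simp
    qed
    define \<delta> where "\<delta> = D / (2 * 2 powr r)"
    have \<delta>: "\<delta> > 0" using D by (simp add: \<delta>_def)
    obtain K where K: "\<And>k. k \<ge> K \<Longrightarrow> Lmod M r (\<lambda>x. grad (\<phi> k) x - G x) \<le> ennreal \<delta>"
      using approxD(5)[OF a] \<delta> unfolding ennreal_tendsto_0_iff eventually_sequentially by blast
    show "\<exists>M. \<forall>x\<in>UNIV. \<forall>m\<ge>M. \<forall>n\<ge>M. dist (\<phi> m x) (\<phi> n x) < e"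
    proof (intro exI[of _ K] ballI allI impI)
      fix x m n assume mn: "K \<le> m" "K \<le> n"
      have d: "approx r (\<lambda>k x. \<phi> m x - \<phi> n x) (\<lambda>x. \<phi> m x - \<phi> n x) (\<lambda>x. grad (\<phi> m) x - grad (\<phi> n) x)"
        by (rule approx_diff[OF approx_const[OF approxD(3)[OF a]] approx_const[OF approxD(3)[OF a]] r0])
      have g: "grad (\<lambda>x. \<phi> m x - \<phi> n x) x = grad (\<phi> m) x - grad (\<phi> n) x" for x
        using grad_add[OF approxD(3)[OF a, of m] test_functions_scale[OF approxD(3)[OF a, of n], of "-1"], of x]
        by (simp add: grad_scale[OF approxD(3)[OF a, of n], of "-1", simplified])
      have "Lmod M r (\<lambda>x. grad (\<phi> m) x - grad (\<phi> n) x) \<le> ennreal (2 powr r) * (Lmod M r (\<lambda>x. grad (\<phi> m) x - G x) + Lmod M r (\<lambda>x. G x - grad (\<phi> n) x))"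
        by (rule Lmod_triangle) (use approxD[OF a] r0 in auto)
      also have "\<dots> \<le> ennreal (2 powr r) * (ennreal \<delta> + ennreal \<delta>)"
        using K[OF mn(1)] K[OF mn(2)] by (intro mult_left_mono add_mono) (auto simp: Lmod_minus[of M r G])
      also have "\<dots> = ennreal D" using \<delta> D by (simp add: ennreal_plus[symmetric] ennreal_mult'[symmetric] \<delta>_def del: ennreal_plus)
      finally have "Lmod M r (grad (\<lambda>x. \<phi> m x - \<phi> n x)) \<le> ennreal D" unfolding Lmod_def g .
      from sup[OF approxD(3)[OF d] less_imp_le[OF D] this, of x] cD
      show "dist (\<phi> m x) (\<phi> n x) < e" by (simp add: dist_real_def)
    qed
  qed
  then have "uniformly_convergent_on UNIV \<phi>" by (rule Cauchy_uniformly_convergent)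
  then obtain c where u: "uniform_limit UNIV \<phi> c sequentially" by (auto simp: uniformly_convergent_on_def)
  have "continuous_on UNIV c"
    by (intro uniform_limit_theorem[OF _ u] always_eventually allI C1c_continuous(1)[OF approxD(8)[OF a]]) simp
  moreover have "AE x in M. c x = w x"
  proof -
    obtain s :: "nat \<Rightarrow> nat" where s: "strict_mono s" "AE x in M. (\<lambda>k. \<phi> (s k) x) \<longlonglongrightarrow> w x"
      using Lmod_tendsto_AE_subseq[OF approxD(1)[OF a] approxD(6)[OF a] r0 approxD(4)[OF a]] by blast
    have "(\<lambda>k. \<phi> (s k) x) \<longlonglongrightarrow> c x" for x
      using LIMSEQ_subseq_LIMSEQ[OF tendsto_uniform_limitI[OF u, of x] s(1)] by (simp add: o_def)
    then show ?thesis using s(2) by (auto elim!: eventually_mono intro: LIMSEQ_unique)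
  qed
  ultimately show ?thesis using u continuous_on_subset by blast
qed

lemma pairing_limit:
  assumes N: "CARD('n) \<ge> 2" and r: "real CARD('n) < r" and a: "approx r \<phi> w G" and f: "f \<in> radon_measures \<Omega>"
  shows "(\<lambda>k. f (\<phi> k)) \<longlonglongrightarrow> pairing \<Omega> f w"
proof -
  obtain c where c: "continuous_on (closure \<Omega>) c" "AE x in M. c x = w x" "uniform_limit UNIV \<phi> c sequentially"
    using continuous_representative[OF N r a] by blast
  define v where "v = continuous_rep \<Omega> w"
  have v: "continuous_on (closure \<Omega>) v \<and> (AE x in M. v x = w x)"
    unfolding v_def continuous_rep_def by (rule someI[of _ c]) (use c in auto)
  have vc: "v x = c x" if "x \<in> closure \<Omega>" for x
  proof (rule continuous_AE_unique[OF _ c(1) _ that])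
    show "AE x in M. v x = c x" using v c(2) by (auto elim: eventually_elim2)
  qed (use v in auto)
  note cont = C1c_continuous(1)[OF approxD(8)[OF a], of "closure \<Omega>"]
  show ?thesis unfolding pairing_def v_def[symmetric]
  proof (rule LIMSEQ_I)
    fix e :: real assume e: "e > 0"
    define B where "B = e / (2 * (radon_norm \<Omega> f + 1))"
    have rn: "radon_norm \<Omega> f \<ge> 0" by (rule radon_norm_nonneg[OF f])
    have B: "B > 0" using e rn by (auto simp: B_def)
    have "eventually (\<lambda>k. \<forall>x\<in>UNIV. dist (\<phi> k x) (c x) < B) sequentially" using uniform_limitD[OF c(3) B] .
    then obtain K where K: "\<And>k x. k \<ge> K \<Longrightarrow> \<bar>\<phi> k x - c x\<bar> < B" by (auto simp: eventually_sequentially dist_real_def)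
    show "\<exists>K. \<forall>k\<ge>K. norm (f (\<phi> k) - f v) < e"
    proof (intro exI[of _ K] allI impI)
      fix k assume k: "K \<le> k"
      have vv: "continuous_on (closure \<Omega>) v" using v by blast
      have "\<bar>f (\<lambda>x. \<phi> k x - v x)\<bar> \<le> radon_norm \<Omega> f * B"
        by (rule radon_norm_bound[OF f _ B]) (use cont vv vc K[OF k] in \<open>auto intro!: continuous_on_diff less_imp_le\<close>)
      also have "\<dots> < e"
      proof -
        have "radon_norm \<Omega> f * B = e * (radon_norm \<Omega> f / (2 * (radon_norm \<Omega> f + 1)))" by (simp add: B_def)
        also have "\<dots> < e * 1" using e rn by (intro mult_strict_left_mono) (auto simp: field_simps)
        finally show ?thesis by simp
      qed
      finally show "norm (f (\<phi> k) - f v) < e" by (simp add: radon_diff[OF f cont vv])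
    qed
  qed
qed

lemma pairing_test:
  assumes N: "CARD('n) \<ge> 2" and \<phi>: "\<phi> \<in> test_functions \<Omega>" and f: "f \<in> radon_measures \<Omega>"
  shows "pairing \<Omega> f \<phi> = f \<phi>"
  using pairing_limit[OF N _ approx_const[OF \<phi>, of "real CARD('n) + 1"] f] by (simp add: LIMSEQ_const_iff)

section \<open>Compactness\<close>

text \<open>The compact embedding of \<open>W\<^sup>1\<^sup>,\<^sup>1\<close> into \<open>L\<^sup>1\<close>. Averages over balls of a fixed radius \<open>h\<close> are equibounded and equi-Lipschitz,
  because translating a function by \<open>z\<close> moves it in \<open>L\<^sup>1\<close> by at most \<open>\<bar>z\<bar>\<close> times the norm of its gradient; so the theorem
  of Arzela and Ascoli applies to them. For the same reason the averages differ from the function by at most \<open>h\<close>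
  times the norm of the gradient.\<close>

definition ball_average :: "real \<Rightarrow> (real^'n \<Rightarrow> real) \<Rightarrow> real^'n \<Rightarrow> real" where
  "ball_average h g x = (\<integral>z. indicator (ball 0 h) z * g (x + z) \<partial>lborel) / measure lborel (ball (0::real^'n) h)"

lemma ball_measure_pos: "h > 0 \<Longrightarrow> measure lborel (ball (0::real^'n) h) > 0"
  by (simp add: content_ball_pos)

lemma C1c_shift_integrable:
  assumes C: "C1c g G"
  shows "integrable lborel (\<lambda>z. indicator (ball (0::real^'n) h) z * g (x + z))"
proof (rule Bochner_Integration.integrable_bound)
  note [measurable] = C1c_measurable[OF C]
  have "integrable (distr lborel borel ((+) x)) g" using C1c_integrable[OF C] by (simp add: lborel_distr_plus)
  then show "integrable lborel (\<lambda>z. g (x + z))" by (subst (asm) integrable_distr_eq) auto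
  show "(\<lambda>z. indicator (ball (0::real^'n) h) z * g (x + z)) \<in> borel_measurable lborel" by measurable
  show "AE z in lborel. norm (indicator (ball (0::real^'n) h) z * g (x + z)) \<le> norm (g (x + z))"
    by (intro AE_I2) (auto simp: indicator_def)
qed

lemma C1c_translation':
  assumes C: "C1c g G" and D: "(\<integral>\<^sup>+x. ennreal (norm (G x)) \<partial>lborel) \<le> ennreal D" "D \<ge> 0"
  shows "(\<integral>\<^sup>+z. ennreal \<bar>g (x + z) - g (y + z)\<bar> \<partial>lborel) \<le> ennreal (norm (x - y) * D)"
proof -
  note [measurable] = C1c_measurable[OF C]
  have "(\<integral>\<^sup>+z. ennreal \<bar>g (x + z) - g (y + z)\<bar> \<partial>lborel) = (\<integral>\<^sup>+z. ennreal \<bar>g ((z + y) + (x - y)) - g (z + y)\<bar> \<partial>lborel)"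
    by (simp add: algebra_simps)
  also have "\<dots> = (\<integral>\<^sup>+z. ennreal \<bar>g (z + (x - y)) - g z\<bar> \<partial>lborel)"
    by (rule nn_integral_lborel_shift) measurable
  also have "\<dots> \<le> ennreal (norm (x - y)) * (\<integral>\<^sup>+x. ennreal (norm (G x)) \<partial>lborel)" by (rule C1c_translation[OF C])
  also have "\<dots> \<le> ennreal (norm (x - y)) * ennreal D" using D by (intro mult_left_mono) auto
  finally show ?thesis using D by (simp add: ennreal_mult')
qed

lemma ball_average_Lipschitz:
  assumes C: "C1c g G" and D: "(\<integral>\<^sup>+x. ennreal (norm (G x)) \<partial>lborel) \<le> ennreal D" "D \<ge> 0" and h: "h > 0"
  shows "\<bar>ball_average h g x - ball_average h g y\<bar> \<le> norm (x - y) * D / measure lborel (ball (0::real^'n) h)"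
proof -
  let ?V = "measure lborel (ball (0::real^'n) h)"
  have V: "?V > 0" by (rule ball_measure_pos[OF h])
  note i = C1c_shift_integrable[OF C, of h]
  have "ball_average h g x - ball_average h g y = (\<integral>z. indicator (ball 0 h) z * g (x + z) - indicator (ball 0 h) z * g (y + z) \<partial>lborel) / ?V"
    using i by (simp add: ball_average_def diff_divide_distrib)
  moreover have "ennreal \<bar>\<integral>z. indicator (ball 0 h) z * g (x + z) - indicator (ball 0 h) z * g (y + z) \<partial>lborel\<bar> \<le> ennreal (norm (x - y) * D)"
  proof -
    have "ennreal \<bar>\<integral>z. indicator (ball 0 h) z * g (x + z) - indicator (ball 0 h) z * g (y + z) \<partial>lborel\<bar>
      \<le> (\<integral>\<^sup>+z. ennreal (norm (indicator (ball 0 h) z * g (x + z) - indicator (ball 0 h) z * g (y + z))) \<partial>lborel)"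
      using integral_norm_bound_ennreal[OF Bochner_Integration.integrable_diff[OF i[of x] i[of y]]] by simp
    also have "\<dots> \<le> (\<integral>\<^sup>+z. ennreal \<bar>g (x + z) - g (y + z)\<bar> \<partial>lborel)"
      by (intro nn_integral_mono ennreal_leI) (auto simp: indicator_def)
    also have "\<dots> \<le> ennreal (norm (x - y) * D)" by (rule C1c_translation'[OF C D])
    finally show ?thesis .
  qed
  then have "\<bar>\<integral>z. indicator (ball 0 h) z * g (x + z) - indicator (ball 0 h) z * g (y + z) \<partial>lborel\<bar> \<le> norm (x - y) * D"
    using D by (subst (asm) ennreal_le_iff) auto
  ultimately show ?thesis using V by (simp add: divide_right_mono)
qed

lemma ball_average_close:
  assumes C: "C1c g G" and D: "(\<integral>\<^sup>+x. ennreal (norm (G x)) \<partial>lborel) \<le> ennreal D" "D \<ge> 0" and h: "h > 0"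
  shows "(\<integral>\<^sup>+x. ennreal \<bar>ball_average h g x - g x\<bar> \<partial>lborel) \<le> ennreal (h * D)"
proof -
  note [measurable] = C1c_measurable[OF C]
  let ?B = "ball (0::real^'n) h" and ?V = "measure lborel (ball (0::real^'n) h)"
  have V: "?V > 0" by (rule ball_measure_pos[OF h])
  have Ve: "emeasure lborel ?B = ennreal ?V"
    using emeasure_bounded_finite[of ?B] by (simp add: emeasure_eq_ennreal_measure)
  have ic: "integrable lborel (\<lambda>z. indicator ?B z * g x)" for x
    using Ve by (intro integrable_mult_left integrable_real_indicator) auto
  have pt: "ennreal \<bar>ball_average h g x - g x\<bar> \<le> ennreal (1 / ?V) * (\<integral>\<^sup>+z. ennreal \<bar>g (x + z) - g x\<bar> * indicator ?B z \<partial>lborel)" for x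
  proof -
    have "(\<integral>z. indicator ?B z * g x \<partial>lborel) = ?V * g x" by simp
    then have "ball_average h g x - g x = (\<integral>z. indicator ?B z * g (x + z) - indicator ?B z * g x \<partial>lborel) / ?V"
      using C1c_shift_integrable[OF C, of h x] ic[of x] V by (simp add: ball_average_def field_simps)
    then have "ennreal \<bar>ball_average h g x - g x\<bar> = ennreal (1/?V) * ennreal \<bar>\<integral>z. indicator ?B z * g (x + z) - indicator ?B z * g x \<partial>lborel\<bar>"
      using V by (simp add: ennreal_mult'[symmetric])
    also have "\<dots> \<le> ennreal (1/?V) * (\<integral>\<^sup>+z. ennreal (norm (indicator ?B z * g (x + z) - indicator ?B z * g x)) \<partial>lborel)"
      using integral_norm_bound_ennreal[OF Bochner_Integration.integrable_diff[OF C1c_shift_integrable[OF C, of h x] ic[of x]]]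
      by (intro mult_left_mono) auto
    also have "(\<lambda>z. ennreal (norm (indicator ?B z * g (x + z) - indicator ?B z * g x))) = (\<lambda>z. ennreal \<bar>g (x + z) - g x\<bar> * indicator ?B z)"
      by (auto simp: indicator_def fun_eq_iff)
    finally show ?thesis .
  qed
  have "(\<integral>\<^sup>+x. ennreal \<bar>ball_average h g x - g x\<bar> \<partial>lborel) \<le> (\<integral>\<^sup>+x. ennreal (1 / ?V) * (\<integral>\<^sup>+z. ennreal \<bar>g (x + z) - g x\<bar> * indicator ?B z \<partial>lborel) \<partial>lborel)"
    by (rule nn_integral_mono) (rule pt)
  also have "\<dots> = ennreal (1 / ?V) * (\<integral>\<^sup>+x. (\<integral>\<^sup>+z. ennreal \<bar>g (x + z) - g x\<bar> * indicator ?B z \<partial>lborel) \<partial>lborel)"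
    by (rule nn_integral_cmult) measurable
  also have "(\<integral>\<^sup>+x. (\<integral>\<^sup>+z. ennreal \<bar>g (x + z) - g x\<bar> * indicator ?B z \<partial>lborel) \<partial>lborel)
     = (\<integral>\<^sup>+z. (\<integral>\<^sup>+x. ennreal \<bar>g (x + z) - g x\<bar> * indicator ?B z \<partial>lborel) \<partial>lborel)"
    by (rule lborel_pair.Fubini'[symmetric]) measurable
  also have "\<dots> \<le> (\<integral>\<^sup>+z. ennreal (h * D) * indicator ?B z \<partial>lborel)"
  proof (rule nn_integral_mono)
    fix z
    have "(\<integral>\<^sup>+x. ennreal \<bar>g (x + z) - g x\<bar> \<partial>lborel) \<le> ennreal (h * D)" if "z \<in> ?B"
    proof -
      have "(\<integral>\<^sup>+x. ennreal \<bar>g (x + z) - g x\<bar> \<partial>lborel) \<le> ennreal (norm z * D)"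
        using C1c_translation'[OF C D, of z 0] by (simp add: add.commute)
      also have "\<dots> \<le> ennreal (h * D)" using that D by (intro ennreal_leI mult_right_mono) auto
      finally show ?thesis .
    qed
    then show "(\<integral>\<^sup>+x. ennreal \<bar>g (x + z) - g x\<bar> * indicator ?B z \<partial>lborel) \<le> ennreal (h * D) * indicator ?B z"
      by (cases "z \<in> ?B") auto
  qed
  also have "\<dots> = ennreal (h * D) * ennreal ?V" by (simp add: nn_integral_cmult_indicator Ve)
  finally have "(\<integral>\<^sup>+x. ennreal \<bar>ball_average h g x - g x\<bar> \<partial>lborel) \<le> ennreal (1 / ?V) * (ennreal (h * D) * ennreal ?V)"
    by (simp add: mult_left_mono)
  also have "\<dots> = ennreal (h * D)" using V h D by (simp add: ennreal_mult'[symmetric])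
  finally show ?thesis .
qed

text \<open>A translation by the diameter of the domain moves the support off itself.\<close>

lemma Poincare_L1:
  shows "\<exists>R>0. \<forall>\<phi>\<in>test_functions \<Omega>. \<forall>D\<ge>0. (\<integral>\<^sup>+x. ennreal (norm (grad \<phi> x)) \<partial>lborel) \<le> ennreal D \<longrightarrow>
     (\<integral>\<^sup>+x. ennreal \<bar>\<phi> x\<bar> \<partial>lborel) \<le> ennreal (R * D)"
proof -
  obtain R where R: "R > 0" "\<And>x. x \<in> \<Omega> \<Longrightarrow> norm x < R" using bounded_domain by (auto simp: bounded_pos_less)
  obtain e :: "real^'n" where e: "norm e = 2 * R" using R vector_choose_size[of "2*R"] by auto
  show ?thesis
  proof (intro exI[of _ "2 * R"] conjI ballI allI impI)
    fix \<phi> D assume \<phi>: "\<phi> \<in> test_functions \<Omega>" and D: "(D::real) \<ge> 0" "(\<integral>\<^sup>+x. ennreal (norm (grad \<phi> x)) \<partial>lborel) \<le> ennreal D"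
    have "ennreal \<bar>\<phi> x\<bar> \<le> ennreal \<bar>\<phi> (e + x) - \<phi> (0 + x)\<bar>" for x
    proof (cases "x \<in> \<Omega>")
      case True
      then have "norm (e + x) \<ge> R" using R(2)[of x] norm_diff_ineq[of e x] e by linarith
      then have "e + x \<notin> \<Omega>" using R(2) by force
      then show ?thesis using test_functions_outside[OF \<phi>] by simp
    qed (use test_functions_outside[OF \<phi>] in simp)
    then have "(\<integral>\<^sup>+x. ennreal \<bar>\<phi> x\<bar> \<partial>lborel) \<le> (\<integral>\<^sup>+x. ennreal \<bar>\<phi> (e + x) - \<phi> (0 + x)\<bar> \<partial>lborel)"
      by (rule nn_integral_mono)
    also have "\<dots> \<le> ennreal (norm (e - 0) * D)" by (rule C1c_translation'[OF test_functions_C1c(1)[OF \<phi>] D(2,1)])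
    finally show "(\<integral>\<^sup>+x. ennreal \<bar>\<phi> x\<bar> \<partial>lborel) \<le> ennreal (2 * R * D)" by (simp add: e)
  qed (use R in auto)
qed

theorem Rellich_L1:
  assumes \<phi>: "\<And>n. \<phi> n \<in> test_functions \<Omega>" and D: "\<And>n. Lmod M 1 (grad (\<phi> n)) \<le> ennreal D" "D \<ge> 0"
  shows "\<exists>r U. strict_mono (r::nat\<Rightarrow>nat) \<and> U \<in> borel_measurable M \<and> (\<lambda>k. Lmod M 1 (\<lambda>x. \<phi> (r k) x - U x)) \<longlonglongrightarrow> 0"
proof -
  note C = test_functions_C1c(1)[OF \<phi>]
  note meas[measurable] = C1c_measurable[OF C]
  have D': "(\<integral>\<^sup>+x. ennreal (norm (grad (\<phi> n) x)) \<partial>lborel) \<le> ennreal D" for n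
  proof -
    have "(\<integral>\<^sup>+x. ennreal (norm (grad (\<phi> n) x)) \<partial>lborel) = (\<integral>\<^sup>+x. ennreal (norm (grad (\<phi> n) x)) * indicator \<Omega> x \<partial>lborel)"
      using test_functions_outside[OF \<phi>] by (intro nn_integral_cong) (auto simp: indicator_def)
    also have "\<dots> = Lmod M 1 (grad (\<phi> n))" unfolding Lmod_def by (simp add: nn_integral_domain)
    finally show ?thesis using D by simp
  qed
  obtain R where R: "R > 0" "\<And>n. (\<integral>\<^sup>+x. ennreal \<bar>\<phi> n x\<bar> \<partial>lborel) \<le> ennreal (R * D)"
    using Poincare_L1 \<phi> D' D(2) by blast
  define h where "h j = 1 / (real j + 1)" for j
  have h: "h j > 0" for j by (simp add: h_def)
  let ?V = "\<lambda>j. measure lborel (ball (0::real^'n) (h j))"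
  have V: "?V j > 0" for j by (rule ball_measure_pos[OF h])
  define P where "P j s \<longleftrightarrow> (\<forall>e>0. \<exists>K. \<forall>m\<ge>K. \<forall>n\<ge>K. \<forall>x\<in>\<Omega>. \<bar>ball_average (h j) (\<phi> (s m)) x - ball_average (h j) (\<phi> (s n)) x\<bar> \<le> e)" for j :: nat and s :: "nat \<Rightarrow> nat"
  \<comment> \<open>A diagonal sequence makes the averages over the balls of every radius \<open>h j\<close> uniformly Cauchy.\<close>
  interpret subseqs P
  proof
    fix j and s :: "nat \<Rightarrow> nat" assume s: "strict_mono s"
    let ?F = "\<lambda>n. ball_average (h j) (\<phi> (s n))"
    have lip: "norm (?F n x - ?F n y) \<le> norm (x - y) * (D / ?V j)" for n x y
      using ball_average_Lipschitz[OF C D' D(2) h, of j "s n" x y] by simp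
    have bd: "norm (?F n x) \<le> R * D / ?V j" for n x
    proof -
      have "ennreal \<bar>\<integral>z. indicator (ball 0 (h j)) z * \<phi> (s n) (x + z) \<partial>lborel\<bar> \<le> (\<integral>\<^sup>+z. ennreal (norm (indicator (ball 0 (h j)) z * \<phi> (s n) (x + z))) \<partial>lborel)"
        using integral_norm_bound_ennreal[OF C1c_shift_integrable[OF C]] by simp
      also have "\<dots> \<le> (\<integral>\<^sup>+z. ennreal \<bar>\<phi> (s n) (z + x)\<bar> \<partial>lborel)"
        by (intro nn_integral_mono ennreal_leI) (auto simp: indicator_def add.commute)
      also have "\<dots> = (\<integral>\<^sup>+z. ennreal \<bar>\<phi> (s n) z\<bar> \<partial>lborel)" by (rule nn_integral_lborel_shift) measurable
      also have "\<dots> \<le> ennreal (R * D)" by (rule R)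
      finally have "\<bar>\<integral>z. indicator (ball 0 (h j)) z * \<phi> (s n) (x + z) \<partial>lborel\<bar> \<le> R * D"
        using R(1) D(2) by (subst (asm) ennreal_le_iff) auto
      then show ?thesis using V[of j] by (simp add: ball_average_def divide_right_mono)
    qed
    obtain g k where gk: "strict_mono (k :: nat \<Rightarrow> nat)" "\<And>e. 0 < e \<Longrightarrow> \<exists>N. \<forall>n x. n \<ge> N \<and> x \<in> closure \<Omega> \<longrightarrow> norm (?F (k n) x - g x) < e"
    proof (rule Arzela_Ascoli[of "closure \<Omega>" ?F "R * D / ?V j"])
      show "compact (closure \<Omega>)" using bounded_domain by (simp add: compact_closure)
      fix x e assume "0 < (e::real)"
      define d where "d = e / (D / ?V j + 1)"
      have DV: "D / ?V j \<ge> 0" using D V[of j] by (simp add: less_imp_le)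
      show "\<exists>d>0. \<forall>n y. y \<in> closure \<Omega> \<and> norm (x - y) < d \<longrightarrow> norm (?F n x - ?F n y) < e"
      proof (intro exI[of _ d] conjI allI impI)
        show "d > 0" using \<open>0 < e\<close> DV by (simp add: d_def add_nonneg_pos)
        fix n y assume "y \<in> closure \<Omega> \<and> norm (x - y) < d"
        then have "norm (x - y) * (D / ?V j) \<le> d * (D / ?V j)" using DV by (intro mult_right_mono) auto
        also have "\<dots> < d * (D / ?V j + 1)" using \<open>d > 0\<close> by (intro mult_strict_left_mono) auto
        also have "\<dots> = e" using DV by (simp add: d_def)
        finally show "norm (?F n x - ?F n y) < e" using lip[of n x y] by linarith
      qed
    qed (use bd in auto)
    have "P j (s \<circ> k)" unfolding P_def
    proof (intro allI impI)
      fix e :: real assume "e > 0"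
      then obtain N where N: "\<And>n x. n \<ge> N \<Longrightarrow> x \<in> closure \<Omega> \<Longrightarrow> norm (?F (k n) x - g x) < e / 2" using gk(2)[of "e/2"] by auto
      show "\<exists>K. \<forall>m\<ge>K. \<forall>n\<ge>K. \<forall>x\<in>\<Omega>. \<bar>ball_average (h j) (\<phi> ((s \<circ> k) m)) x - ball_average (h j) (\<phi> ((s \<circ> k) n)) x\<bar> \<le> e"
      proof (intro exI[of _ N] allI impI ballI)
        fix m n x assume "N \<le> m" "N \<le> n" "x \<in> \<Omega>"
        then have "\<bar>?F (k m) x - g x\<bar> < e / 2" "\<bar>?F (k n) x - g x\<bar> < e / 2"
          using N closure_subset[of \<Omega>] by (auto simp flip: real_norm_def)
        then show "\<bar>ball_average (h j) (\<phi> ((s \<circ> k) m)) x - ball_average (h j) (\<phi> ((s \<circ> k) n)) x\<bar> \<le> e"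
          unfolding o_def by linarith
      qed
    qed
    then show "\<exists>r'. strict_mono r' \<and> P j (s \<circ> r')" using gk(1) by blast
  qed
  define r where "r = diagseq"
  have r: "strict_mono r" unfolding r_def by (rule subseq_diagseq)
  have Pr: "P j r" for j
  proof -
    have "P j (diagseq \<circ> ((+) (Suc j)))"
    proof (rule diagseq_holds)
      fix r s :: "nat \<Rightarrow> nat" and n assume r: "strict_mono r" and P: "P n s"
      show "P n (s \<circ> r)" unfolding P_def
      proof (intro allI impI)
        fix e :: real assume "e > 0"
        then obtain K where K: "\<forall>m\<ge>K. \<forall>l\<ge>K. \<forall>x\<in>\<Omega>. \<bar>ball_average (h n) (\<phi> (s m)) x - ball_average (h n) (\<phi> (s l)) x\<bar> \<le> e"
          using P unfolding P_def by blast
        have "K \<le> r m" if "K \<le> m" for m using seq_suble[OF r, of m] that by linarith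
        with K show "\<exists>K. \<forall>m\<ge>K. \<forall>l\<ge>K. \<forall>x\<in>\<Omega>. \<bar>ball_average (h n) (\<phi> ((s \<circ> r) m)) x - ball_average (h n) (\<phi> ((s \<circ> r) l)) x\<bar> \<le> e"
          by (intro exI[of _ K]) auto
      qed
    qed
    show ?thesis unfolding P_def
    proof (intro allI impI)
      fix e :: real assume "e > 0"
      then obtain K where K: "\<And>m n x. m \<ge> K \<Longrightarrow> n \<ge> K \<Longrightarrow> x \<in> \<Omega> \<Longrightarrow>
          \<bar>ball_average (h j) (\<phi> (diagseq (Suc j + m))) x - ball_average (h j) (\<phi> (diagseq (Suc j + n))) x\<bar> \<le> e"
        using \<open>P j (diagseq \<circ> ((+) (Suc j)))\<close> unfolding P_def by fastforce
      show "\<exists>K. \<forall>m\<ge>K. \<forall>n\<ge>K. \<forall>x\<in>\<Omega>. \<bar>ball_average (h j) (\<phi> (r m)) x - ball_average (h j) (\<phi> (r n)) x\<bar> \<le> e"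
      proof (intro exI[of _ "Suc j + K"] allI impI ballI)
        fix m n x assume mn: "Suc j + K \<le> m" "Suc j + K \<le> n" "x \<in> \<Omega>"
        then show "\<bar>ball_average (h j) (\<phi> (r m)) x - ball_average (h j) (\<phi> (r n)) x\<bar> \<le> e"
          using K[of "m - Suc j" "n - Suc j" x] unfolding r_def by simp
      qed
    qed
  qed
  have Am: "ball_average (h j) (\<phi> n) \<in> borel_measurable borel" for j n
  proof -
    have "(D / ?V j)-lipschitz_on UNIV (ball_average (h j) (\<phi> n))"
      using ball_average_Lipschitz[OF C D' D(2) h, of j n] D(2) V[of j]
      by (intro lipschitz_onI) (auto simp: dist_norm mult.commute)
    then show ?thesis by (intro borel_measurable_continuous_onI lipschitz_on_continuous_on)
  qed
  note mm = Am[THEN borel_measurable_domain] meas(1)[THEN borel_measurable_domain]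
  have close: "Lmod M 1 (\<lambda>x. \<phi> n x - ball_average (h j) (\<phi> n) x) \<le> ennreal (h j * D)" for j n
  proof -
    have "Lmod M 1 (\<lambda>x. \<phi> n x - ball_average (h j) (\<phi> n) x) = (\<integral>\<^sup>+x. ennreal \<bar>ball_average (h j) (\<phi> n) x - \<phi> n x\<bar> * indicator \<Omega> x \<partial>lborel)"
      unfolding Lmod_minus[of M 1 "\<phi> n"] using Am[of j n] by (simp add: Lmod_def nn_integral_domain)
    also have "\<dots> \<le> (\<integral>\<^sup>+x. ennreal \<bar>ball_average (h j) (\<phi> n) x - \<phi> n x\<bar> \<partial>lborel)"
      by (intro nn_integral_mono) (auto simp: indicator_def)
    also have "\<dots> \<le> ennreal (h j * D)" by (rule ball_average_close[OF C D' D(2) h])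
    finally show ?thesis .
  qed
  let ?m = "measure lebesgue \<Omega>"
  have "\<exists>K. \<forall>m\<ge>K. \<forall>n\<ge>K. Lmod M 1 (\<lambda>x. \<phi> (r m) x - \<phi> (r n) x) \<le> ennreal e" if e: "e > 0" for e
  proof -
    \<comment> \<open>Compare \<open>\<phi> (r m)\<close> and \<open>\<phi> (r n)\<close> with their averages; the two uses of \<open>Lmod_triangle\<close> account for \<open>6 = 2 + 4\<close> and \<open>4\<close>.\<close>
    obtain j where j: "h j * (6 * D) < e / 2"
    proof -
      have "(\<lambda>j. h j * (6 * D)) \<longlonglongrightarrow> 0 * (6 * D)" unfolding h_def
        by (intro tendsto_mult tendsto_const tendsto_inverse_plus_1)
      then have "eventually (\<lambda>j. h j * (6 * D) < e / 2) sequentially" by (rule order_tendstoD) (use e in simp)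
      then show ?thesis using that by (auto simp: eventually_sequentially)
    qed
    define d where "d = e / (8 * (?m + 1))"
    have d: "d > 0" "4 * (d * ?m) \<le> e / 2"
    proof -
      have m: "?m \<ge> 0" by simp
      have pos: "8 * (?m + 1) > 0" by (intro mult_pos_pos add_nonneg_pos m) auto
      show "d > 0" unfolding d_def by (rule divide_pos_pos[OF e pos])
      have "8 * (d * ?m) \<le> d * (8 * (?m + 1))" using \<open>d > 0\<close> by (simp add: algebra_simps)
      also have "\<dots> = e" using pos by (simp add: d_def)
      finally show "4 * (d * ?m) \<le> e / 2" by simp
    qed
    obtain K where K: "\<And>m n x. m \<ge> K \<Longrightarrow> n \<ge> K \<Longrightarrow> x \<in> \<Omega> \<Longrightarrow> \<bar>ball_average (h j) (\<phi> (r m)) x - ball_average (h j) (\<phi> (r n)) x\<bar> \<le> d"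
      using Pr[of j] d unfolding P_def by blast
    show ?thesis
    proof (intro exI[of _ K] allI impI)
      fix m n assume mn: "K \<le> m" "K \<le> n"
      let ?A = "\<lambda>m. ball_average (h j) (\<phi> (r m))"
      interpret finite_measure M by (rule finite_measure_domain)
      have mid: "Lmod M 1 (\<lambda>x. ?A m x - ?A n x) \<le> ennreal (d * ?m)"
      proof -
        have "Lmod M 1 (\<lambda>x. ?A m x - ?A n x) \<le> (\<integral>\<^sup>+x. ennreal d \<partial>M)"
          unfolding Lmod_def by (rule nn_integral_mono) (use K[OF mn] in \<open>auto intro: ennreal_leI\<close>)
        also have "\<dots> = ennreal (d * ?m)" using d measure_domain by (simp add: emeasure_eq_measure ennreal_mult')
        finally show ?thesis .
      qed
      have "Lmod M 1 (\<lambda>x. \<phi> (r m) x - \<phi> (r n) x) \<le> ennreal (2 powr 1) * (Lmod M 1 (\<lambda>x. \<phi> (r m) x - ?A m x) + Lmod M 1 (\<lambda>x. ?A m x - \<phi> (r n) x))"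
        by (rule Lmod_triangle) (use mm in auto)
      also have "\<dots> \<le> ennreal 2 * (ennreal (h j * D) + ennreal (2 powr 1) * (Lmod M 1 (\<lambda>x. ?A m x - ?A n x) + Lmod M 1 (\<lambda>x. ?A n x - \<phi> (r n) x)))"
        using close[of "r m" j] Lmod_triangle[of "?A m" M "?A n" "\<phi> (r n)" 1] mm
        by (intro mult_mono add_mono) auto
      also have "\<dots> \<le> ennreal 2 * (ennreal (h j * D) + ennreal (2 powr 1) * (ennreal (d * ?m) + ennreal (h j * D)))"
        using mid close[of "r n" j] by (intro mult_left_mono add_mono) (auto simp: Lmod_minus[of M 1 "?A n"])
      also have "\<dots> = ennreal (h j * (6 * D) + 4 * (d * ?m))"
      proof -
        have "h j * D \<ge> 0" "d * ?m \<ge> 0" using h[of j] D d by auto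
        then show ?thesis by (simp add: ennreal_plus[symmetric] ennreal_mult''[symmetric] numeral_mult_ennreal algebra_simps del: ennreal_plus)
      qed
      also have "\<dots> \<le> ennreal e" using j d by (intro ennreal_leI) linarith
      finally show "Lmod M 1 (\<lambda>x. \<phi> (r m) x - \<phi> (r n) x) \<le> ennreal e" .
    qed
  qed
  from Lmod_complete[of "\<lambda>k. \<phi> (r k)", OF mm(2) _ this] obtain U where "U \<in> borel_measurable M" "(\<lambda>k. Lmod M 1 (\<lambda>x. \<phi> (r k) x - U x)) \<longlonglongrightarrow> 0"
    by auto
  with r show ?thesis by blast
qed

end

section \<open>The nonlinearities\<close>

text \<open>The smooth substitute for \<open>(1 + \<bar>s\<bar>) powr (- \<theta>)\<close>.\<close>

definition weight :: "real \<Rightarrow> real \<Rightarrow> real" where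
  "weight \<theta> s = (1 + s^2) powr (- \<theta> / 2)"

lemma one_plus_square_pos: "1 + (s::real)^2 > 0" by (meson add_pos_nonneg zero_le_power2 zero_less_one)

lemma powr_one_plus_square_deriv:
  "((\<lambda>s. (1 + s^2) powr b) has_real_derivative (b * (1 + s^2) powr (b - 1) * (2 * s))) (at s)"
  using one_plus_square_pos[of s] by (auto intro!: derivative_eq_intros simp: powr_diff)

lemma continuous_powr_one_plus_square: "continuous_on UNIV (\<lambda>s::real. (1 + s^2) powr b)"
  by (intro continuous_on_powr continuous_intros) (use one_plus_square_pos in \<open>auto simp: less_imp_neq[symmetric]\<close>)

lemma weight_pos: "weight \<theta> s > 0" unfolding weight_def using one_plus_square_pos[of s] by simp

lemma weight_le_1: "\<theta> \<ge> 0 \<Longrightarrow> weight \<theta> s \<le> 1"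
  unfolding weight_def using powr_mono[of "- \<theta> / 2" 0 "1 + s^2"] by (simp add: one_plus_square_pos less_imp_neq[symmetric])

text \<open>A bounded, increasing, smooth function whose derivative decays no faster than \<open>weight (1 + 2 * a)\<close>, with an exponent
  arbitrarily close to \<open>1\<close>. It is an antiderivative of such a weight up to bounded factors, but explicit, which makes
  its compositions with test functions visibly smooth.\<close>

definition truncation :: "real \<Rightarrow> real \<Rightarrow> real" where
  "truncation a s = s * (1 + s^2) powr (- 1 / 2) * (2 - (1 + s^2) powr (- a))"

definition truncation' :: "real \<Rightarrow> real \<Rightarrow> real" where
  "truncation' a s = 2 * (1 + s^2) powr (- 3 / 2) - (1 + s^2) powr (- 3 / 2 - a) + 2 * a * s^2 * (1 + s^2) powr (- 3 / 2 - a)"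

lemma truncation_deriv: "(truncation a has_real_derivative truncation' a s) (at s)"
proof -
  let ?r = "1 + s^2"
  have r: "?r > 0" by (rule one_plus_square_pos)
  have e1: "?r powr (- 1/2) = ?r * ?r powr (- 3/2)" using r powr_add[of ?r 1 "- 3/2"] by simp
  have e2: "?r powr (- 1/2) * ?r powr (- a - 1) = ?r powr (- 3/2 - a)" by (simp flip: powr_add)
  have e3: "?r powr (- 3/2) * ?r powr (- a) = ?r powr (- 3/2 - a)" by (simp flip: powr_add)
  have "((\<lambda>s. s * (1 + s^2) powr (- 1/2) * (2 - (1 + s^2) powr (- a))) has_real_derivative
     ((1 * ?r powr (- 1/2) + ((- 1/2) * ?r powr (- 1/2 - 1) * (2 * s)) * s) * (2 - ?r powr (- a))
      + (0 - (- a) * ?r powr (- a - 1) * (2 * s)) * (s * ?r powr (- 1/2)))) (at s)"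
    by (intro DERIV_mult DERIV_diff powr_one_plus_square_deriv DERIV_const DERIV_ident)
  also have "(1 * ?r powr (- 1/2) + ((- 1/2) * ?r powr (- 1/2 - 1) * (2 * s)) * s) = ?r powr (- 3/2)"
    unfolding e1 by (simp add: algebra_simps power2_eq_square)
  also have "?r powr (- 3/2) * (2 - ?r powr (- a)) + (0 - (- a) * ?r powr (- a - 1) * (2 * s)) * (s * ?r powr (- 1/2))
     = 2 * ?r powr (- 3/2) - ?r powr (- 3/2) * ?r powr (- a) + 2 * a * s^2 * (?r powr (- 1/2) * ?r powr (- a - 1))"
    by (simp add: algebra_simps power2_eq_square)
  also have "\<dots> = truncation' a s" unfolding e2 e3 truncation'_def ..
  finally show ?thesis unfolding truncation_def[abs_def] .
qed

lemma truncation'_bounds: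
  assumes a: "0 < a" "a \<le> 1/2"
  shows "2 * a * weight (1 + 2 * a) s \<le> truncation' a s" "\<bar>truncation' a s\<bar> \<le> 3"
proof -
  let ?r = "1 + s^2"
  have r: "?r > 0" "?r \<ge> 1" "?r \<noteq> 0" using one_plus_square_pos[of s] by auto
  have m: "?r powr (- 3/2 - a) \<le> ?r powr (- 3/2)" by (rule powr_mono) (use a r in auto)
  have m1: "?r powr (- 3/2) \<le> 1" using powr_mono[of "- 3/2" 0 ?r] r by simp
  have p: "?r powr (- 3/2 - a) \<ge> 0" by simp
  have w: "weight (1 + 2*a) s = ?r * ?r powr (- 3/2 - a)"
    using r powr_add[of ?r 1 "- 3/2 - a"] by (simp add: weight_def) (simp add: field_simps)
  have "2 * a * weight (1 + 2*a) s = 2 * a * ?r powr (- 3/2 - a) + 2 * a * s^2 * ?r powr (- 3/2 - a)"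
    unfolding w by (simp add: algebra_simps)
  also have "\<dots> \<le> 1 * ?r powr (- 3/2 - a) + 2 * a * s^2 * ?r powr (- 3/2 - a)"
    using a p by (intro add_mono mult_right_mono) auto
  also have "\<dots> \<le> truncation' a s" unfolding truncation'_def using m by simp
  finally show 1: "2 * a * weight (1 + 2 * a) s \<le> truncation' a s" .
  have "2 * a * s^2 * ?r powr (- 3/2 - a) \<le> 1 * ?r * ?r powr (- 3/2 - a)"
    using a p by (intro mult_right_mono mult_mono) auto
  also have "\<dots> = weight (1 + 2*a) s" using w by simp
  also have "\<dots> \<le> 1" using a by (intro weight_le_1) auto
  finally have "truncation' a s \<le> 3" unfolding truncation'_def using m1 p by linarith
  moreover have "truncation' a s \<ge> 0" using 1 a weight_pos[of "1 + 2*a" s] by (smt (verit) mult_nonneg_nonneg)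
  ultimately show "\<bar>truncation' a s\<bar> \<le> 3" by simp
qed

lemma truncation'_continuous: "continuous_on UNIV (truncation' a)"
  unfolding truncation'_def[abs_def] by (intro continuous_intros continuous_powr_one_plus_square)

lemma truncation_bound:
  assumes "0 < a" shows "\<bar>truncation a s\<bar> \<le> 2"
proof -
  let ?r = "1 + s^2"
  have r: "?r > 0" "?r \<ge> 1" "?r \<noteq> 0" using one_plus_square_pos[of s] by auto
  have "\<bar>s\<bar> * ?r powr (- 1/2) \<le> 1"
  proof -
    have "\<bar>s\<bar> \<le> sqrt ?r" by (rule real_le_rsqrt) simp
    then have "\<bar>s\<bar> \<le> ?r powr (1/2)" using r by (simp add: powr_half_sqrt)
    then have "\<bar>s\<bar> * ?r powr (- 1/2) \<le> ?r powr (1/2) * ?r powr (- 1/2)" by (rule mult_right_mono) simp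
    also have "\<dots> = 1" using r by (simp flip: powr_add)
    finally show ?thesis .
  qed
  moreover have "\<bar>2 - ?r powr (- a)\<bar> \<le> 2"
    using powr_mono[of "- a" 0 ?r] r assms powr_ge_zero[of ?r "- a"] by simp
  ultimately have "(\<bar>s\<bar> * ?r powr (- 1/2)) * \<bar>2 - ?r powr (- a)\<bar> \<le> 1 * 2" by (intro mult_mono) auto
  then show ?thesis by (simp add: truncation_def abs_mult)
qed

lemma truncation_test_function:
  assumes \<phi>: "\<phi> \<in> test_functions \<Omega>"
  shows "(\<lambda>x. truncation a (\<phi> x)) \<in> test_functions \<Omega>"
proof (rule test_functions_compose[OF \<phi>])
  fix k
  have c: "C_k k \<phi>" using \<phi> by (auto simp: test_functions_def)
  have p: "C_k k (\<lambda>x. (1 + \<phi> x ^ 2) powr b)" for b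
    unfolding power2_eq_square
    by (intro C_k_powr C_k_add C_k_const C_k_mult c) (use one_plus_square_pos in \<open>simp add: power2_eq_square\<close>)
  have "C_k k (\<lambda>x. \<phi> x * (1 + \<phi> x ^ 2) powr (- 1/2) * (2 + (-1) * (1 + \<phi> x ^ 2) powr (- a)))"
    by (intro C_k_mult C_k_add C_k_const c p)
  then show "C_k k (\<lambda>x. truncation a (\<phi> x))" by (simp add: truncation_def)
qed (simp add: truncation_def)

lemma weight_measurable [measurable]: "weight t \<in> borel_measurable borel"
  using continuous_powr_one_plus_square by (auto simp: weight_def[abs_def] intro!: borel_measurable_continuous_onI)

definition psi' :: "real \<Rightarrow> real" where
  "psi' s = 1 / ((1 + \<bar>s\<bar>) * (1 + ln (1 + \<bar>s\<bar>))^2)"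

lemma ln_one_plus_abs: "ln (1 + \<bar>s\<bar>) \<ge> 0" "1 + ln (1 + \<bar>s::real\<bar>) > 0"
proof -
  show "ln (1 + \<bar>s\<bar>) \<ge> 0" by simp
  then show "1 + ln (1 + \<bar>s\<bar>) > 0" by linarith
qed

lemma psi_deriv: "(psi has_real_derivative psi' s) (at s)"
proof -
  have L: "((\<lambda>t. ln (1 + t) / (1 + ln (1 + t))) has_real_derivative 1 / ((1 + t) * (1 + ln (1 + t))^2)) (at t)" if "t > 0" for t :: real
  proof -
    have "1 + ln (1 + t) > 0" using that by (intro add_pos_nonneg) auto
    then show ?thesis using that
      by (auto intro!: derivative_eq_intros simp: divide_simps power2_eq_square)
  qed
  consider "s > 0" | "s < 0" | "s = 0" by linarith
  then show ?thesis
  proof cases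
    case 1
    have "eventually (\<lambda>t. t \<in> {0<..}) (nhds s)" by (rule eventually_nhds_in_open) (use 1 in auto)
    then have "eventually (\<lambda>t. psi t = ln (1 + t) / (1 + ln (1 + t))) (nhds s)"
      by eventually_elim (simp add: psi_def)
    then show ?thesis using L[OF 1] 1 by (subst DERIV_cong_ev[OF refl _ refl]) (auto simp: psi'_def)
  next
    case 2
    have "eventually (\<lambda>t. t \<in> {..<0}) (nhds s)" by (rule eventually_nhds_in_open) (use 2 in auto)
    then have ev: "eventually (\<lambda>t. psi t = - (ln (1 + (- t)) / (1 + ln (1 + (- t))))) (nhds s)"
      by eventually_elim (simp add: psi_def)
    have "((\<lambda>t. - (ln (1 + (- t)) / (1 + ln (1 + (- t))))) has_real_derivative - (1 / ((1 + (- s)) * (1 + ln (1 + (- s)))^2) * (- 1))) (at s)"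
      by (intro DERIV_minus DERIV_chain2[of "\<lambda>t. ln (1 + t) / (1 + ln (1 + t))"] L DERIV_ident) (use 2 in auto)
    then show ?thesis using 2 ev by (subst DERIV_cong_ev[OF refl _ refl]) (auto simp: psi'_def)
  next
    case 3
    let ?g = "\<lambda>t::real. (ln (1 + t) / t) / (1 + ln (1 + t))"
    have "((\<lambda>t::real. ln (1 + t)) has_real_derivative 1) (at 0)" by (auto intro!: derivative_eq_intros)
    then have "((\<lambda>t::real. ln (1 + t) / t) \<longlongrightarrow> 1) (at 0)" by (simp add: DERIV_def)
    moreover have "((\<lambda>t::real. 1 + ln (1 + t)) \<longlongrightarrow> 1) (at 0)" by (auto intro!: tendsto_eq_intros)
    ultimately have "(?g \<longlongrightarrow> 1 / 1) (at 0)" by (rule tendsto_divide) simp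
    moreover have "filterlim (\<lambda>h::real. \<bar>h\<bar>) (at 0) (at 0)"
      by (auto simp: filterlim_at eventually_at_filter intro!: tendsto_eq_intros)
    ultimately have "((\<lambda>h. ?g \<bar>h\<bar>) \<longlongrightarrow> 1) (at 0)" by (auto dest: filterlim_compose)
    moreover have "eventually (\<lambda>h. (psi (0 + h) - psi 0) / h = ?g \<bar>h\<bar>) (at 0)"
      by (auto simp: eventually_at_filter psi_def)
    ultimately have "((\<lambda>h. (psi (0 + h) - psi 0) / h) \<longlongrightarrow> 1) (at 0)" using tendsto_cong by fast
    then show ?thesis using 3 by (simp add: DERIV_def psi'_def)
  qed
qed

lemma psi'_continuous: "continuous_on UNIV psi'"
proof -
  have "1 + \<bar>s\<bar> \<noteq> 0" "1 + ln (1 + \<bar>s\<bar>) \<noteq> 0" for s :: real using ln_one_plus_abs(2)[of s] by linarith+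
  note n = this
  show ?thesis unfolding psi'_def[abs_def]
  proof (intro continuous_on_divide continuous_on_mult continuous_on_power continuous_on_add continuous_on_const continuous_on_ln continuous_on_rabs continuous_on_id ballI)
    show "(1 + \<bar>s\<bar>) * (1 + ln (1 + \<bar>s\<bar>))^2 \<noteq> 0" for s :: real using n[of s] by simp
  qed (use n in auto)
qed

lemma psi'_measurable [measurable]: "psi' \<in> borel_measurable borel"
  using psi'_continuous by (rule borel_measurable_continuous_onI)

text \<open>The decay of \<open>psi'\<close>, at least that of \<open>1 / \<bar>s\<bar>\<close>, is the property of \<open>psi\<close> on which the estimate of the
  regularising term rests.\<close>

lemma psi'_bounds: "0 < psi' s" "psi' s \<le> 1" "psi' s \<le> weight 1 s"
proof -
  let ?l = "1 + ln (1 + \<bar>s\<bar>)"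
  have l: "?l > 0" "?l \<ge> 1" using ln_one_plus_abs[of s] by auto
  show "0 < psi' s" unfolding psi'_def by (intro divide_pos_pos mult_pos_pos zero_less_power l(1)) auto
  have l2: "?l^2 \<ge> 1" using l by (simp add: one_le_power)
  have le: "psi' s \<le> 1 / (1 + \<bar>s\<bar>)" unfolding psi'_def
    by (intro divide_left_mono mult_pos_pos zero_less_power l(1)) (use l2 in \<open>auto simp: mult_le_cancel_left1\<close>)
  then show "psi' s \<le> 1" by (rule order_trans) simp
  have "sqrt (1 + s^2) \<le> 1 + \<bar>s\<bar>" by (rule real_le_lsqrt) (auto simp: power2_eq_square algebra_simps)
  then have "1 / (1 + \<bar>s\<bar>) \<le> 1 / sqrt (1 + s^2)" using one_plus_square_pos[of s] by (intro divide_left_mono) auto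
  also have "\<dots> = weight 1 s" using one_plus_square_pos[of s] by (simp add: weight_def powr_minus_divide powr_half_sqrt)
  finally show "psi' s \<le> weight 1 s" using le by linarith
qed

lemma psi_Lipschitz: "\<bar>psi s - psi t\<bar> \<le> \<bar>s - t\<bar>"
proof -
  have "norm (psi s - psi t) \<le> 1 * norm (s - t)"
    by (rule field_differentiable_bound[of UNIV psi psi' 1 s t])
       (use psi_deriv psi'_bounds in \<open>auto intro!: abs_leI less_imp_le intro: DERIV_subset simp: abs_of_pos\<close>)
  then show ?thesis by simp
qed

section \<open>Convergence of compositions\<close>

lemma borel_measurable_continuous_compose:
  assumes "continuous_on UNIV (F::'b::topological_space \<Rightarrow> 'c::topological_space)" "u \<in> borel_measurable M"
  shows "(\<lambda>x. F (u x)) \<in> borel_measurable M"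
  using borel_measurable_continuous_on[OF assms] by simp

lemma borel_measurable_matrix_vector_mult:
  fixes A :: "'a \<Rightarrow> real^'n^'m"
  assumes "A \<in> borel_measurable M" "v \<in> borel_measurable M"
  shows "(\<lambda>x. A x *v v x) \<in> borel_measurable M"
proof (rule borel_measurable_continuous_Pair[OF assms])
  show "continuous_on UNIV (\<lambda>x::(real^'n^'m) \<times> (real^'n). fst x *v snd x)"
    unfolding matrix_vector_mult_def
    by (intro continuous_on_vec_lambda continuous_on_sum continuous_on_mult continuous_on_component continuous_on_fst continuous_on_snd continuous_on_id)
qed

lemma norm_matrix_vector_mult_le:
  fixes A :: "real^'n^'m" shows "norm (A *v v) \<le> norm A * norm v"
proof -
  have "\<bar>(A *v v) $ i\<bar> \<le> norm (A $ i) * norm v" for i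
    using Cauchy_Schwarz_ineq2[of "A $ i" v] by (simp add: matrix_vector_mult_def inner_vec_def)
  then have "norm (A *v v) \<le> L2_set (\<lambda>i. norm (A $ i) * norm v) UNIV"
    unfolding norm_vec_def by (intro L2_set_mono) auto
  also have "\<dots> = norm A * norm v" unfolding norm_vec_def[of A] by (simp add: L2_set_left_distrib)
  finally show ?thesis .
qed

lemma Linfty_matrix_bound:
  fixes \<Lambda> :: "real^'n \<Rightarrow> real^'n^'n"
  assumes "\<Lambda> \<in> Linfty \<Omega>"
  shows "\<exists>K\<ge>0. AE x in lebesgue_on \<Omega>. \<forall>v. norm (\<Lambda> x *v v) \<le> K * norm v"
proof -
  obtain K where K: "AE x in lebesgue_on \<Omega>. norm (\<Lambda> x) \<le> K" using assms by (auto simp: Linfty_def)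
  have "AE x in lebesgue_on \<Omega>. \<forall>v. norm (\<Lambda> x *v v) \<le> \<bar>K\<bar> * norm v"
    using K
  proof eventually_elim
    case (elim x)
    then show ?case using norm_matrix_vector_mult_le[of "\<Lambda> x"] by (meson abs_ge_self mult_right_mono norm_ge_zero order_trans)
  qed
  then show ?thesis by (intro exI[of _ "\<bar>K\<bar>"]) auto
qed

context bounded_domain begin

lemma approx_compose_gradient:
  assumes a: "approx q \<phi> u G" and q: "q > 0" and ae: "AE x in M. (\<lambda>k. \<phi> k x) \<longlonglongrightarrow> u x"
    and F: "continuous_on UNIV F'" "\<And>s. \<bar>F' s\<bar> \<le> B"
  shows "(\<lambda>k. Lmod M q (\<lambda>x. F' (\<phi> k x) *\<^sub>R grad (\<phi> k) x - F' (u x) *\<^sub>R G x)) \<longlonglongrightarrow> 0"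
proof (rule Lmod_tendsto_dominated_product[OF approxD(2,7)[OF a] _ _ q])
  show "(\<lambda>x. F' (u x)) \<in> borel_measurable M" "(\<lambda>x. F' (\<phi> k x)) \<in> borel_measurable M" for k
    using borel_measurable_continuous_compose[OF F(1)] approxD(1,6)[OF a] by auto
  show "AE x in M. (\<lambda>k. F' (\<phi> k x)) \<longlonglongrightarrow> F' (u x)"
    using ae
  proof eventually_elim
    case (elim x)
    have "isCont F' (u x)" using F(1) by (simp add: continuous_on_eq_continuous_at)
    then show ?case using elim by (rule isCont_tendsto_compose)
  qed
qed (use F(2) approx_Lmod_finite[OF a q] approxD(5)[OF a] in auto)

lemma weak_gradient_compose:
  assumes a: "approx q \<phi> u G" and q: "q \<ge> 1" and ae: "AE x in M. (\<lambda>k. \<phi> k x) \<longlonglongrightarrow> u x"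
    and F: "\<And>s. (F has_real_derivative F' s) (at s)" "continuous_on UNIV F'" "F 0 = 0" "\<And>s. \<bar>F' s\<bar> \<le> B" "\<And>s t. \<bar>F s - F t\<bar> \<le> B * \<bar>s - t\<bar>"
  shows "has_weak_gradient \<Omega> (\<lambda>x. F (u x)) (\<lambda>x. F' (u x) *\<^sub>R G x)"
proof -
  have a1: "approx 1 \<phi> u G" by (rule approx_lower_exponent[OF a]) (use q in auto)
  have contF: "continuous_on UNIV F" using F(1) DERIV_isCont by (auto simp: continuous_on_eq_continuous_at)
  have Fm: "(\<lambda>x. F (u x)) \<in> borel_measurable M" "(\<lambda>x. F (\<phi> k x)) \<in> borel_measurable M" for k
    using borel_measurable_continuous_compose[OF contF] approxD(1,6)[OF a] by auto
  have F'm: "(\<lambda>x. F' (u x) *\<^sub>R G x) \<in> borel_measurable M"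
    using borel_measurable_continuous_compose[OF F(2) approxD(1)[OF a]] approxD(2)[OF a] by simp
  show ?thesis
  proof (rule has_weak_gradient_limit[OF C1c_compose[OF approxD(8)[OF a1] F(1,2,3)] Fm(1) F'm])
    show "(\<lambda>k. Lmod M 1 (\<lambda>x. F (\<phi> k x) - F (u x))) \<longlonglongrightarrow> 0"
    proof (rule tendsto_ennreal_0_squeeze)
      have "Lmod M 1 (\<lambda>x. F (\<phi> k x) - F (u x)) \<le> Lmod M 1 (\<lambda>x. B *\<^sub>R (\<phi> k x - u x))" for k
      proof (rule Lmod_mono_AE)
        have "\<bar>F s - F t\<bar> \<le> \<bar>B\<bar> * \<bar>s - t\<bar>" for s t
          using F(5)[of s t] mult_right_mono[OF abs_ge_self[of B] abs_ge_zero[of "s - t"]] by linarith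
        then show "AE x in M. norm (F (\<phi> k x) - F (u x)) \<le> norm (B *\<^sub>R (\<phi> k x - u x))" by (simp add: abs_mult)
      qed simp
      also have "Lmod M 1 (\<lambda>x. B *\<^sub>R (\<phi> k x - u x)) = ennreal (\<bar>B\<bar> powr 1) * Lmod M 1 (\<lambda>x. \<phi> k x - u x)" for k
        by (rule Lmod_scaleR) (use approxD(1,6)[OF a] in simp)
      finally show "Lmod M 1 (\<lambda>x. F (\<phi> k x) - F (u x)) \<le> ennreal (\<bar>B\<bar> powr 1) * Lmod M 1 (\<lambda>x. \<phi> k x - u x)" for k .
      show "(\<lambda>k. ennreal (\<bar>B\<bar> powr 1) * Lmod M 1 (\<lambda>x. \<phi> k x - u x)) \<longlonglongrightarrow> 0"
        using ennreal_tendsto_cmult[OF _ approxD(4)[OF a1], of "ennreal (\<bar>B\<bar> powr 1)"] by simp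
    qed
    show "(\<lambda>k. Lmod M 1 (\<lambda>x. F' (\<phi> k x) *\<^sub>R grad (\<phi> k) x - F' (u x) *\<^sub>R G x)) \<longlonglongrightarrow> 0"
      by (rule approx_compose_gradient[OF a1 _ ae F(2) F(4)]) simp
  qed
qed

lemma weak_gradient_psi:
  assumes a: "approx q \<phi> u G" and q: "q \<ge> 1"
  shows "AE x in M. weak_gradient \<Omega> (\<lambda>y. psi (u y)) x = psi' (u x) *\<^sub>R G x"
proof -
  obtain \<eta> where b: "approx q \<eta> u G" and ae: "AE x in M. (\<lambda>k. \<eta> k x) \<longlonglongrightarrow> u x" using approx_AE_subseq[OF a] q by auto
  show ?thesis
    by (rule weak_gradient_AE[OF open_domain weak_gradient_compose[OF b q ae psi_deriv psi'_continuous, of 1]])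
       (use psi'_bounds psi_Lipschitz in \<open>auto simp: psi_def abs_of_pos\<close>)
qed

section \<open>The energy estimate\<close>

text \<open>Test the regularised equation with \<open>truncation a u\<close>, which is bounded by 2. The right-hand side is then at most
  twice the norm of the measure \<open>f\<close>, and both terms on the left are nonnegative, because the gradient of the test
  function is a nonnegative multiple of the gradient of \<open>u\<close>. On test functions the duality pairing is
  explicit, so the equation is used with the truncations of the test functions that approximate \<open>u\<close>, and the resulting
  inequality is passed to the limit.\<close>

lemma energy_estimate:
  assumes N: "CARD('n) \<ge> 2" and p: "real CARD('n) < p"
    and ell: "elliptic_coefficient \<Omega> lo hi \<Lambda>" and f: "f \<in> radon_measures \<Omega>" and \<epsilon>: "\<epsilon> > 0"
    and sol: "regularised_solution \<Omega> p \<Lambda> f \<epsilon> u" and a: "0 < a" "a \<le> 1/2"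
  defines "G \<equiv> weak_gradient \<Omega> u" and "R \<equiv> radon_norm \<Omega> f"
  shows "(\<integral>\<^sup>+x. ennreal (weight (1 + 2 * a) (u x) * norm (G x)^2) \<partial>M) \<le> ennreal (R / (a * lo))"
    "(\<integral>\<^sup>+x. ennreal (\<epsilon> * psi' (u x) powr (p - 2) * weight (1 + 2 * a) (u x) * norm (G x) powr p) \<partial>M) \<le> ennreal (R / a)"
proof -
  have p2: "p > 2" "p > 1" "p \<ge> 1" "p > 0" using N p by auto
  let ?p' = "p / (p - 1)"
  have p': "0 < ?p'" "?p' \<le> p" using p2 by (auto simp: field_simps)
  have uW: "u \<in> W1_0 \<Omega> p" using sol by (simp add: regularised_solution_def)
  obtain \<phi> where ap: "approx p \<phi> u G" and ae: "AE x in M. (\<lambda>k. \<phi> k x) \<longlonglongrightarrow> u x"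
    using W1_0_imp_approx[OF uW p2(3)] approx_AE_subseq[OF _ p2(4)] unfolding G_def by blast
  note m[measurable] = approxD(1,2,6,7)[OF ap]
  have lo: "lo > 0" and \<Lambda>L: "\<Lambda> \<in> Linfty \<Omega>" and lower: "AE x in M. \<forall>\<xi>. lo * (norm \<xi>)\<^sup>2 \<le> (\<Lambda> x *v \<xi>) \<bullet> \<xi>"
    using ell unfolding elliptic_coefficient_def by (auto elim: eventually_mono)
  have \<Lambda>m[measurable]: "\<Lambda> \<in> borel_measurable M" using \<Lambda>L by (simp add: Linfty_def)
  obtain K where K: "K \<ge> 0" "AE x in M. \<forall>v. norm (\<Lambda> x *v v) \<le> K * norm v" using Linfty_matrix_bound[OF \<Lambda>L] by blast
  let ?T = "truncation' a"
  have [measurable]: "?T \<in> borel_measurable borel" using truncation'_continuous by (rule borel_measurable_continuous_onI)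
  \<comment> \<open>The two fluxes belong to the dual exponent \<open>p / (p - 1)\<close>, so that the equation can be passed to the limit in \<open>\<phi> k\<close>.\<close>
  define A where "A x = \<Lambda> x *v G x" for x
  define H where "H x = (psi' (u x) powr (p - 2) * norm (G x) powr (p - 2)) *\<^sub>R G x" for x
  have Am[measurable]: "A \<in> borel_measurable M" unfolding A_def by (rule borel_measurable_matrix_vector_mult) measurable
  have Hm[measurable]: "H \<in> borel_measurable M" unfolding H_def by measurable
  have finG: "Lmod M p G < \<infinity>" by (rule approx_Lmod_finite(2)[OF ap p2(4)])
  have finG': "Lmod M ?p' G < \<infinity>" by (rule Lmod_lower_exponent_finite[OF finite_measure_domain m(2) p' finG])
  have finA: "Lmod M ?p' A < \<infinity>"
  proof -
    have "Lmod M ?p' A \<le> Lmod M ?p' (\<lambda>x. K *\<^sub>R G x)"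
      by (rule Lmod_mono_AE) (use K p' in \<open>auto simp: A_def elim: eventually_mono\<close>)
    also have "\<dots> < \<infinity>" using finG' by (simp add: Lmod_scaleR ennreal_mult_less_top)
    finally show ?thesis .
  qed
  have finH: "Lmod M ?p' H < \<infinity>"
  proof -
    have "norm (H x) powr ?p' \<le> norm (G x) powr p" for x
    proof -
      have "norm (H x) = psi' (u x) powr (p - 2) * (norm (G x) powr (p - 2) * norm (G x))" by (simp add: H_def)
      also have "norm (G x) powr (p - 2) * norm (G x) = norm (G x) powr (p - 1)"
        using powr_add[of "norm (G x)" "p - 2" 1] by simp
      also have "psi' (u x) powr (p - 2) * norm (G x) powr (p - 1) \<le> 1 * norm (G x) powr (p - 1)"
        using psi'_bounds[of "u x"] powr_mono2[of "p - 2" "psi' (u x)" 1] p2 by (intro mult_right_mono) auto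
      finally have "norm (H x) powr ?p' \<le> (norm (G x) powr (p - 1)) powr ?p'" using p' by (intro powr_mono2) auto
      also have "\<dots> = norm (G x) powr p" using p2 by (simp add: powr_powr)
      finally show ?thesis .
    qed
    then have "Lmod M ?p' H \<le> Lmod M p G" unfolding Lmod_def by (intro nn_integral_mono ennreal_leI)
    then show ?thesis using finG by (rule le_less_trans)
  qed
  let ?F = "\<lambda>k x. ?T (\<phi> k x) *\<^sub>R grad (\<phi> k) x" and ?Fu = "\<lambda>x. ?T (u x) *\<^sub>R G x"
  have Flim: "(\<lambda>k. Lmod M p (\<lambda>x. ?F k x - ?Fu x)) \<longlonglongrightarrow> 0"
    by (rule approx_compose_gradient[OF ap p2(4) ae truncation'_continuous truncation'_bounds(2)[OF a]])
  let ?w = "\<lambda>k x. truncation a (\<phi> k x)"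
  have wt: "?w k \<in> test_functions \<Omega>" for k by (rule truncation_test_function[OF approxD(3)[OF ap]])
  have gw: "grad (?w k) = ?F k" for k
    using grad_compose[OF test_functions_differentiable[OF approxD(3)[OF ap]] truncation_deriv] by (intro ext) auto
  have finF: "Lmod M p (?F k) < \<infinity>" for k
    using C1c_Lmod_finite(2)[OF test_functions_C1c(1)[OF wt] p2(4), of k] unfolding gw .
  have lim1: "(\<lambda>k. \<integral>x. ?F k x \<bullet> A x \<partial>M) \<longlonglongrightarrow> (\<integral>x. ?Fu x \<bullet> A x \<partial>M)"
    by (rule tendsto_integral_inner[OF _ Am _ p2(2) finF finA Flim]) measurable
  have lim2: "(\<lambda>k. \<integral>x. ?F k x \<bullet> H x \<partial>M) \<longlonglongrightarrow> (\<integral>x. ?Fu x \<bullet> H x \<partial>M)"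
    by (rule tendsto_integral_inner[OF _ Hm _ p2(2) finF finH Flim]) measurable
  note psiG = weak_gradient_psi[OF ap p2(3)]
  have psim: "weak_gradient \<Omega> (\<lambda>y. psi (u y)) \<in> borel_measurable M"
    by (rule borel_measurable_lebesgue_on_AE[OF _ psiG]) measurable
  have le: "(\<integral>x. ?F k x \<bullet> A x \<partial>M) + \<epsilon> * (\<integral>x. ?F k x \<bullet> H x \<partial>M) \<le> 2 * R" for k
  proof -
    have wW: "?w k \<in> W1_0 \<Omega> p" by (rule approx_imp_W1_0[OF approx_const[OF wt] p2(3)])
    have wg: "AE x in M. weak_gradient \<Omega> (?w k) x = ?F k x"
      using weak_gradient_approx_AE[OF approx_const[OF wt] p2(3)] unfolding gw .
    have wm: "weak_gradient \<Omega> (?w k) \<in> borel_measurable M"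
      by (rule borel_measurable_lebesgue_on_AE[OF _ wg]) measurable
    have 1: "(\<integral>x. (\<Lambda> x *v weak_gradient \<Omega> u x) \<bullet> weak_gradient \<Omega> (?w k) x \<partial>M) = (\<integral>x. ?F k x \<bullet> A x \<partial>M)"
    proof (rule integral_cong_AE)
      show "(\<lambda>x. (\<Lambda> x *v weak_gradient \<Omega> u x) \<bullet> weak_gradient \<Omega> (?w k) x) \<in> borel_measurable M"
        using Am wm unfolding A_def G_def by (rule borel_measurable_inner)
      show "AE x in M. (\<Lambda> x *v weak_gradient \<Omega> u x) \<bullet> weak_gradient \<Omega> (?w k) x = ?F k x \<bullet> A x"
        using wg by eventually_elim (simp add: A_def G_def inner_commute)
    qed measurable
    have 2: "(\<integral>x. norm (weak_gradient \<Omega> (\<lambda>y. psi (u y)) x) powr (p - 2) * (weak_gradient \<Omega> u x \<bullet> weak_gradient \<Omega> (?w k) x) \<partial>M) = (\<integral>x. ?F k x \<bullet> H x \<partial>M)"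
    proof (rule integral_cong_AE)
      show "(\<lambda>x. norm (weak_gradient \<Omega> (\<lambda>y. psi (u y)) x) powr (p - 2) * (weak_gradient \<Omega> u x \<bullet> weak_gradient \<Omega> (?w k) x)) \<in> borel_measurable M"
        using psim wm m(2) unfolding G_def by measurable
      show "AE x in M. norm (weak_gradient \<Omega> (\<lambda>y. psi (u y)) x) powr (p - 2) * (weak_gradient \<Omega> u x \<bullet> weak_gradient \<Omega> (?w k) x) = ?F k x \<bullet> H x"
        using wg psiG
      proof eventually_elim
        case (elim x)
        have "norm (psi' (u x) *\<^sub>R G x) powr (p - 2) = psi' (u x) powr (p - 2) * norm (G x) powr (p - 2)"
          using psi'_bounds[of "u x"] by (simp add: powr_mult)
        then show ?case using elim by (simp add: H_def G_def inner_commute mult_ac)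
      qed
    qed measurable
    have "(\<integral>x. ?F k x \<bullet> A x \<partial>M) + \<epsilon> * (\<integral>x. ?F k x \<bullet> H x \<partial>M) = f (?w k)"
      using sol wW unfolding regularised_solution_def 1[symmetric] 2[symmetric] pairing_test[OF N wt f, symmetric] by blast
    also have "\<dots> \<le> R * 2" unfolding R_def
    proof (rule order_trans[OF abs_ge_self radon_norm_bound[OF f]])
      show "continuous_on (closure \<Omega>) (?w k)" by (rule C1c_continuous(1)[OF test_functions_C1c(1)[OF wt]])
    qed (use truncation_bound a in auto)
    finally show ?thesis by simp
  qed
  have lim: "(\<integral>x. ?Fu x \<bullet> A x \<partial>M) + \<epsilon> * (\<integral>x. ?Fu x \<bullet> H x \<partial>M) \<le> 2 * R"
    by (rule LIMSEQ_le_const2[OF tendsto_add[OF lim1 tendsto_mult[OF tendsto_const lim2]]]) (use le in auto)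
  have finF0: "Lmod M p ?Fu < \<infinity>" by (rule Lmod_finite_if_tendsto[OF _ _ finF p2(4) Flim]) measurable
  have i1: "integrable M (\<lambda>x. ?Fu x \<bullet> A x)" by (rule integrable_inner_Holder[OF _ Am p2(2) finF0 finA]) measurable
  have i2: "integrable M (\<lambda>x. ?Fu x \<bullet> H x)" by (rule integrable_inner_Holder[OF _ Hm p2(2) finF0 finH]) measurable
  let ?W = "\<lambda>x. weight (1 + 2 * a) (u x)"
  have W: "?W x > 0" "2 * a * ?W x \<le> ?T (u x)" for x using weight_pos truncation'_bounds(1)[OF a] by auto
  have low1: "AE x in M. 2 * a * lo * (?W x * norm (G x)^2) \<le> ?Fu x \<bullet> A x"
    using lower
  proof eventually_elim
    case (elim x)
    have "(2 * a * ?W x) * (lo * norm (G x)^2) \<le> ?T (u x) * (A x \<bullet> G x)"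
      using elim W[of x] a lo unfolding A_def by (intro mult_mono) (auto intro: order_trans[of _ "2 * a * ?W x"])
    then show ?case by (simp add: inner_commute mult_ac)
  qed
  have low2: "2 * a * (psi' (u x) powr (p - 2) * ?W x * norm (G x) powr p) \<le> ?Fu x \<bullet> H x" for x
  proof -
    have "?Fu x \<bullet> H x = ?T (u x) * (psi' (u x) powr (p - 2) * (norm (G x) powr (p - 2) * norm (G x)^2))"
      by (simp add: H_def power2_norm_eq_inner)
    also have "norm (G x) powr (p - 2) * norm (G x)^2 = norm (G x) powr p"
      using powr_add[of "norm (G x)" "p - 2" 2] by (cases "norm (G x) = 0") auto
    finally have eq: "?Fu x \<bullet> H x = ?T (u x) * (psi' (u x) powr (p - 2) * norm (G x) powr p)" .
    have "(2 * a * ?W x) * (psi' (u x) powr (p - 2) * norm (G x) powr p) \<le> ?T (u x) * (psi' (u x) powr (p - 2) * norm (G x) powr p)"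
      using W by (intro mult_right_mono) auto
    then show ?thesis unfolding eq by (simp add: mult_ac)
  qed
  have nn1: "AE x in M. 0 \<le> ?Fu x \<bullet> A x" using low1 by eventually_elim (use W a lo in \<open>auto intro: order_trans[rotated] simp: less_imp_le\<close>)
  have nn2: "0 \<le> ?Fu x \<bullet> H x" for x by (rule order_trans[OF _ low2]) (use W[of x] a in \<open>auto intro!: mult_nonneg_nonneg less_imp_le\<close>)
  have I1: "0 \<le> (\<integral>x. ?Fu x \<bullet> A x \<partial>M)" by (rule integral_nonneg_AE[OF nn1])
  have I2: "0 \<le> (\<integral>x. ?Fu x \<bullet> H x \<partial>M)" by (rule integral_nonneg_AE) (use nn2 in simp)
  have b1: "(\<integral>x. ?Fu x \<bullet> A x \<partial>M) \<le> 2 * R" using lim I2 \<epsilon> by (smt (verit) mult_nonneg_nonneg)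
  have b2: "\<epsilon> * (\<integral>x. ?Fu x \<bullet> H x \<partial>M) \<le> 2 * R" using lim I1 by linarith
  have "ennreal (2 * a * lo) * (\<integral>\<^sup>+x. ennreal (?W x * norm (G x)^2) \<partial>M) = (\<integral>\<^sup>+x. ennreal (2 * a * lo * (?W x * norm (G x)^2)) \<partial>M)"
    using a lo by (subst nn_integral_cmult[symmetric]) (auto simp: ennreal_mult')
  also have "\<dots> \<le> (\<integral>\<^sup>+x. ennreal (?Fu x \<bullet> A x) \<partial>M)"
    by (rule nn_integral_mono_AE) (use low1 in \<open>auto elim!: eventually_mono intro: ennreal_leI\<close>)
  also have "\<dots> = ennreal (\<integral>x. ?Fu x \<bullet> A x \<partial>M)" by (rule nn_integral_eq_integral[OF i1 nn1])
  also have "\<dots> \<le> ennreal (2 * R)" by (rule ennreal_leI[OF b1])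
  finally have e1: "ennreal (2 * a * lo) * (\<integral>\<^sup>+x. ennreal (?W x * norm (G x)^2) \<partial>M) \<le> ennreal (2 * R)" .
  have "(\<integral>\<^sup>+x. ennreal (?W x * norm (G x)^2) \<partial>M) = ennreal (1 / (2 * a * lo)) * (ennreal (2 * a * lo) * (\<integral>\<^sup>+x. ennreal (?W x * norm (G x)^2) \<partial>M))"
    using a lo by (simp add: mult.assoc[symmetric] ennreal_mult'[symmetric])
  also have "\<dots> \<le> ennreal (1 / (2 * a * lo)) * ennreal (2 * R)" by (rule mult_left_mono[OF e1]) simp
  also have "\<dots> = ennreal (R / (a * lo))" using a lo by (simp add: ennreal_mult'[symmetric])
  finally show "(\<integral>\<^sup>+x. ennreal (?W x * norm (G x)^2) \<partial>M) \<le> ennreal (R / (a * lo))" .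
  have "(\<integral>\<^sup>+x. ennreal (\<epsilon> * psi' (u x) powr (p - 2) * ?W x * norm (G x) powr p) \<partial>M)
      \<le> (\<integral>\<^sup>+x. ennreal (\<epsilon> / (2 * a)) * ennreal (?Fu x \<bullet> H x) \<partial>M)"
  proof (rule nn_integral_mono)
    fix x
    have "\<epsilon> / (2 * a) * (2 * a * (psi' (u x) powr (p - 2) * ?W x * norm (G x) powr p)) \<le> \<epsilon> / (2 * a) * (?Fu x \<bullet> H x)"
      using \<epsilon> a by (intro mult_left_mono low2) auto
    then have "\<epsilon> * psi' (u x) powr (p - 2) * ?W x * norm (G x) powr p \<le> \<epsilon> / (2 * a) * (?Fu x \<bullet> H x)"
      using a by (simp add: mult_ac)
    then show "ennreal (\<epsilon> * psi' (u x) powr (p - 2) * ?W x * norm (G x) powr p) \<le> ennreal (\<epsilon> / (2 * a)) * ennreal (?Fu x \<bullet> H x)"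
      using \<epsilon> a nn2[of x] by (subst ennreal_mult[symmetric]) (auto intro!: ennreal_leI)
  qed
  also have "\<dots> = ennreal (\<epsilon> / (2 * a)) * ennreal (\<integral>x. ?Fu x \<bullet> H x \<partial>M)"
    using nn_integral_eq_integral[OF i2] nn2 i2 by (subst nn_integral_cmult) auto
  also have "\<dots> = ennreal (\<epsilon> * (\<integral>x. ?Fu x \<bullet> H x \<partial>M) / (2 * a))" using \<epsilon> a I2 by (simp add: ennreal_mult[symmetric])
  also have "\<dots> \<le> ennreal (R / a)" using b2 a by (intro ennreal_leI) (simp add: field_simps)
  finally show "(\<integral>\<^sup>+x. ennreal (\<epsilon> * psi' (u x) powr (p - 2) * ?W x * norm (G x) powr p) \<partial>M) \<le> ennreal (R / a)" .
qed

end

section \<open>Estimates depending on the measure of the domain only\<close>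

text \<open>What the energy estimate says about a solution. The bounds below hold for all functions of such a class; they
  depend on the domain through its measure only.\<close>

definition energy_class :: "(real^'n) set \<Rightarrow> real \<Rightarrow> real \<Rightarrow> (real^'n \<Rightarrow> real) \<Rightarrow> (real^'n \<Rightarrow> real^'n) \<Rightarrow> bool" where
  "energy_class \<Omega> R lo u G \<longleftrightarrow> bounded_domain \<Omega> \<and> (\<exists>p\<ge>2. \<exists>\<phi>. bounded_domain.approx \<Omega> p \<phi> u G) \<and>
     (\<forall>\<theta>. 1 < \<theta> \<and> \<theta> \<le> 2 \<longrightarrow>
       (\<integral>\<^sup>+x. ennreal (weight \<theta> (u x) * norm (G x)^2) \<partial>lebesgue_on \<Omega>) \<le> ennreal (2 * R / ((\<theta> - 1) * lo)))"

lemma (in bounded_domain) energy_classD: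
  assumes "energy_class \<Omega> R lo u G"
  shows "\<exists>\<phi>. approx 2 \<phi> u G" "u \<in> borel_measurable M" "G \<in> borel_measurable M"
    "1 < \<theta> \<Longrightarrow> \<theta> \<le> 2 \<Longrightarrow> (\<integral>\<^sup>+x. ennreal (weight \<theta> (u x) * norm (G x)^2) \<partial>M) \<le> ennreal (2 * R / ((\<theta> - 1) * lo))"
proof -
  obtain p \<phi> where p: "p \<ge> 2" and a: "approx p \<phi> u G" using assms by (auto simp: energy_class_def)
  have "approx 2 \<phi> u G" by (rule approx_lower_exponent[OF a]) (use p in auto)
  then show "\<exists>\<phi>. approx 2 \<phi> u G" by blast
qed (use assms approxD(1,2) in \<open>auto simp: energy_class_def\<close>)

lemma exponent_above_one:
  fixes A B :: real assumes "0 \<le> A" "A < B"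
  shows "\<exists>\<theta>>1. \<theta> \<le> 2 \<and> \<theta> * A < B"
proof (intro exI[of _ "1 + min 1 ((B - A) / (2 * (A + 1)))"] conjI)
  let ?t = "min 1 ((B - A) / (2 * (A + 1)))"
  have "?t * A \<le> (B - A) / (2 * (A + 1)) * A" using assms by (intro mult_right_mono) auto
  also have "\<dots> = (B - A) * (A / (2 * (A + 1)))" by simp
  also have "\<dots> < (B - A) * 1" using assms by (intro mult_strict_left_mono) (auto simp: divide_simps)
  finally show "(1 + ?t) * A < B" by (simp add: algebra_simps)
qed (use assms in auto)

lemma subcritical_exponent_less_2:
  assumes "CARD('n::finite) \<ge> 2" "q * (real CARD('n) - 1) < real CARD('n)"
  shows "q < 2"
proof (rule ccontr)
  assume "\<not> q < 2"
  then have "2 * (real CARD('n) - 1) \<le> q * (real CARD('n) - 1)" using assms by (intro mult_right_mono) auto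
  then have "2 * real CARD('n) - 2 \<le> q * (real CARD('n) - 1)" by (simp add: algebra_simps)
  then show False using assms by linarith
qed

text \<open>The power \<open>m\<close> of \<open>u\<close> that Hoelder's inequality needs in order to turn the weighted bound for the square of the
  gradient into a bound for its \<open>q\<close>-th power; it is subcritical if the exponent \<open>\<theta>\<close> of the weight is close enough to 1.\<close>

lemma weight_exponent:
  assumes N: "CARD('n::finite) \<ge> 2" and q: "1 \<le> q" "q * (real CARD('n) - 1) < real CARD('n)"
  shows "\<exists>\<theta>>1. \<theta> \<le> 2 \<and> q \<le> \<theta> * q / (2 - q) \<and> \<theta> * q / (2 - q) * (real CARD('n) - 2) < real CARD('n)"
proof -
  let ?N = "real CARD('n)"
  note q2 = subcritical_exponent_less_2[OF N q(2)]
  have A: "0 \<le> q * (?N - 2)" using q N by simp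
  have "q * (?N - 2) < ?N * (2 - q)" using q(2) by (simp add: algebra_simps)
  from exponent_above_one[OF A this] obtain \<theta> where \<theta>: "1 < \<theta>" "\<theta> \<le> 2" "\<theta> * (q * (?N - 2)) < ?N * (2 - q)" by blast
  have "q * (2 - q) \<le> \<theta> * q" using \<theta> q mult_mono[of "2 - q" \<theta> q q] by (simp add: mult.commute)
  then have "q \<le> \<theta> * q / (2 - q)" using q2 by (simp add: pos_le_divide_eq)
  moreover have "\<theta> * q / (2 - q) * (?N - 2) < ?N" using \<theta>(3) q2 by (simp add: field_simps)
  ultimately show ?thesis using \<theta> by blast
qed

text \<open>Apply the Sobolev inequality in \<open>L\<^sup>1\<close> to \<open>(1 + \<phi>\<^sup>2) powr (\<gamma> / 2)\<close>. Its gradient is controlled by Hoelder's inequality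
  through the weighted energy and the very integral \<open>X\<close> to be bounded, with the result \<open>X \<le> A * (X + 1) powr (s / 2)\<close>;
  this bounds \<open>X\<close> since \<open>s < 2\<close>. The relation \<open>2 * \<gamma> - 2 + \<theta> = m = \<gamma> * s\<close> makes the powers match.\<close>

lemma test_function_power_estimate:
  assumes N: "CARD('n::finite) \<ge> 2" and m: "m > 0" "m * (real CARD('n) - 2) < real CARD('n)" and V: "V \<ge> 0"
  shows "\<exists>\<theta>>1. \<theta> \<le> 2 \<and> (\<forall>E>0. \<exists>C\<ge>0. \<forall>(\<Omega>::(real^'n) set) \<phi>. bounded_domain \<Omega> \<longrightarrow> measure lebesgue \<Omega> = V \<longrightarrow>
     \<phi> \<in> test_functions \<Omega> \<longrightarrow>
     (\<integral>\<^sup>+x. ennreal (weight \<theta> (\<phi> x) * norm (grad \<phi> x)^2) \<partial>lebesgue_on \<Omega>) \<le> ennreal E \<longrightarrow>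
     (\<integral>\<^sup>+x. ennreal ((1 + (\<phi> x)^2) powr (m/2)) \<partial>lebesgue_on \<Omega>) \<le> ennreal C)"
proof -
  let ?N = "real CARD('n)"
  \<comment> \<open>The hypothesis on \<open>m\<close> says \<open>2 * m / (m + 1) < N / (N - 1)\<close>, and \<open>s\<close> lies between these two numbers. Above the first
    one \<open>\<theta> > 1\<close>, and below the second one the Sobolev inequality holds.\<close>
  define s0 where "s0 = max 1 (2 * m / (m + 1))"
  define s where "s = (s0 + ?N / (?N - 1)) / 2"
  have N1: "?N - 1 > 0" using N by simp
  have "2 * m / (m + 1) < ?N / (?N - 1)"
  proof -
    have "2 * m * (?N - 1) < ?N * (m + 1)" using m by (simp add: algebra_simps)
    then show ?thesis using N1 m by (simp add: divide_simps mult.commute)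
  qed
  moreover have "1 < ?N / (?N - 1)" using N1 by (simp add: divide_simps)
  ultimately have s0: "s0 < ?N / (?N - 1)" by (simp add: s0_def)
  have s: "s0 < s" "s < ?N / (?N - 1)" 
  proof -
    have mid: "a < (a + b) / 2 \<and> (a + b) / 2 < b" if "a < b" for a b :: real using that by simp
    show "s0 < s" "s < ?N / (?N - 1)" using mid[OF s0] unfolding s_def by blast+
  qed
  have s1: "1 < s" using s by (simp add: s0_def)
  have sN: "s * (?N - 1) < ?N" using s(2) N1 by (simp add: pos_less_divide_eq)
  have "?N / (?N - 1) \<le> 2" using N N1 by (simp add: divide_simps)
  then have s2: "s < 2" using s by linarith
  have "2 * m / (m + 1) < s" using s by (simp add: s0_def)
  then have "2 * m < s * (m + 1)" using m by (simp add: pos_divide_less_eq)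
  then have ms: "m * (2/s - 1) < 1" using s1 by (simp add: divide_simps) (simp add: algebra_simps)
  define \<theta> where "\<theta> = 2 - m * (2/s - 1)"
  have "m * (2/s - 1) \<ge> 0" using m s1 s2 by (intro mult_nonneg_nonneg) (auto simp: divide_simps)
  then have \<theta>: "1 < \<theta>" "\<theta> \<le> 2" using ms by (auto simp: \<theta>_def)
  define \<gamma> where "\<gamma> = m / s"
  have \<gamma>: "\<gamma> > 0" using m s1 by (simp add: \<gamma>_def)
  have \<theta>\<gamma>: "2 * \<gamma> - 2 + \<theta> = m" using s1 by (simp add: \<theta>_def \<gamma>_def algebra_simps)
  obtain c where c: "c \<ge> 0" and sob: "\<And>(g::real^'n \<Rightarrow> real) G A D. C1c g G \<Longrightarrow> A \<in> sets borel \<Longrightarrow> emeasure lborel A \<le> ennreal V \<Longrightarrow> D > 0 \<Longrightarrow>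
     (\<integral>\<^sup>+y. ennreal (norm (G y)) \<partial>lborel) \<le> ennreal D \<Longrightarrow>
     (\<integral>\<^sup>+x. ennreal (\<bar>g x\<bar> powr s) * indicator A x \<partial>lborel) \<le> ennreal (c * D powr s)"
    using L1_Sobolev[where 'a="real^'n", of s V] N s1 sN V by auto
  have "\<exists>C\<ge>0. \<forall>(\<Omega>::(real^'n) set) \<phi>. bounded_domain \<Omega> \<longrightarrow> measure lebesgue \<Omega> = V \<longrightarrow>
     \<phi> \<in> test_functions \<Omega> \<longrightarrow>
     (\<integral>\<^sup>+x. ennreal (weight \<theta> (\<phi> x) * norm (grad \<phi> x)^2) \<partial>lebesgue_on \<Omega>) \<le> ennreal E \<longrightarrow>
     (\<integral>\<^sup>+x. ennreal ((1 + (\<phi> x)^2) powr (m/2)) \<partial>lebesgue_on \<Omega>) \<le> ennreal C" if E: "E > 0" for E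
  proof -
    define A where "A = 1 + 2 powr s * V + 2 powr s * (c * (\<gamma> * E powr (1/2)) powr s)"
    have A: "A \<ge> 1" using V c by (simp add: A_def)
    show ?thesis
    proof (intro exI[of _ "A powr (2 / (2 - s))"] conjI allI impI)
      fix \<Omega> :: "(real^'n) set" and \<phi>
      assume "bounded_domain \<Omega>" and V': "measure lebesgue \<Omega> = V" and \<phi>: "\<phi> \<in> test_functions \<Omega>"
        and en: "(\<integral>\<^sup>+x. ennreal (weight \<theta> (\<phi> x) * norm (grad \<phi> x)^2) \<partial>lebesgue_on \<Omega>) \<le> ennreal E"
      interpret bounded_domain \<Omega> by fact
      interpret finite_measure M by (rule finite_measure_domain)
      note C = test_functions_C1c(1)[OF \<phi>]
      note [measurable] = C1c_measurable[OF C] test_measurable[OF \<phi>]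
      define X where "X = (\<integral>\<^sup>+x. ennreal ((1 + (\<phi> x)^2) powr (m/2)) \<partial>M)"
      obtain B where B: "\<And>x. \<bar>\<phi> x\<bar> \<le> B" using C1c_bounded[OF C] by blast
      have "X \<le> (\<integral>\<^sup>+x. ennreal ((1 + B^2) powr (m/2)) \<partial>M)" unfolding X_def
        using B m by (intro nn_integral_mono ennreal_leI powr_mono2) (auto simp: abs_le_square_iff[symmetric] intro: order_trans[OF _ abs_ge_self])
      also have "\<dots> < \<infinity>" by (simp add: emeasure_eq_measure ennreal_mult_less_top)
      finally have "X \<noteq> \<infinity>" by simp
      then obtain y where y: "X = ennreal y" "y \<ge> 0" by (cases X) auto
      \<comment> \<open>The constant is subtracted to preserve the compact support.\<close>
      let ?F = "\<lambda>t::real. (1 + t^2) powr (\<gamma>/2) - 1" and ?D = "\<lambda>t::real. \<gamma>/2 * (1 + t^2) powr (\<gamma>/2 - 1) * (2 * t) - 0"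
      have Fd: "(?F has_real_derivative ?D t) (at t)" for t
        by (intro DERIV_diff powr_one_plus_square_deriv DERIV_const)
      have CF: "C1c (\<lambda>x. ?F (\<phi> x)) (\<lambda>x. ?D (\<phi> x) *\<^sub>R grad \<phi> x)"
        by (rule C1c_compose[OF C Fd]) (auto intro!: continuous_intros continuous_powr_one_plus_square)
      have Db: "\<bar>?D t\<bar> \<le> \<gamma> * (1 + t^2) powr ((\<gamma> - 1)/2)" for t :: real
      proof -
        let ?r = "1 + t^2"
        have r: "?r > 0" by (rule one_plus_square_pos)
        have "\<bar>t\<bar> \<le> sqrt ?r" by (rule real_le_rsqrt) simp
        then have t: "\<bar>t\<bar> \<le> ?r powr (1/2)" using r by (simp add: powr_half_sqrt)
        have "\<bar>?D t\<bar> = \<gamma> * ?r powr (\<gamma>/2 - 1) * \<bar>t\<bar>" using \<gamma> by (simp add: abs_mult)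
        also have "\<dots> \<le> \<gamma> * ?r powr (\<gamma>/2 - 1) * ?r powr (1/2)" using t \<gamma> by (intro mult_left_mono) auto
        also have "\<dots> = \<gamma> * ?r powr ((\<gamma> - 1)/2)"
          using r by (simp add: mult.assoc powr_add[symmetric]) (simp add: field_simps)
        finally show ?thesis .
      qed
      let ?Dc = "\<gamma> * (E powr (1/2) * (y + 1) powr (1/2))"
      have Dpos: "?Dc > 0" using \<gamma> E y by simp
      have hold: "(\<integral>\<^sup>+x. ennreal ((weight \<theta> (\<phi> x) * norm (grad \<phi> x)^2) powr (1/2) * ((1 + (\<phi> x)^2) powr (m/2)) powr (1/2)) \<partial>M)
         \<le> ennreal (E powr (1/2) * (y + 1) powr (1/2))"
      proof (rule nn_integral_Holder)
        show "(\<integral>\<^sup>+x. ennreal ((1 + (\<phi> x)^2) powr (m/2)) \<partial>M) \<le> ennreal (y + 1)"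
          using y unfolding X_def[symmetric] by (simp add: ennreal_leI)
        show "weight \<theta> (\<phi> x) * norm (grad \<phi> x)^2 \<ge> 0" for x using weight_pos[of \<theta> "\<phi> x"] by simp
      qed (use en E y in auto)
      have "(\<integral>\<^sup>+x. ennreal (norm (?D (\<phi> x) *\<^sub>R grad \<phi> x)) \<partial>lborel) = (\<integral>\<^sup>+x. ennreal (norm (?D (\<phi> x) *\<^sub>R grad \<phi> x)) * indicator \<Omega> x \<partial>lborel)"
        using test_functions_outside[OF \<phi>] by (intro nn_integral_cong) (auto simp: indicator_def)
      also have "\<dots> = (\<integral>\<^sup>+x. ennreal (norm (?D (\<phi> x) *\<^sub>R grad \<phi> x)) \<partial>M)"
        using C1c_measurable(2)[OF CF] by (intro nn_integral_domain[symmetric]) measurable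
      also have "\<dots> \<le> (\<integral>\<^sup>+x. ennreal \<gamma> * ennreal ((weight \<theta> (\<phi> x) * norm (grad \<phi> x)^2) powr (1/2) * ((1 + (\<phi> x)^2) powr (m/2)) powr (1/2)) \<partial>M)"
      proof (rule nn_integral_mono)
        fix x
        let ?r = "1 + (\<phi> x)^2"
        have r: "?r > 0" by (rule one_plus_square_pos)
        have "(weight \<theta> (\<phi> x) * norm (grad \<phi> x)^2) powr (1/2) * (?r powr (m/2)) powr (1/2) = (?r powr (- \<theta>/4) * ?r powr (m/4)) * norm (grad \<phi> x)"
          by (simp add: weight_def powr_mult powr_powr powr_half_sqrt)
        also have "?r powr (- \<theta>/4) * ?r powr (m/4) = ?r powr ((\<gamma> - 1)/2)"
        proof -
          have "- \<theta>/4 + m/4 = (\<gamma> - 1)/2" using \<theta>\<gamma> by (simp add: field_simps)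
          then show ?thesis by (simp only: powr_add[symmetric])
        qed
        finally have eq: "(weight \<theta> (\<phi> x) * norm (grad \<phi> x)^2) powr (1/2) * (?r powr (m/2)) powr (1/2) = ?r powr ((\<gamma> - 1)/2) * norm (grad \<phi> x)" .
        have "norm (?D (\<phi> x) *\<^sub>R grad \<phi> x) \<le> \<gamma> * ?r powr ((\<gamma> - 1)/2) * norm (grad \<phi> x)"
          unfolding norm_scaleR by (intro mult_right_mono Db) simp
        then show "ennreal (norm (?D (\<phi> x) *\<^sub>R grad \<phi> x)) \<le> ennreal \<gamma> * ennreal ((weight \<theta> (\<phi> x) * norm (grad \<phi> x)^2) powr (1/2) * (?r powr (m/2)) powr (1/2))"
          unfolding eq using \<gamma> by (subst ennreal_mult'[symmetric]) (auto simp: mult.assoc intro!: ennreal_leI)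
      qed
      also have "\<dots> = ennreal \<gamma> * (\<integral>\<^sup>+x. ennreal ((weight \<theta> (\<phi> x) * norm (grad \<phi> x)^2) powr (1/2) * ((1 + (\<phi> x)^2) powr (m/2)) powr (1/2)) \<partial>M)"
        by (rule nn_integral_cmult) measurable
      also have "\<dots> \<le> ennreal \<gamma> * ennreal (E powr (1/2) * (y + 1) powr (1/2))" by (rule mult_left_mono[OF hold]) simp
      also have "\<dots> = ennreal ?Dc" using \<gamma> by (simp add: ennreal_mult')
      finally have gradb: "(\<integral>\<^sup>+x. ennreal (norm (?D (\<phi> x) *\<^sub>R grad \<phi> x)) \<partial>lborel) \<le> ennreal ?Dc" .
      have so: "(\<integral>\<^sup>+x. ennreal (\<bar>?F (\<phi> x)\<bar> powr s) * indicator \<Omega> x \<partial>lborel) \<le> ennreal (c * ?Dc powr s)"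
        by (rule sob[OF CF _ _ Dpos gradb]) (auto simp: emeasure_domain V')
      have "X \<le> (\<integral>\<^sup>+x. ennreal (2 powr s) * (1 + ennreal (\<bar>?F (\<phi> x)\<bar> powr s)) \<partial>M)"
        unfolding X_def
      proof (rule nn_integral_mono)
        fix x
        let ?r = "1 + (\<phi> x)^2"
        have r1: "?r powr (\<gamma>/2) \<ge> 1" using \<gamma> by (intro ge_one_powr_ge_zero) auto
        have "?r powr (m/2) = (?r powr (\<gamma>/2)) powr s" using s1 by (simp add: powr_powr \<gamma>_def)
        also have "\<dots> = (1 + \<bar>?F (\<phi> x)\<bar>) powr s" using r1 by simp
        also have "\<dots> \<le> 2 powr s * (1 powr s + \<bar>?F (\<phi> x)\<bar> powr s)" by (rule powr_add_le) (use s1 in auto)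
        finally have "?r powr (m/2) \<le> 2 powr s * (1 + \<bar>?F (\<phi> x)\<bar> powr s)" by simp
        then show "ennreal (?r powr (m/2)) \<le> ennreal (2 powr s) * (1 + ennreal (\<bar>?F (\<phi> x)\<bar> powr s))"
          by (simp add: ennreal_mult'[symmetric] ennreal_plus[symmetric] ennreal_1[symmetric] ennreal_leI del: ennreal_plus ennreal_1)
      qed
      also have "\<dots> = ennreal (2 powr s) * (ennreal V + (\<integral>\<^sup>+x. ennreal (\<bar>?F (\<phi> x)\<bar> powr s) \<partial>M))"
        using measure_domain V' by (subst nn_integral_cmult, simp, subst nn_integral_add) (auto simp: emeasure_eq_measure)
      also have "(\<integral>\<^sup>+x. ennreal (\<bar>?F (\<phi> x)\<bar> powr s) \<partial>M) = (\<integral>\<^sup>+x. ennreal (\<bar>?F (\<phi> x)\<bar> powr s) * indicator \<Omega> x \<partial>lborel)"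
        using C1c_measurable(1)[OF CF] by (intro nn_integral_domain) measurable
      also have "ennreal (2 powr s) * (ennreal V + \<dots>) \<le> ennreal (2 powr s) * (ennreal V + ennreal (c * ?Dc powr s))"
        by (intro mult_left_mono add_left_mono so) simp
      also have "\<dots> = ennreal (2 powr s * (V + c * ?Dc powr s))"
        using V c by (simp add: ennreal_mult'[symmetric] ennreal_plus[symmetric] del: ennreal_plus)
      finally have "y \<le> 2 powr s * (V + c * ?Dc powr s)" using y V c by (subst (asm) y(1), subst (asm) ennreal_le_iff) auto
      moreover have "?Dc powr s = (\<gamma> * E powr (1/2)) powr s * (y + 1) powr (s/2)"
        using \<gamma> E y by (simp add: powr_mult powr_powr mult.assoc)
      moreover have z: "(y + 1) powr (s/2) \<ge> 1" using y s1 by (intro ge_one_powr_ge_zero) auto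
      ultimately have "y + 1 \<le> (1 + 2 powr s * V) * 1 + 2 powr s * (c * (\<gamma> * E powr (1/2)) powr s) * (y + 1) powr (s/2)"
        by (simp add: algebra_simps)
      also have "\<dots> \<le> (1 + 2 powr s * V) * (y + 1) powr (s/2) + 2 powr s * (c * (\<gamma> * E powr (1/2)) powr s) * (y + 1) powr (s/2)"
        using z V by (intro add_right_mono mult_left_mono) auto
      also have "\<dots> = A * (y + 1) powr (s/2)" by (simp add: A_def algebra_simps)
      finally have "(y + 1) * (y + 1) powr (- s/2) \<le> A * (y + 1) powr (s/2) * (y + 1) powr (- s/2)"
        by (rule mult_right_mono) simp
      then have "(y + 1) powr (1 - s/2) \<le> A"
      proof -
        assume le: "(y + 1) * (y + 1) powr (- s/2) \<le> A * (y + 1) powr (s/2) * (y + 1) powr (- s/2)"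
        have "(y + 1) powr (1 - s/2) = (y + 1) * (y + 1) powr (- s/2)"
          using y powr_add[of "y+1" 1 "-s/2"] by simp
        moreover have "(y + 1) powr (s/2) * (y + 1) powr (- s/2) = 1"
          using y by (simp add: powr_add[symmetric])
        ultimately show "(y + 1) powr (1 - s/2) \<le> A" using le by (simp only: mult.assoc mult_1_right)
      qed
      then have "((y + 1) powr (1 - s/2)) powr (2 / (2 - s)) \<le> A powr (2 / (2 - s))" using s2 by (intro powr_mono2) auto
      moreover have "(1 - s/2) * (2 / (2 - s)) = 1" using s2 by (simp add: field_simps)
      ultimately have "y + 1 \<le> A powr (2 / (2 - s))" using y by (simp only: powr_powr powr_one)
      then show "(\<integral>\<^sup>+x. ennreal ((1 + (\<phi> x)^2) powr (m/2)) \<partial>lebesgue_on \<Omega>) \<le> ennreal (A powr (2 / (2 - s)))"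
        unfolding X_def[symmetric] y(1) by (intro ennreal_leI) simp
    qed simp
  qed
  with \<theta> show ?thesis by blast
qed

text \<open>Pass to the limit from the test functions. The weighted energies converge because the weight is a bounded continuous
  function of \<open>u\<close>, and Fatou's lemma preserves the bound.\<close>

lemma power_estimate:
  assumes N: "CARD('n::finite) \<ge> 2" and m: "m > 0" "m * (real CARD('n) - 2) < real CARD('n)" and V: "V \<ge> 0"
    and R: "R \<ge> 0" and lo: "lo > 0"
  shows "\<exists>C\<ge>0. \<forall>(\<Omega>::(real^'n) set) u G. measure lebesgue \<Omega> = V \<longrightarrow> energy_class \<Omega> R lo u G \<longrightarrow>
     (\<integral>\<^sup>+x. ennreal ((1 + (u x)^2) powr (m/2)) \<partial>lebesgue_on \<Omega>) \<le> ennreal C"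
proof -
  obtain \<theta> where \<theta>: "1 < \<theta>" "\<theta> \<le> 2" and T: "\<And>E. E > 0 \<Longrightarrow> \<exists>C\<ge>0. \<forall>(\<Omega>::(real^'n) set) \<phi>. bounded_domain \<Omega> \<longrightarrow> measure lebesgue \<Omega> = V \<longrightarrow>
     \<phi> \<in> test_functions \<Omega> \<longrightarrow>
     (\<integral>\<^sup>+x. ennreal (weight \<theta> (\<phi> x) * norm (grad \<phi> x)^2) \<partial>lebesgue_on \<Omega>) \<le> ennreal E \<longrightarrow>
     (\<integral>\<^sup>+x. ennreal ((1 + (\<phi> x)^2) powr (m/2)) \<partial>lebesgue_on \<Omega>) \<le> ennreal C"
    using test_function_power_estimate[OF N m V] by blast
  define E where "E = 2 * R / ((\<theta> - 1) * lo)"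
  have E: "E \<ge> 0" using R lo \<theta> by (simp add: E_def)
  have E4: "4 * (E + 1) > 0" using E by simp
  obtain C where C: "C \<ge> 0" "\<And>(\<Omega>::(real^'n) set) \<phi>. bounded_domain \<Omega> \<Longrightarrow> measure lebesgue \<Omega> = V \<Longrightarrow>
     \<phi> \<in> test_functions \<Omega> \<Longrightarrow>
     (\<integral>\<^sup>+x. ennreal (weight \<theta> (\<phi> x) * norm (grad \<phi> x)^2) \<partial>lebesgue_on \<Omega>) \<le> ennreal (4 * (E + 1)) \<Longrightarrow>
     (\<integral>\<^sup>+x. ennreal ((1 + (\<phi> x)^2) powr (m/2)) \<partial>lebesgue_on \<Omega>) \<le> ennreal C"
    using T[OF E4] by blast
  show ?thesis
  proof (intro exI[of _ C] conjI allI impI C(1))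
    fix \<Omega> :: "(real^'n) set" and u G
    assume V': "measure lebesgue \<Omega> = V" and en: "energy_class \<Omega> R lo u G"
    have bd: "bounded_domain \<Omega>" using en by (simp add: energy_class_def)
    interpret bounded_domain \<Omega> by (rule bd)
    obtain \<phi> where "approx 2 \<phi> u G" using energy_classD(1)[OF en] by blast
    from approx_AE_subseq[OF this] obtain \<psi> where a: "approx 2 \<psi> u G" and ae: "AE x in M. (\<lambda>k. \<psi> k x) \<longlonglongrightarrow> u x"
      by auto
    note [measurable] = approxD(1,2,6,7)[OF a]
    let ?w = "\<lambda>t. weight (\<theta>/2) t"
    have ww: "norm (?w t *\<^sub>R g) powr 2 = weight \<theta> t * norm g ^ 2" for t and g :: "real^'n"
    proof -
      have "norm (?w t *\<^sub>R g) powr 2 = norm (?w t *\<^sub>R g) ^ 2" by simp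
      also have "\<dots> = (?w t)^2 * norm g ^2" by (simp add: power_mult_distrib)
      also have "(?w t)^2 = ?w t powr 2" using weight_pos[of "\<theta>/2" t] by simp
      also have "\<dots> = weight \<theta> t" by (simp add: weight_def powr_powr)
      finally show ?thesis .
    qed
    have lim: "(\<lambda>k. Lmod M 2 (\<lambda>x. ?w (\<psi> k x) *\<^sub>R grad (\<psi> k) x - ?w (u x) *\<^sub>R G x)) \<longlonglongrightarrow> 0"
    proof (rule approx_compose_gradient[OF a _ ae, of ?w 1])
      show "continuous_on UNIV ?w" unfolding weight_def by (rule continuous_powr_one_plus_square)
      show "\<bar>?w t\<bar> \<le> 1" for t using weight_pos[of "\<theta>/2" t] weight_le_1[of "\<theta>/2" t] \<theta> by simp
    qed simp
    have wE: "Lmod M 2 (\<lambda>x. ?w (u x) *\<^sub>R G x) \<le> ennreal E"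
      using energy_classD(4)[OF en \<theta>] unfolding Lmod_def ww E_def .
    have "eventually (\<lambda>k. Lmod M 2 (\<lambda>x. ?w (\<psi> k x) *\<^sub>R grad (\<psi> k) x - ?w (u x) *\<^sub>R G x) \<le> ennreal 1) sequentially"
      by (rule lim[unfolded ennreal_tendsto_0_iff, rule_format]) simp
    then have ev: "eventually (\<lambda>k. Lmod M (m/2) (\<lambda>x. 1 + (\<psi> k x)^2) \<le> ennreal C) sequentially"
    proof eventually_elim
      case (elim k)
      have "Lmod M 2 (\<lambda>x. ?w (\<psi> k x) *\<^sub>R grad (\<psi> k) x) \<le> ennreal (2 powr 2) *
          (Lmod M 2 (\<lambda>x. ?w (\<psi> k x) *\<^sub>R grad (\<psi> k) x - ?w (u x) *\<^sub>R G x) + Lmod M 2 (\<lambda>x. ?w (u x) *\<^sub>R G x))"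
        using Lmod_add[of "\<lambda>x. ?w (\<psi> k x) *\<^sub>R grad (\<psi> k) x - ?w (u x) *\<^sub>R G x" M "\<lambda>x. ?w (u x) *\<^sub>R G x" 2] by simp
      also have "\<dots> \<le> ennreal (2 powr 2) * (ennreal 1 + ennreal E)" by (intro mult_left_mono add_mono elim wE) simp
      also have "\<dots> = ennreal (4 * (E + 1))"
      proof -
        have "ennreal (2 powr 2) * (ennreal 1 + ennreal E) = ennreal (2 powr 2 * (1 + E))"
          using E by (simp only: ennreal_mult' ennreal_plus zero_le_one powr_ge_zero)
        then show ?thesis by (simp add: add.commute)
      qed
      finally have "(\<integral>\<^sup>+x. ennreal (weight \<theta> (\<psi> k x) * norm (grad (\<psi> k) x)^2) \<partial>M) \<le> ennreal (4 * (E + 1))"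
        unfolding Lmod_def ww .
      from C(2)[OF bd V' approxD(3)[OF a] this] show ?case
        unfolding Lmod_def using one_plus_square_pos by (simp add: abs_of_pos)
    qed
    have "Lmod M (m/2) (\<lambda>x. 1 + (u x)^2) \<le> ennreal C"
    proof (rule Lmod_Fatou[OF _ _ _ ev])
      show "AE x in M. (\<lambda>k. 1 + (\<psi> k x)^2) \<longlonglongrightarrow> 1 + (u x)^2"
        using ae by eventually_elim (intro tendsto_intros)
    qed (use m in \<open>measurable, simp\<close>)
    then show "(\<integral>\<^sup>+x. ennreal ((1 + (u x)^2) powr (m/2)) \<partial>lebesgue_on \<Omega>) \<le> ennreal C"
      unfolding Lmod_def using one_plus_square_pos by (simp add: abs_of_pos)
  qed
qed

lemma abs_powr_le_one_plus_square_powr: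
  fixes t :: real assumes "m > 0" shows "\<bar>t\<bar> powr m \<le> (1 + t^2) powr (m/2)"
proof -
  have "t^2 = \<bar>t\<bar> powr 2" by (cases "t = 0") auto
  then have "(t^2) powr (m/2) = (\<bar>t\<bar> powr 2) powr (m/2)" by (simp only:)
  then have "\<bar>t\<bar> powr m = (t^2) powr (m/2)" unfolding powr_powr by simp
  also have "\<dots> \<le> (1 + t^2) powr (m/2)" using assms by (intro powr_mono2) auto
  finally show ?thesis .
qed

lemma (in bounded_domain) energy_class_Lmod_bounded:
  assumes N: "CARD('n) \<ge> 2" and m: "m > 0" "m * (real CARD('n) - 2) < real CARD('n)" and R: "R \<ge> 0" and lo: "lo > 0"
  shows "\<exists>C\<ge>0. \<forall>u G. energy_class \<Omega> R lo u G \<longrightarrow> Lmod M m u \<le> ennreal C"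
proof -
  obtain C where C: "C \<ge> 0" "\<And>(\<Omega>'::(real^'n) set) u G. measure lebesgue \<Omega>' = measure lebesgue \<Omega> \<Longrightarrow> energy_class \<Omega>' R lo u G \<Longrightarrow>
     (\<integral>\<^sup>+x. ennreal ((1 + (u x)^2) powr (m/2)) \<partial>lebesgue_on \<Omega>') \<le> ennreal C"
    using power_estimate[OF N m measure_nonneg[of lebesgue \<Omega>] R lo] by blast
  have "Lmod M m u \<le> ennreal C" if "energy_class \<Omega> R lo u G" for u G
    unfolding Lmod_def using abs_powr_le_one_plus_square_powr[OF m(1)]
    by (intro order_trans[OF nn_integral_mono C(2)[OF refl that]] ennreal_leI) auto
  with C(1) show ?thesis by blast
qed

text \<open>Write \<open>\<bar>H\<bar> powr q\<close> as the geometric mean, with exponents \<open>q/2\<close> and \<open>1 - q/2\<close>, of the weighted square and a power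
  of \<open>1 + S\<^sup>2\<close>. The function \<open>S\<close> in the weight is unrelated to \<open>H\<close>: it is the solution itself in \<open>gradient_estimate\<close>, and
  a common bound of a whole sequence in \<open>convex_combinations_converge\<close>.\<close>

lemma (in bounded_domain) weighted_gradient_bound:
  assumes \<theta>: "0 < q" "q < 2" and [measurable]: "S \<in> borel_measurable M" "H \<in> borel_measurable M"
    and E: "(\<integral>\<^sup>+x. ennreal (weight \<theta> (S x) * norm (H x)^2) \<partial>M) \<le> ennreal E" "E \<ge> 0"
    and A: "(\<integral>\<^sup>+x. ennreal ((1 + (S x)^2) powr (\<theta> * q / (2 - q) / 2)) \<partial>M) \<le> ennreal A" "A \<ge> 0"
  shows "Lmod M q H \<le> ennreal (E powr (q/2) * A powr (1 - q/2))"
proof -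
  let ?m = "\<theta> * q / (2 - q)"
  have "(\<integral>\<^sup>+x. ennreal ((weight \<theta> (S x) * norm (H x)^2) powr (q/2) * ((1 + (S x)^2) powr (?m/2)) powr (1 - q/2)) \<partial>M)
     \<le> ennreal (E powr (q/2) * A powr (1 - q/2))"
  proof (rule nn_integral_Holder)
    show "weight \<theta> (S x) * norm (H x)^2 \<ge> 0" for x using weight_pos[of \<theta> "S x"] by simp
  qed (use \<theta> E A in auto)
  also have "(\<lambda>x. (weight \<theta> (S x) * norm (H x)^2) powr (q/2) * ((1 + (S x)^2) powr (?m/2)) powr (1 - q/2)) = (\<lambda>x. norm (H x) powr q)"
  proof
    fix x
    let ?r = "1 + (S x)^2"
    have r: "?r > 0" by (rule one_plus_square_pos)
    have "?m/2 * (1 - q/2) = \<theta> * q / 4" using \<theta> by (simp add: field_simps)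
    then have e: "(?r powr (?m/2)) powr (1 - q/2) = ?r powr (\<theta> * q / 4)" by (simp only: powr_powr)
    have "(norm (H x)^2) powr (q/2) = norm (H x) powr q"
      by (cases "norm (H x) = 0") (simp_all add: powr_powr flip: powr_numeral)
    then have "(weight \<theta> (S x) * norm (H x)^2) powr (q/2) = ?r powr (- (\<theta> * q / 4)) * norm (H x) powr q"
      by (simp add: weight_def powr_mult powr_powr)
    moreover have "?r powr (- (\<theta> * q / 4)) * ?r powr (\<theta> * q / 4) = 1" using r by (simp flip: powr_add)
    ultimately show "(weight \<theta> (S x) * norm (H x)^2) powr (q/2) * (?r powr (?m/2)) powr (1 - q/2) = norm (H x) powr q"
      unfolding e by (simp add: mult_ac)
  qed
  finally show ?thesis by (simp add: Lmod_def)
qed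

lemma gradient_estimate:
  assumes N: "CARD('n::finite) \<ge> 2" and q: "1 \<le> q" "q * (real CARD('n) - 1) < real CARD('n)" and V: "V \<ge> 0"
    and R: "R \<ge> 0" and lo: "lo > 0"
  shows "\<exists>C\<ge>0. \<forall>(\<Omega>::(real^'n) set) u G. measure lebesgue \<Omega> = V \<longrightarrow> energy_class \<Omega> R lo u G \<longrightarrow>
     Lmod (lebesgue_on \<Omega>) q G \<le> ennreal C"
proof -
  obtain \<theta> where \<theta>: "1 < \<theta>" "\<theta> \<le> 2" "q \<le> \<theta> * q / (2 - q)" "\<theta> * q / (2 - q) * (real CARD('n) - 2) < real CARD('n)"
    using weight_exponent[OF N q] by blast
  have m: "\<theta> * q / (2 - q) > 0" using \<theta>(3) q by linarith
  obtain Cm where Cm: "Cm \<ge> 0" "\<And>(\<Omega>::(real^'n) set) u G. measure lebesgue \<Omega> = V \<Longrightarrow> energy_class \<Omega> R lo u G \<Longrightarrow>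
     (\<integral>\<^sup>+x. ennreal ((1 + (u x)^2) powr (\<theta> * q / (2 - q) / 2)) \<partial>lebesgue_on \<Omega>) \<le> ennreal Cm"
    using power_estimate[OF N m \<theta>(4) V R lo] by blast
  define E where "E = 2 * R / ((\<theta> - 1) * lo)"
  have E: "E \<ge> 0" using R lo \<theta> by (simp add: E_def)
  show ?thesis
  proof (intro exI[of _ "E powr (q/2) * Cm powr (1 - q/2)"] conjI allI impI)
    fix \<Omega> :: "(real^'n) set" and u G
    assume V': "measure lebesgue \<Omega> = V" and en: "energy_class \<Omega> R lo u G"
    interpret bounded_domain \<Omega> using en by (simp add: energy_class_def)
    show "Lmod (lebesgue_on \<Omega>) q G \<le> ennreal (E powr (q/2) * Cm powr (1 - q/2))"
      by (rule weighted_gradient_bound[OF _ subcritical_exponent_less_2[OF N q(2)] energy_classD(2,3)[OF en] _ E Cm(2)[OF V' en] Cm(1)])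
         (use energy_classD(4)[OF en \<theta>(1,2)] q in \<open>auto simp: E_def\<close>)
  qed (use E Cm in auto)
qed

text \<open>The regularising term is of order \<open>\<epsilon> powr (1/p)\<close> in \<open>L\<^sup>1\<close>, by Hoelder's inequality with the exponents \<open>p / (p - 1)\<close>
  for the regularising energy and \<open>p\<close> for the rest. The remaining powers of \<open>1 + u\<^sup>2\<close> are collected with the decay of \<open>psi'\<close>,
  and they amount to the power \<open>m = \<theta> * (p - 1) - (p - 2)\<close> of \<open>u\<close>. Since \<open>m\<close> tends to \<open>1\<close> with \<open>\<theta>\<close>, it is subcritical
  for \<open>\<theta>\<close> close to \<open>1\<close>.\<close>

lemma (in bounded_domain) regularising_term_bound:
  assumes N: "CARD('n) \<ge> 2" and p: "p > 2" and R: "R \<ge> 0" and lo: "lo > 0"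
  shows "\<exists>C\<ge>0. \<forall>\<epsilon> u G. 0 < \<epsilon> \<longrightarrow> energy_class \<Omega> R lo u G \<longrightarrow>
     (\<forall>\<theta>. 1 < \<theta> \<and> \<theta> \<le> 2 \<longrightarrow> (\<integral>\<^sup>+x. ennreal (\<epsilon> * psi' (u x) powr (p - 2) * weight \<theta> (u x) * norm (G x) powr p) \<partial>M) \<le> ennreal (2 * R / (\<theta> - 1))) \<longrightarrow>
     (\<integral>\<^sup>+x. ennreal (\<epsilon> * psi' (u x) powr (p - 2) * norm (G x) powr (p - 1)) \<partial>M) \<le> ennreal (C * \<epsilon> powr (1/p))"
proof -
  let ?N = "real CARD('n)"
  have A: "0 \<le> (p - 1) * (?N - 2)" using p N by simp
  have "(p - 1) * (?N - 2) < ?N + (p - 2) * (?N - 2)" by (simp add: algebra_simps)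
  from exponent_above_one[OF A this] obtain \<theta> where \<theta>: "1 < \<theta>" "\<theta> \<le> 2" "\<theta> * ((p - 1) * (?N - 2)) < ?N + (p - 2) * (?N - 2)" by blast
  define m where "m = \<theta> * (p - 1) - (p - 2)"
  have "1 * (p - 1) \<le> \<theta> * (p - 1)" using \<theta> p by (intro mult_right_mono) auto
  then have m: "m > 0" "m * (?N - 2) < ?N" using \<theta> by (auto simp: m_def algebra_simps)
  obtain Cm where Cm: "Cm \<ge> 0" "\<And>u G. energy_class \<Omega> R lo u G \<Longrightarrow> (\<integral>\<^sup>+x. ennreal ((1 + (u x)^2) powr (m/2)) \<partial>M) \<le> ennreal Cm"
    using power_estimate[OF N m measure_nonneg[of lebesgue \<Omega>] R lo] by blast
  define D where "D = 2 * R / (\<theta> - 1)"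
  have D: "D \<ge> 0" using R \<theta> by (simp add: D_def)
  show ?thesis
  proof (intro exI[of _ "D powr ((p-1)/p) * Cm powr (1/p)"] conjI allI impI)
    fix \<epsilon> :: real and u G
    assume \<epsilon>: "0 < \<epsilon>" and en: "energy_class \<Omega> R lo u G"
      and reg: "\<forall>\<theta>. 1 < \<theta> \<and> \<theta> \<le> 2 \<longrightarrow> (\<integral>\<^sup>+x. ennreal (\<epsilon> * psi' (u x) powr (p - 2) * weight \<theta> (u x) * norm (G x) powr p) \<partial>M) \<le> ennreal (2 * R / (\<theta> - 1))"
    note [measurable] = energy_classD(2,3)[OF en]
    let ?f = "\<lambda>x. \<epsilon> * psi' (u x) powr (p - 2) * weight \<theta> (u x) * norm (G x) powr p" and ?g = "\<lambda>x. (1 + (u x)^2) powr (m/2)"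
    have "(\<integral>\<^sup>+x. ennreal (?f x powr ((p-1)/p) * ?g x powr (1/p)) \<partial>M) \<le> ennreal (D powr ((p-1)/p) * Cm powr (1/p))"
    proof (rule nn_integral_Holder)
      show "(\<integral>\<^sup>+x. ennreal (?f x) \<partial>M) \<le> ennreal D" using reg \<theta> unfolding D_def by blast
      show "(\<integral>\<^sup>+x. ennreal (?g x) \<partial>M) \<le> ennreal Cm" by (rule Cm(2)[OF en])
      show "?f x \<ge> 0" for x using \<epsilon> weight_pos[of \<theta> "u x"] by simp
      show "(p - 1) / p + 1 / p = 1" using p by (simp add: field_simps)
    qed (use p D Cm in auto)
    note H = this
    have pt: "\<epsilon> * psi' (u x) powr (p - 2) * norm (G x) powr (p - 1) \<le> \<epsilon> powr (1/p) * (?f x powr ((p-1)/p) * ?g x powr (1/p))" for x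
    proof -
      let ?r = "1 + (u x)^2" and ?P = "psi' (u x)"
      have r: "?r > 0" by (rule one_plus_square_pos)
      have P: "?P > 0" "?P \<le> weight 1 (u x)" using psi'_bounds by auto
      have "?P powr (p - 2) \<le> weight 1 (u x) powr (p - 2)" using P p by (intro powr_mono2) auto
      also have "\<dots> = ?r powr (- (p - 2) / 2)" 
      proof -
        have "- 1 / 2 * (p - 2) = - (p - 2) / 2" by (simp add: field_simps)
        then show ?thesis unfolding weight_def powr_powr by (simp only:)
      qed
      also have "- (p - 2) / 2 = - \<theta> / 2 * (p - 1) + m / 2" by (simp add: m_def field_simps)
      also have "?r powr (- \<theta> / 2 * (p - 1) + m / 2) = weight \<theta> (u x) powr (p - 1) * ?g x"
        unfolding powr_add weight_def powr_powr ..
      finally have "(?P powr (p - 2)) powr (1/p) \<le> (weight \<theta> (u x) powr (p - 1) * ?g x) powr (1/p)"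
        using p by (intro powr_mono2) auto
      then have k: "?P powr ((p - 2) / p) \<le> weight \<theta> (u x) powr ((p - 1)/p) * ?g x powr (1/p)"
        by (simp add: powr_mult powr_powr)
      have "?f x powr ((p-1)/p) = \<epsilon> powr ((p-1)/p) * ?P powr ((p-2) * ((p-1)/p)) * weight \<theta> (u x) powr ((p-1)/p) * norm (G x) powr (p - 1)"
        using p by (simp add: powr_mult powr_powr)
      then have "\<epsilon> powr (1/p) * (?f x powr ((p-1)/p) * ?g x powr (1/p))
         = (\<epsilon> powr (1/p) * \<epsilon> powr ((p-1)/p)) * ?P powr ((p-2) * ((p-1)/p)) * (weight \<theta> (u x) powr ((p-1)/p) * ?g x powr (1/p)) * norm (G x) powr (p - 1)"
        by (simp only: mult_ac)
      also have "\<epsilon> powr (1/p) * \<epsilon> powr ((p-1)/p) = \<epsilon>"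
        using \<epsilon> p by (simp add: powr_add[symmetric] add_divide_distrib[symmetric])
      finally have eq: "\<epsilon> powr (1/p) * (?f x powr ((p-1)/p) * ?g x powr (1/p))
         = \<epsilon> * ?P powr ((p-2) * ((p-1)/p)) * (weight \<theta> (u x) powr ((p-1)/p) * ?g x powr (1/p)) * norm (G x) powr (p - 1)" .
      have ex: "(p-2) * ((p-1)/p) + (p-2)/p = p - 2" using p by (simp add: field_simps)
      have "?P powr (p - 2) = ?P powr ((p-2) * ((p-1)/p)) * ?P powr ((p-2)/p)"
        unfolding powr_add[symmetric] ex ..
      then have "\<epsilon> * ?P powr (p - 2) * norm (G x) powr (p - 1) = \<epsilon> * ?P powr ((p-2) * ((p-1)/p)) * ?P powr ((p-2)/p) * norm (G x) powr (p - 1)" by simp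
      also have "\<dots> \<le> \<epsilon> * ?P powr ((p-2) * ((p-1)/p)) * (weight \<theta> (u x) powr ((p-1)/p) * ?g x powr (1/p)) * norm (G x) powr (p - 1)"
        using \<epsilon> by (intro mult_right_mono mult_left_mono k) auto
      finally show ?thesis unfolding eq .
    qed
    have "(\<integral>\<^sup>+x. ennreal (\<epsilon> * psi' (u x) powr (p - 2) * norm (G x) powr (p - 1)) \<partial>M) \<le> (\<integral>\<^sup>+x. ennreal (\<epsilon> powr (1/p)) * ennreal (?f x powr ((p-1)/p) * ?g x powr (1/p)) \<partial>M)"
      using pt by (intro nn_integral_mono) (simp add: ennreal_mult'[symmetric] ennreal_leI)
    also have "\<dots> = ennreal (\<epsilon> powr (1/p)) * (\<integral>\<^sup>+x. ennreal (?f x powr ((p-1)/p) * ?g x powr (1/p)) \<partial>M)"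
      by (rule nn_integral_cmult) measurable
    also have "\<dots> \<le> ennreal (\<epsilon> powr (1/p)) * ennreal (D powr ((p-1)/p) * Cm powr (1/p))" by (rule mult_left_mono[OF H]) simp
    also have "\<dots> = ennreal (D powr ((p-1)/p) * Cm powr (1/p) * \<epsilon> powr (1/p))" by (simp add: ennreal_mult'[symmetric] mult.commute)
    finally show "(\<integral>\<^sup>+x. ennreal (\<epsilon> * psi' (u x) powr (p - 2) * norm (G x) powr (p - 1)) \<partial>M) \<le> ennreal (D powr ((p-1)/p) * Cm powr (1/p) * \<epsilon> powr (1/p))" .
  qed simp
qed

section \<open>Weak convergence through convex combinations\<close>

text \<open>The bounded linear functionals on \<open>W1_0 \<Omega> q\<close> are known through linearity and boundedness only, so weak convergence
  is shown as in Mazur's lemma: suitable convex combinations of the given functions converge strongly, which contradicts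
  any separation of the functions from their limit by a functional. The convex combinations arise from iterated
  midpoints, for which the parallelogram identity is made.\<close>

inductive_set midpoint_hull :: "(('a \<Rightarrow> real) \<times> ('a \<Rightarrow> 'b::real_vector)) set \<Rightarrow> (('a \<Rightarrow> real) \<times> ('a \<Rightarrow> 'b)) set"
  for S :: "(('a \<Rightarrow> real) \<times> ('a \<Rightarrow> 'b)) set" where
  base: "x \<in> S \<Longrightarrow> x \<in> midpoint_hull S"
| mid: "(v, H) \<in> midpoint_hull S \<Longrightarrow> (w, K) \<in> midpoint_hull S \<Longrightarrow>
    (\<lambda>x. (1/2) * (v x + w x), \<lambda>x. (1/2) *\<^sub>R (H x + K x)) \<in> midpoint_hull S"

lemma midpoint_hull_mono:
  assumes "S \<subseteq> T" shows "midpoint_hull S \<subseteq> midpoint_hull T"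
proof
  fix x assume "x \<in> midpoint_hull S"
  then show "x \<in> midpoint_hull T"
  proof induction
    case (mid v H w K)
    show ?case by (rule midpoint_hull.mid[OF mid.IH])
  qed (use assms in \<open>auto intro: midpoint_hull.base\<close>)
qed

text \<open>Convexity of the power function at midpoints: Young's inequality applied to \<open>a / c\<close> and \<open>b / c\<close>, where \<open>c\<close> is the
  midpoint.\<close>

lemma midpoint_powr_le:
  fixes a b :: real assumes "a \<ge> 0" "b \<ge> 0" "q \<ge> 1"
  shows "((1/2) * (a + b)) powr q \<le> (a powr q + b powr q) / 2"
proof (cases "q = 1 \<or> a + b = 0")
  case True then show ?thesis using assms by auto
next
  case False
  then have q: "q > 1" and ab: "a + b > 0" using assms by auto
  define c where "c = (1/2) * (a + b)"
  have c: "c > 0" using ab by (simp add: c_def)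
  have Y: "t / c \<le> (t / c) powr q / q + (1 - 1/q)" if "t \<ge> 0" for t
    using Youngs_inequality[of q "q/(q-1)" "t / c" 1] q that c by (simp add: field_simps)
  have "a / c + b / c = (a + b) / c" by (simp add: add_divide_distrib)
  also have "(a + b) / c = 2"
  proof -
    have "a + b = 2 * c" by (simp add: c_def)
    then show ?thesis using c by simp
  qed
  finally have "2 = a / c + b / c" by simp
  also have "\<dots> \<le> ((a / c) powr q + (b / c) powr q) / q + 2 * (1 - 1/q)" using Y[OF assms(1)] Y[OF assms(2)] by (simp add: add_divide_distrib)
  finally have "2 / q \<le> ((a / c) powr q + (b / c) powr q) / q" by (simp add: algebra_simps)
  then have "2 \<le> (a / c) powr q + (b / c) powr q" using q by (simp add: divide_le_cancel)
  also have "\<dots> = (a powr q + b powr q) / c powr q" using assms c by (simp add: powr_divide add_divide_distrib)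
  finally show ?thesis using c unfolding c_def[symmetric] by (simp add: pos_le_divide_eq)
qed

lemma parallelogram_weighted:
  fixes a b :: "'a::real_inner"
  shows "c * norm (a - b)^2 = 2 * (c * norm a ^2) + 2 * (c * norm b ^2) - 4 * (c * norm ((1/2) *\<^sub>R (a + b)) ^2)"
proof -
  have "norm ((1/2) *\<^sub>R (a + b)) ^2 = (1/4) * norm (a + b)^2" by (simp add: power_mult_distrib power2_eq_square)
  then show ?thesis
    by (simp add: power2_norm_eq_inner inner_add_left inner_add_right inner_diff_left inner_diff_right inner_commute algebra_simps)
qed

lemma nn_integral_cmult_add:
  assumes [measurable]: "f \<in> borel_measurable M" "g \<in> borel_measurable M"
  shows "(\<integral>\<^sup>+x. c * (f x + g x) \<partial>M) = c * (nn_integral M f + nn_integral M g)"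
  by (simp add: nn_integral_cmult nn_integral_add)

lemma weight_antimono: "\<bar>s\<bar> \<le> \<bar>t\<bar> \<Longrightarrow> \<theta> \<ge> 0 \<Longrightarrow> weight \<theta> t \<le> weight \<theta> s"
  unfolding weight_def by (intro powr_mono2') (use one_plus_square_pos in \<open>auto simp: abs_le_square_iff\<close>)

context bounded_domain begin

text \<open>The usual argument for minimising sequences in a Hilbert space: the infima \<open>d j\<close> of the weighted square integrals
  over the decreasing midpoint-convex sets \<open>T j\<close> increase to a limit, and by the parallelogram identity almost
  minimising gradients are close to each other.\<close>

lemma minimal_midpoints_Cauchy:
  fixes T :: "nat \<Rightarrow> ((real^'n \<Rightarrow> real) \<times> (real^'n \<Rightarrow> real^'n)) set" and g :: "real^'n \<Rightarrow> real"
  assumes int: "\<And>v H j. (v, H) \<in> T j \<Longrightarrow> integrable M (\<lambda>x. g x * norm (H x)^2)"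
    and le: "\<And>v H j. (v, H) \<in> T j \<Longrightarrow> (\<integral>x. g x * norm (H x)^2 \<partial>M) \<le> E"
    and mid: "\<And>v H w K j. (v, H) \<in> T j \<Longrightarrow> (w, K) \<in> T j \<Longrightarrow> (\<lambda>x. (1/2) * (v x + w x), \<lambda>x. (1/2) *\<^sub>R (H x + K x)) \<in> T j"
    and anti: "\<And>i j. i \<le> j \<Longrightarrow> T j \<subseteq> T i" and ne: "\<And>j. T j \<noteq> {}" and g: "\<And>x. g x \<ge> 0"
  shows "\<exists>v H. (\<forall>j. (v j, H j) \<in> T j) \<and>
     (\<forall>e>0. \<exists>k. \<forall>i\<ge>k. \<forall>j\<ge>k. integrable M (\<lambda>x. g x * norm (H i x - H j x)^2) \<and> (\<integral>x. g x * norm (H i x - H j x)^2 \<partial>M) \<le> e)"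
proof -
  let ?I = "\<lambda>H::real^'n \<Rightarrow> real^'n. \<integral>x. g x * norm (H x)^2 \<partial>M"
  have I0: "?I H \<ge> 0" for H by (rule integral_nonneg_AE) (use g in auto)
  define d where "d j = (INF z\<in>T j. ?I (snd z))" for j
  have bdd: "bdd_below ((\<lambda>z. ?I (snd z)) ` T j)" for j using I0 by (auto intro!: bdd_belowI[of _ 0])
  have dle: "d j \<le> ?I H" if "(v, H) \<in> T j" for v H j
    unfolding d_def using cINF_lower[OF bdd that] by simp
  have dmono: "d i \<le> d j" if "i \<le> j" for i j
    unfolding d_def by (rule cINF_superset_mono[OF ne bdd anti[OF that]]) simp
  have dE: "d j \<le> E" for j
  proof -
    obtain v H where vH: "(v, H) \<in> T j" using ne[of j] by auto
    show ?thesis using dle[OF vH] le[OF vH] by linarith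
  qed
  have "\<exists>z\<in>T j. ?I (snd z) < d j + 1 / (real j + 1)" for j
    using cInf_lessD[of "(\<lambda>z. ?I (snd z)) ` T j" "d j + 1 / (real j + 1)"] ne[of j] unfolding d_def by auto
  then have "\<forall>j. \<exists>z. z \<in> T j \<and> ?I (snd z) < d j + 1 / (real j + 1)" by blast
  from choice[OF this] obtain z where z: "\<forall>j. z j \<in> T j \<and> ?I (snd (z j)) < d j + 1 / (real j + 1)" ..
  define v H where "v j = fst (z j)" and "H j = snd (z j)" for j
  have vH: "(v j, H j) \<in> T j" "?I (H j) < d j + 1 / (real j + 1)" for j using z by (auto simp: v_def H_def)
  have bda: "bdd_above (range d)" using dE by (auto intro!: bdd_aboveI[of _ E])
  define D where "D = (SUP j. d j)"
  have dD: "d j \<le> D" for j unfolding D_def by (rule cSUP_upper[OF _ bda]) simp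
  have "\<exists>k. \<forall>i\<ge>k. \<forall>j\<ge>k. integrable M (\<lambda>x. g x * norm (H i x - H j x)^2) \<and> (\<integral>x. g x * norm (H i x - H j x)^2 \<partial>M) \<le> e" if e: "e > 0" for e
  proof -
    have "\<exists>k. D - e / 8 < d k" using less_cSUP_iff[OF _ bda, of "D - e/8"] e unfolding D_def by auto
    then obtain k1 where k1: "D - e / 8 < d k1" by blast
    obtain k2 where k2: "1 / (real k2 + 1) < e / 8"
      using reals_Archimedean[of "e/8"] e by (auto simp: inverse_eq_divide add.commute)
    let ?k = "max k1 k2"
    show ?thesis
    proof (intro exI[of _ ?k] allI impI)
      fix i j assume ij: "?k \<le> i" "?k \<le> j"
      let ?m = "\<lambda>x. (1/2) *\<^sub>R (H i x + H j x)"
      have T: "(v i, H i) \<in> T ?k" "(v j, H j) \<in> T ?k" using vH anti[OF ij(1)] anti[OF ij(2)] by auto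
      note m = mid[OF T]
      have up: "?I (H l) < D + e / 8" if "?k \<le> l" for l
      proof -
        have "1 / (real l + 1) \<le> 1 / (real k2 + 1)" using that by (intro divide_left_mono) auto
        then show ?thesis using vH(2)[of l] dD[of l] k2 by linarith
      qed
      have lowm: "D - e / 8 < ?I ?m" using dle[OF m] k1 dmono[of k1 ?k] by simp
      have eq: "(\<lambda>x. g x * norm (H i x - H j x)^2) = (\<lambda>x. 2 * (g x * norm (H i x)^2) + 2 * (g x * norm (H j x)^2) - 4 * (g x * norm (?m x)^2))"
        by (rule ext) (rule parallelogram_weighted)
      note ints = int[OF T(1)] int[OF T(2)] int[OF m]
      have "integrable M (\<lambda>x. g x * norm (H i x - H j x)^2)" unfolding eq using ints by (intro Bochner_Integration.integrable_diff Bochner_Integration.integrable_add integrable_mult_right)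
      moreover have "(\<integral>x. g x * norm (H i x - H j x)^2 \<partial>M) = 2 * ?I (H i) + 2 * ?I (H j) - 4 * ?I ?m"
        unfolding eq using ints by simp
      moreover have "2 * ?I (H i) + 2 * ?I (H j) - 4 * ?I ?m \<le> e" using up[OF ij(1)] up[OF ij(2)] lowm by linarith
      ultimately show "integrable M (\<lambda>x. g x * norm (H i x - H j x)^2) \<and> (\<integral>x. g x * norm (H i x - H j x)^2 \<partial>M) \<le> e" by simp
    qed
  qed
  with vH(1) show ?thesis by blast
qed

text \<open>The weights \<open>weight \<theta> (u k)\<close> in the energy bounds vary with \<open>k\<close>. Along a subsequence that converges fast in
  \<open>L\<^sup>m\<close> all \<open>\<bar>u k\<bar>\<close> are dominated by one function \<open>S\<close> of class \<open>L\<^sup>m\<close>, so that the fixed weight \<open>weight \<theta> S\<close> may be used.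
  Then the gradients are bounded in one Hilbert space, and convergence there implies convergence in \<open>L\<^sup>q\<close> by Hoelder's
  inequality. The functions \<open>D j\<close> dominate \<open>\<bar>v - U\<bar> powr m\<close> for every element \<open>v\<close> of the hull of the tail from \<open>j\<close> on.\<close>

lemma convex_combinations_converge:
  assumes N: "CARD('n) \<ge> 2" and q: "1 \<le> q" "q * (real CARD('n) - 1) < real CARD('n)" and R: "R \<ge> 0" and lo: "lo > 0"
    and en: "\<And>k::nat. energy_class \<Omega> R lo (u k) (G k)"
    and U[measurable]: "U \<in> borel_measurable M"
    and conv: "\<And>m. 1 \<le> m \<Longrightarrow> m * (real CARD('n) - 2) < real CARD('n) \<Longrightarrow> (\<lambda>k. Lmod M m (\<lambda>x. u k x - U x)) \<longlonglongrightarrow> 0"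
  shows "\<exists>v H G'. (\<forall>j. (v j, H j) \<in> midpoint_hull (range (\<lambda>k. (u k, G k)))) \<and> G' \<in> borel_measurable M \<and>
     (\<lambda>j. Lmod M q (\<lambda>x. v j x - U x)) \<longlonglongrightarrow> 0 \<and> (\<lambda>j. Lmod M q (\<lambda>x. H j x - G' x)) \<longlonglongrightarrow> 0"
proof -
  let ?N = "real CARD('n)"
  note meas[measurable] = energy_classD(2,3)[OF en]
  note q2 = subcritical_exponent_less_2[OF N q(2)]
  obtain \<theta> where \<theta>: "1 < \<theta>" "\<theta> \<le> 2" and m0: "q \<le> \<theta> * q / (2 - q)" "\<theta> * q / (2 - q) * (?N - 2) < ?N"
    using weight_exponent[OF N q] by blast
  define m where "m = \<theta> * q / (2 - q)"
  have mq: "q \<le> m" and mN: "m * (?N - 2) < ?N" using m0 by (simp_all add: m_def)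
  have m1: "m \<ge> 1" "m > 0" using mq q by auto
  have "eventually (\<lambda>n. Lmod M m (\<lambda>x. u n x - U x) \<le> ennreal ((1/2)^k)) sequentially" for k :: nat
    using conv[OF m1(1) mN] unfolding ennreal_tendsto_0_iff by auto
  from subseq_eventually[of "\<lambda>k n. Lmod M m (\<lambda>x. u n x - U x) \<le> ennreal ((1/2)^k)", OF this]
  obtain r :: "nat \<Rightarrow> nat" where r: "strict_mono r" "\<And>k. Lmod M m (\<lambda>x. u (r k) x - U x) \<le> ennreal ((1/2)^k)" by blast
  define D where "D j x = (\<Sum>k. ennreal (norm (u (r (k + j)) x - U x) powr m))" for j x
  have Dm[measurable]: "D j \<in> borel_measurable M" for j unfolding D_def by measurable
  have Dint: "(\<integral>\<^sup>+x. D j x \<partial>M) \<le> ennreal (2 * (1/2)^j)" for j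
  proof -
    have "(\<integral>\<^sup>+x. D j x \<partial>M) = (\<Sum>k. Lmod M m (\<lambda>x. u (r (k + j)) x - U x))"
      unfolding D_def Lmod_def by (rule nn_integral_suminf) measurable
    also have "\<dots> \<le> (\<Sum>k. ennreal ((1/2)^(k + j)))" by (intro suminf_le r(2)) auto
    also have "\<dots> = ennreal (\<Sum>k. (1/2)^(k + j))"
      by (rule suminf_ennreal2) (auto simp: power_add intro!: summable_mult2 summable_geometric)
    also have "(\<Sum>k. (1/2::real)^(k + j)) = 2 * (1/2)^j"
      using suminf_mult2[of "\<lambda>k. (1/2::real)^k" "(1/2)^j"] by (simp add: power_add suminf_geometric summable_geometric)
    finally show ?thesis .
  qed
  have Dfin: "AE x in M. D 0 x \<noteq> \<infinity>"
    by (rule nn_integral_noteq_infinite) (use Dint[of 0] in \<open>auto simp: top_unique\<close>)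
  \<comment> \<open>The common bound of the functions \<open>\<bar>u (r k)\<bar>\<close>; replacing \<open>u (r k)\<close> by it in the weight preserves the energy bounds.\<close>
  define S where "S x = \<bar>U x\<bar> + enn2real (D 0 x) powr (1/m)" for x
  have Sm[measurable]: "S \<in> borel_measurable M" unfolding S_def by measurable
  have uD: "ennreal (norm (u (r k) x - U x) powr m) \<le> D j x" if "j \<le> k" for k j x
  proof -
    have "(\<Sum>i\<in>{k - j}. ennreal (norm (u (r (i + j)) x - U x) powr m)) \<le> D j x"
      unfolding D_def by (rule sum_le_suminf) auto
    then show ?thesis using that by simp
  qed
  have uS: "AE x in M. \<forall>k. \<bar>u (r k) x\<bar> \<le> \<bar>S x\<bar>"
    using Dfin
  proof eventually_elim
    case (elim x)
    show ?case
    proof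
      fix k
      have "ennreal (norm (u (r k) x - U x) powr m) \<le> ennreal (enn2real (D 0 x))" using uD[of 0 k x] elim by (simp add: less_top)
      then have "norm (u (r k) x - U x) powr m \<le> enn2real (D 0 x)" by simp
      then have "(norm (u (r k) x - U x) powr m) powr (1/m) \<le> enn2real (D 0 x) powr (1/m)" using m1 by (intro powr_mono2) auto
      then have "\<bar>u (r k) x - U x\<bar> \<le> enn2real (D 0 x) powr (1/m)" using m1 by (simp add: powr_powr)
      then show "\<bar>u (r k) x\<bar> \<le> \<bar>S x\<bar>" unfolding S_def by linarith
    qed
  qed
  have finU: "Lmod M m U < \<infinity>"
  proof (rule Lmod_finite_if_tendsto[OF U _ _ m1(2) conv[OF m1(1) mN]])
    show "Lmod M m (u k) < \<infinity>" for k
    proof -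
      obtain C where "Lmod M m (u k) \<le> ennreal C" using energy_class_Lmod_bounded[OF N m1(2) mN R lo] en by blast
      then show ?thesis by (rule le_less_trans) simp
    qed
  qed measurable
  have "(\<integral>\<^sup>+x. ennreal ((1 + (S x)^2) powr (m/2)) \<partial>M) < \<infinity>"
  proof -
    interpret finite_measure M by (rule finite_measure_domain)
    have "(\<integral>\<^sup>+x. ennreal ((1 + (S x)^2) powr (m/2)) \<partial>M) \<le> (\<integral>\<^sup>+x. ennreal (2 powr m) * (1 + ennreal (2 powr m) * (ennreal (norm (U x) powr m) + D 0 x)) \<partial>M)"
    proof (rule nn_integral_mono_AE, use Dfin in eventually_elim)
      fix x assume f: "D 0 x \<noteq> \<infinity>"
      have S0: "S x \<ge> 0" by (simp add: S_def)
      have "(1 + (S x)^2) powr (m/2) \<le> ((1 + S x)^2) powr (m/2)" using S0 m1 by (intro powr_mono2) (auto simp: power2_eq_square algebra_simps)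
      also have "\<dots> = (1 + S x) powr m" using S0 by (simp add: powr_powr flip: powr_numeral)
      also have "\<dots> \<le> 2 powr m * (1 powr m + S x powr m)" by (rule powr_add_le) (use S0 m1 in auto)
      also have "S x powr m \<le> 2 powr m * (\<bar>U x\<bar> powr m + (enn2real (D 0 x) powr (1/m)) powr m)"
        unfolding S_def by (rule powr_add_le) (use m1 in auto)
      also have "(enn2real (D 0 x) powr (1/m)) powr m = enn2real (D 0 x)" using m1 by (simp add: powr_powr)
      finally have "(1 + (S x)^2) powr (m/2) \<le> 2 powr m * (1 + 2 powr m * (\<bar>U x\<bar> powr m + enn2real (D 0 x)))" by simp
      then have "ennreal ((1 + (S x)^2) powr (m/2)) \<le> ennreal (2 powr m * (1 + 2 powr m * (\<bar>U x\<bar> powr m + enn2real (D 0 x))))" by (rule ennreal_leI)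
      also have "\<dots> = ennreal (2 powr m) * (1 + ennreal (2 powr m) * (ennreal (norm (U x) powr m) + ennreal (enn2real (D 0 x))))"
        by (simp add: ennreal_mult' ennreal_plus)
      finally show "ennreal ((1 + (S x)^2) powr (m/2)) \<le> ennreal (2 powr m) * (1 + ennreal (2 powr m) * (ennreal (norm (U x) powr m) + D 0 x))"
        using f by (simp add: less_top)
    qed
    also have "\<dots> = ennreal (2 powr m) * (emeasure M (space M) + ennreal (2 powr m) * (Lmod M m U + (\<integral>\<^sup>+x. D 0 x \<partial>M)))"
    proof -
      have "(\<integral>\<^sup>+x. ennreal (2 powr m) * (1 + ennreal (2 powr m) * (ennreal (norm (U x) powr m) + D 0 x)) \<partial>M)
        = ennreal (2 powr m) * ((\<integral>\<^sup>+x. 1 \<partial>M) + (\<integral>\<^sup>+x. ennreal (2 powr m) * (ennreal (norm (U x) powr m) + D 0 x) \<partial>M))"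
        by (rule nn_integral_cmult_add) measurable
      also have "(\<integral>\<^sup>+x. ennreal (2 powr m) * (ennreal (norm (U x) powr m) + D 0 x) \<partial>M)
        = ennreal (2 powr m) * (Lmod M m U + (\<integral>\<^sup>+x. D 0 x \<partial>M))"
        unfolding Lmod_def by (rule nn_integral_cmult_add) measurable
      finally show ?thesis by (simp only: nn_integral_const mult_1_left)
    qed
    also have "\<dots> < \<infinity>" using finU Dint[of 0] by (auto simp: ennreal_mult_less_top emeasure_eq_measure intro: le_less_trans)
    finally show ?thesis .
  qed
  then obtain A where A: "(\<integral>\<^sup>+x. ennreal ((1 + (S x)^2) powr (m/2)) \<partial>M) \<le> ennreal A" "A \<ge> 0"
    by (metis enn2real_nonneg ennreal_enn2real infinity_ennreal_def order_refl)
  define E where "E = 2 * R / ((\<theta> - 1) * lo)"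
  have E: "E \<ge> 0" using R lo \<theta> by (simp add: E_def)
  define T where "T j = midpoint_hull ((\<lambda>k. (u (r k), G (r k))) ` {j..})" for j
  let ?g = "\<lambda>x. weight \<theta> (S x)"
  have gpos: "?g x \<ge> 0" for x using weight_pos[of \<theta> "S x"] by simp
  have Tprop: "v \<in> borel_measurable M \<and> H \<in> borel_measurable M \<and> integrable M (\<lambda>x. ?g x * norm (H x)^2) \<and>
      (\<integral>x. ?g x * norm (H x)^2 \<partial>M) \<le> E \<and> (AE x in M. ennreal (norm (v x - U x) powr m) \<le> D j x)"
    if "(v, H) \<in> T j" for v H j
  proof -
    have "fst z \<in> borel_measurable M \<and> snd z \<in> borel_measurable M \<and> integrable M (\<lambda>x. ?g x * norm (snd z x)^2) \<and>
      (\<integral>x. ?g x * norm (snd z x)^2 \<partial>M) \<le> E \<and> (AE x in M. ennreal (norm (fst z x - U x) powr m) \<le> D j x)" if "z \<in> T j" for z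
      using that unfolding T_def
    proof (induction rule: midpoint_hull.induct)
      case (base z)
      then obtain k where k: "k \<ge> j" "z = (u (r k), G (r k))" by auto
      have "(\<integral>\<^sup>+x. ennreal (?g x * norm (G (r k) x)^2) \<partial>M) \<le> (\<integral>\<^sup>+x. ennreal (weight \<theta> (u (r k) x) * norm (G (r k) x)^2) \<partial>M)"
        by (rule nn_integral_mono_AE) (use uS \<theta> in \<open>auto elim!: eventually_mono intro!: ennreal_leI mult_right_mono weight_antimono\<close>)
      also have "\<dots> \<le> ennreal E" using energy_classD(4)[OF en \<theta>] unfolding E_def .
      finally have le: "(\<integral>\<^sup>+x. ennreal (?g x * norm (G (r k) x)^2) \<partial>M) \<le> ennreal E" .
      have i: "integrable M (\<lambda>x. ?g x * norm (G (r k) x)^2)"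
        by (rule integrableI_nonneg) (use gpos le in \<open>auto intro: le_less_trans\<close>)
      have "(\<integral>x. ?g x * norm (G (r k) x)^2 \<partial>M) \<le> E"
        using le nn_integral_eq_integral[OF i] gpos E by simp
      then show ?case using i k uD[of j k] by simp
    next
      case (mid v H w K)
      then have ms[measurable]: "v \<in> borel_measurable M" "H \<in> borel_measurable M" "w \<in> borel_measurable M" "K \<in> borel_measurable M"
        and i: "integrable M (\<lambda>x. ?g x * norm (H x)^2)" "integrable M (\<lambda>x. ?g x * norm (K x)^2)"
        and le: "(\<integral>x. ?g x * norm (H x)^2 \<partial>M) \<le> E" "(\<integral>x. ?g x * norm (K x)^2 \<partial>M) \<le> E"
        and ae: "AE x in M. ennreal (norm (v x - U x) powr m) \<le> D j x" "AE x in M. ennreal (norm (w x - U x) powr m) \<le> D j x"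
        by auto
      let ?m = "\<lambda>x. (1/2) *\<^sub>R (H x + K x)"
      have pt: "?g x * norm (?m x)^2 \<le> (1/2) * (?g x * norm (H x)^2 + ?g x * norm (K x)^2)" for x
      proof -
        have "0 \<le> ?g x * norm (H x - K x)^2" using gpos by simp
        then have "4 * (?g x * norm (?m x)^2) \<le> 2 * (?g x * norm (H x)^2) + 2 * (?g x * norm (K x)^2)"
          using parallelogram_weighted[of "?g x" "H x" "K x"] by linarith
        then show ?thesis unfolding distrib_left by linarith
      qed
      have i2: "integrable M (\<lambda>x. (1/2) * (?g x * norm (H x)^2 + ?g x * norm (K x)^2))" using i by (intro integrable_mult_right Bochner_Integration.integrable_add)
      have im: "integrable M (\<lambda>x. ?g x * norm (?m x)^2)"
      proof (rule Bochner_Integration.integrable_bound[OF i2])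
        show "(\<lambda>x. ?g x * norm (?m x)^2) \<in> borel_measurable M" by measurable
        show "AE x in M. norm (?g x * norm (?m x)^2) \<le> norm ((1/2) * (?g x * norm (H x)^2 + ?g x * norm (K x)^2))"
          using pt gpos by (intro AE_I2) (auto simp: abs_of_nonneg)
      qed
      have "(\<integral>x. ?g x * norm (?m x)^2 \<partial>M) \<le> (\<integral>x. (1/2) * (?g x * norm (H x)^2 + ?g x * norm (K x)^2) \<partial>M)"
        by (rule integral_mono[OF im i2 pt])
      also have "\<dots> = (1/2) * ((\<integral>x. ?g x * norm (H x)^2 \<partial>M) + (\<integral>x. ?g x * norm (K x)^2 \<partial>M))" using i by simp
      also have "\<dots> \<le> E" using le by simp
      finally have lem: "(\<integral>x. ?g x * norm (?m x)^2 \<partial>M) \<le> E" .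
      have aem: "AE x in M. ennreal (norm ((1/2) * (v x + w x) - U x) powr m) \<le> D j x"
        using ae
      proof eventually_elim
        case (elim x)
        have "\<bar>(1/2) * (v x + w x) - U x\<bar> \<le> max \<bar>v x - U x\<bar> \<bar>w x - U x\<bar>" by (simp add: max_def abs_if field_simps)
        then have "norm ((1/2) * (v x + w x) - U x) powr m \<le> (max \<bar>v x - U x\<bar> \<bar>w x - U x\<bar>) powr m"
          using m1 by (intro powr_mono2) auto
        then have "ennreal (norm ((1/2) * (v x + w x) - U x) powr m) \<le> ennreal ((max \<bar>v x - U x\<bar> \<bar>w x - U x\<bar>) powr m)" by (rule ennreal_leI)
        also have "\<dots> \<le> D j x" using elim by (auto simp: max_def)
        finally show ?case .
      qed
      show ?case using im lem aem by simp
    qed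
    from this[OF that] show ?thesis by simp
  qed
  have Tmid: "(\<lambda>x. (1/2) * (v x + w x), \<lambda>x. (1/2) *\<^sub>R (H x + K x)) \<in> T j" if "(v, H) \<in> T j" "(w, K) \<in> T j" for v H w K j
    using that unfolding T_def by (rule midpoint_hull.mid)
  have Tanti: "T j \<subseteq> T i" if "i \<le> j" for i j unfolding T_def using that by (intro midpoint_hull_mono) auto
  have Tne: "T j \<noteq> {}" for j
  proof -
    have "(u (r j), G (r j)) \<in> T j" unfolding T_def by (rule midpoint_hull.base) simp
    then show ?thesis by (auto simp only:)
  qed
  have ex: "\<exists>v H. (\<forall>j. (v j, H j) \<in> T j) \<and>
     (\<forall>e>0. \<exists>k. \<forall>i\<ge>k. \<forall>j\<ge>k. integrable M (\<lambda>x. ?g x * norm (H i x - H j x)^2) \<and> (\<integral>x. ?g x * norm (H i x - H j x)^2 \<partial>M) \<le> e)"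
  proof (rule minimal_midpoints_Cauchy[of T ?g E])
    fix v H j assume vH: "(v, H) \<in> T j"
    show "integrable M (\<lambda>x. ?g x * norm (H x)^2)" "(\<integral>x. ?g x * norm (H x)^2 \<partial>M) \<le> E" using Tprop[OF vH] by auto
  qed (rule Tmid Tanti Tne gpos; assumption?)+
  from ex obtain v H where vH0: "\<forall>j. (v j, H j) \<in> T j" and
    Ca0: "\<forall>e>0. \<exists>k. \<forall>i\<ge>k. \<forall>j\<ge>k. integrable M (\<lambda>x. ?g x * norm (H i x - H j x)^2) \<and> (\<integral>x. ?g x * norm (H i x - H j x)^2 \<partial>M) \<le> e"
    by (elim exE conjE)
  note vH = vH0[rule_format] and Ca = Ca0[rule_format]
  have vm: "v j \<in> borel_measurable M" and Hm: "H j \<in> borel_measurable M" for j using Tprop[OF vH[of j]] by auto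
  have "\<exists>k. \<forall>i\<ge>k. \<forall>j\<ge>k. Lmod M q (\<lambda>x. H i x - H j x) \<le> ennreal e" if e: "e > 0" for e
  proof -
    \<comment> \<open>Chosen such that the Hoelder estimate \<open>e' powr (q/2) * (A + 1) powr (1 - q/2)\<close> equals \<open>e\<close>.\<close>
    define e' where "e' = (e / (A + 1) powr (1 - q/2)) powr (2/q)"
    have A1: "(A + 1) powr (1 - q/2) > 0" using A by simp
    have e': "e' > 0" using e A1 by (simp add: e'_def)
    obtain k where k: "\<And>i j. i \<ge> k \<Longrightarrow> j \<ge> k \<Longrightarrow> integrable M (\<lambda>x. ?g x * norm (H i x - H j x)^2) \<and> (\<integral>x. ?g x * norm (H i x - H j x)^2 \<partial>M) \<le> e'"
      using Ca[OF e'] by blast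
    show ?thesis
    proof (intro exI[of _ k] allI impI)
      fix i j assume ij: "k \<le> i" "k \<le> j"
      note kij = k[OF ij]
      have "Lmod M q (\<lambda>x. H i x - H j x) \<le> ennreal (e' powr (q/2) * (A + 1) powr (1 - q/2))"
      proof (rule weighted_gradient_bound[of q S "\<lambda>x. H i x - H j x" \<theta>])
        show "(\<integral>\<^sup>+x. ennreal (?g x * norm (H i x - H j x)^2) \<partial>M) \<le> ennreal e'"
          using nn_integral_eq_integral[OF conjunct1[OF kij]] gpos kij by (simp add: ennreal_leI)
        show "(\<integral>\<^sup>+x. ennreal ((1 + (S x)^2) powr (\<theta> * q / (2 - q) / 2)) \<partial>M) \<le> ennreal (A + 1)"
          using A unfolding m_def by (rule_tac order_trans) (auto intro: ennreal_leI)
      qed (use q q2 e' A Hm in auto)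
      also have "e' powr (q/2) * (A + 1) powr (1 - q/2) = e"
        using e A1 q unfolding e'_def by (simp add: powr_powr)
      finally show "Lmod M q (\<lambda>x. H i x - H j x) \<le> ennreal e" .
    qed
  qed
  from Lmod_complete[of H M q, OF Hm _ this] obtain G' where G': "G' \<in> borel_measurable M" "(\<lambda>k. Lmod M q (\<lambda>x. H k x - G' x)) \<longlonglongrightarrow> 0"
    using q by auto
  have "(\<lambda>j. Lmod M m (\<lambda>x. v j x - U x)) \<longlonglongrightarrow> 0"
  proof (rule tendsto_ennreal_0_squeeze)
    show "Lmod M m (\<lambda>x. v j x - U x) \<le> ennreal (2 * (1/2)^j)" for j
    proof -
      have "Lmod M m (\<lambda>x. v j x - U x) \<le> (\<integral>\<^sup>+x. D j x \<partial>M)" unfolding Lmod_def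
        by (rule nn_integral_mono_AE) (use Tprop[OF vH[of j]] in simp)
      then show ?thesis using Dint[of j] by (rule order_trans)
    qed
    have "(\<lambda>j. 2 * (1/2::real)^j) \<longlonglongrightarrow> 2 * 0" by (intro tendsto_mult tendsto_const LIMSEQ_power_zero) simp
    from tendsto_ennrealI[OF this] show "(\<lambda>j. ennreal (2 * (1/2)^j)) \<longlonglongrightarrow> 0" by (simp only: mult_zero_right ennreal_0)
  qed
  then have "(\<lambda>j. Lmod M q (\<lambda>x. v j x - U x)) \<longlonglongrightarrow> 0"
    by (rule Lmod_lower_exponent_tendsto[OF finite_measure_domain U vm _ mq, rotated]) (use q in simp)
  moreover have "(v j, H j) \<in> midpoint_hull (range (\<lambda>k. (u k, G k)))" for j
  proof -
    have "T j \<subseteq> midpoint_hull (range (\<lambda>k. (u k, G k)))" unfolding T_def by (rule midpoint_hull_mono) auto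
    then show ?thesis using vH[of j] by blast
  qed
  ultimately show ?thesis using G' by blast
qed

lemma midpoint_hull_approx:
  assumes ap: "\<And>k. approx q (\<phi> k) (u k) (G k)" and q: "q \<ge> 1" and le: "\<And>k. Lmod M q (G k) \<le> C"
    and vH: "(v, H) \<in> midpoint_hull (range (\<lambda>k::nat. (u k, G k)))"
  shows "(\<exists>\<psi>. approx q \<psi> v H) \<and> Lmod M q H \<le> C"
proof -
  have "(\<exists>\<psi>. approx q \<psi> (fst z) (snd z)) \<and> Lmod M q (snd z) \<le> C" if "z \<in> midpoint_hull (range (\<lambda>k::nat. (u k, G k)))" for z
    using that
  proof (induction rule: midpoint_hull.induct)
    case (base z)
    then obtain k where "z = (u k, G k)" by auto
    then show ?case using ap[of k] le[of k] by auto
  next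
    case (mid v H w K)
    then obtain \<psi> \<eta> where a: "approx q \<psi> v H" "approx q \<eta> w K" and b: "Lmod M q H \<le> C" "Lmod M q K \<le> C" by auto
    note [measurable] = approxD(2)[OF a(1)] approxD(2)[OF a(2)]
    have "approx q (\<lambda>k x. (1/2) * (\<psi> k x + \<eta> k x)) (\<lambda>x. (1/2) * (v x + w x)) (\<lambda>x. (1/2) *\<^sub>R (H x + K x))"
      by (rule approx_scale[OF approx_add[OF a]]) (use q in simp)
    moreover have "Lmod M q (\<lambda>x. (1/2) *\<^sub>R (H x + K x)) \<le> C"
    proof -
      have "Lmod M q (\<lambda>x. (1/2) *\<^sub>R (H x + K x)) \<le> (\<integral>\<^sup>+x. ennreal (1/2) * (ennreal (norm (H x) powr q) + ennreal (norm (K x) powr q)) \<partial>M)"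
        unfolding Lmod_def
      proof (rule nn_integral_mono)
        fix x
        have "norm ((1/2) *\<^sub>R (H x + K x)) \<le> (1/2) * (norm (H x) + norm (K x))" using norm_triangle_ineq[of "H x" "K x"] by simp
        then have "norm ((1/2) *\<^sub>R (H x + K x)) powr q \<le> ((1/2) * (norm (H x) + norm (K x))) powr q" using q by (intro powr_mono2) auto
        also have "\<dots> \<le> (norm (H x) powr q + norm (K x) powr q) / 2" by (rule midpoint_powr_le) (use q in auto)
        finally have "norm ((1/2) *\<^sub>R (H x + K x)) powr q \<le> 1/2 * (norm (H x) powr q + norm (K x) powr q)" by simp
        then have "ennreal (norm ((1/2) *\<^sub>R (H x + K x)) powr q) \<le> ennreal (1/2 * (norm (H x) powr q + norm (K x) powr q))" by (rule ennreal_leI)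
        also have "\<dots> = ennreal (1/2) * (ennreal (norm (H x) powr q) + ennreal (norm (K x) powr q))"
          by (subst ennreal_mult') (auto simp: ennreal_plus)
        finally show "ennreal (norm ((1/2) *\<^sub>R (H x + K x)) powr q) \<le> \<dots>" .
      qed
      also have "\<dots> = ennreal (1/2) * (Lmod M q H + Lmod M q K)"
        unfolding Lmod_def by (rule nn_integral_cmult_add) measurable
      also have "\<dots> \<le> ennreal (1/2) * (C + C)" by (intro mult_left_mono add_mono b) simp
      also have "\<dots> = C"
      proof -
        have "ennreal (1/2) * (C + C) = ennreal (1/2) * (2 * C)" by (simp add: mult_2)
        also have "\<dots> = (ennreal (1/2) * 2) * C" by (simp only: mult.assoc)
        also have "ennreal (1/2) * 2 = 1"
        proof -
          have "ennreal (1/2) * ennreal 2 = ennreal (1/2 * 2)" by (rule ennreal_mult''[symmetric]) simp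
          also have "(1/2 * 2 :: real) = 1" by simp
          also have "ennreal 1 = 1" by (rule ennreal_1)
          finally show ?thesis by (simp only: ennreal_numeral)
        qed
        finally show ?thesis by simp
      qed
      finally show ?thesis .
    qed
    ultimately show ?case by auto
  qed
  from this[OF vH] show ?thesis by simp
qed

text \<open>A half-space \<open>\<sigma> * (L v - L U) \<ge> e\<close> is convex, so it contains with the functions \<open>u k\<close> the convex combinations
  \<open>v j\<close>, but \<open>v j\<close> converges to \<open>U\<close> strongly.\<close>

lemma dual_limit_contradiction:
  assumes q: "q \<ge> 1" and L: "L \<in> W1_0_dual \<Omega> q" and ap: "\<And>k. approx q (\<phi> k) (u k) (G k)"
    and vH: "\<And>j. (v j, H j) \<in> midpoint_hull (range (\<lambda>k::nat. (u k, G k)))"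
    and U: "approx q \<psi> U G'" and v: "(\<lambda>j. Lmod M q (\<lambda>x. v j x - U x)) \<longlonglongrightarrow> 0" and H: "(\<lambda>j. Lmod M q (\<lambda>x. H j x - G' x)) \<longlonglongrightarrow> 0"
    and sep: "\<And>k. \<sigma> * (L (u k) - L U) \<ge> e" and \<sigma>: "\<bar>\<sigma>\<bar> = 1" and e: "e > 0"
  shows False
proof -
  have q0: "q > 0" using q by simp
  have add: "L (\<lambda>x. v x + w x) = L v + L w" if "v \<in> W1_0 \<Omega> q" "w \<in> W1_0 \<Omega> q" for v w using L that by (auto simp: W1_0_dual_def)
  have scale: "L (\<lambda>x. c * v x) = c * L v" if "v \<in> W1_0 \<Omega> q" for c v using L that by (auto simp: W1_0_dual_def)
  obtain K where K: "\<And>v. v \<in> W1_0 \<Omega> q \<Longrightarrow> \<bar>L v\<bar> \<le> K * W1_norm \<Omega> q v" using L unfolding W1_0_dual_def by blast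
  have sepv: "(\<exists>\<psi>. approx q \<psi> (fst z) (snd z)) \<and> \<sigma> * (L (fst z) - L U) \<ge> e" if "z \<in> midpoint_hull (range (\<lambda>k::nat. (u k, G k)))" for z
    using that
  proof (induction rule: midpoint_hull.induct)
    case (base z)
    then obtain k where "z = (u k, G k)" by auto
    then show ?case using ap[of k] sep[of k] by auto
  next
    case (mid v H w K)
    then obtain \<psi> \<eta> where a: "approx q \<psi> v H" "approx q \<eta> w K" and b: "\<sigma> * (L v - L U) \<ge> e" "\<sigma> * (L w - L U) \<ge> e" by auto
    have "approx q (\<lambda>k x. (1/2) * (\<psi> k x + \<eta> k x)) (\<lambda>x. (1/2) * (v x + w x)) (\<lambda>x. (1/2) *\<^sub>R (H x + K x))"
      by (rule approx_scale[OF approx_add[OF a q0]])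
    moreover
    have "L (\<lambda>x. (1/2) * (v x + w x)) = (1/2) * (L v + L w)"
      using scale[OF approx_imp_W1_0[OF approx_add[OF a q0] q], of "1/2"] add[OF approx_imp_W1_0[OF a(1) q] approx_imp_W1_0[OF a(2) q]] by simp
    then have e1: "\<sigma> * (L (\<lambda>x. (1/2) * (v x + w x)) - L U) = \<sigma> * ((1/2) * (L v + L w) - L U)" by (simp only:)
    have e2: "\<sigma> * ((1/2) * (L v + L w) - L U) = (1/2) * (\<sigma> * (L v - L U)) + (1/2) * (\<sigma> * (L w - L U))" by (simp add: field_simps)
    have "\<sigma> * (L (\<lambda>x. (1/2) * (v x + w x)) - L U) \<ge> e" unfolding e1 e2 using b by linarith
    ultimately show ?case by auto
  qed
  have lower: "\<bar>L (\<lambda>x. v j x - U x)\<bar> \<ge> e" and dif: "\<exists>\<eta>. approx q \<eta> (\<lambda>x. v j x - U x) (\<lambda>x. H j x - G' x)" for j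
  proof -
    obtain \<eta> where a: "approx q \<eta> (v j) (H j)" and s: "\<sigma> * (L (v j) - L U) \<ge> e" using sepv[OF vH[of j]] by auto
    show "\<exists>\<eta>. approx q \<eta> (\<lambda>x. v j x - U x) (\<lambda>x. H j x - G' x)" using approx_diff[OF a U q0] by blast
    have "L (\<lambda>x. v j x + (-1) * U x) = L (v j) + (-1) * L U"
      using add[OF approx_imp_W1_0[OF a q] approx_imp_W1_0[OF approx_scale[OF U, of "-1"] q]] scale[OF approx_imp_W1_0[OF U q], of "-1"] by simp
    then have "L (\<lambda>x. v j x - U x) = L (v j) - L U" by simp
    moreover have "\<bar>L (v j) - L U\<bar> = \<bar>\<sigma> * (L (v j) - L U)\<bar>" using \<sigma> by (simp add: abs_mult)
    ultimately show "\<bar>L (\<lambda>x. v j x - U x)\<bar> \<ge> e" using s by linarith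
  qed
  have n: "Lp_norm \<Omega> q (weak_gradient \<Omega> (\<lambda>x. v j x - U x)) = Lp_norm \<Omega> q (\<lambda>x. H j x - G' x)"
    and dm: "(\<lambda>x. v j x - U x) \<in> borel_measurable M" "(\<lambda>x. H j x - G' x) \<in> borel_measurable M"
    and dW: "(\<lambda>x. v j x - U x) \<in> W1_0 \<Omega> q" for j
  proof -
    obtain \<eta> where d: "approx q \<eta> (\<lambda>x. v j x - U x) (\<lambda>x. H j x - G' x)" using dif by blast
    show "(\<lambda>x. v j x - U x) \<in> borel_measurable M" "(\<lambda>x. H j x - G' x) \<in> borel_measurable M" using approxD(1,2)[OF d] .
    show "(\<lambda>x. v j x - U x) \<in> W1_0 \<Omega> q" by (rule approx_imp_W1_0[OF d q])
    show "Lp_norm \<Omega> q (weak_gradient \<Omega> (\<lambda>x. v j x - U x)) = Lp_norm \<Omega> q (\<lambda>x. H j x - G' x)"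
      by (rule Lp_norm_weak_gradient[OF d q])
  qed
  have "(\<lambda>j. W1_norm \<Omega> q (\<lambda>x. v j x - U x)) \<longlonglongrightarrow> 0 + 0"
    unfolding W1_norm_def n by (intro tendsto_add Lp_norm_tendsto_0 dm v H q0)
  then have "(\<lambda>j. K * W1_norm \<Omega> q (\<lambda>x. v j x - U x)) \<longlonglongrightarrow> K * (0 + 0)" by (intro tendsto_mult tendsto_const)
  then have "eventually (\<lambda>j. K * W1_norm \<Omega> q (\<lambda>x. v j x - U x) < e) sequentially" by (rule order_tendstoD) (use e in simp)
  then obtain j where "K * W1_norm \<Omega> q (\<lambda>x. v j x - U x) < e" by (auto simp: eventually_sequentially)
  with K[OF dW[of j]] lower[of j] show False by linarith
qed

end

section \<open>The limit problem\<close>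

context bounded_domain begin

text \<open>The functional that turns weak convergence into convergence of the linear term of the equation. It is bounded for
  every \<open>q > 1\<close> since both \<open>\<Lambda>\<close> and the gradient of a test function are bounded.\<close>

lemma flux_functional_dual:
  assumes \<Lambda>: "\<Lambda> \<in> Linfty \<Omega>" and h: "h \<in> test_functions \<Omega>" and q: "q > 1"
  shows "(\<lambda>v. \<integral>x. (\<Lambda> x *v weak_gradient \<Omega> v x) \<bullet> grad h x \<partial>M) \<in> W1_0_dual \<Omega> q"
proof -
  let ?L = "\<lambda>v. \<integral>x. (\<Lambda> x *v weak_gradient \<Omega> v x) \<bullet> grad h x \<partial>M"
  have q1: "q \<ge> 1" "q > 0" using q by auto
  have \<Lambda>m[measurable]: "\<Lambda> \<in> borel_measurable M" using \<Lambda> by (simp add: Linfty_def)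
  obtain K where K: "K \<ge> 0" "AE x in M. \<forall>v. norm (\<Lambda> x *v v) \<le> K * norm v" using Linfty_matrix_bound[OF \<Lambda>] by blast
  obtain B where B: "B > 0" "\<And>x. norm (grad h x) \<le> B" using C1c_bounded[OF test_functions_C1c(1)[OF h]] by blast
  note [measurable] = test_measurable[OF h]
  have pt: "AE x in M. \<forall>v. \<bar>(\<Lambda> x *v v) \<bullet> grad h x\<bar> \<le> (K * B) * norm v"
    using K(2)
  proof eventually_elim
    case (elim x)
    show ?case
    proof
      fix v
      have "\<bar>(\<Lambda> x *v v) \<bullet> grad h x\<bar> \<le> norm (\<Lambda> x *v v) * norm (grad h x)" by (rule Cauchy_Schwarz_ineq2)
      also have "\<dots> \<le> (K * norm v) * B" using elim B(2)[of x] K(1) by (intro mult_mono) auto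
      finally show "\<bar>(\<Lambda> x *v v) \<bullet> grad h x\<bar> \<le> (K * B) * norm v" by (simp add: mult_ac)
    qed
  qed
  have int: "integrable M (\<lambda>x. (\<Lambda> x *v H x) \<bullet> grad h x)" and bound: "\<bar>\<integral>x. (\<Lambda> x *v H x) \<bullet> grad h x \<partial>M\<bar> \<le> (K * B) * (\<integral>x. norm (H x) \<partial>M)"
    and iH: "integrable M (\<lambda>x. norm (H x))"
    if a: "approx q \<phi> v H" for \<phi> v H
  proof -
    note [measurable] = approxD(2)[OF a]
    have "Lmod M 1 H < \<infinity>" by (rule Lmod_lower_exponent_finite[OF finite_measure_domain approxD(2)[OF a] _ q1(1) approx_Lmod_finite(2)[OF a q1(2)]]) simp
    then have iH: "integrable M H" by (rule integrable_if_Lmod_1[rotated]) measurable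
    then show iH': "integrable M (\<lambda>x. norm (H x))" by (rule integrable_norm)
    have [measurable]: "(\<lambda>x. \<Lambda> x *v H x) \<in> borel_measurable M" by (rule borel_measurable_matrix_vector_mult) measurable
    have i2: "integrable M (\<lambda>x. (K * B) * norm (H x))" using iH' by (rule integrable_mult_right)
    show i: "integrable M (\<lambda>x. (\<Lambda> x *v H x) \<bullet> grad h x)"
      by (rule Bochner_Integration.integrable_bound[OF i2]) (measurable, use pt K B in \<open>auto elim!: eventually_mono simp: abs_mult\<close>)
    have "\<bar>\<integral>x. (\<Lambda> x *v H x) \<bullet> grad h x \<partial>M\<bar> \<le> (\<integral>x. \<bar>(\<Lambda> x *v H x) \<bullet> grad h x\<bar> \<partial>M)" by (rule integral_abs_bound)
    also have "\<dots> \<le> (\<integral>x. (K * B) * norm (H x) \<partial>M)"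
      by (rule integral_mono_AE[OF integrable_abs[OF i] i2]) (use pt in \<open>auto elim!: eventually_mono\<close>)
    finally show "\<bar>\<integral>x. (\<Lambda> x *v H x) \<bullet> grad h x \<partial>M\<bar> \<le> (K * B) * (\<integral>x. norm (H x) \<partial>M)" by simp
  qed
  have L: "?L v = (\<integral>x. (\<Lambda> x *v H x) \<bullet> grad h x \<partial>M)" if a: "approx q \<phi> v H" for \<phi> v H
  proof (rule integral_cong_AE)
    have [measurable]: "weak_gradient \<Omega> v \<in> borel_measurable M" "H \<in> borel_measurable M"
      using weak_gradient_measurable[OF approx_has_weak_gradient[OF a q1(1)] approxD(2)[OF a]] approxD(2)[OF a] .
    have [measurable]: "(\<lambda>x. \<Lambda> x *v H x) \<in> borel_measurable M" "(\<lambda>x. \<Lambda> x *v weak_gradient \<Omega> v x) \<in> borel_measurable M"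
      by (rule borel_measurable_matrix_vector_mult; measurable)+
    show "(\<lambda>x. (\<Lambda> x *v weak_gradient \<Omega> v x) \<bullet> grad h x) \<in> borel_measurable M" "(\<lambda>x. (\<Lambda> x *v H x) \<bullet> grad h x) \<in> borel_measurable M"
      by measurable
    show "AE x in M. (\<Lambda> x *v weak_gradient \<Omega> v x) \<bullet> grad h x = (\<Lambda> x *v H x) \<bullet> grad h x"
      using weak_gradient_approx_AE[OF a q1(1)] by eventually_elim simp
  qed
  show ?thesis unfolding W1_0_dual_def
  proof (intro CollectI conjI ballI allI)
    fix v w assume v: "v \<in> W1_0 \<Omega> q" and w: "w \<in> W1_0 \<Omega> q"
    obtain \<phi> \<psi> where a: "approx q \<phi> v (weak_gradient \<Omega> v)" and b: "approx q \<psi> w (weak_gradient \<Omega> w)"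
      using W1_0_imp_approx[OF v q1(1)] W1_0_imp_approx[OF w q1(1)] by blast
    show "?L (\<lambda>x. v x + w x) = ?L v + ?L w"
      unfolding L[OF approx_add[OF a b q1(2)]]
      using int[OF a] int[OF b] by (simp add: matrix_vector_right_distrib inner_add_left)
  next
    fix c v assume v: "v \<in> W1_0 \<Omega> q"
    obtain \<phi> where a: "approx q \<phi> v (weak_gradient \<Omega> v)" using W1_0_imp_approx[OF v q1(1)] by blast
    show "?L (\<lambda>x. c * v x) = c * ?L v"
      unfolding L[OF approx_scale[OF a]] using int[OF a] by (simp add: matrix_vector_mult_scaleR)
  next
    let ?V = "measure M (space M) powr (1 - 1/q)"
    show "\<exists>C. \<forall>v\<in>W1_0 \<Omega> q. \<bar>?L v\<bar> \<le> C * W1_norm \<Omega> q v"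
    proof (intro exI[of _ "(K * B) * ?V"] ballI)
      fix v assume v: "v \<in> W1_0 \<Omega> q"
      let ?H = "weak_gradient \<Omega> v"
      obtain \<phi> where a: "approx q \<phi> v ?H" using W1_0_imp_approx[OF v q1(1)] by blast
      note Hm[measurable] = approxD(2)[OF a]
      have "Lmod M q ?H \<le> ennreal (enn2real (Lmod M q ?H))" using approx_Lmod_finite(2)[OF a q1(2)] by simp
      from Lmod_lower_exponent[OF finite_measure_domain Hm _ q this]
      have "Lmod M 1 ?H \<le> ennreal (enn2real (Lmod M q ?H) powr (1/q) * ?V)" by simp
      moreover have "Lmod M 1 ?H = ennreal (\<integral>x. norm (?H x) \<partial>M)"
        unfolding Lmod_def using nn_integral_eq_integral[OF iH[OF a]] by simp
      ultimately have "(\<integral>x. norm (?H x) \<partial>M) \<le> Lp_norm \<Omega> q ?H * ?V" by (simp add: Lp_norm_eq[OF Hm])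
      also have "\<dots> \<le> W1_norm \<Omega> q v * ?V"
        unfolding W1_norm_def by (intro mult_right_mono) (auto simp: Lp_norm_def)
      finally have "(K * B) * (\<integral>x. norm (?H x) \<partial>M) \<le> (K * B) * (W1_norm \<Omega> q v * ?V)" using K B by (intro mult_left_mono) auto
      then show "\<bar>?L v\<bar> \<le> (K * B) * ?V * W1_norm \<Omega> q v" using bound[OF a] by (simp add: mult_ac)
    qed
  qed
qed

end

locale regularised_sequence = bounded_domain \<Omega> for \<Omega> :: "(real^'n) set" +
  fixes p lo hi :: real and \<Lambda> :: "real^'n \<Rightarrow> real^'n^'n" and f :: "(real^'n \<Rightarrow> real) \<Rightarrow> real"
    and \<epsilon> :: "nat \<Rightarrow> real" and u :: "nat \<Rightarrow> real^'n \<Rightarrow> real"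
  assumes dim: "CARD('n) \<ge> 2" and p: "real CARD('n) < p" and elliptic: "elliptic_coefficient \<Omega> lo hi \<Lambda>"
    and f: "f \<in> radon_measures \<Omega>" and eps_pos: "\<And>n. 0 < \<epsilon> n" and eps_lim: "\<epsilon> \<longlonglongrightarrow> 0"
    and sol: "\<And>n. regularised_solution \<Omega> p \<Lambda> f (\<epsilon> n) (u n)"
begin

abbreviation "R \<equiv> radon_norm \<Omega> f"

lemma p2: "p > 2" "p \<ge> 2" "p > 1" "p \<ge> 1" "p > 0" using dim p by auto

lemma lo: "lo > 0" using elliptic by (simp add: elliptic_coefficient_def)

lemma R0: "R \<ge> 0" by (rule radon_norm_nonneg[OF f])

lemma solution_approx: "\<exists>\<phi>. approx p \<phi> (u k) (weak_gradient \<Omega> (u k))"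
  using W1_0_imp_approx[OF _ p2(4)] sol[of k] by (simp add: regularised_solution_def)

lemma solution_energy: "energy_class \<Omega> R lo (u k) (weak_gradient \<Omega> (u k))"
  unfolding energy_class_def
proof (intro conjI allI impI; (elim conjE)?)
  show "\<exists>p\<ge>2. \<exists>\<phi>. approx p \<phi> (u k) (weak_gradient \<Omega> (u k))" using p2(2) solution_approx by blast
  fix \<theta> :: real assume \<theta>: "1 < \<theta>" "\<theta> \<le> 2"
  have a: "0 < (\<theta> - 1) / 2" "(\<theta> - 1) / 2 \<le> 1/2" using \<theta> by auto
  have "1 + 2 * ((\<theta> - 1) / 2) = \<theta>" by (simp add: field_simps)
  moreover have "R / ((\<theta> - 1) / 2 * lo) = 2 * R / ((\<theta> - 1) * lo)" by simp
  ultimately show "(\<integral>\<^sup>+x. ennreal (weight \<theta> (u k x) * norm (weak_gradient \<Omega> (u k) x)^2) \<partial>M) \<le> ennreal (2 * R / ((\<theta> - 1) * lo))"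
    using energy_estimate(1)[OF dim p elliptic f eps_pos sol a, of k] by (simp only:)
qed (rule bounded_domain_axioms)

lemma solution_regularising_energy:
  assumes \<theta>: "1 < \<theta>" "\<theta> \<le> 2"
  shows "(\<integral>\<^sup>+x. ennreal (\<epsilon> k * psi' (u k x) powr (p - 2) * weight \<theta> (u k x) * norm (weak_gradient \<Omega> (u k) x) powr p) \<partial>M) \<le> ennreal (2 * R / (\<theta> - 1))"
proof -
  have a: "0 < (\<theta> - 1) / 2" "(\<theta> - 1) / 2 \<le> 1/2" using \<theta> by auto
  have "1 + 2 * ((\<theta> - 1) / 2) = \<theta>" by (simp add: field_simps)
  moreover have "R / ((\<theta> - 1) / 2) = 2 * R / (\<theta> - 1)" by simp
  ultimately show ?thesis
    using energy_estimate(2)[OF dim p elliptic f eps_pos sol a, of k] by (simp only:)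
qed

text \<open>The chain rule for \<open>psi\<close> turns the integrand into the one of \<open>regularising_term_bound\<close>, up to a bounded factor.\<close>

lemma regularising_term_vanishes:
  assumes h: "h \<in> test_functions \<Omega>"
  shows "(\<lambda>k. \<epsilon> k * (\<integral>x. norm (weak_gradient \<Omega> (\<lambda>y. psi (u k y)) x) powr (p - 2) * (weak_gradient \<Omega> (u k) x \<bullet> weak_gradient \<Omega> h x) \<partial>M)) \<longlonglongrightarrow> 0"
proof -
  obtain C where C: "C \<ge> 0" "\<And>\<epsilon> u G. 0 < \<epsilon> \<Longrightarrow> energy_class \<Omega> R lo u G \<Longrightarrow>
     (\<forall>\<theta>. 1 < \<theta> \<and> \<theta> \<le> 2 \<longrightarrow> (\<integral>\<^sup>+x. ennreal (\<epsilon> * psi' (u x) powr (p - 2) * weight \<theta> (u x) * norm (G x) powr p) \<partial>M) \<le> ennreal (2 * R / (\<theta> - 1))) \<Longrightarrow>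
     (\<integral>\<^sup>+x. ennreal (\<epsilon> * psi' (u x) powr (p - 2) * norm (G x) powr (p - 1)) \<partial>M) \<le> ennreal (C * \<epsilon> powr (1/p))"
    using regularising_term_bound[OF dim p2(1) R0 lo] by blast
  obtain B where B: "B > 0" "\<And>x. norm (grad h x) \<le> B" using C1c_bounded[OF test_functions_C1c(1)[OF h]] by blast
  let ?T = "\<lambda>k. \<epsilon> k * (\<integral>x. norm (weak_gradient \<Omega> (\<lambda>y. psi (u k y)) x) powr (p - 2) * (weak_gradient \<Omega> (u k) x \<bullet> weak_gradient \<Omega> h x) \<partial>M)"
  have bound: "\<bar>?T k\<bar> \<le> B * (C * \<epsilon> k powr (1/p))" for k
  proof -
    let ?G = "weak_gradient \<Omega> (u k)"
    obtain \<phi> where ap: "approx p \<phi> (u k) ?G" using solution_approx by blast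
    note [measurable] = approxD(1,2)[OF ap] and psiG = weak_gradient_psi[OF ap p2(4)]
    have hG: "AE x in M. weak_gradient \<Omega> h x = grad h x"
      by (rule weak_gradient_approx_AE[OF approx_const[OF h], of 1]) simp
    let ?F = "\<lambda>x. norm (weak_gradient \<Omega> (\<lambda>y. psi (u k y)) x) powr (p - 2) * (?G x \<bullet> weak_gradient \<Omega> h x)"
    have pt: "AE x in M. norm (\<epsilon> k * ?F x) \<le> B * (\<epsilon> k * psi' (u k x) powr (p - 2) * norm (?G x) powr (p - 1))"
      using psiG hG
    proof eventually_elim
      case (elim x)
      have "\<bar>?G x \<bullet> grad h x\<bar> \<le> norm (?G x) * B"
        using Cauchy_Schwarz_ineq2[of "?G x" "grad h x"] mult_left_mono[OF B(2)[of x], of "norm (?G x)"] by simp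
      then have "norm (?G x) powr (p - 2) * \<bar>?G x \<bullet> grad h x\<bar> \<le> norm (?G x) powr (p - 2) * (norm (?G x) * B)" by (intro mult_left_mono) auto
      also have "\<dots> = norm (?G x) powr (p - 1) * B" using powr_add[of "norm (?G x)" "p - 2" 1] by simp
      finally have "\<epsilon> k * psi' (u k x) powr (p - 2) * (norm (?G x) powr (p - 2) * \<bar>?G x \<bullet> grad h x\<bar>) \<le> \<epsilon> k * psi' (u k x) powr (p - 2) * (norm (?G x) powr (p - 1) * B)"
        using eps_pos[of k] by (intro mult_left_mono) auto
      moreover have "norm (psi' (u k x) *\<^sub>R ?G x) powr (p - 2) = psi' (u k x) powr (p - 2) * norm (?G x) powr (p - 2)"
        using psi'_bounds[of "u k x"] by (simp add: powr_mult)
      ultimately show ?case using elim eps_pos[of k] by (simp add: abs_mult mult_ac)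
    qed
    have "\<bar>?T k\<bar> = \<bar>\<integral>x. \<epsilon> k * ?F x \<partial>M\<bar>" by simp
    also have "ennreal \<dots> \<le> (\<integral>\<^sup>+x. ennreal (norm (\<epsilon> k * ?F x)) \<partial>M)"
      by (cases "integrable M (\<lambda>x. \<epsilon> k * ?F x)") (use integral_norm_bound_ennreal[of M "\<lambda>x. \<epsilon> k * ?F x"] in \<open>auto simp: not_integrable_integral_eq\<close>)
    also have "\<dots> \<le> (\<integral>\<^sup>+x. ennreal B * ennreal (\<epsilon> k * psi' (u k x) powr (p - 2) * norm (?G x) powr (p - 1)) \<partial>M)"
      by (rule nn_integral_mono_AE) (use pt B in \<open>auto elim!: eventually_mono simp: ennreal_mult'[symmetric] intro!: ennreal_leI\<close>)
    also have "\<dots> = ennreal B * (\<integral>\<^sup>+x. ennreal (\<epsilon> k * psi' (u k x) powr (p - 2) * norm (?G x) powr (p - 1)) \<partial>M)"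
      by (rule nn_integral_cmult) measurable
    also have "\<dots> \<le> ennreal B * ennreal (C * \<epsilon> k powr (1/p))"
      by (intro mult_left_mono C(2)[OF eps_pos solution_energy]) (use solution_regularising_energy in auto)
    also have "\<dots> = ennreal (B * (C * \<epsilon> k powr (1/p)))" using B by (simp add: ennreal_mult')
    finally show ?thesis using B C by (subst (asm) ennreal_le_iff) auto
  qed
  have "(\<lambda>k. B * (C * \<epsilon> k powr (1/p))) \<longlonglongrightarrow> B * (C * 0 powr (1/p))"
    using p2 by (intro tendsto_mult tendsto_const tendsto_powr2 eps_lim) (auto intro!: always_eventually less_imp_le eps_pos)
  then have "(\<lambda>k. B * (C * \<epsilon> k powr (1/p))) \<longlonglongrightarrow> 0" by simp
  then show ?thesis by (rule Lim_null_comparison[rotated]) (use bound in auto)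
qed

lemma solution_powers_bounded:
  assumes m: "m > 0" "m * (real CARD('n) - 2) < real CARD('n)"
  shows "\<exists>C\<ge>0. \<forall>k. Lmod M m (u k) \<le> ennreal C"
  using energy_class_Lmod_bounded[OF dim m R0 lo] solution_energy by blast

lemma solution_measurable: "u k \<in> borel_measurable M"
  using solution_approx approxD(1) by blast

text \<open>The gradients are bounded in \<open>L\<^sup>1\<close>. Each solution is replaced by a test function at distance at most \<open>1 / (k + 1)\<close>
  with comparable gradient, to which the compactness theorem applies.\<close>

lemma convergent_subsequence:
  shows "\<exists>s U. strict_mono (s::nat\<Rightarrow>nat) \<and> U \<in> borel_measurable M \<and> (AE x in M. (\<lambda>k. u (s k) x) \<longlonglongrightarrow> U x) \<and>
    (\<lambda>k. Lmod M 1 (\<lambda>x. u (s k) x - U x)) \<longlonglongrightarrow> 0"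
proof -
  obtain C where C: "C \<ge> 0" "\<And>(\<Omega>'::(real^'n) set) u G. measure lebesgue \<Omega>' = measure lebesgue \<Omega> \<Longrightarrow> energy_class \<Omega>' R lo u G \<Longrightarrow>
     Lmod (lebesgue_on \<Omega>') 1 G \<le> ennreal C"
    using gradient_estimate[OF dim _ _ measure_nonneg[of lebesgue \<Omega>] R0 lo, of 1] by auto
  note gb = C(2)[OF refl solution_energy]
  have "\<exists>\<eta>. \<eta> \<in> test_functions \<Omega> \<and> Lmod M 1 (\<lambda>x. \<eta> x - u k x) \<le> ennreal (1 / (real k + 1)) \<and> Lmod M 1 (grad \<eta>) \<le> ennreal (2 * (1 + C))" for k
  proof -
    obtain \<phi> where "approx p \<phi> (u k) (weak_gradient \<Omega> (u k))" using solution_approx by blast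
    then have a: "approx 1 \<phi> (u k) (weak_gradient \<Omega> (u k))" by (rule approx_lower_exponent) (use p2 in auto)
    have "eventually (\<lambda>j. Lmod M 1 (\<lambda>x. \<phi> j x - u k x) \<le> ennreal (1 / (real k + 1)) \<and> Lmod M 1 (\<lambda>x. grad (\<phi> j) x - weak_gradient \<Omega> (u k) x) \<le> ennreal 1) sequentially"
      using approxD(4,5)[OF a] unfolding ennreal_tendsto_0_iff by (intro eventually_conj) (auto simp del: ennreal_1)
    then obtain j where j: "Lmod M 1 (\<lambda>x. \<phi> j x - u k x) \<le> ennreal (1 / (real k + 1))" "Lmod M 1 (\<lambda>x. grad (\<phi> j) x - weak_gradient \<Omega> (u k) x) \<le> ennreal 1"
      by (auto simp: eventually_sequentially simp del: ennreal_1)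
    have "Lmod M 1 (grad (\<phi> j)) \<le> ennreal (2 powr 1) * (Lmod M 1 (\<lambda>x. grad (\<phi> j) x - weak_gradient \<Omega> (u k) x) + Lmod M 1 (weak_gradient \<Omega> (u k)))"
      using Lmod_add[of "\<lambda>x. grad (\<phi> j) x - weak_gradient \<Omega> (u k) x" M "weak_gradient \<Omega> (u k)" 1] approxD(2,7)[OF a] by simp
    also have "\<dots> \<le> ennreal (2 powr 1) * (ennreal 1 + ennreal C)" by (intro mult_left_mono add_mono j gb) simp
    also have "\<dots> = ennreal (2 powr 1 * (1 + C))" using C by (simp only: ennreal_mult' ennreal_plus zero_le_one powr_ge_zero)
    finally show ?thesis using j(1) approxD(3)[OF a, of j] by auto
  qed
  then have "\<forall>k. \<exists>\<eta>. \<eta> \<in> test_functions \<Omega> \<and> Lmod M 1 (\<lambda>x. \<eta> x - u k x) \<le> ennreal (1 / (real k + 1)) \<and> Lmod M 1 (grad \<eta>) \<le> ennreal (2 * (1 + C))" by blast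
  from choice[OF this] obtain \<eta> where "\<forall>k. \<eta> k \<in> test_functions \<Omega> \<and> Lmod M 1 (\<lambda>x. \<eta> k x - u k x) \<le> ennreal (1 / (real k + 1)) \<and> Lmod M 1 (grad (\<eta> k)) \<le> ennreal (2 * (1 + C))" ..
  then have \<eta>: "\<And>k. \<eta> k \<in> test_functions \<Omega>" "\<And>k. Lmod M 1 (\<lambda>x. \<eta> k x - u k x) \<le> ennreal (1 / (real k + 1))"
    "\<And>k. Lmod M 1 (grad (\<eta> k)) \<le> ennreal (2 * (1 + C))" by simp_all
  obtain r U where r: "strict_mono (r::nat\<Rightarrow>nat)" and U[measurable]: "U \<in> borel_measurable M" and lim: "(\<lambda>k. Lmod M 1 (\<lambda>x. \<eta> (r k) x - U x)) \<longlonglongrightarrow> 0"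
  proof -
    have "0 \<le> 2 * (1 + C)" using C(1) by simp
    from Rellich_L1[of \<eta>, OF \<eta>(1,3) this] show thesis by (elim exE conjE) (rule that)
  qed
  have inv: "(\<lambda>k. ennreal (1 / (real (r k) + 1))) \<longlonglongrightarrow> 0"
    using LIMSEQ_subseq_LIMSEQ[OF tendsto_ennreal_inverse_plus_1 r] by (simp add: o_def)
  have lim1: "(\<lambda>k. Lmod M 1 (\<lambda>x. u (r k) x - U x)) \<longlonglongrightarrow> 0"
  proof (rule tendsto_ennreal_0_squeeze[OF _ tendsto_ennreal_0_add_cmult[OF inv lim, of "2 powr 1"]])
    fix k
    have "Lmod M 1 (\<lambda>x. u (r k) x - U x) \<le> ennreal (2 powr 1) * (Lmod M 1 (\<lambda>x. u (r k) x - \<eta> (r k) x) + Lmod M 1 (\<lambda>x. \<eta> (r k) x - U x))"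
      by (rule Lmod_triangle) (use solution_measurable test_measurable[OF \<eta>(1)] U in auto)
    also have "\<dots> \<le> ennreal (2 powr 1) * (ennreal (1 / (real (r k) + 1)) + Lmod M 1 (\<lambda>x. \<eta> (r k) x - U x))"
      using \<eta>(2)[of "r k"] by (intro mult_left_mono add_right_mono) (auto simp: Lmod_minus[of M 1 "u (r k)"])
    finally show "Lmod M 1 (\<lambda>x. u (r k) x - U x) \<le> \<dots>" .
  qed
  obtain t :: "nat \<Rightarrow> nat" where t: "strict_mono t" "AE x in M. (\<lambda>k. u (r (t k)) x) \<longlonglongrightarrow> U x"
    using Lmod_tendsto_AE_subseq[OF U solution_measurable _ lim1] by auto
  show ?thesis
  proof (intro exI[of _ "\<lambda>k. r (t k)"] exI[of _ U] conjI U t(2))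
    show "strict_mono (\<lambda>k. r (t k))" using r t(1) by (simp add: strict_mono_def)
    show "(\<lambda>k. Lmod M 1 (\<lambda>x. u (r (t k)) x - U x)) \<longlonglongrightarrow> 0"
      using LIMSEQ_subseq_LIMSEQ[OF lim1 t(1)] by (simp add: o_def)
  qed
qed

text \<open>Interpolation between the convergence in \<open>L\<^sup>1\<close> and the bounds in \<open>L\<^sup>m\<close> for a slightly larger exponent \<open>m'\<close> that is
  still subcritical.\<close>

lemma strong_convergence:
  assumes [measurable]: "U \<in> borel_measurable M" and ae: "AE x in M. (\<lambda>k. u (s k) x) \<longlonglongrightarrow> U x"
    and L1: "(\<lambda>k. Lmod M 1 (\<lambda>x. u (s k) x - U x)) \<longlonglongrightarrow> 0" and m: "1 \<le> m" "m * (real CARD('n) - 2) < real CARD('n)"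
  shows "Lmod M m U < \<infinity>" "(\<lambda>k. Lmod M m (\<lambda>x. u (s k) x - U x)) \<longlonglongrightarrow> 0"
proof -
  let ?N = "real CARD('n)"
  note [measurable] = solution_measurable
  have "0 \<le> m * (?N - 2)" using m dim by simp
  from exponent_above_one[OF this m(2)] obtain \<theta> where \<theta>: "1 < \<theta>" "\<theta> * (m * (?N - 2)) < ?N" by blast
  define m' where "m' = \<theta> * m"
  have m': "m < m'" "m' > 1" "m' > 0" "m' * (?N - 2) < ?N"
  proof -
    have "1 * m < \<theta> * m" using \<theta> m by (intro mult_strict_right_mono) auto
    then show "m < m'" by (simp add: m'_def)
    then show "m' > 1" "m' > 0" using m by auto
    show "m' * (?N - 2) < ?N" using \<theta>(2) by (simp add: m'_def mult.assoc)
  qed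
  obtain C where C: "C \<ge> 0" "\<And>k. Lmod M m' (u k) \<le> ennreal C" using solution_powers_bounded[OF m'(3,4)] by blast
  have UC: "Lmod M m' U \<le> ennreal C"
    by (rule Lmod_Fatou[OF _ ae m'(3)]) (use C in auto)
  show finU: "Lmod M m U < \<infinity>"
    by (rule Lmod_lower_exponent_finite[OF finite_measure_domain, of _ m m']) (use m m' UC in \<open>auto intro: le_less_trans\<close>)
  show "(\<lambda>k. Lmod M m (\<lambda>x. u (s k) x - U x)) \<longlonglongrightarrow> 0"
  proof (cases "m = 1")
    case True then show ?thesis using L1 by simp
  next
    case False
    then have m1: "m > 1" using m by simp
    \<comment> \<open>The weights \<open>1 - \<beta>\<close> and \<open>\<beta>\<close> express \<open>m\<close> as a convex combination of \<open>1\<close> and \<open>m'\<close>.\<close>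
    define \<beta> where "\<beta> = (m - 1) / (m' - 1)"
    have \<beta>: "0 < \<beta>" "\<beta> < 1" using m1 m' by (auto simp: \<beta>_def)
    have e: "1 * (1 - \<beta>) + m' * \<beta> = m"
    proof -
      have "\<beta> * (m' - 1) = m - 1" using m' by (simp add: \<beta>_def)
      then show ?thesis by (simp add: algebra_simps)
    qed
    define C' where "C' = 2 powr m' * (C + C)"
    have C': "C' \<ge> 0" using C by (simp add: C'_def)
    have dC: "Lmod M m' (\<lambda>x. u (s k) x - U x) \<le> ennreal C'" for k
    proof -
      have "Lmod M m' (\<lambda>x. u (s k) x - U x) \<le> ennreal (2 powr m') * (Lmod M m' (u (s k)) + Lmod M m' U)"
        by (rule Lmod_diff) (use m' in auto)
      also have "\<dots> \<le> ennreal (2 powr m') * (ennreal C + ennreal C)" by (intro mult_left_mono add_mono C UC) simp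
      also have "\<dots> = ennreal C'" unfolding C'_def using C by (simp only: ennreal_mult' ennreal_plus powr_ge_zero)
      finally show ?thesis .
    qed
    show ?thesis
    proof (rule tendsto_0_via_powr[OF _ _ _ L1])
      fix k A assume A: "(A::real) \<ge> 0" "Lmod M 1 (\<lambda>x. u (s k) x - U x) \<le> ennreal A"
      let ?d = "\<lambda>x. norm (u (s k) x - U x)"
      have "(\<integral>\<^sup>+x. ennreal ((?d x powr 1) powr (1 - \<beta>) * (?d x powr m') powr \<beta>) \<partial>M) \<le> ennreal (A powr (1 - \<beta>) * C' powr \<beta>)"
        by (rule nn_integral_Holder) (use A dC[of k] C' \<beta> in \<open>auto simp: Lmod_def\<close>)
      also have "(\<lambda>x. (?d x powr 1) powr (1 - \<beta>) * (?d x powr m') powr \<beta>) = (\<lambda>x. ?d x powr m)"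
        unfolding powr_powr powr_add[symmetric] e ..
      finally show "Lmod M m (\<lambda>x. u (s k) x - U x) \<le> ennreal (C' powr \<beta> * A powr (1 - \<beta>))"
        by (simp add: Lmod_def mult.commute)
    qed (use \<beta> in auto)
  qed
qed

lemma subcritical_exponent:
  assumes "1 < q" "q < real CARD('n) / (real CARD('n) - 1)"
  shows "q * (real CARD('n) - 1) < real CARD('n)"
  using assms dim by (simp add: pos_less_divide_eq)

text \<open>If some functional did not converge along the sequence, it would stay away from its value at \<open>U\<close>, on one side, along
  a subsequence. Convex combinations of that subsequence converge strongly to \<open>U\<close>, which is a contradiction. Their
  gradients obey the bound of the original gradients, so the gradient of \<open>U\<close> inherits it.\<close>

lemma weak_limit:
  assumes U: "U \<in> borel_measurable M" and ae: "AE x in M. (\<lambda>k. u (s k) x) \<longlonglongrightarrow> U x"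
    and L1: "(\<lambda>k. Lmod M 1 (\<lambda>x. u (s k) x - U x)) \<longlonglongrightarrow> 0" and q: "1 < q" "q < real CARD('n) / (real CARD('n) - 1)"
    and C: "\<And>k. Lmod M q (weak_gradient \<Omega> (u k)) \<le> ennreal C"
  shows "\<exists>\<psi> G'. approx q \<psi> U G' \<and> Lmod M q G' \<le> ennreal C" "weakly_converges_W1_0 \<Omega> q (\<lambda>k. u (s k)) U"
proof -
  have q1: "q \<ge> 1" "q > 0" using q by auto
  note qN = subcritical_exponent[OF q]
  have qp: "q \<le> p"
  proof -
    have "real CARD('n) / (real CARD('n) - 1) \<le> 2" using dim by (simp add: divide_simps)
    then show ?thesis using q p2 by linarith
  qed
  obtain \<phi> where ap: "\<And>k. approx p (\<phi> k) (u k) (weak_gradient \<Omega> (u k))" using solution_approx by metis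
  have aq: "approx q (\<phi> k) (u k) (weak_gradient \<Omega> (u k))" for k by (rule approx_lower_exponent[OF ap q1(2) qp])
  \<comment> \<open>The convexity argument applies to every subsequence of the given sequence.\<close>
  have conv: "\<exists>v H G' \<psi>. (\<forall>j. (v j, H j) \<in> midpoint_hull (range (\<lambda>k::nat. (u (t k), weak_gradient \<Omega> (u (t k)))))) \<and> approx q \<psi> U G' \<and>
     (\<lambda>j. Lmod M q (\<lambda>x. v j x - U x)) \<longlonglongrightarrow> 0 \<and> (\<lambda>j. Lmod M q (\<lambda>x. H j x - G' x)) \<longlonglongrightarrow> 0 \<and> Lmod M q G' \<le> ennreal C"
    if t: "\<And>m. 1 \<le> m \<Longrightarrow> m * (real CARD('n) - 2) < real CARD('n) \<Longrightarrow> (\<lambda>k. Lmod M m (\<lambda>x. u (t k) x - U x)) \<longlonglongrightarrow> 0" for t :: "nat \<Rightarrow> nat"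
  proof -
    obtain v H G' where v: "\<forall>j. (v j, H j) \<in> midpoint_hull (range (\<lambda>k::nat. (u (t k), weak_gradient \<Omega> (u (t k)))))" "G' \<in> borel_measurable M"
     "(\<lambda>j. Lmod M q (\<lambda>x. v j x - U x)) \<longlonglongrightarrow> 0" "(\<lambda>j. Lmod M q (\<lambda>x. H j x - G' x)) \<longlonglongrightarrow> 0"
      using convex_combinations_converge[of q R lo "\<lambda>k. u (t k)" "\<lambda>k. weak_gradient \<Omega> (u (t k))" U, OF dim q1(1) qN R0 lo solution_energy U t]
      by blast
    have h: "(\<exists>\<psi>. approx q \<psi> (v j) (H j)) \<and> Lmod M q (H j) \<le> ennreal C" for j
      by (rule midpoint_hull_approx[OF aq q1(1) C v(1)[rule_format]])
    then obtain \<psi>s where \<psi>s: "\<And>j. approx q (\<psi>s j) (v j) (H j)" by metis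
    obtain \<psi> where "approx q \<psi> U G'" using approx_closed[OF \<psi>s U v(2) q1(2) v(3,4)] by blast
    moreover have "Lmod M q G' \<le> ennreal C"
    proof -
      obtain a :: "nat \<Rightarrow> nat" where a: "AE x in M. (\<lambda>k. H (a k) x) \<longlonglongrightarrow> G' x"
        using Lmod_tendsto_AE_subseq[OF v(2) approxD(2)[OF \<psi>s] q1(2) v(4)] by blast
      show ?thesis by (rule Lmod_Fatou[OF approxD(2)[OF \<psi>s] a q1(2)]) (use h in auto)
    qed
    ultimately show ?thesis using v by blast
  qed
  have full: "(\<lambda>k. Lmod M m (\<lambda>x. u (s k) x - U x)) \<longlonglongrightarrow> 0" if "1 \<le> m" "m * (real CARD('n) - 2) < real CARD('n)" for m
    by (rule strong_convergence(2)[OF U ae L1 that])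
  from conv[OF full] show ex: "\<exists>\<psi> G'. approx q \<psi> U G' \<and> Lmod M q G' \<le> ennreal C" by blast
  show "weakly_converges_W1_0 \<Omega> q (\<lambda>k. u (s k)) U"
    unfolding weakly_converges_W1_0_def
  proof (intro conjI allI ballI)
    show "u (s k) \<in> W1_0 \<Omega> q" for k by (rule approx_imp_W1_0[OF aq q1(1)])
    show "U \<in> W1_0 \<Omega> q" using ex approx_imp_W1_0[OF _ q1(1)] by blast
    fix L assume L: "L \<in> W1_0_dual \<Omega> q"
    show "(\<lambda>k. L (u (s k))) \<longlonglongrightarrow> L U"
    proof (rule ccontr)
      assume "\<not> (\<lambda>k. L (u (s k))) \<longlonglongrightarrow> L U"
      then obtain e where e: "e > 0" "\<not> (\<forall>\<^sub>F k in sequentially. dist (L (u (s k))) (L U) < e)" by (auto simp: tendsto_iff)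
      have inf: "infinite {k. \<bar>L (u (s k)) - L U\<bar> \<ge> e}"
      proof
        assume "finite {k. \<bar>L (u (s k)) - L U\<bar> \<ge> e}"
        then have "\<forall>\<^sub>F k in sequentially. \<not> (\<bar>L (u (s k)) - L U\<bar> \<ge> e)"
          unfolding cofinite_eq_sequentially[symmetric] eventually_cofinite by simp
        then show False using e(2) by (simp add: dist_real_def not_le)
      qed
      have "{k. \<bar>L (u (s k)) - L U\<bar> \<ge> e} = {k. 1 * (L (u (s k)) - L U) \<ge> e} \<union> {k. (-1) * (L (u (s k)) - L U) \<ge> e}"
        using e(1) by (auto simp: abs_if)
      with inf have "infinite {k. 1 * (L (u (s k)) - L U) \<ge> e} \<or> infinite {k. (-1) * (L (u (s k)) - L U) \<ge> e}"
        by (simp only: finite_Un) blast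
      moreover have "\<bar>1::real\<bar> = 1" "\<bar>-1::real\<bar> = 1" by auto
      ultimately obtain \<sigma> :: real where \<sigma>: "\<bar>\<sigma>\<bar> = 1" "infinite {k. \<sigma> * (L (u (s k)) - L U) \<ge> e}"
        by (elim disjE) (rule that; assumption)+
      obtain t :: "nat \<Rightarrow> nat" where t: "strict_mono t" "\<And>k. \<sigma> * (L (u (s (t k))) - L U) \<ge> e"
        using infinite_enumerate[OF \<sigma>(2)] by auto
      have lt: "(\<lambda>k. Lmod M m (\<lambda>x. u (s (t k)) x - U x)) \<longlonglongrightarrow> 0" if "1 \<le> m" "m * (real CARD('n) - 2) < real CARD('n)" for m
        using LIMSEQ_subseq_LIMSEQ[OF full[OF that] t(1)] by (simp add: o_def)
      from conv[of "\<lambda>k. s (t k)", OF lt] obtain v H G' \<psi> where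
        v: "\<forall>j. (v j, H j) \<in> midpoint_hull (range (\<lambda>k::nat. (u (s (t k)), weak_gradient \<Omega> (u (s (t k))))))" and a: "approx q \<psi> U G'"
        and l: "(\<lambda>j. Lmod M q (\<lambda>x. v j x - U x)) \<longlonglongrightarrow> 0" "(\<lambda>j. Lmod M q (\<lambda>x. H j x - G' x)) \<longlonglongrightarrow> 0" by blast
      show False
        by (rule dual_limit_contradiction[OF q1(1) L aq v[rule_format] a l t(2) \<sigma>(1) e(1)])
    qed
  qed
qed

text \<open>The equation holds first for test functions \<open>h\<close>, by weak convergence in the linear term. For \<open>w\<close> in \<open>W1_0 \<Omega> r\<close> with
  \<open>r > N\<close> the conjugate exponent of \<open>r\<close> is below \<open>N / (N - 1)\<close>, so the gradient of \<open>U\<close> is integrable to that power;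
  hence both sides are continuous along test functions approximating \<open>w\<close>.\<close>

lemma weak_solution_limit:
  assumes W: "\<And>q. 1 < q \<Longrightarrow> q < real CARD('n) / (real CARD('n) - 1) \<Longrightarrow> weakly_converges_W1_0 \<Omega> q (\<lambda>k. u (s k)) U"
    and s: "strict_mono s"
  shows "weak_solution \<Omega> \<Lambda> f U"
  unfolding weak_solution_def
proof (intro conjI ballI)
  let ?N = "real CARD('n)"
  show "U \<in> S_N \<Omega>" unfolding S_N_def using W by (auto simp: weakly_converges_W1_0_def)
  have N1: "?N - 1 > 0" using dim by simp
  have \<Lambda>: "\<Lambda> \<in> Linfty \<Omega>" using elliptic by (simp add: elliptic_coefficient_def)
  have \<Lambda>m: "\<Lambda> \<in> borel_measurable M" using \<Lambda> by (simp add: Linfty_def)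
  fix w assume "w \<in> T_N \<Omega>"
  then obtain r where r: "?N < r" "w \<in> W1_0 \<Omega> r" by (auto simp: T_N_def)
  have r1: "r > 1" "r \<ge> 1" "r > 0" using r dim by auto
  let ?q = "r / (r - 1)"
  have q: "1 < ?q" "?q < ?N / (?N - 1)"
  proof -
    show "1 < ?q" using r1 by (simp add: pos_less_divide_eq)
    have "r * (?N - 1) < ?N * (r - 1)" using r by (simp add: algebra_simps)
    then show "?q < ?N / (?N - 1)" using r1 N1 by (simp add: divide_simps mult.commute)
  qed
  have q1: "?q \<ge> 1" "?q > 0" using q by auto
  note Wq = W[OF q]
  have UW: "U \<in> W1_0 \<Omega> ?q" using Wq by (simp add: weakly_converges_W1_0_def)
  let ?G = "weak_gradient \<Omega> U"
  obtain \<psi> where aU: "approx ?q \<psi> U ?G" using W1_0_imp_approx[OF UW q1(1)] by blast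
  have test: "(\<integral>x. (\<Lambda> x *v ?G x) \<bullet> grad h x \<partial>M) = f h" if h: "h \<in> test_functions \<Omega>" for h
  proof -
    let ?L = "\<lambda>v. \<integral>x. (\<Lambda> x *v weak_gradient \<Omega> v x) \<bullet> grad h x \<partial>M"
    have "\<forall>L\<in>W1_0_dual \<Omega> ?q. (\<lambda>k. L (u (s k))) \<longlonglongrightarrow> L U" using Wq unfolding weakly_converges_W1_0_def by blast
    from bspec[OF this flux_functional_dual[OF \<Lambda> h q(1)]] have l1: "(\<lambda>k. ?L (u (s k))) \<longlonglongrightarrow> ?L U" .
    let ?T = "\<lambda>k. \<epsilon> k * (\<integral>x. norm (weak_gradient \<Omega> (\<lambda>y. psi (u k y)) x) powr (p - 2) * (weak_gradient \<Omega> (u k) x \<bullet> weak_gradient \<Omega> h x) \<partial>M)"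
    have l2: "(\<lambda>k. ?T (s k)) \<longlonglongrightarrow> 0"
      using LIMSEQ_subseq_LIMSEQ[OF regularising_term_vanishes[OF h] s] by (simp add: o_def)
    have hW: "h \<in> W1_0 \<Omega> p" by (rule approx_imp_W1_0[OF approx_const[OF h] p2(4)])
    have hG: "AE x in M. weak_gradient \<Omega> h x = grad h x"
      by (rule weak_gradient_approx_AE[OF approx_const[OF h], of 1]) simp
    have hm: "weak_gradient \<Omega> h \<in> borel_measurable M"
      by (rule borel_measurable_lebesgue_on_AE[OF _ hG test_measurable(2)[OF h]]) simp
    have eq: "?L (u k) = f h - ?T k" for k
    proof -
      obtain \<phi> where ap: "approx p \<phi> (u k) (weak_gradient \<Omega> (u k))" using solution_approx by blast
      have fm: "(\<lambda>x. \<Lambda> x *v weak_gradient \<Omega> (u k) x) \<in> borel_measurable M"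
        by (rule borel_measurable_matrix_vector_mult[OF \<Lambda>m approxD(2)[OF ap]])
      have "(\<integral>x. (\<Lambda> x *v weak_gradient \<Omega> (u k) x) \<bullet> weak_gradient \<Omega> h x \<partial>M) = ?L (u k)"
        by (rule integral_cong_AE[OF borel_measurable_inner[OF fm hm] borel_measurable_inner[OF fm test_measurable(2)[OF h]]])
           (use hG in eventually_elim, simp)
      moreover have "(\<integral>x. (\<Lambda> x *v weak_gradient \<Omega> (u k) x) \<bullet> weak_gradient \<Omega> h x \<partial>M) + ?T k = pairing \<Omega> f h"
        using sol[of k] hW unfolding regularised_solution_def by blast
      ultimately show ?thesis using pairing_test[OF dim h f] by simp
    qed
    have "(\<lambda>k. f h - ?T (s k)) \<longlonglongrightarrow> f h - 0" by (intro tendsto_diff tendsto_const l2)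
    then have "(\<lambda>k. ?L (u (s k))) \<longlonglongrightarrow> f h" unfolding eq by simp
    with l1 show ?thesis by (rule LIMSEQ_unique)
  qed
  let ?w = "weak_gradient \<Omega> w"
  obtain \<eta> where aw: "approx r \<eta> w ?w" using W1_0_imp_approx[OF r(2) r1(2)] by blast
  obtain K where K: "K \<ge> 0" "AE x in M. \<forall>v. norm (\<Lambda> x *v v) \<le> K * norm v" using Linfty_matrix_bound[OF \<Lambda>] by blast
  have Am: "(\<lambda>x. \<Lambda> x *v ?G x) \<in> borel_measurable M" by (rule borel_measurable_matrix_vector_mult[OF \<Lambda>m approxD(2)[OF aU]])
  have finA: "Lmod M ?q (\<lambda>x. \<Lambda> x *v ?G x) < \<infinity>"
  proof -
    have "Lmod M ?q (\<lambda>x. \<Lambda> x *v ?G x) \<le> Lmod M ?q (\<lambda>x. K *\<^sub>R ?G x)"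
      by (rule Lmod_mono_AE) (use K q1 in \<open>auto elim: eventually_mono\<close>)
    also have "\<dots> < \<infinity>" using approx_Lmod_finite(2)[OF aU q1(2)] approxD(2)[OF aU] by (simp add: Lmod_scaleR ennreal_mult_less_top)
    finally show ?thesis .
  qed
  have fing: "Lmod M r (grad (\<eta> k)) < \<infinity>" for k by (rule C1c_Lmod_finite(2)[OF approxD(8)[OF aw] r1(3)])
  have "(\<lambda>k. \<integral>x. grad (\<eta> k) x \<bullet> (\<Lambda> x *v ?G x) \<partial>M) \<longlonglongrightarrow> (\<integral>x. ?w x \<bullet> (\<Lambda> x *v ?G x) \<partial>M)"
    by (rule tendsto_integral_inner[OF approxD(2)[OF aw] Am approxD(7)[OF aw] r1(1) fing finA approxD(5)[OF aw]])
  then have "(\<lambda>k. f (\<eta> k)) \<longlonglongrightarrow> (\<integral>x. (\<Lambda> x *v ?G x) \<bullet> ?w x \<partial>M)"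
    using test[OF approxD(3)[OF aw]] by (simp add: inner_commute)
  moreover have "(\<lambda>k. f (\<eta> k)) \<longlonglongrightarrow> pairing \<Omega> f w" by (rule pairing_limit[OF dim r(1) aw f])
  ultimately show "(\<integral>x. (\<Lambda> x *v ?G x) \<bullet> ?w x \<partial>M) = pairing \<Omega> f w" by (rule LIMSEQ_unique)
qed

end

theorem lemma4p2:
  assumes "CARD('n::finite) \<ge> 2"
  shows "\<exists>C :: real \<Rightarrow> real \<Rightarrow> real \<Rightarrow> real \<Rightarrow> real.
    \<forall>(\<Omega> :: (real^'n) set) (p :: real) (\<Lambda> :: real^'n \<Rightarrow> real^'n^'n) (lam_lo :: real) (lam_hi :: real)
      (f :: (real^'n \<Rightarrow> real) \<Rightarrow> real) (\<epsilon> :: nat \<Rightarrow> real) (u :: nat \<Rightarrow> real^'n \<Rightarrow> real).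
      open \<Omega> \<and> bounded \<Omega> \<and> real CARD('n) < p \<and>
      elliptic_coefficient \<Omega> lam_lo lam_hi \<Lambda> \<and>
      f \<in> radon_measures \<Omega> \<and>
      (\<forall>n. 0 < \<epsilon> n) \<and> \<epsilon> \<longlonglongrightarrow> 0 \<and>
      (\<forall>n. regularised_solution \<Omega> p \<Lambda> f (\<epsilon> n) (u n))
      \<longrightarrow>
      (\<exists>(s :: nat \<Rightarrow> nat) (U :: real^'n \<Rightarrow> real).
         strict_mono s \<and> U \<in> S_N \<Omega> \<and>
         (\<forall>q. 1 < q \<and> q < real CARD('n) / (real CARD('n) - 1) \<longrightarrow>
            weakly_converges_W1_0 \<Omega> q (\<lambda>k. u (s k)) U) \<and>
         (CARD('n) = 2 \<longrightarrow>
            (\<forall>q\<ge>1. strongly_converges_Lp \<Omega> q (\<lambda>k. u (s k)) U)) \<and>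
         (CARD('n) \<ge> 3 \<longrightarrow>
            (\<forall>q. 1 \<le> q \<and> q < real CARD('n) / (real CARD('n) - 2) \<longrightarrow>
               strongly_converges_Lp \<Omega> q (\<lambda>k. u (s k)) U)) \<and>
         (AE x in lebesgue_on \<Omega>. (\<lambda>k. u (s k) x) \<longlonglongrightarrow> U x) \<and>
         weak_solution \<Omega> \<Lambda> f U \<and>
         (\<forall>q. 1 < q \<and> q < real CARD('n) / (real CARD('n) - 1) \<longrightarrow>
            Lp_norm \<Omega> q (weak_gradient \<Omega> U)
              \<le> C q (measure lebesgue \<Omega>) lam_lo (radon_norm \<Omega> f)))"
proof -
  let ?N = "real CARD('n)"
  have "\<forall>q V lo R. \<exists>C. 1 < q \<and> q < ?N / (?N - 1) \<and> V \<ge> 0 \<and> R \<ge> 0 \<and> lo > 0 \<longrightarrow> C \<ge> 0 \<and>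
     (\<forall>(\<Omega>::(real^'n) set) u G. measure lebesgue \<Omega> = V \<longrightarrow> energy_class \<Omega> R lo u G \<longrightarrow>
     Lmod (lebesgue_on \<Omega>) q G \<le> ennreal C)"
  proof (intro allI)
    fix q V lo R :: real
    show "\<exists>C. 1 < q \<and> q < ?N / (?N - 1) \<and> V \<ge> 0 \<and> R \<ge> 0 \<and> lo > 0 \<longrightarrow> C \<ge> 0 \<and>
     (\<forall>(\<Omega>::(real^'n) set) u G. measure lebesgue \<Omega> = V \<longrightarrow> energy_class \<Omega> R lo u G \<longrightarrow>
     Lmod (lebesgue_on \<Omega>) q G \<le> ennreal C)"
    proof (cases "1 < q \<and> q < ?N / (?N - 1) \<and> V \<ge> 0 \<and> R \<ge> 0 \<and> lo > 0")
      case True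
      then have "1 \<le> q" "q * (?N - 1) < ?N" "V \<ge> 0" "R \<ge> 0" "lo > 0" using assms by (auto simp: pos_less_divide_eq)
      from gradient_estimate[OF assms this] show ?thesis by blast
    qed blast
  qed
  \<comment> \<open>The constant has to be chosen before the domain, as a function of the four parameters that determine it.\<close>
  then obtain Cf where Cf: "\<forall>q V lo R. 1 < q \<and> q < ?N / (?N - 1) \<and> V \<ge> 0 \<and> R \<ge> 0 \<and> lo > 0 \<longrightarrow> Cf q V lo R \<ge> 0 \<and>
     (\<forall>(\<Omega>::(real^'n) set) u G. measure lebesgue \<Omega> = V \<longrightarrow> energy_class \<Omega> R lo u G \<longrightarrow>
     Lmod (lebesgue_on \<Omega>) q G \<le> ennreal (Cf q V lo R))"
    by (simp only: choice_iff) blast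
  show ?thesis
  proof (intro exI[of _ "\<lambda>q V lo R. Cf q V lo R powr (1/q)"] allI impI; elim conjE)
    fix \<Omega> :: "(real^'n) set" and p \<Lambda> lo hi f \<epsilon> u
    assume A: "open \<Omega>" "bounded \<Omega>" "?N < p" "elliptic_coefficient \<Omega> lo hi \<Lambda>" "f \<in> radon_measures \<Omega>"
      "\<forall>n. 0 < \<epsilon> n" "\<epsilon> \<longlonglongrightarrow> 0" "\<forall>n. regularised_solution \<Omega> p \<Lambda> f (\<epsilon> n) (u n)"
    interpret regularised_sequence \<Omega> p lo hi \<Lambda> f \<epsilon> u
      by unfold_locales (use A assms in auto)
    let ?V = "measure lebesgue \<Omega>"
    obtain s U where s: "strict_mono s" and U: "U \<in> borel_measurable M" and ae: "AE x in M. (\<lambda>k. u (s k) x) \<longlonglongrightarrow> U x"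
      and L1: "(\<lambda>k. Lmod M 1 (\<lambda>x. u (s k) x - U x)) \<longlonglongrightarrow> 0"
      using convergent_subsequence by blast
    have Cq: "Cf q ?V lo R \<ge> 0" "\<And>k. Lmod M q (weak_gradient \<Omega> (u k)) \<le> ennreal (Cf q ?V lo R)"
      if q: "1 < q" "q < ?N / (?N - 1)" for q
      using Cf q R0 lo measure_nonneg[of lebesgue \<Omega>] solution_energy by blast+
    have W: "weakly_converges_W1_0 \<Omega> q (\<lambda>k. u (s k)) U" if "1 < q" "q < ?N / (?N - 1)" for q
      by (rule weak_limit(2)[OF U ae L1 that Cq(2)[OF that]])
    have S: "strongly_converges_Lp \<Omega> q (\<lambda>k. u (s k)) U" if q: "1 \<le> q" "q * (?N - 2) < ?N" for q
    proof -
      have q0: "q > 0" using q by simp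
      have "Lmod M q (u k) < \<infinity>" for k using solution_powers_bounded[OF q0 q(2)] by (auto intro: le_less_trans)
      then show ?thesis
        unfolding strongly_converges_Lp_def
        using strong_convergence[OF U ae L1 q] U solution_measurable
        by (auto simp: Lp_iff intro!: Lp_norm_tendsto_0[OF _ _ q0] borel_measurable_diff)
    qed
    have ws: "weak_solution \<Omega> \<Lambda> f U" by (rule weak_solution_limit[OF W s])
    have gb: "Lp_norm \<Omega> q (weak_gradient \<Omega> U) \<le> Cf q ?V lo R powr (1/q)" if q: "1 < q" "q < ?N / (?N - 1)" for q
    proof -
      obtain \<psi> G' where a: "approx q \<psi> U G'" and le: "Lmod M q G' \<le> ennreal (Cf q ?V lo R)"
        using weak_limit(1)[OF U ae L1 q Cq(2)[OF q]] by blast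
      have q1: "q \<ge> 1" using q by simp
      have "Lp_norm \<Omega> q (weak_gradient \<Omega> U) = enn2real (Lmod M q G') powr (1/q)"
        unfolding Lp_norm_weak_gradient[OF a q1] by (rule Lp_norm_eq[OF approxD(2)[OF a]])
      also have "\<dots> \<le> Cf q ?V lo R powr (1/q)"
        using q enn2real_mono[OF le] Cq(1)[OF q] by (intro powr_mono2) auto
      finally show ?thesis .
    qed
    show "\<exists>s U. strict_mono s \<and> U \<in> S_N \<Omega> \<and>
         (\<forall>q. 1 < q \<and> q < ?N / (?N - 1) \<longrightarrow> weakly_converges_W1_0 \<Omega> q (\<lambda>k. u (s k)) U) \<and>
         (CARD('n) = 2 \<longrightarrow> (\<forall>q\<ge>1. strongly_converges_Lp \<Omega> q (\<lambda>k. u (s k)) U)) \<and>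
         (CARD('n) \<ge> 3 \<longrightarrow> (\<forall>q. 1 \<le> q \<and> q < ?N / (?N - 2) \<longrightarrow> strongly_converges_Lp \<Omega> q (\<lambda>k. u (s k)) U)) \<and>
         (AE x in lebesgue_on \<Omega>. (\<lambda>k. u (s k) x) \<longlonglongrightarrow> U x) \<and>
         weak_solution \<Omega> \<Lambda> f U \<and>
         (\<forall>q. 1 < q \<and> q < ?N / (?N - 1) \<longrightarrow> Lp_norm \<Omega> q (weak_gradient \<Omega> U) \<le> Cf q ?V lo (radon_norm \<Omega> f) powr (1/q))"
    proof (intro exI[of _ s] exI[of _ U] conjI allI impI; (elim conjE)?)
      show "U \<in> S_N \<Omega>" using ws by (simp add: weak_solution_def)
      show "strongly_converges_Lp \<Omega> q (\<lambda>k. u (s k)) U" if "CARD('n) = 2" "1 \<le> q" for q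
        by (rule S) (use that in auto)
      show "strongly_converges_Lp \<Omega> q (\<lambda>k. u (s k)) U" if "3 \<le> CARD('n)" "1 \<le> q" "q < ?N / (?N - 2)" for q
        by (rule S) (use that in \<open>auto simp: pos_less_divide_eq\<close>)
    qed (use s W ae ws gb in auto)
  qed
qed

end
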